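(* Let $\varphi\in\mathcal{D}(\mathcal{A}^{(0)})\cap \mathcal{S}^{A,G}(H)$. Then, for every $x\in H$, $\lambda>0$, $T>0$ and $u(\cdot)\in\mathcal{U}_p$, $$\mathbb{E}\left[e^{-\lambda T}\varphi\big(X(T;x,u(\cdot))\big)\right]=\varphi(x)+\mathbb{E}\left[\int_0^T e^{-\lambda t}\left[(\mathcal{A}^{(0)}-\lambda)[\varphi]\big(X(t;x,u(\cdot))\big)+\left\langle L(u(t)),\,D^G\varphi\big(X(t;x,u(\cdot))\big)\right\rangle_K\right]dt\right].$$
   Context: Setting. $H,K,\Xi$ are real separable Hilbert spaces; $(U,|\cdot|_U)$ is a real Banach space and $\Lambda\subseteq U$ is a Borel set. $(\Omega,\mathcal{F},\{\mathcal{F}_t\}_{t\ge0},\mathbb{P})$ is a complete filtered probability space satisfying the usual conditions, $W$ a $\Xi$-valued cylindrical Brownian motion on it. Standing assumptions: (i) $A:\mathcal{D}(A)\subseteq H\to H$ is closed, densely defined and generates a $C_0$-semigroup $\{e^{tA}\}_{t\ge0}$ on $H$. (ii) $\sigma\in\mathcal{L}(\Xi,H)$ (bounded linear operators), $e^{sA}\sigma\sigma^*e^{sA^*}$ is trace class on $H$ for all $s>0$, and there is $\gamma\in(0,1/2)$ with $\int_0^t s^{-2\gamma}\,\mathrm{Tr}[e^{sA}\sigma\sigma^*e^{sA^*}]ds<\infty$ for all $t\ge0$. (iii) $G:\mathcal{D}(G)\subseteq K\to H$ is a closed densely defined (possibly unbounded) linear operator such that for every $s>0$ the operator $e^{sA}G:\mathcal{D}(G)\to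 H$ extends to a bounded operator $\overline{e^{sA}G}\in\mathcal{L}(K,H)$, and there exist $C_G>0$, $a_G\in\mathbb{R}$, $\beta\in[0,1)$ with $|\overline{e^{sA}G}|_{\mathcal{L}(K,H)}\le C_G(s^{-\beta}\vee1)e^{a_Gs}$ for all $s>0$. (iv) $L:\Lambda\to K$ is measurable and $|L(u)|_K\le C_L(1+|u|_U)$ for some $C_L>0$. A number $p\in(\frac{1}{1-\beta},+\infty)$ is fixed, and $\mathcal{U}_p$ is the set of progressively measurable $u:\Omega\times[0,+\infty)\to\Lambda$ with $\int_0^t\mathbb{E}[|u(s)|_U^p]ds<\infty$ for all $t\ge0$. For $x\in H$, $u(\cdot)\in\mathcal{U}_p$, $$X(t;x,u(\cdot)):=e^{tA}x+\int_0^te^{(t-s)A}\sigma\,dW(s)+\int_0^t\overline{e^{(t-s)A}G}L(u(s))ds,$$ always taken in its version with continuous trajectories. $G$-derivative. $f:H\to\mathbb{R}$ is $G$-differentiable at $x\in H$ if there is a (unique) $D^Gf(x)\in K$ with $\lim_{k\in\mathcal{D}(G),|k|_K\to0}\frac{|f(x+Gk)-f(x)-\langle D^Gf(x),k\rangle_K|}{|k|_K}=0$. $C^{1,G}_b(H)$ is the space of $f:H\to\mathbb{R}$ that are $G$-differentiable at every $x\in H$ with $D^Gf:H\to K$ bounded and continuous. Class $\mathcal{S}^{A,G}(H)$: the set of $\varphi\in C^{1,G}_b(H)$ such that for all $k\in K$ and all continuous $z:[0,\infty)\to H$, $$\lim_{t\to0^+}\frac{\varphi\left(z(t)+\int_0^t\overline{e^{sA}G}k\,ds\right)-\varphi(z(t))}{t}=\langle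 D^G\varphi(z(0)),k\rangle_K.$$ Generator. $C_b(H)$ is the space of bounded continuous functions $H\to\mathbb{R}$ with sup norm. $P^{(0)}_t[\varphi](x):=\mathbb{E}\big[\varphi\big(e^{tA}x+\int_0^te^{(t-s)A}\sigma\,dW(s)\big)\big]$ for $\varphi\in C_b(H)$. A sequence $(f_n)\subset C_b(H)$ $\pi$-converges to $f\in C_b(H)$ if $\sup_n|f_n|_\infty<\infty$ and $f_n\to f$ pointwise; a $\pi$-limit as $t\to0^+$ is understood along every sequence $t_n\downarrow0$. $\mathcal{D}(\mathcal{A}^{(0)})$ is the set of $\varphi\in C_b(H)$ for which $\mathcal{A}^{(0)}[\varphi]:=\pi\text{-}\lim_{t\to0^+}\frac{P_t^{(0)}[\varphi]-\varphi}{t}$ exists (in $C_b(H)$). *)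

theory Defs
  imports "HOL-Probability.Probability"
begin

text \<open>
  A real separable Hilbert space is a type of sort
  \<open>{real_inner, banach, second_countable_topology}\<close>.  An unbounded linear operator is a pair
  consisting of a domain and a total function, whose values outside the domain are irrelevant.
\<close>

subsection \<open>Unbounded operators and semigroups\<close>

definition closed_densely_defined ::
  "'a::real_normed_vector set \<Rightarrow> ('a \<Rightarrow> 'b::real_normed_vector) \<Rightarrow> bool" where
  "closed_densely_defined D A \<longleftrightarrow>
     subspace D \<and>
     (\<forall>x\<in>D. \<forall>y\<in>D. A (x + y) = A x + A y) \<and>
     (\<forall>c. \<forall>x\<in>D. A (c *\<^sub>R x) = c *\<^sub>R A x) \<and>
     closed {(x, A x) | x. x \<in> D} \<and>
     closure D = UNIV"

text \<open>Only the values of a semigroup at nonnegative times matter.\<close>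

definition C0_semigroup :: "(real \<Rightarrow> 'a::real_normed_vector \<Rightarrow>\<^sub>L 'a) \<Rightarrow> bool" where
  "C0_semigroup S \<longleftrightarrow>
     S 0 = id_blinfun \<and>
     (\<forall>s\<ge>0. \<forall>t\<ge>0. S (s + t) = S s o\<^sub>L S t) \<and>
     (\<forall>x. continuous_on {0..} (\<lambda>t. S t x))"

definition generates ::
  "'a::real_normed_vector set \<Rightarrow> ('a \<Rightarrow> 'a) \<Rightarrow> (real \<Rightarrow> 'a \<Rightarrow>\<^sub>L 'a) \<Rightarrow> bool" where
  "generates D A S \<longleftrightarrow>
     C0_semigroup S \<and>
     D = {x. \<exists>y. ((\<lambda>t. (1 / t) *\<^sub>R (S t x - x)) \<longlongrightarrow> y) (at_right 0)} \<and>
     (\<forall>x\<in>D. ((\<lambda>t. (1 / t) *\<^sub>R (S t x - x)) \<longlongrightarrow> A x) (at_right 0))"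

text \<open>The bounded extension of \<open>e\<^sup>s\<^sup>A G\<close> to the whole of \<open>K\<close>; it is unique because the
  domain of \<open>G\<close> is dense.\<close>

definition ext_op ::
  "(real \<Rightarrow> 'h::real_normed_vector \<Rightarrow>\<^sub>L 'h) \<Rightarrow> 'k::real_normed_vector set \<Rightarrow> ('k \<Rightarrow> 'h) \<Rightarrow>
   real \<Rightarrow> 'k \<Rightarrow>\<^sub>L 'h" where
  "ext_op S D G s = (THE E :: 'k \<Rightarrow>\<^sub>L 'h. \<forall>k\<in>D. E k = S s (G k))"

subsection \<open>Trace class and Hilbert--Schmidt operators\<close>

definition orthonormal_basis :: "'a::real_inner set \<Rightarrow> bool" where
  "orthonormal_basis B \<longleftrightarrow>
     pairwise orthogonal B \<and> (\<forall>e\<in>B. norm e = 1) \<and> closure (span B) = UNIV"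

definition some_basis :: "'a::real_inner set" where
  "some_basis = (SOME B. orthonormal_basis B)"

definition trace_class :: "('a::real_inner \<Rightarrow> 'b::real_inner) \<Rightarrow> bool" where
  "trace_class T \<longleftrightarrow>
     (\<exists>a b. summable (\<lambda>n::nat. norm (a n) * norm (b n)) \<and>
            (\<forall>x. (\<lambda>n. (x \<bullet> a n) *\<^sub>R b n) sums T x))"

text \<open>For trace class operators, and for the squared Hilbert--Schmidt norm, the value
  does not depend on the orthonormal basis.\<close>

definition op_trace :: "('a::real_inner \<Rightarrow> 'a) \<Rightarrow> real" where
  "op_trace T = (\<Sum>\<^sub>\<infinity>e\<in>some_basis. T e \<bullet> e)"

definition hs_norm_sq :: "('a::real_inner \<Rightarrow> 'b::real_inner) \<Rightarrow> ennreal" where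
  "hs_norm_sq T = (\<Sum>\<^sub>\<infinity>e\<in>some_basis. ennreal ((norm (T e))\<^sup>2))"

text \<open>\<open>e\<^sup>s\<^sup>A \<sigma> \<sigma>* e\<^sup>s\<^sup>A\<^sup>*\<close>, where \<open>e\<^sup>s\<^sup>A\<^sup>*\<close> is the adjoint of \<open>e\<^sup>s\<^sup>A\<close>.\<close>

definition cov_op ::
  "(real \<Rightarrow> 'h::real_inner \<Rightarrow>\<^sub>L 'h) \<Rightarrow> ('xi::real_inner \<Rightarrow>\<^sub>L 'h) \<Rightarrow> real \<Rightarrow> 'h \<Rightarrow> 'h" where
  "cov_op S \<sigma> s =
     blinfun_apply (S s) \<circ> blinfun_apply \<sigma> \<circ>
     adjoint (blinfun_apply \<sigma>) \<circ> adjoint (blinfun_apply (S s))"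

subsection \<open>Filtered probability spaces and cylindrical Brownian motion\<close>

definition usual_filtered_prob_space :: "'w measure \<Rightarrow> (real \<Rightarrow> 'w measure) \<Rightarrow> bool" where
  "usual_filtered_prob_space M F \<longleftrightarrow>
     prob_space M \<and> complete_measure M \<and>
     (\<forall>t\<ge>0. subalgebra M (F t)) \<and>
     (\<forall>s\<ge>0. \<forall>t\<ge>s. sets (F s) \<subseteq> sets (F t)) \<and>
     null_sets M \<subseteq> sets (F 0) \<and>
     (\<forall>t\<ge>0. sets (F t) = (\<Inter>s\<in>{t<..}. sets (F s)))"

text \<open>\<open>W t \<xi> \<omega>\<close> stands for \<open>\<langle>W(t), \<xi>\<rangle>(\<omega>)\<close>.  By polarisation, linearity and the
  law of each \<open>W t \<xi> - W s \<xi>\<close> fix the joint law, with covariance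
  \<open>E[(W t \<xi>) (W s \<eta>)] = min t s \<langle>\<xi>, \<eta>\<rangle>\<close>.  The case \<open>\<xi> = 0\<close> is excluded from the Gaussian law only
  because that law is then a point mass; linearity gives \<open>W t 0 = 0\<close> almost surely.\<close>

definition cylindrical_BM ::
  "'w measure \<Rightarrow> (real \<Rightarrow> 'w measure) \<Rightarrow> (real \<Rightarrow> 'xi::real_inner \<Rightarrow> 'w \<Rightarrow> real) \<Rightarrow> bool" where
  "cylindrical_BM M F W \<longleftrightarrow>
     (\<forall>t\<ge>0. \<forall>a b \<xi> \<eta>. AE \<omega> in M. W t (a *\<^sub>R \<xi> + b *\<^sub>R \<eta>) \<omega> = a * W t \<xi> \<omega> + b * W t \<eta> \<omega>) \<and>
     (\<forall>\<xi>. AE \<omega> in M. W 0 \<xi> \<omega> = 0) \<and>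
     (\<forall>t\<ge>0. \<forall>\<xi>. W t \<xi> \<in> borel_measurable (F t)) \<and>
     (\<forall>\<xi>. AE \<omega> in M. continuous_on {0..} (\<lambda>t. W t \<xi> \<omega>)) \<and>
     (\<forall>s\<ge>0. \<forall>t>s. \<forall>\<xi>.
        prob_space.indep_set M (sets (F s))
          {(\<lambda>\<omega>. W t \<xi> \<omega> - W s \<xi> \<omega>) -` B \<inter> space M | B. B \<in> sets borel}) \<and>
     (\<forall>s\<ge>0. \<forall>t>s. \<forall>\<xi>. \<xi> \<noteq> 0 \<longrightarrow>
        distributed M lborel (\<lambda>\<omega>. W t \<xi> \<omega> - W s \<xi> \<omega>)
          (normal_density 0 (sqrt (t - s) * norm \<xi>)))"

subsection \<open>Stochastic integral of deterministic operator-valued functions\<close>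

text \<open>A list of tuples \<open>(a, b, \<xi>, h)\<close> encodes the elementary integrand
  \<open>s \<mapsto> \<Sum> 1\<^bsub>(a,b]\<^esub>(s) \<langle>\<xi>, \<cdot>\<rangle> h\<close>, a step function with finite-rank values, whose
  integral is \<open>\<Sum> \<langle>W(b) - W(a), \<xi>\<rangle> h\<close>.\<close>

type_synonym ('xi, 'h) elementary = "(real \<times> real \<times> 'xi \<times> 'h) list"

definition elem_on :: "real \<Rightarrow> ('xi, 'h) elementary \<Rightarrow> bool" where
  "elem_on t es \<longleftrightarrow> (\<forall>(a, b, \<xi>, h) \<in> set es. 0 \<le> a \<and> a \<le> b \<and> b \<le> t)"

definition elem_fun ::
  "('xi::real_inner, 'h::real_vector) elementary \<Rightarrow> real \<Rightarrow> 'xi \<Rightarrow> 'h" where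
  "elem_fun es s v = (\<Sum>(a, b, \<xi>, h)\<leftarrow>es. (indicator {a<..b} s * (\<xi> \<bullet> v)) *\<^sub>R h)"

definition elem_integral ::
  "(real \<Rightarrow> 'xi \<Rightarrow> 'w \<Rightarrow> real) \<Rightarrow> ('xi, 'h::real_vector) elementary \<Rightarrow> 'w \<Rightarrow> 'h" where
  "elem_integral W es \<omega> = (\<Sum>(a, b, \<xi>, h)\<leftarrow>es. (W b \<xi> \<omega> - W a \<xi> \<omega>) *\<^sub>R h)"

text \<open>\<open>Z\<close> is a version of \<open>\<integral>\<^sub>0\<^sup>t \<Phi>(s) dW(s)\<close>: the \<open>L\<^sup>2(\<Omega>; H)\<close>-limit of integrals
  of elementary integrands that approximate \<open>\<Phi>\<close> in \<open>L\<^sup>2([0,t]; L\<^sub>2(\<Xi>, H))\<close>.  By the Ito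
  isometry, \<open>Z\<close> is unique up to almost sure equality.\<close>

definition is_stoch_integral ::
  "'w measure \<Rightarrow> (real \<Rightarrow> 'xi::real_inner \<Rightarrow> 'w \<Rightarrow> real) \<Rightarrow> (real \<Rightarrow> 'xi \<Rightarrow> 'h::real_inner) \<Rightarrow>
   real \<Rightarrow> ('w \<Rightarrow> 'h) \<Rightarrow> bool" where
  "is_stoch_integral M W \<Phi> t Z \<longleftrightarrow>
     Z \<in> borel_measurable M \<and>
     (\<exists>es :: nat \<Rightarrow> ('xi, 'h) elementary.
        (\<forall>n. elem_on t (es n)) \<and>
        (\<lambda>n. \<integral>\<^sup>+ s\<in>{0..t}. hs_norm_sq (\<lambda>v. \<Phi> s v - elem_fun (es n) s v) \<partial>lborel) \<longlonglongrightarrow> 0 \<and>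
        (\<lambda>n. \<integral>\<^sup>+ \<omega>. ennreal ((norm (Z \<omega> - elem_integral W (es n) \<omega>))\<^sup>2) \<partial>M) \<longlonglongrightarrow> 0)"

definition stoch_integral ::
  "'w measure \<Rightarrow> (real \<Rightarrow> 'xi::real_inner \<Rightarrow> 'w \<Rightarrow> real) \<Rightarrow> (real \<Rightarrow> 'xi \<Rightarrow> 'h::real_inner) \<Rightarrow>
   real \<Rightarrow> 'w \<Rightarrow> 'h" where
  "stoch_integral M W \<Phi> t = (SOME Z. is_stoch_integral M W \<Phi> t Z)"

definition stoch_conv ::
  "'w measure \<Rightarrow> (real \<Rightarrow> 'xi::real_inner \<Rightarrow> 'w \<Rightarrow> real) \<Rightarrow>
   (real \<Rightarrow> 'h::real_inner \<Rightarrow>\<^sub>L 'h) \<Rightarrow> ('xi \<Rightarrow>\<^sub>L 'h) \<Rightarrow> real \<Rightarrow> 'w \<Rightarrow> 'h" where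
  "stoch_conv M W S \<sigma> t = stoch_integral M W (\<lambda>s v. S (t - s) (\<sigma> v)) t"

subsection \<open>Controls and the state process\<close>

definition prog_measurable ::
  "(real \<Rightarrow> 'w measure) \<Rightarrow> 'u measure \<Rightarrow> (real \<Rightarrow> 'w \<Rightarrow> 'u) \<Rightarrow> bool" where
  "prog_measurable F N u \<longleftrightarrow>
     (\<forall>t\<ge>0. (\<lambda>(s, \<omega>). u s \<omega>) \<in> restrict_space borel {0..t} \<Otimes>\<^sub>M F t \<rightarrow>\<^sub>M N)"

definition admissible ::
  "'w measure \<Rightarrow> (real \<Rightarrow> 'w measure) \<Rightarrow> 'u::real_normed_vector set \<Rightarrow> real \<Rightarrow>
   (real \<Rightarrow> 'w \<Rightarrow> 'u) set" where
  "admissible M F \<Lambda> p =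
     {u. prog_measurable F (restrict_space borel \<Lambda>) u \<and>
         (\<forall>t\<ge>0. (\<integral>\<^sup>+ s\<in>{0..t}. (\<integral>\<^sup>+ \<omega>. ennreal (norm (u s \<omega>) powr p) \<partial>M) \<partial>lborel) < \<infinity>)}"

text \<open>\<open>X\<close> is a version with continuous trajectories of the mild solution with initial state \<open>x\<close>
  and control \<open>u\<close>; \<open>E s\<close> is the bounded extension of \<open>e\<^sup>s\<^sup>A G\<close>, meaningful for \<open>s > 0\<close>
  only, whence the half-open interval.\<close>

definition is_state_process ::
  "'w measure \<Rightarrow> (real \<Rightarrow> 'xi::real_inner \<Rightarrow> 'w \<Rightarrow> real) \<Rightarrow>
   (real \<Rightarrow> 'h::{real_inner, banach, second_countable_topology} \<Rightarrow>\<^sub>L 'h) \<Rightarrow> ('xi \<Rightarrow>\<^sub>L 'h) \<Rightarrow>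
   (real \<Rightarrow> 'k::real_normed_vector \<Rightarrow>\<^sub>L 'h) \<Rightarrow> ('u \<Rightarrow> 'k) \<Rightarrow>
   'h \<Rightarrow> (real \<Rightarrow> 'w \<Rightarrow> 'u) \<Rightarrow> (real \<Rightarrow> 'w \<Rightarrow> 'h) \<Rightarrow> bool" where
  "is_state_process M W S \<sigma> E L x u X \<longleftrightarrow>
     (\<forall>t\<ge>0. X t \<in> borel_measurable M) \<and>
     (\<forall>t\<ge>0. AE \<omega> in M.
        X t \<omega> = S t x + stoch_conv M W S \<sigma> t \<omega> + (LINT s:{0..<t}|lborel. E (t - s) (L (u s \<omega>)))) \<and>
     (\<forall>\<omega>\<in>space M. continuous_on {0..} (\<lambda>t. X t \<omega>))"

subsection \<open>\<open>G\<close>-derivatives\<close>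

definition has_G_derivative ::
  "'k::real_inner set \<Rightarrow> ('k \<Rightarrow> 'h::real_normed_vector) \<Rightarrow> ('h \<Rightarrow> real) \<Rightarrow> 'k \<Rightarrow> 'h \<Rightarrow> bool" where
  "has_G_derivative D G f d x \<longleftrightarrow>
     ((\<lambda>k. \<bar>f (x + G k) - f x - d \<bullet> k\<bar> / norm k) \<longlongrightarrow> 0) (at 0 within D)"

definition G_derivative ::
  "'k::real_inner set \<Rightarrow> ('k \<Rightarrow> 'h::real_normed_vector) \<Rightarrow> ('h \<Rightarrow> real) \<Rightarrow> 'h \<Rightarrow> 'k" where
  "G_derivative D G f x = (THE d. has_G_derivative D G f d x)"

definition C1G_b ::
  "'k::real_inner set \<Rightarrow> ('k \<Rightarrow> 'h::real_normed_vector) \<Rightarrow> ('h \<Rightarrow> real) set" where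
  "C1G_b D G =
     {f. (\<forall>x. \<exists>d. has_G_derivative D G f d x) \<and>
         bounded (range (G_derivative D G f)) \<and>
         continuous_on UNIV (G_derivative D G f)}"

definition class_S ::
  "(real \<Rightarrow> 'h::{real_inner, banach, second_countable_topology} \<Rightarrow>\<^sub>L 'h) \<Rightarrow>
   'k::real_inner set \<Rightarrow> ('k \<Rightarrow> 'h) \<Rightarrow> ('h \<Rightarrow> real) set" where
  "class_S S D G =
     {\<phi> \<in> C1G_b D G.
        \<forall>k. \<forall>z :: real \<Rightarrow> 'h. continuous_on {0..} z \<longrightarrow>
          ((\<lambda>t. (\<phi> (z t + (LINT s:{0<..t}|lborel. ext_op S D G s k)) - \<phi> (z t)) / t)
             \<longlongrightarrow> G_derivative D G \<phi> (z 0) \<bullet> k) (at_right 0)}"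

subsection \<open>The uncontrolled transition semigroup and its generator\<close>

text \<open>\<open>bcontfun\<close> is the library's set of bounded continuous functions.\<close>

definition P0 ::
  "'w measure \<Rightarrow> (real \<Rightarrow> 'xi::real_inner \<Rightarrow> 'w \<Rightarrow> real) \<Rightarrow>
   (real \<Rightarrow> 'h::real_inner \<Rightarrow>\<^sub>L 'h) \<Rightarrow> ('xi \<Rightarrow>\<^sub>L 'h) \<Rightarrow> real \<Rightarrow> ('h \<Rightarrow> real) \<Rightarrow> 'h \<Rightarrow> real" where
  "P0 M W S \<sigma> t \<phi> x = (LINT \<omega>|M. \<phi> (S t x + stoch_conv M W S \<sigma> t \<omega>))"

definition pi_converges ::
  "(nat \<Rightarrow> 'h::topological_space \<Rightarrow> real) \<Rightarrow> ('h \<Rightarrow> real) \<Rightarrow> bool" where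
  "pi_converges fs f \<longleftrightarrow>
     (\<forall>n. fs n \<in> bcontfun) \<and> f \<in> bcontfun \<and>
     bdd_above (range (\<lambda>n. SUP x. \<bar>fs n x\<bar>)) \<and>
     (\<forall>x. (\<lambda>n. fs n x) \<longlonglongrightarrow> f x)"

definition is_A0 ::
  "'w measure \<Rightarrow> (real \<Rightarrow> 'xi::real_inner \<Rightarrow> 'w \<Rightarrow> real) \<Rightarrow>
   (real \<Rightarrow> 'h::real_inner \<Rightarrow>\<^sub>L 'h) \<Rightarrow> ('xi \<Rightarrow>\<^sub>L 'h) \<Rightarrow> ('h \<Rightarrow> real) \<Rightarrow> ('h \<Rightarrow> real) \<Rightarrow> bool" where
  "is_A0 M W S \<sigma> \<phi> \<psi> \<longleftrightarrow>
     (\<forall>ts :: nat \<Rightarrow> real. (\<forall>n. ts n > 0) \<and> decseq ts \<and> ts \<longlonglongrightarrow> 0 \<longrightarrow>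
        pi_converges (\<lambda>n x. (P0 M W S \<sigma> (ts n) \<phi> x - \<phi> x) / ts n) \<psi>)"

definition dom_A0 ::
  "'w measure \<Rightarrow> (real \<Rightarrow> 'xi::real_inner \<Rightarrow> 'w \<Rightarrow> real) \<Rightarrow>
   (real \<Rightarrow> 'h::real_inner \<Rightarrow>\<^sub>L 'h) \<Rightarrow> ('xi \<Rightarrow>\<^sub>L 'h) \<Rightarrow> ('h \<Rightarrow> real) set" where
  "dom_A0 M W S \<sigma> = {\<phi> \<in> bcontfun. \<exists>\<psi>. is_A0 M W S \<sigma> \<phi> \<psi>}"

definition A0 ::
  "'w measure \<Rightarrow> (real \<Rightarrow> 'xi::real_inner \<Rightarrow> 'w \<Rightarrow> real) \<Rightarrow>
   (real \<Rightarrow> 'h::real_inner \<Rightarrow>\<^sub>L 'h) \<Rightarrow> ('xi \<Rightarrow>\<^sub>L 'h) \<Rightarrow> ('h \<Rightarrow> real) \<Rightarrow> 'h \<Rightarrow> real" where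
  "A0 M W S \<sigma> \<phi> = (THE \<psi>. is_A0 M W S \<sigma> \<phi> \<psi>)"

end

theory Submission
  imports Defs "HOL-Real_Asymp.Real_Asymp"
begin

text \<open>
  If \<open>\<phi>\<close> were smooth, this would be Ito's formula in expectation.  Here \<open>\<phi>\<close> need not be differentiable in
  the directions of the noise or of \<open>A\<close>.  Only two things are known: its mean along the uncontrolled process,
  through the generator, and its increments in the directions of the drift, through the class \<open>\<S>\<close>.  The
  proof looks at short time intervals and treats the two effects one after the other.

  The stochastic convolution is Markov (\<open>incr_markov\<close>): what the noise adds during a time step is
  independent of the past and a copy of the convolution over that step.  This is a comparison of
  characteristic functionals, which determine finite Borel measures on a separable Hilbert space
  (\<open>char_functional_unique\<close>).  It follows that the uncontrolled transition operators form a semigroup and that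
  Dynkin's formula holds (\<open>dynkin\<close>).  The limit that defines \<open>\<S>\<close> is required along all continuous paths, and
  since every convergent sequence of points lies on such a path it is a continuous convergence of difference
  quotients (\<open>quot_loc_unif\<close>).

  The core is \<open>cell_formula\<close>, the case of a control that has a constant, possibly random, value on an
  interval and is known at its start.  On a fine grid each increment of \<open>\<phi>\<close> is a martingale difference plus a
  generator term plus a difference quotient in the direction of the control.  The Riemann sums of the last two
  converge along every path.  The quotients have no bound that is uniform in the path, so the sums are
  stopped before they become too large; then dominated convergence applies.

  Summation over intervals gives the formula for step controls.  A general control is approximated by its averages
  over the preceding block of a partition of \<open>[0, T]\<close>: these are adapted step controls and converge in \<open>L\<^sup>1\<close>
  (\<open>block_conv_integrable\<close>), and Young's inequality carries the convergence over to the states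
  (\<open>conv_lstep_L1\<close>).  This proves the formula without discount at almost every time, and by
  continuity at \<open>T\<close>; the discount factor is inserted by Fubini's theorem (\<open>discounted_integral\<close>).
\<close>

abbreviation L1 :: "'a measure => ('a => 'b::real_normed_vector) => ennreal" where
  "L1 M f \<equiv> \<integral>\<^sup>+ x. ennreal (norm (f x)) \<partial>M"

abbreviation L2sq :: "'a measure => ('a => 'b::real_normed_vector) => ennreal" where
  "L2sq M f \<equiv> \<integral>\<^sup>+ x. ennreal ((norm (f x))\<^sup>2) \<partial>M"

section \<open>Hilbert space preliminaries\<close>

subsection \<open>Orthonormal bases\<close>

text \<open>Gram--Schmidt along a countable dense sequence.\<close>

lemma orthonormal_basis_exists:
  "\<exists>B::'a::{real_inner,second_countable_topology} set. orthonormal_basis B"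
proof -
  obtain D :: "'a set" where D: "countable D" "\<And>X. open X ==> X \<noteq> {} ==> \<exists>d\<in>D. d \<in> X"
    using countable_dense_exists[where 'a='a] by blast
  then have "D \<noteq> {}" using D(2)[of UNIV] by auto
  define d where "d = from_nat_into D"
  have rd: "range d = D" unfolding d_def by (rule range_from_nat_into) fact+
  define step where "step n B = (let r = d n - (\<Sum>e\<in>B. (d n \<bullet> e) *\<^sub>R e) in
     if r = 0 then B else insert (r /\<^sub>R norm r) B)" for n and B :: "'a set"
  define Bs where "Bs = rec_nat {} step"
  have Bs0: "Bs 0 = {}" and BsS: "Bs (Suc n) = step n (Bs n)" for n by (simp_all add: Bs_def)
  have mono: "Bs n \<subseteq> Bs (Suc n)" for n by (auto simp: BsS step_def Let_def)
  then have mono': "m \<le> n ==> Bs m \<subseteq> Bs n" for m n by (rule lift_Suc_mono_le)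
  have inv: "finite (Bs n) \<and> pairwise orthogonal (Bs n) \<and> (\<forall>e\<in>Bs n. norm e = 1)" for n
  proof (induction n)
    case 0 show ?case by (simp add: Bs0)
  next
    case (Suc n)
    define r where "r = d n - (\<Sum>e\<in>Bs n. (d n \<bullet> e) *\<^sub>R e)"
    have orth: "r \<bullet> f = 0" if f: "f \<in> Bs n" for f
    proof -
      have "(\<Sum>e\<in>Bs n. (d n \<bullet> e) *\<^sub>R e) \<bullet> f = (\<Sum>e\<in>Bs n. if e = f then d n \<bullet> f else 0)"
        unfolding inner_sum_left
      proof (rule sum.cong[OF refl])
        fix e assume e: "e \<in> Bs n"
        show "(d n \<bullet> e) *\<^sub>R e \<bullet> f = (if e = f then d n \<bullet> f else 0)"
        proof (cases "e = f")
          case True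
          then have "e \<bullet> f = 1" using Suc f by (metis norm_eq_1)
          then show ?thesis using True by simp
        next
          case False
          then have "e \<bullet> f = 0" using Suc e f by (auto simp: pairwise_def orthogonal_def)
          then show ?thesis using False by simp
        qed
      qed
      also have "... = d n \<bullet> f" using Suc f by simp
      finally show ?thesis by (simp add: r_def inner_diff_left)
    qed
    show ?case
    proof (cases "r = 0")
      case True
      then show ?thesis using Suc by (simp add: BsS step_def r_def Let_def)
    next
      case False
      have "Bs (Suc n) = insert (r /\<^sub>R norm r) (Bs n)"
        using False by (simp add: BsS step_def r_def Let_def)
      moreover have "norm (r /\<^sub>R norm r) = 1" using False by simp
      moreover have "orthogonal (r /\<^sub>R norm r) f" "orthogonal f (r /\<^sub>R norm r)" if "f \<in> Bs n" for f
        using orth[OF that] by (simp_all add: orthogonal_def inner_commute)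
      ultimately show ?thesis using Suc by (auto simp: pairwise_insert)
    qed
  qed
  have dspan: "d n \<in> span (Bs (Suc n))" for n
  proof -
    define r where "r = d n - (\<Sum>e\<in>Bs n. (d n \<bullet> e) *\<^sub>R e)"
    have s: "(\<Sum>e\<in>Bs n. (d n \<bullet> e) *\<^sub>R e) \<in> span (Bs (Suc n))"
      using mono[of n] by (intro span_sum span_scale span_base) auto
    have "r \<in> span (Bs (Suc n))"
    proof (cases "r = 0")
      case True then show ?thesis by (simp add: span_zero)
    next
      case False
      then have "r /\<^sub>R norm r \<in> span (Bs (Suc n))"
        by (intro span_base) (simp add: BsS step_def r_def Let_def)
      then have "norm r *\<^sub>R (r /\<^sub>R norm r) \<in> span (Bs (Suc n))" by (rule span_scale)
      then show ?thesis using False by simp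
    qed
    then have "r + (\<Sum>e\<in>Bs n. (d n \<bullet> e) *\<^sub>R e) \<in> span (Bs (Suc n))" using s by (rule span_add)
    then show ?thesis by (simp add: r_def)
  qed
  define B where "B = (\<Union>n. Bs n)"
  have "D \<subseteq> span B"
  proof -
    have "d n \<in> span B" for n
      using dspan[of n] span_mono[of "Bs (Suc n)" B] by (auto simp: B_def)
    then show ?thesis using rd by auto
  qed
  moreover have "closure D = UNIV"
  proof (rule ccontr)
    assume "closure D \<noteq> UNIV"
    then have "- closure D \<noteq> {}" by auto
    then obtain x where "x \<in> D" "x \<in> - closure D" using D(2)[of "- closure D"] by auto
    then show False using closure_subset by auto
  qed
  ultimately have "closure (span B) = UNIV" by (metis closure_mono top.extremum_uniqueI)
  moreover have "pairwise orthogonal B"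
  proof (rule pairwiseI)
    fix x y assume "x \<in> B" "y \<in> B" "x \<noteq> y"
    then obtain m n where "x \<in> Bs m" "y \<in> Bs n" by (auto simp: B_def)
    then have "x \<in> Bs (max m n)" "y \<in> Bs (max m n)" using mono' by (meson max.cobounded1 max.cobounded2 subsetD)+
    then show "orthogonal x y" using inv[of "max m n"] \<open>x \<noteq> y\<close> by (auto simp: pairwise_def)
  qed
  moreover have "\<forall>e\<in>B. norm e = 1" using inv by (auto simp: B_def)
  ultimately show ?thesis unfolding orthonormal_basis_def by blast
qed

lemma orthonormal_some_basis:
  "orthonormal_basis (some_basis :: 'a::{real_inner,second_countable_topology} set)"
  unfolding some_basis_def by (rule someI_ex) (rule orthonormal_basis_exists)

lemma orthonormal_basis_inner:
  assumes "orthonormal_basis B" "e \<in> B" "f \<in> B"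
  shows "e \<bullet> f = (if e = f then 1 else 0)"
  using assms by (auto simp: orthonormal_basis_def pairwise_def orthogonal_def norm_eq_1)

lemma countable_orthonormal_basis:
  fixes B :: "'a::{real_inner,second_countable_topology} set"
  assumes "orthonormal_basis B" shows "countable B"
proof -
  have dist: "dist e f ^ 2 = 2" if "e \<in> B" "f \<in> B" "e \<noteq> f" for e f
    using that orthonormal_basis_inner[OF assms]
    by (simp add: dist_norm power2_norm_eq_inner inner_diff_left inner_diff_right)
  have "countable ((\<lambda>e. ball e (1/2)) ` B)"
  proof (rule countable_disjoint_open_subsets)
    show "pairwise disjnt ((\<lambda>e. ball e (1/2)) ` B)"
    proof (rule pairwise_imageI)
      fix e f assume ef: "e \<in> B" "f \<in> B" "e \<noteq> f"
      show "disjnt (ball e (1/2)) (ball f (1/2))"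
      proof (rule ccontr)
        assume "\<not> disjnt (ball e (1/2)) (ball f (1/2))"
        then obtain z where "dist e z < 1/2" "dist f z < 1/2" by (auto simp: disjnt_def)
        then have "dist e f < 1" by (metis dist_commute dist_triangle_half_r)
        then have "dist e f ^ 2 < 1" by (simp add: power_less_one_iff)
        then show False using dist[OF ef] by simp
      qed
    qed
  qed auto
  moreover have "inj_on (\<lambda>e. ball e (1/2)) B"
  proof (rule inj_onI)
    fix e f assume ef: "e \<in> B" "f \<in> B" "ball e (1/2) = ball f (1/2)"
    then have "f \<in> ball e (1/2)" by simp
    then have "dist e f < 1" by simp
    then have "dist e f ^ 2 < 1" by (simp add: power_less_one_iff)
    then show "e = f" using dist[OF ef(1,2)] by fastforce
  qed
  ultimately show ?thesis by (rule countable_image_inj_on)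
qed

lemma inner_fourier_sum:
  assumes B: "orthonormal_basis B" and F: "finite F" "F \<subseteq> B" and f: "f \<in> F"
  shows "(\<Sum>e\<in>F. (v \<bullet> e) *\<^sub>R e) \<bullet> f = v \<bullet> f"
proof -
  have "(\<Sum>e\<in>F. (v \<bullet> e) *\<^sub>R e) \<bullet> f = (\<Sum>e\<in>F. if e = f then v \<bullet> f else 0)"
    unfolding inner_sum_left using f F orthonormal_basis_inner[OF B]
    by (intro sum.cong) (auto simp: subset_iff)
  then show ?thesis using f F by simp
qed

lemma bessel_finite:
  fixes v :: "'a::real_inner"
  assumes B: "orthonormal_basis B" and F: "finite F" "F \<subseteq> B"
  shows "(norm (v - (\<Sum>e\<in>F. (v \<bullet> e) *\<^sub>R e)))\<^sup>2 = (norm v)\<^sup>2 - (\<Sum>e\<in>F. (v \<bullet> e)\<^sup>2)"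
proof -
  have 1: "v \<bullet> (\<Sum>e\<in>F. (v \<bullet> e) *\<^sub>R e) = (\<Sum>e\<in>F. (v \<bullet> e)\<^sup>2)"
    by (simp add: inner_sum_right power2_eq_square)
  have 2: "(\<Sum>e\<in>F. (v \<bullet> e) *\<^sub>R e) \<bullet> (\<Sum>e\<in>F. (v \<bullet> e) *\<^sub>R e) = (\<Sum>e\<in>F. (v \<bullet> e)\<^sup>2)"
  proof -
    note inner_fourier_sum[OF B F, of _ v]
    then show ?thesis by (simp add: inner_sum_right power2_eq_square)
  qed
  show ?thesis using 1 2
    by (simp add: power2_norm_eq_inner inner_diff_left inner_diff_right inner_commute)
qed

text \<open>A linear combination of basis vectors approximates \<open>x\<close>, and the partial Fourier sum does so at
  least as well; hence the Bessel sums exhaust \<open>\<parallel>x\<parallel>\<^sup>2\<close>.\<close>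

lemma parseval_approx:
  fixes v :: "'a::real_inner"
  assumes B: "orthonormal_basis B" and "\<epsilon> > 0"
  obtains F where "finite F" "F \<subseteq> B" "(norm v)\<^sup>2 - (\<Sum>e\<in>F. (v \<bullet> e)\<^sup>2) < \<epsilon>"
proof -
  have "v \<in> closure (span B)" using B by (simp add: orthonormal_basis_def)
  then obtain w where w: "w \<in> span B" "dist w v < sqrt \<epsilon>"
    using \<open>\<epsilon> > 0\<close> by (meson closure_approachable real_sqrt_gt_zero)
  then obtain F r where F: "finite F" "F \<subseteq> B" and wr: "w = (\<Sum>e\<in>F. r e *\<^sub>R e)"
    by (auto simp: span_explicit)
  define p where "p = (\<Sum>e\<in>F. (v \<bullet> e) *\<^sub>R e)"
  have orth: "(v - p) \<bullet> f = 0" if "f \<in> F" for f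
    unfolding p_def using inner_fourier_sum[OF B F that, of v] by (simp add: inner_diff_left)
  have "(v - p) \<bullet> (p - w) = 0"
    unfolding wr p_def[symmetric] using orth
    by (simp add: inner_diff_right p_def inner_sum_right flip: sum_subtractf)
  then have "(norm (v - w))\<^sup>2 = (norm (v - p))\<^sup>2 + (norm (p - w))\<^sup>2"
    using norm_add_Pythagorean[of "v - p" "p - w"] by (simp add: orthogonal_def)
  then have "(norm (v - p))\<^sup>2 \<le> (norm (v - w))\<^sup>2" by simp
  also have "... < (sqrt \<epsilon>)\<^sup>2"
    using w(2) by (intro power_strict_mono) (auto simp: dist_norm norm_minus_commute)
  finally have "(norm (v - p))\<^sup>2 < \<epsilon>" using \<open>\<epsilon> > 0\<close> by simp
  then show ?thesis using that[OF F] bessel_finite[OF B F, of v] by (simp add: p_def)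
qed

text \<open>Series over a basis become integrals against the counting measure, so that Tonelli's theorem and
  dominated convergence apply to them.\<close>

lemma infsum_ennreal_eq_nn_integral:
  fixes f :: "'a => ennreal"
  assumes "countable B"
  shows "infsum f B = (\<integral>\<^sup>+ e. f e \<partial>count_space B)"
proof (rule antisym)
  have sup: "infsum f B = (SUP F\<in>{F. finite F \<and> F \<subseteq> B}. sum f F)"
    by (rule nonneg_infsum_complete) simp
  show "infsum f B \<le> (\<integral>\<^sup>+ e. f e \<partial>count_space B)"
    unfolding sup
  proof (rule SUP_least, clarsimp)
    fix F assume F: "finite F" "F \<subseteq> B"
    have "sum f F = (\<integral>\<^sup>+ e. f e * indicator F e \<partial>count_space B)"
      using F by (subst nn_integral_count_space'[where A=F]) (auto split: split_indicator)
    also have "... \<le> (\<integral>\<^sup>+ e. f e \<partial>count_space B)"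
      by (intro nn_integral_mono) (auto split: split_indicator)
    finally show "sum f F \<le> (\<integral>\<^sup>+ e. f e \<partial>count_space B)" .
  qed
  show "(\<integral>\<^sup>+ e. f e \<partial>count_space B) \<le> infsum f B"
  proof (cases "finite B")
    case True
    then show ?thesis by (simp add: nn_integral_count_space_finite)
  next
    case False
    have bij: "bij_betw (from_nat_into B) UNIV B" using assms False by (rule bij_betw_from_nat_into)
    have "(\<integral>\<^sup>+ e. f e \<partial>count_space B) = (\<integral>\<^sup>+ n. f (from_nat_into B n) \<partial>count_space UNIV)"
      by (rule nn_integral_bij_count_space[OF bij, symmetric])
    also have "... = (\<Sum>n. f (from_nat_into B n))" by (rule nn_integral_count_space_nat)
    also have "... = (SUP n. \<Sum>i<n. f (from_nat_into B i))" by (rule suminf_eq_SUP)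
    also have "... \<le> infsum f B"
    proof (rule SUP_least)
      fix n
      have inj: "inj_on (from_nat_into B) {..<n}" using bij by (auto simp: bij_betw_def intro: inj_on_subset)
      have "(\<Sum>i<n. f (from_nat_into B i)) = sum f (from_nat_into B ` {..<n})"
        using inj by (simp add: sum.reindex)
      also have "... \<le> infsum f B" unfolding sup
        using bij by (intro SUP_upper) (auto simp: bij_betw_def)
      finally show "(\<Sum>i<n. f (from_nat_into B i)) \<le> infsum f B" .
    qed
    finally show ?thesis .
  qed
qed

lemma parseval:
  fixes v :: "'a::{real_inner,second_countable_topology}"
  assumes B: "orthonormal_basis B"
  shows "(\<integral>\<^sup>+ e. ennreal ((v \<bullet> e)\<^sup>2) \<partial>count_space B) = ennreal ((norm v)\<^sup>2)"
proof -
  have sup: "(\<integral>\<^sup>+ e. ennreal ((v \<bullet> e)\<^sup>2) \<partial>count_space B)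
      = (SUP F\<in>{F. finite F \<and> F \<subseteq> B}. sum (\<lambda>e. ennreal ((v \<bullet> e)\<^sup>2)) F)"
    unfolding infsum_ennreal_eq_nn_integral[OF countable_orthonormal_basis[OF B], symmetric]
    by (rule nonneg_infsum_complete) simp
  show ?thesis unfolding sup
  proof (rule antisym)
    show "(SUP F\<in>{F. finite F \<and> F \<subseteq> B}. sum (\<lambda>e. ennreal ((v \<bullet> e)\<^sup>2)) F) \<le> ennreal ((norm v)\<^sup>2)"
    proof (rule SUP_least)
      fix F assume "F \<in> {F. finite F \<and> F \<subseteq> B}"
      then have F: "finite F" "F \<subseteq> B" by auto
      have "0 \<le> (norm v)\<^sup>2 - (\<Sum>e\<in>F. (v \<bullet> e)\<^sup>2)" by (subst bessel_finite[OF B F, symmetric]) simp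
      then show "(\<Sum>e\<in>F. ennreal ((v \<bullet> e)\<^sup>2)) \<le> ennreal ((norm v)\<^sup>2)"
        by (subst sum_ennreal) (auto intro: ennreal_leI)
    qed
    show "ennreal ((norm v)\<^sup>2) \<le> (SUP F\<in>{F. finite F \<and> F \<subseteq> B}. sum (\<lambda>e. ennreal ((v \<bullet> e)\<^sup>2)) F)"
    proof (rule ennreal_le_epsilon)
      fix \<epsilon> :: real assume "\<epsilon> > 0"
      then obtain F where F: "finite F" "F \<subseteq> B" "(norm v)\<^sup>2 - (\<Sum>e\<in>F. (v \<bullet> e)\<^sup>2) < \<epsilon>"
        using parseval_approx[OF B] by blast
      then have "ennreal ((norm v)\<^sup>2) \<le> ennreal ((\<Sum>e\<in>F. (v \<bullet> e)\<^sup>2) + \<epsilon>)" by (intro ennreal_leI) simp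
      also have "... = sum (\<lambda>e. ennreal ((v \<bullet> e)\<^sup>2)) F + ennreal \<epsilon>"
        using \<open>\<epsilon> > 0\<close> by (subst ennreal_plus) (auto intro: sum_nonneg)
      also have "... \<le> (SUP F\<in>{F. finite F \<and> F \<subseteq> B}. sum (\<lambda>e. ennreal ((v \<bullet> e)\<^sup>2)) F) + ennreal \<epsilon>"
        using F by (intro add_right_mono SUP_upper) auto
      finally show "ennreal ((norm v)\<^sup>2)
         \<le> (SUP F\<in>{F. finite F \<and> F \<subseteq> B}. sum (\<lambda>e. ennreal ((v \<bullet> e)\<^sup>2)) F) + ennreal \<epsilon>" .
    qed
  qed
qed

lemma hs_norm_sq_eq:
  fixes T :: "'a::{real_inner,second_countable_topology} => 'b::real_inner"
  shows "hs_norm_sq T = L2sq (count_space some_basis) T"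
  unfolding hs_norm_sq_def
  by (rule infsum_ennreal_eq_nn_integral[OF countable_orthonormal_basis[OF orthonormal_some_basis]])

subsection \<open>Adjoints and the trace of the covariance\<close>

text \<open>The representing vector minimises \<open>\<parallel>v\<parallel>\<^sup>2 - 2 g v\<close>; minimising sequences are Cauchy by the
  parallelogram law.\<close>

lemma riesz_representation:
  fixes g :: "'a::{real_inner,banach} => real"
  assumes g: "bounded_linear g"
  obtains y where "\<And>x. g x = x \<bullet> y"
proof -
  interpret g: bounded_linear g by fact
  define J where "J v = (norm v)\<^sup>2 - 2 * g v" for v
  obtain K where K: "\<And>x. norm (g x) \<le> norm x * K" using g.bounded by blast
  have low: "J v \<ge> - K\<^sup>2" for v
  proof -
    have "g v \<le> norm v * K" using K[of v] by simp
    moreover have "0 \<le> (norm v - K)\<^sup>2" by simp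
    ultimately show ?thesis by (simp add: J_def power2_diff)
  qed
  then have bdd: "bdd_below (range J)" by (intro bdd_belowI[of _ "- K\<^sup>2"]) auto
  define m where "m = Inf (range J)"
  have m: "m \<le> J v" for v unfolding m_def using bdd by (intro cInf_lower) auto
  have "\<exists>v. J v < m + 1 / real (Suc n)" for n
  proof -
    have "Inf (range J) < m + 1 / real (Suc n)" by (simp add: m_def)
    then show ?thesis using cInf_lessD[of "range J"] by blast
  qed
  then obtain v where v: "\<And>n. J (v n) < m + 1 / real (Suc n)" by metis
  have par: "(norm (a - b))\<^sup>2 = 2 * J a + 2 * J b - 4 * J ((1/2) *\<^sub>R (a + b))" for a b
    by (simp add: J_def g.scaleR g.add power2_norm_eq_inner inner_diff_left inner_diff_right
        inner_add_left inner_add_right inner_commute algebra_simps)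
  have small: "(norm (v i - v j))\<^sup>2 < 4 / real (Suc N)" if "N \<le> i" "N \<le> j" for i j N
  proof -
    have "1 / real (Suc i) \<le> 1 / real (Suc N)" "1 / real (Suc j) \<le> 1 / real (Suc N)"
      using that by (auto intro!: divide_left_mono)
    moreover have "m \<le> J ((1/2) *\<^sub>R (v i + v j))" by (rule m)
    ultimately show ?thesis using par[of "v i" "v j"] v[of i] v[of j] by linarith
  qed
  have "Cauchy v"
  proof (rule CauchyI)
    fix e :: real assume "e > 0"
    then obtain N :: nat where N: "4 / e\<^sup>2 < real N" using reals_Archimedean2 by blast
    have "4 / real (Suc N) < e\<^sup>2"
      using N \<open>e > 0\<close> by (simp add: field_simps) (smt (verit) mult_nonneg_nonneg zero_le_power2 power2_eq_square zero_less_power2)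
    then have "norm (v i - v j) < e" if "N \<le> i" "N \<le> j" for i j
      using small[OF that] \<open>e > 0\<close> by (intro power_less_imp_less_base[of _ 2 e]) auto
    then show "\<exists>M. \<forall>i\<ge>M. \<forall>j\<ge>M. norm (v i - v j) < e" by blast
  qed
  then obtain y where y: "v \<longlonglongrightarrow> y" using Cauchy_convergent convergent_def by blast
  have "J y \<le> m"
  proof (rule LIMSEQ_le)
    show "(\<lambda>n. J (v n)) \<longlonglongrightarrow> J y" unfolding J_def
      by (intro tendsto_intros g.tendsto y)
    show "(\<lambda>n. m + 1 / real (Suc n)) \<longlonglongrightarrow> m"
      using tendsto_add[OF tendsto_const LIMSEQ_inverse_real_of_nat, of m] by (simp add: inverse_eq_divide)
    show "\<exists>N. \<forall>n\<ge>N. J (v n) \<le> m + 1 / real (Suc n)" using v less_imp_le by blast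
  qed
  have "g x = x \<bullet> y" for x
  proof -
    define c where "c = x \<bullet> y - g x"
    have q: "0 \<le> t\<^sup>2 * (norm x)\<^sup>2 + 2 * t * c" for t
    proof -
      have "J y \<le> J (y + t *\<^sub>R x)" using m[of "y + t *\<^sub>R x"] \<open>J y \<le> m\<close> by linarith
      moreover have "J (y + t *\<^sub>R x) = J y + t\<^sup>2 * (norm x)\<^sup>2 + 2 * t * c"
      proof -
        have "(y + t *\<^sub>R x) \<bullet> (y + t *\<^sub>R x) = y \<bullet> y + 2 * t * (x \<bullet> y) + t\<^sup>2 * (x \<bullet> x)"
          unfolding inner_add_left inner_add_right inner_scaleR_left inner_scaleR_right inner_commute[of y x]
          by (simp only: power2_eq_square) algebra
        then have "(norm (y + t *\<^sub>R x))\<^sup>2 = (norm y)\<^sup>2 + 2 * t * (x \<bullet> y) + t\<^sup>2 * (norm x)\<^sup>2"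
          by (simp only: power2_norm_eq_inner)
        then show ?thesis unfolding J_def c_def g.add g.scaleR by (simp add: algebra_simps)
      qed
      ultimately show ?thesis by linarith
    qed
    have "c = 0"
    proof (rule ccontr)
      assume "c \<noteq> 0"
      define n where "n = (norm x)\<^sup>2 + 1"
      have n: "n > 0" "(norm x)\<^sup>2 < n" by (simp_all add: n_def add_nonneg_pos)
      have "(- c / n)\<^sup>2 * (norm x)\<^sup>2 \<le> (- c / n)\<^sup>2 * n" using n by (intro mult_left_mono) auto
      also have "... = c\<^sup>2 / n" using n by (simp add: power2_eq_square field_simps)
      finally have "0 \<le> c\<^sup>2 / n + 2 * (- c / n) * c" using q[of "- c / n"] by linarith
      also have "... = - (c\<^sup>2 / n)" by (simp add: power2_eq_square field_simps)
      finally show False using \<open>c \<noteq> 0\<close> n by (simp add: divide_le_0_iff)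
    qed
    then show ?thesis by (simp add: c_def)
  qed
  then show ?thesis using that by blast
qed

lemma inner_adjoint_blinfun:
  fixes f :: "'a::{real_inner,banach} \<Rightarrow>\<^sub>L 'b::real_inner"
  shows "f x \<bullet> y = x \<bullet> adjoint (blinfun_apply f) y"
proof -
  have "\<exists>z. \<forall>x. f x \<bullet> y = x \<bullet> z" for y
  proof -
    have "bounded_linear (\<lambda>x. f x \<bullet> y)"
      by (rule bounded_linear_compose[OF bounded_linear_inner_left blinfun.bounded_linear_right])
    then obtain z where "\<And>x. f x \<bullet> y = x \<bullet> z" using riesz_representation by blast
    then show ?thesis by blast
  qed
  then have "\<exists>h. \<forall>x y. f x \<bullet> y = x \<bullet> h y" by metis
  then have "\<forall>x y. f x \<bullet> y = x \<bullet> adjoint (blinfun_apply f) y"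
    unfolding adjoint_def by (rule someI_ex)
  then show ?thesis by blast
qed

lemma summable_trace_class_diagonal:
  fixes T :: "'a::{real_inner,second_countable_topology} => 'a"
  assumes T: "trace_class T" and B: "orthonormal_basis B" and pos: "\<And>x. 0 \<le> T x \<bullet> x"
  shows "(\<lambda>e. T e \<bullet> e) summable_on B"
proof -
  obtain a b where sm: "summable (\<lambda>n::nat. norm (a n) * norm (b n))"
    and ab: "\<And>x. (\<lambda>n. (x \<bullet> a n) *\<^sub>R b n) sums T x" using T by (auto simp: trace_class_def)
  have bound: "(\<Sum>e\<in>F. T e \<bullet> e) \<le> (\<Sum>n. norm (a n) * norm (b n))" if F: "finite F" "F \<subseteq> B" for F
  proof -
    have "(\<lambda>n. ((e \<bullet> a n) *\<^sub>R b n) \<bullet> e) sums (T e \<bullet> e)" for e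
      by (rule bounded_linear.sums[OF bounded_linear_inner_left ab])
    then have "(\<lambda>n. (e \<bullet> a n) * (b n \<bullet> e)) sums (T e \<bullet> e)" for e by simp
    then have s: "(\<lambda>n. \<Sum>e\<in>F. (e \<bullet> a n) * (b n \<bullet> e)) sums (\<Sum>e\<in>F. T e \<bullet> e)"
      by (intro sums_sum)
    have le: "(\<Sum>e\<in>F. (e \<bullet> a n) * (b n \<bullet> e)) \<le> norm (a n) * norm (b n)" for n
    proof -
      have fin: "(\<Sum>e\<in>F. (v \<bullet> e)\<^sup>2) \<le> (norm v)\<^sup>2" for v :: 'a
        using bessel_finite[OF B F, of v] by (smt (verit) zero_le_power2)
      have "(\<Sum>e\<in>F. (e \<bullet> a n) * (b n \<bullet> e)) \<le> \<bar>\<Sum>e\<in>F. (a n \<bullet> e) * (b n \<bullet> e)\<bar>"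
        by (simp add: inner_commute)
      also have "... \<le> L2_set (\<lambda>e. a n \<bullet> e) F * L2_set (\<lambda>e. b n \<bullet> e) F"
        by (rule order_trans[OF sum_abs]) (simp add: abs_mult L2_set_mult_ineq)
      also have "... \<le> norm (a n) * norm (b n)"
        unfolding L2_set_def by (intro mult_mono real_le_lsqrt fin sum_nonneg) (auto intro: sum_nonneg)
      finally show ?thesis .
    qed
    show ?thesis by (rule sums_le[OF _ s summable_sums[OF sm]]) (rule le)
  qed
  show ?thesis
    by (rule nonneg_bdd_above_summable_on)
      (use pos in \<open>auto intro!: bdd_aboveI[of _ "\<Sum>n. norm (a n) * norm (b n)"] bound\<close>)
qed

text \<open>The trace of \<open>T T\<^sup>*\<close> is the squared Hilbert--Schmidt norm of \<open>T\<close>: expand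
  \<open>\<parallel>T\<^sup>* e\<parallel>\<^sup>2\<close> and \<open>\<parallel>T f\<parallel>\<^sup>2\<close> in the double series \<open>\<Sum> \<langle>T f, e\<rangle>\<^sup>2\<close>.  Trace class enters only to make
  the real series of the diagonal converge.\<close>

lemma hs_norm_sq_eq_op_trace:
  fixes S :: "real => 'h::{real_inner,banach,second_countable_topology} \<Rightarrow>\<^sub>L 'h"
    and \<sigma> :: "'xi::{real_inner,banach,second_countable_topology} \<Rightarrow>\<^sub>L 'h"
  assumes "trace_class (cov_op S \<sigma> s)"
  shows "hs_norm_sq (\<lambda>v. S s (\<sigma> v)) = ennreal (op_trace (cov_op S \<sigma> s))"
proof -
  let ?BH = "some_basis :: 'h set" and ?BX = "some_basis :: 'xi set"
  let ?adj = "\<lambda>e. adjoint (blinfun_apply \<sigma>) (adjoint (blinfun_apply (S s)) e)"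
  have BH: "orthonormal_basis ?BH" and BX: "orthonormal_basis ?BX" by (rule orthonormal_some_basis)+
  have cH: "countable ?BH" and cX: "countable ?BX"
    using BH BX by (auto intro: countable_orthonormal_basis)
  have adj: "S s (\<sigma> f) \<bullet> e = f \<bullet> ?adj e" for f e by (simp add: inner_adjoint_blinfun)
  have diag: "cov_op S \<sigma> s e \<bullet> e = (norm (?adj e))\<^sup>2" for e
    by (simp add: cov_op_def adj power2_norm_eq_inner)
  have sm: "(\<lambda>e. cov_op S \<sigma> s e \<bullet> e) summable_on ?BH"
    by (rule summable_trace_class_diagonal[OF assms BH]) (simp add: diag)
  have "ennreal (op_trace (cov_op S \<sigma> s)) = (SUP F\<in>{F. finite F \<and> F \<subseteq> ?BH}. ennreal (sum (\<lambda>e. cov_op S \<sigma> s e \<bullet> e) F))"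
    unfolding op_trace_def by (rule infsum_nonneg_is_SUPREMUM_ennreal[OF sm]) (simp add: diag)
  also have "... = (SUP F\<in>{F. finite F \<and> F \<subseteq> ?BH}. sum (\<lambda>e. ennreal ((norm (?adj e))\<^sup>2)) F)"
    by (intro SUP_cong refl) (simp add: diag)
  also have "... = infsum (\<lambda>e. ennreal ((norm (?adj e))\<^sup>2)) ?BH"
    by (rule nonneg_infsum_complete[symmetric]) simp
  also have "... = (\<integral>\<^sup>+ e. ennreal ((norm (?adj e))\<^sup>2) \<partial>count_space ?BH)"
    by (rule infsum_ennreal_eq_nn_integral[OF cH])
  also have "... = (\<integral>\<^sup>+ e. \<integral>\<^sup>+ f. ennreal ((S s (\<sigma> f) \<bullet> e)\<^sup>2) \<partial>count_space ?BX \<partial>count_space ?BH)"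
    unfolding adj parseval[OF BX, symmetric] by (simp add: inner_commute)
  also have "... = (\<integral>\<^sup>+ f. \<integral>\<^sup>+ e. ennreal ((S s (\<sigma> f) \<bullet> e)\<^sup>2) \<partial>count_space ?BH \<partial>count_space ?BX)"
  proof -
    interpret H: sigma_finite_measure "count_space ?BH" using cH by (rule sigma_finite_measure_count_space_countable)
    interpret X: sigma_finite_measure "count_space ?BX" using cX by (rule sigma_finite_measure_count_space_countable)
    interpret P: pair_sigma_finite "count_space ?BH" "count_space ?BX" ..
    show ?thesis
      by (rule P.Fubini'[symmetric]) (simp add: pair_measure_countable[OF cH cX])
  qed
  also have "... = hs_norm_sq (\<lambda>v. S s (\<sigma> v))"
    by (simp add: hs_norm_sq_eq parseval[OF BH])
  finally show ?thesis by simp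
qed

subsection \<open>Uniform boundedness\<close>

text \<open>The closed sets \<open>{x. \<forall>i. \<parallel>T i x\<parallel> \<le> n}\<close> cover the space, so by Baire's theorem one of them
  contains a ball; linearity moves the bound on this ball to the unit ball.\<close>

lemma uniform_boundedness:
  fixes T :: "'i => 'a::banach \<Rightarrow>\<^sub>L 'b::real_normed_vector"
  assumes bdd: "\<And>x. \<exists>C. \<forall>i\<in>I. norm (T i x) \<le> C"
  shows "\<exists>C. \<forall>i\<in>I. norm (T i) \<le> C"
proof -
  define A where "A n = {x. \<forall>i\<in>I. norm (T i x) \<le> real n}" for n :: nat
  have "A n = (\<Inter>i\<in>I. {x. norm (T i x) \<le> real n})" for n by (auto simp: A_def)
  then have "closed (A n)" for n by (auto intro!: closed_INT closed_Collect_le continuous_intros)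
  moreover have "\<Union>(range A) = UNIV"
  proof (rule set_eqI, rule iffI)
    fix x
    obtain C where "\<forall>i\<in>I. norm (T i x) \<le> C" using bdd by blast
    then have "x \<in> A (nat \<lceil>C\<rceil>)" by (auto simp: A_def intro: order_trans[OF _ real_nat_ceiling_ge])
    then show "x \<in> \<Union>(range A)" by blast
  qed simp
  ultimately obtain n where "interior (A n) \<noteq> {}"
    using Baire_category_alt[OF disjI1[OF completely_metrizable_space_euclidean], of "range A"] by auto
  then obtain a r where r: "r > 0" "ball a r \<subseteq> A n" by (auto simp: mem_interior)
  have "norm (T i) \<le> 4 * real n / r" if i: "i \<in> I" for i
  proof (rule norm_blinfun_bound)
    fix x
    show "norm (T i x) \<le> 4 * real n / r * norm x"
    proof (cases "x = 0")
      case False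
      define c where "c = r / (2 * norm x)"
      have c: "c > 0" using False r by (simp add: c_def)
      have "norm (c *\<^sub>R x) < r" using False r by (simp add: c_def)
      then have "a + c *\<^sub>R x \<in> A n" "a \<in> A n" using r by (auto simp: dist_norm)
      then have "norm (T i (a + c *\<^sub>R x)) \<le> n" "norm (T i a) \<le> n" using i by (auto simp: A_def)
      then have "norm (T i (a + c *\<^sub>R x) - T i a) \<le> 2 * real n" using norm_triangle_ineq4 by (smt (verit))
      then have "c * norm (T i x) \<le> 2 * real n" using c by (simp add: blinfun.add_right blinfun.scaleR_right)
      then show ?thesis using False r by (simp add: c_def field_simps)
    qed (simp add: blinfun.zero_right)
  qed (use r in simp)
  then show ?thesis by blast
qed

lemma C0_semigroup_bounded:
  fixes S :: "real => 'a::banach \<Rightarrow>\<^sub>L 'a"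
  assumes "C0_semigroup S"
  obtains C where "C \<ge> 1" "\<And>r. 0 \<le> r ==> r \<le> T ==> norm (S r) \<le> C"
proof -
  have "\<exists>C. \<forall>r\<in>{0..T}. norm (S r x) \<le> C" for x
  proof -
    have "continuous_on {0..T} (\<lambda>t. S t x)" using assms
      by (auto simp: C0_semigroup_def intro: continuous_on_subset)
    then have "compact ((\<lambda>t. S t x) ` {0..T})" by (rule compact_continuous_image) simp
    then have "bounded ((\<lambda>t. S t x) ` {0..T})" by (rule compact_imp_bounded)
    then show ?thesis by (auto simp: bounded_iff)
  qed
  then obtain C where "\<forall>r\<in>{0..T}. norm (S r) \<le> C" using uniform_boundedness[of "{0..T}" S] by blast
  then show ?thesis using that[of "max C 1"] by (auto simp: le_max_iff_disj)
qed

section \<open>Gaussian sums of Brownian increments\<close>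

definition inc_fun :: "(real \<times> real \<times> 'a::real_vector) list => real => 'a" where
  "inc_fun ts s = (\<Sum>(a, b, \<xi>)\<leftarrow>ts. indicator {a<..b} s *\<^sub>R \<xi>)"

locale filtered_BM = prob_space M
  for M :: "'w measure" +
  fixes F :: "real => 'w measure"
    and W :: "real => 'xi::{real_inner,banach,second_countable_topology} => 'w => real"
  assumes filtration: "usual_filtered_prob_space M F"
    and BM: "cylindrical_BM M F W"
begin

lemma subalgebra_F: "t \<ge> 0 ==> subalgebra M (F t)"
  using filtration by (auto simp: usual_filtered_prob_space_def)

lemma space_F [simp]: "t \<ge> 0 ==> space (F t) = space M"
  using subalgebra_F by (auto simp: subalgebra_def)

lemma sets_F_subset: "t \<ge> 0 ==> sets (F t) \<subseteq> sets M"
  using subalgebra_F by (auto simp: subalgebra_def)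

lemma sets_F_mono: "0 \<le> s ==> s \<le> t ==> sets (F s) \<subseteq> sets (F t)"
  using filtration unfolding usual_filtered_prob_space_def by blast

lemma subalgebra_F_mono: "0 \<le> s ==> s \<le> t ==> subalgebra (F t) (F s)"
  using sets_F_mono by (auto simp: subalgebra_def)

lemma measurable_F: "f \<in> F t \<rightarrow>\<^sub>M N ==> t \<ge> 0 ==> f \<in> M \<rightarrow>\<^sub>M N"
  by (rule measurable_from_subalg[OF subalgebra_F])

lemma measurable_F_mono: "f \<in> F s \<rightarrow>\<^sub>M N ==> 0 \<le> s ==> s \<le> t ==> f \<in> F t \<rightarrow>\<^sub>M N"
  by (rule measurable_from_subalg[OF subalgebra_F_mono])

lemma null_sets_F: "t \<ge> 0 ==> null_sets M \<subseteq> sets (F t)"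
  using filtration sets_F_mono[of 0 t] unfolding usual_filtered_prob_space_def by blast

lemma W_measurable_F: "t \<ge> 0 ==> W t \<xi> \<in> borel_measurable (F t)"
  using BM by (auto simp: cylindrical_BM_def)

lemma W_measurable [measurable]: "t \<ge> 0 ==> W t \<xi> \<in> borel_measurable M"
  using W_measurable_F measurable_F by blast

lemma W_linear: "t \<ge> 0 ==> AE w in M. W t (a *\<^sub>R \<xi> + b *\<^sub>R \<eta>) w = a * W t \<xi> w + b * W t \<eta> w"
  using BM by (auto simp: cylindrical_BM_def)

lemma W_zero: "t \<ge> 0 ==> AE w in M. W t 0 w = 0"
  using W_linear[of t 0 0 0 0] by simp

lemma indep_var_increment:
  assumes st: "0 \<le> s" "s < t" and X: "X \<in> F s \<rightarrow>\<^sub>M N" and f: "f \<in> borel \<rightarrow>\<^sub>M L"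
  shows "indep_var N X L (\<lambda>w. f (W t \<xi> w - W s \<xi> w) :: 'b)"
proof -
  let ?D = "\<lambda>w. W t \<xi> w - W s \<xi> w"
  have D: "?D \<in> borel_measurable M" using st by (auto intro!: borel_measurable_diff W_measurable)
  have ind: "indep_set (sets (F s)) {?D -` B \<inter> space M | B. B \<in> sets borel}"
    using BM st by (auto simp: cylindrical_BM_def)
  have XM: "X \<in> M \<rightarrow>\<^sub>M N" using X st by (auto intro: measurable_F)
  let ?Y = "\<lambda>w. f (?D w)"
  have Y: "?Y \<in> M \<rightarrow>\<^sub>M L" by (rule measurable_compose[OF D f])
  have sig: "sigma_sets (space M) {Z -` B \<inter> space M | B. B \<in> sets K} = {Z -` B \<inter> space M | B. B \<in> sets K}"
    if "Z \<in> M \<rightarrow>\<^sub>M K" for Z :: "'w => 'b" and K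
  proof -
    have "Z \<in> space M \<rightarrow> space K" using that by (rule measurable_space[THEN funcsetI])
    from sets_vimage_algebra2[OF this] show ?thesis by (simp only: sets_vimage_algebra)
  qed
  have "{X -` A \<inter> space M | A. A \<in> sets N} \<subseteq> sets (F s)"
    using measurable_sets[OF X] st by auto
  moreover have "{?Y -` B \<inter> space M | B. B \<in> sets L} \<subseteq> {?D -` B \<inter> space M | B. B \<in> sets borel}"
  proof (clarify)
    fix B assume "B \<in> sets L"
    then have "f -` B \<in> sets borel" using measurable_sets[OF f] by simp
    moreover have "?Y -` B \<inter> space M = ?D -` (f -` B) \<inter> space M" by auto
    ultimately show "\<exists>B'. ?Y -` B \<inter> space M = ?D -` B' \<inter> space M \<and> B' \<in> sets borel" by blast
  qed
  ultimately have "indep_set {X -` A \<inter> space M | A. A \<in> sets N} {?Y -` B \<inter> space M | B. B \<in> sets L}"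
    using ind unfolding indep_sets2_eq by (meson order_trans subsetD)
  then show ?thesis unfolding indep_var_eq sig[OF XM] sig[OF Y] using XM Y by blast
qed

lemma increment_std_normal:
  assumes "0 \<le> s" "s < t" "\<xi> \<noteq> 0"
  shows "distributed M lborel (\<lambda>w. (W t \<xi> w - W s \<xi> w) / (sqrt (t - s) * norm \<xi>)) std_normal_density"
proof -
  have "distributed M lborel (\<lambda>w. W t \<xi> w - W s \<xi> w) (normal_density 0 (sqrt (t - s) * norm \<xi>))"
    using BM assms by (auto simp: cylindrical_BM_def)
  then show ?thesis
    using normal_standard_normal_convert[of "sqrt (t - s) * norm \<xi>" "\<lambda>w. W t \<xi> w - W s \<xi> w" 0] assms by simp
qed

lemma increment_moments:
  assumes st: "0 \<le> s" "s < t"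
  shows "integrable M (\<lambda>w. W t \<xi> w - W s \<xi> w)"
    and "(LINT w|M. W t \<xi> w - W s \<xi> w) = 0"
    and "integrable M (\<lambda>w. (W t \<xi> w - W s \<xi> w)\<^sup>2)"
    and "(LINT w|M. (W t \<xi> w - W s \<xi> w)\<^sup>2) = (t - s) * (norm \<xi>)\<^sup>2"
    and "(CLINT w|M. iexp (W t \<xi> w - W s \<xi> w)) = exp (- ((t - s) * (norm \<xi>)\<^sup>2) / 2)"
proof -
  let ?D = "\<lambda>w. W t \<xi> w - W s \<xi> w"
  have Dm [measurable]: "?D \<in> borel_measurable M" using st by (auto intro!: borel_measurable_diff W_measurable)
  have "integrable M ?D \<and> (LINT w|M. ?D w) = 0 \<and> integrable M (\<lambda>w. (?D w)\<^sup>2) \<and>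
     (LINT w|M. (?D w)\<^sup>2) = (t - s) * (norm \<xi>)\<^sup>2 \<and>
     (CLINT w|M. iexp (?D w)) = exp (- ((t - s) * (norm \<xi>)\<^sup>2) / 2)"
  proof (cases "\<xi> = 0")
    case True
    have ie: "(\<lambda>w. iexp (?D w)) \<in> borel_measurable M"
      by (rule borel_measurable_continuous_on[OF _ Dm]) (intro continuous_intros)
    have ae: "AE w in M. ?D w = 0" using W_zero[of t] W_zero[of s] st True by auto
    have "integrable M ?D \<longleftrightarrow> integrable M (\<lambda>_. 0::real)" by (rule integrable_cong_AE) (use ae in auto)
    moreover have "integrable M (\<lambda>w. (?D w)\<^sup>2) \<longleftrightarrow> integrable M (\<lambda>_. 0::real)"
      by (rule integrable_cong_AE) (use ae in auto)
    moreover have "(LINT w|M. ?D w) = (LINT w|M. 0)" by (rule integral_cong_AE) (use ae in auto)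
    moreover have "(LINT w|M. (?D w)\<^sup>2) = (LINT w|M. 0)" by (rule integral_cong_AE) (use ae in auto)
    moreover have "(CLINT w|M. iexp (?D w)) = (CLINT w|M. 1)"
      by (rule integral_cong_AE[OF ie]) (use ae in auto)
    ultimately show ?thesis using True by (simp add: prob_space)
  next
    case False
    define c where "c = sqrt (t - s) * norm \<xi>"
    have c: "c > 0" "c\<^sup>2 = (t - s) * (norm \<xi>)\<^sup>2" using False st by (auto simp: c_def power_mult_distrib)
    define Y where "Y = (\<lambda>w. ?D w / c)"
    have Y: "distributed M lborel Y std_normal_density"
      using increment_std_normal[OF st False] by (simp add: Y_def c_def)
    have Ym [measurable]: "Y \<in> borel_measurable M" unfolding Y_def by measurable
    have D: "?D w = c * Y w" for w using c by (auto simp: Y_def)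
    have i1: "integrable M Y"
      using distributed_integrable[OF Y, of "\<lambda>x. x"] integrable_std_normal_moment[of 1] by simp
    have i2: "integrable M (\<lambda>w. (Y w)\<^sup>2)"
      using distributed_integrable[OF Y, of "\<lambda>x. x\<^sup>2"] integrable_std_normal_moment[of 2] by simp
    have e1: "(LINT w|M. Y w) = 0"
      using distributed_integral[OF Y, of "\<lambda>x. x"] integral_std_normal_moment_odd[of 0] by simp
    have e2: "(LINT w|M. (Y w)\<^sup>2) = 1"
      using distributed_integral[OF Y, of "\<lambda>x. x\<^sup>2"] integral_std_normal_moment_even[of 1]
      by (simp add: fact_numeral)
    have "(CLINT w|M. iexp (c * Y w)) = char (distr M lborel Y) c"
      unfolding char_def by (subst integral_distr) auto
    also have "distr M lborel Y = std_normal_distribution"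
      using Y by (simp add: distributed_distr_eq_density)
    finally have ch: "(CLINT w|M. iexp (c * Y w)) = exp (- (c\<^sup>2) / 2)"
      by (simp add: char_std_normal_distribution flip: exp_of_real)
    show ?thesis unfolding D using i1 i2 e1 e2 ch c(2) by (simp add: power_mult_distrib)
  qed
  then show "integrable M ?D" "(LINT w|M. ?D w) = 0" "integrable M (\<lambda>w. (?D w)\<^sup>2)"
     "(LINT w|M. (?D w)\<^sup>2) = (t - s) * (norm \<xi>)\<^sup>2"
     "(CLINT w|M. iexp (?D w)) = exp (- ((t - s) * (norm \<xi>)\<^sup>2) / 2)" by blast+
qed

definition grid_sum :: "(nat => real) => (nat => 'xi) => nat => 'w => real" where
  "grid_sum p \<eta> m w = (\<Sum>j<m. W (p (Suc j)) (\<eta> j) w - W (p j) (\<eta> j) w)"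

lemma grid_sum:
  assumes c: "0 \<le> c" "c \<le> p 0" and p: "\<And>j. j < m ==> p j < p (Suc j)" and A: "A \<in> sets (F c)"
  shows "c \<le> p m" and "grid_sum p \<eta> m \<in> borel_measurable (F (p m))"
    and "integrable M (\<lambda>w. (grid_sum p \<eta> m w)\<^sup>2)"
    and "(LINT w|M. (grid_sum p \<eta> m w)\<^sup>2) = (\<Sum>j<m. (p (Suc j) - p j) * (norm (\<eta> j))\<^sup>2)"
    and "(CLINT w|M. indicator A w *\<^sub>R iexp (grid_sum p \<eta> m w)) =
      prob A * exp (- (\<Sum>j<m. (p (Suc j) - p j) * (norm (\<eta> j))\<^sup>2) / 2)"
proof -
  have AM: "A \<in> sets M" using A c sets_F_subset by auto
  let ?J = "grid_sum p \<eta>" and ?V = "\<lambda>m. \<Sum>j<m. (p (Suc j) - p j) * (norm (\<eta> j))\<^sup>2"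
  let ?D = "\<lambda>m w. W (p (Suc m)) (\<eta> m) w - W (p m) (\<eta> m) w"
  have J: "?J (Suc m) w = ?J m w + ?D m w" for m w by (simp add: grid_sum_def)
  have *: "c \<le> p m \<and> ?J m \<in> borel_measurable (F (p m)) \<and> integrable M (\<lambda>w. (?J m w)\<^sup>2) \<and>
     (LINT w|M. (?J m w)\<^sup>2) = ?V m \<and>
     (CLINT w|M. indicator A w *\<^sub>R iexp (?J m w)) = prob A * exp (- ?V m / 2)"
    using p
  proof (induction m)
    case 0
    have "(CLINT w|M. indicator A w *\<^sub>R 1) = complex_of_real (LINT w|M. indicator A w)"
      unfolding integral_complex_of_real[symmetric] by (simp add: scaleR_conv_of_real)
    then show ?case using c A AM by (simp add: grid_sum_def)
  next
    case (Suc m)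
    then have IH: "c \<le> p m" "?J m \<in> borel_measurable (F (p m))" "integrable M (\<lambda>w. (?J m w)\<^sup>2)"
      "(LINT w|M. (?J m w)\<^sup>2) = ?V m"
      "(CLINT w|M. indicator A w *\<^sub>R iexp (?J m w)) = prob A * exp (- ?V m / 2)" by simp_all
    have lt: "0 \<le> p m" "p m < p (Suc m)" using IH(1) c Suc.prems[of m] by auto
    have JM [measurable]: "?J m \<in> borel_measurable M" using IH(2) lt by (auto intro: measurable_F)
    have DM [measurable]: "?D m \<in> borel_measurable M" using lt by (auto intro!: borel_measurable_diff W_measurable)
    have intJ: "integrable M (?J m)" using IH(3) by (rule square_integrable_imp_integrable[OF JM])
    note D = increment_moments[OF lt, of "\<eta> m"]
    have meas: "?J (Suc m) \<in> borel_measurable (F (p (Suc m)))"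
    proof -
      have "?J m \<in> borel_measurable (F (p (Suc m)))"
        "W (p (Suc m)) (\<eta> m) \<in> borel_measurable (F (p (Suc m)))"
        "W (p m) (\<eta> m) \<in> borel_measurable (F (p (Suc m)))"
        using measurable_F_mono[OF IH(2), of "p (Suc m)"] lt W_measurable_F[of "p (Suc m)"]
          measurable_F_mono[OF W_measurable_F[of "p m"], of "p (Suc m)"] by auto
      then show ?thesis unfolding J[abs_def] by measurable
    qed
    have ind: "indep_var borel (?J m) borel (?D m)"
      using indep_var_increment[OF lt IH(2), of "\<lambda>x. x" borel "\<eta> m"] by simp
    have cross: "integrable M (\<lambda>w. ?J m w * ?D m w)" "(LINT w|M. ?J m w * ?D m w) = 0"
      using indep_var_integrable[OF ind intJ D(1)] indep_var_lebesgue_integral[OF ind intJ D(1)] D(2) by simp_all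
    have sq: "(?J (Suc m) w)\<^sup>2 = (?J m w)\<^sup>2 + (2 * (?J m w * ?D m w) + (?D m w)\<^sup>2)" for w
      unfolding J by (simp only: power2_eq_square) (simp add: algebra_simps)
    have i: "integrable M (\<lambda>w. (?J (Suc m) w)\<^sup>2)"
      unfolding sq by (intro Bochner_Integration.integrable_add integrable_mult_right IH(3) cross(1) D(3))
    have e: "(LINT w|M. (?J (Suc m) w)\<^sup>2) = ?V (Suc m)"
      unfolding sq using IH(3,4) cross D(3,4)
      by (simp only: Bochner_Integration.integral_add integrable_mult_right Bochner_Integration.integrable_add) simp
    have AS: "A \<in> sets (F (p m))" using A sets_F_mono[OF c(1) IH(1)] by auto
    have Xm: "(\<lambda>w. indicator A w *\<^sub>R iexp (?J m w)) \<in> borel_measurable (F (p m))"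
      using AS IH(2) by measurable
    have ie: "iexp \<in> borel_measurable borel" by (intro borel_measurable_continuous_onI continuous_intros)
    have ind2: "indep_var borel (\<lambda>w. indicator A w *\<^sub>R iexp (?J m w)) borel (\<lambda>w. iexp (?D m w))"
      by (rule indep_var_increment[OF lt Xm ie])
    have n1: "norm (iexp x) = 1" for x :: real by (simp add: norm_exp_eq_Re)
    have "integrable M (\<lambda>w. indicator A w *\<^sub>R iexp (?J m w))"
      by (rule integrable_const_bound[of _ 1]) (use AM in "auto simp: n1 split: split_indicator")
    moreover have "integrable M (\<lambda>w. iexp (?D m w))"
      by (rule integrable_const_bound[of _ 1]) (rule AE_I2, simp only: n1, rule measurable_compose[OF DM ie])
    ultimately have "(CLINT w|M. (indicator A w *\<^sub>R iexp (?J m w)) * iexp (?D m w)) =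
        (prob A * exp (- ?V m / 2)) * exp (- ((p (Suc m) - p m) * (norm (\<eta> m))\<^sup>2) / 2)"
      using indep_var_lebesgue_integral[OF ind2] IH(5) D(5) by simp
    also have "... = prob A * exp (- ?V (Suc m) / 2)"
      by (simp add: add_divide_distrib diff_divide_distrib flip: exp_add of_real_mult)
    also have "(\<lambda>w. (indicator A w *\<^sub>R iexp (?J m w)) * iexp (?D m w)) = (\<lambda>w. indicator A w *\<^sub>R iexp (?J (Suc m) w))"
      unfolding J by (simp add: distrib_left exp_add)
    finally show ?case using meas i e IH(1) lt by simp
  qed
  then show "c \<le> p m" "?J m \<in> borel_measurable (F (p m))" "integrable M (\<lambda>w. (?J m w)\<^sup>2)"
     "(LINT w|M. (?J m w)\<^sup>2) = ?V m"
     "(CLINT w|M. indicator A w *\<^sub>R iexp (?J m w)) = prob A * exp (- ?V m / 2)" by blast+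
qed

definition inc_sum :: "(real \<times> real \<times> 'xi) list => 'w => real" where
  "inc_sum ts w = (\<Sum>(a, b, \<xi>)\<leftarrow>ts. W b \<xi> w - W a \<xi> w)"

lemma inc_sum_measurable:
  "(\<And>a b \<xi>. (a, b, \<xi>) \<in> set ts ==> 0 \<le> a \<and> 0 \<le> b) ==> inc_sum ts \<in> borel_measurable M"
proof (induction ts)
  case Nil
  then show ?case by (simp add: inc_sum_def[abs_def])
next
  case (Cons tr ts)
  obtain a b \<xi> where tr: "tr = (a, b, \<xi>)" by (cases tr)
  have "inc_sum (tr # ts) = (\<lambda>w. (W b \<xi> w - W a \<xi> w) + inc_sum ts w)"
    by (simp add: inc_sum_def[abs_def] tr)
  moreover have "inc_sum ts \<in> borel_measurable M" using Cons by auto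
  moreover have "0 \<le> a" "0 \<le> b" using Cons.prems[of a b \<xi>] tr by auto
  ultimately show ?case by simp
qed

lemma inc_sum_eq_grid_sum:
  assumes p0: "0 \<le> p 0" and p: "\<And>i j. i < j ==> j \<le> m ==> p i < p j"
    and ts: "\<And>a b \<xi>. (a, b, \<xi>) \<in> set ts ==> \<exists>i k. i \<le> k \<and> k \<le> m \<and> a = p i \<and> b = p k"
  shows "AE w in M. inc_sum ts w = grid_sum p (\<lambda>j. inc_fun ts (p (Suc j))) m w"
  using ts
proof (induction ts)
  case Nil
  have pos: "0 \<le> p j" if "j \<le> m" for j using p[of 0 j] p0 that by (cases "j = 0") auto
  have "AE w in M. \<forall>j\<le>m. W (p j) 0 w = 0"
    using W_zero[OF pos] by (simp add: AE_all_countable)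
  then show ?case by eventually_elim (simp add: inc_sum_def inc_fun_def grid_sum_def)
next
  case (Cons tr ts)
  obtain a b \<xi> where tr: "tr = (a, b, \<xi>)" by (cases tr)
  have pos: "0 \<le> p j" if "j \<le> m" for j using p[of 0 j] p0 that by (cases "j = 0") auto
  obtain i k where ik: "i \<le> k" "k \<le> m" "a = p i" "b = p k" using Cons.prems[of a b \<xi>] tr by auto
  have le: "p i \<le> p j \<longleftrightarrow> i \<le> j" if "i \<le> m" "j \<le> m" for i j
    using p[of i j] p[of j i] that by (cases i j rule: linorder_cases) auto
  have lt: "p i < p j \<longleftrightarrow> i < j" if "i \<le> m" "j \<le> m" for i j
    using le[OF that(2,1)] by auto
  have IH: "AE w in M. inc_sum ts w = grid_sum p (\<lambda>j. inc_fun ts (p (Suc j))) m w"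
    by (rule Cons.IH) (metis Cons.prems list.set_intros(2))
  define c where "c j = (indicator {a<..b} (p (Suc j)) :: real)" for j
  have lin: "AE w in M. \<forall>j<m. \<forall>l\<in>{j, Suc j}. W (p l) (inc_fun (tr # ts) (p (Suc j))) w =
      c j * W (p l) \<xi> w + W (p l) (inc_fun ts (p (Suc j))) w"
  proof -
    have "AE w in M. W (p l) (c j *\<^sub>R \<xi> + 1 *\<^sub>R inc_fun ts (p (Suc j))) w =
      c j * W (p l) \<xi> w + 1 * W (p l) (inc_fun ts (p (Suc j))) w" if "l \<le> m" for l j
      by (rule W_linear[OF pos[OF that]])
    then have "AE w in M. \<forall>j. \<forall>l\<le>m. W (p l) (c j *\<^sub>R \<xi> + 1 *\<^sub>R inc_fun ts (p (Suc j))) w =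
      c j * W (p l) \<xi> w + 1 * W (p l) (inc_fun ts (p (Suc j))) w"
      by (simp add: AE_all_countable)
    then show ?thesis
    proof eventually_elim
      case (elim w)
      then show ?case by (auto simp: inc_fun_def tr c_def)
    qed
  qed
  show ?case using IH lin
  proof eventually_elim
    case (elim w)
    have c_eq: "c j = (if i \<le> j \<and> j < k then 1 else 0)" if "j < m" for j
      using ik that le[of "Suc j" k] lt[of i "Suc j"] by (auto simp: c_def indicator_def)
    have "(\<Sum>j<m. c j * (W (p (Suc j)) \<xi> w - W (p j) \<xi> w)) =
       (\<Sum>j\<in>{i..<k}. W (p (Suc j)) \<xi> w - W (p j) \<xi> w)"
      using ik by (intro sum.mono_neutral_cong_right) (auto simp: c_eq)
    also have "... = W b \<xi> w - W a \<xi> w"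
      using sum_Suc_diff'[OF ik(1), of "\<lambda>j. W (p j) \<xi> w"] ik by simp
    finally have s: "(\<Sum>j<m. c j * (W (p (Suc j)) \<xi> w - W (p j) \<xi> w)) = W b \<xi> w - W a \<xi> w" .
    have "grid_sum p (\<lambda>j. inc_fun (tr # ts) (p (Suc j))) m w =
       (\<Sum>j<m. c j * (W (p (Suc j)) \<xi> w - W (p j) \<xi> w) +
          (W (p (Suc j)) (inc_fun ts (p (Suc j))) w - W (p j) (inc_fun ts (p (Suc j))) w))"
      unfolding grid_sum_def using elim(2) by (intro sum.cong refl) (auto simp: algebra_simps)
    also have "... = (W b \<xi> w - W a \<xi> w) + grid_sum p (\<lambda>j. inc_fun ts (p (Suc j))) m w"
      by (simp add: sum.distrib s grid_sum_def)
    finally show ?case using elim(1) by (simp add: inc_sum_def tr)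
  qed
qed

text \<open>The law of a sum of increments is Gaussian and does not see the past: on a grid that contains
  all endpoints the summands are independent, and the variance is the squared norm of the integrand.\<close>

lemma inc_sum_gaussian:
  assumes c: "0 \<le> c" and A: "A \<in> sets (F c)"
    and ts: "\<And>a b \<xi>. (a, b, \<xi>) \<in> set ts ==> c \<le> a \<and> a \<le> b"
  shows "integrable M (\<lambda>w. (inc_sum ts w)\<^sup>2)"
    and "ennreal (LINT w|M. (inc_sum ts w)\<^sup>2) = L2sq lborel (inc_fun ts)"
    and "(CLINT w|M. indicator A w *\<^sub>R iexp (inc_sum ts w)) =
      prob A * exp (- enn2real (L2sq lborel (inc_fun ts)) / 2)"
proof -
  define P where "P = insert c ((\<lambda>(a, b, \<xi>). a) ` set ts \<union> (\<lambda>(a, b, \<xi>). b) ` set ts)"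
  have P: "finite P" "P \<noteq> {}" by (auto simp: P_def)
  have Pc: "c \<le> x" if "x \<in> P" for x using that ts by (fastforce simp: P_def)
  define l where "l = sorted_list_of_set P"
  define p where "p j = l ! j" for j
  define m where "m = card P - 1"
  have len: "length l = Suc m" using P by (simp add: l_def m_def card_gt_0_iff)
  have inP: "p j \<in> P" if "j \<le> m" for j
    using that len nth_mem[of j l] P(1) by (simp add: p_def l_def less_Suc_eq_le)
  have sm: "p i < p j" if "i < j" "j \<le> m" for i j
    using that len sorted_wrt_nth_less[of "(<)" l i j] by (simp add: p_def l_def)
  have ex: "\<exists>j\<le>m. x = p j" if "x \<in> P" for x
  proof -
    have "x \<in> set l" using that P by (simp add: l_def)
    then show ?thesis using len by (auto simp: in_set_conv_nth p_def less_Suc_eq_le)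
  qed
  have le: "p i \<le> p j \<longleftrightarrow> i \<le> j" if "i \<le> m" "j \<le> m" for i j
    using sm[of i j] sm[of j i] that by (cases i j rule: linorder_cases) auto
  have p0: "c \<le> p 0" using Pc inP[of 0] by simp
  have idx: "\<exists>i k. i \<le> k \<and> k \<le> m \<and> a = p i \<and> b = p k" if "(a, b, \<xi>) \<in> set ts" for a b \<xi>
  proof -
    have "a \<in> P" "b \<in> P" using that by (force simp: P_def)+
    then obtain i k where "i \<le> m" "k \<le> m" "a = p i" "b = p k" using ex by metis
    moreover from this have "i \<le> k" using ts[OF that] le by simp
    ultimately show ?thesis by blast
  qed
  define \<eta> where "\<eta> j = inc_fun ts (p (Suc j))" for j
  let ?V = "\<Sum>j<m. (p (Suc j) - p j) * (norm (\<eta> j))\<^sup>2"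
  have ae: "AE w in M. inc_sum ts w = grid_sum p \<eta> m w"
    using inc_sum_eq_grid_sum[of p m ts] p0 c sm idx unfolding \<eta>_def by force
  have step: "inc_fun ts s = \<eta> j" if "j < m" "p j < s" "s \<le> p (Suc j)" for s j
  proof -
    have "indicator {a<..b} s = (indicator {a<..b} (p (Suc j)) :: real)" if ab: "(a, b, \<xi>) \<in> set ts" for a b \<xi>
    proof -
      obtain i k where ik: "i \<le> k" "k \<le> m" "a = p i" "b = p k" using idx[OF ab] by blast
      have "a < s \<longleftrightarrow> a < p (Suc j)"
        using le[of i j] le[of "Suc j" i] ik \<open>j < m\<close> \<open>p j < s\<close> \<open>s \<le> p (Suc j)\<close> by (auto simp: not_less_eq_eq)
      moreover have "s \<le> b \<longleftrightarrow> p (Suc j) \<le> b"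
        using le[of "Suc j" k] le[of k j] ik \<open>j < m\<close> \<open>p j < s\<close> \<open>s \<le> p (Suc j)\<close> by (auto simp: not_less_eq_eq)
      ultimately show ?thesis by (simp add: indicator_def)
    qed
    then show ?thesis unfolding inc_fun_def \<eta>_def
      by (intro arg_cong[where f=sum_list] map_cong) auto
  qed
  have outside: "inc_fun ts s = 0" if "\<not> (p 0 < s \<and> s \<le> p m)" for s
  proof -
    have "indicator {a<..b} s = (0::real)" if ab: "(a, b, \<xi>) \<in> set ts" for a b \<xi>
    proof -
      obtain i k where ik: "i \<le> k" "k \<le> m" "a = p i" "b = p k" using idx[OF ab] by blast
      then have "p 0 \<le> a" "b \<le> p m" by (auto simp: le)
      then show ?thesis using \<open>\<not> (p 0 < s \<and> s \<le> p m)\<close> by (auto simp: indicator_def)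
    qed
    then have "(\<Sum>(a, b, \<xi>)\<leftarrow>ts. indicator {a<..b} s *\<^sub>R \<xi>) = (\<Sum>_\<leftarrow>ts. 0)"
      by (intro arg_cong[where f=sum_list] map_cong) auto
    then show ?thesis unfolding inc_fun_def by simp
  qed
  have pw: "ennreal ((norm (inc_fun ts s))\<^sup>2) = (\<Sum>j<m. ennreal ((norm (\<eta> j))\<^sup>2) * indicator {p j<..p (Suc j)} s)" for s
  proof (cases "p 0 < s \<and> s \<le> p m")
    case False
    have "indicator {p j<..p (Suc j)} s = (0::ennreal)" if "j < m" for j
    proof -
      have "p 0 \<le> p j" "p (Suc j) \<le> p m" using that by (auto simp: le)
      then show ?thesis using False by (auto simp: indicator_def)
    qed
    then show ?thesis using outside[OF False] by simp
  next
    case True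
    define j where "j = (LEAST j. s \<le> p j)"
    have j1: "s \<le> p j" "j \<le> m" unfolding j_def using True by (auto intro: LeastI Least_le)
    have "j \<noteq> 0" using True j1 by (metis not_le)
    then obtain i where i: "j = Suc i" by (cases j) auto
    then have "p i < s" using not_less_Least[of i "\<lambda>j. s \<le> p j"] by (simp add: j_def not_le)
    have "indicator {p k<..p (Suc k)} s = (if k = i then 1 else (0::ennreal))" if "k < m" for k
    proof (cases k i rule: linorder_cases)
      case less
      then have "p (Suc k) \<le> p i" using i j1 by (simp add: le)
      then show ?thesis using \<open>p i < s\<close> less by (auto simp: indicator_def)
    next
      case equal
      then show ?thesis using \<open>p i < s\<close> j1 i by (auto simp: indicator_def)
    next
      case greater
      then have "p j \<le> p k" using i that by (simp add: le)
      then show ?thesis using j1 greater by (auto simp: indicator_def)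
    qed
    then have "(\<Sum>k<m. ennreal ((norm (\<eta> k))\<^sup>2) * indicator {p k<..p (Suc k)} s) =
       (\<Sum>k<m. if k = i then ennreal ((norm (\<eta> i))\<^sup>2) else 0)" by (intro sum.cong) auto
    also have "... = ennreal ((norm (inc_fun ts s))\<^sup>2)"
      using step[of i s] \<open>p i < s\<close> j1 i by simp
    finally show ?thesis by simp
  qed
  have Vpos: "0 \<le> (p (Suc j) - p j) * (norm (\<eta> j))\<^sup>2" if "j < m" for j
    using sm[of j "Suc j"] that by simp
  have V: "L2sq lborel (inc_fun ts) = ennreal ?V"
  proof -
    have "L2sq lborel (inc_fun ts) =
       (\<Sum>j<m. ennreal ((norm (\<eta> j))\<^sup>2) * ennreal (p (Suc j) - p j))"
      unfolding pw using sm
      by (subst nn_integral_sum) (auto simp: nn_integral_cmult less_imp_le intro!: sum.cong)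
    also have "... = (\<Sum>j<m. ennreal ((p (Suc j) - p j) * (norm (\<eta> j))\<^sup>2))"
      using sm by (intro sum.cong refl) (simp add: ennreal_mult less_imp_le mult.commute)
    also have "... = ennreal ?V" using Vpos by (intro sum_ennreal) auto
    finally show ?thesis .
  qed
  have Vn: "?V \<ge> 0" using Vpos by (intro sum_nonneg) auto
  have sm': "p j < p (Suc j)" if "j < m" for j using sm that by simp
  have pm: "c \<le> p m" by (rule grid_sum(1)[OF c p0 sm' A])
  note g = grid_sum(2-5)[where \<eta>=\<eta> and m=m and p=p, OF c p0 sm' A]
  have gm [measurable]: "grid_sum p \<eta> m \<in> borel_measurable M" using g(1) pm c by (auto intro: measurable_F)
  have im [measurable]: "inc_sum ts \<in> borel_measurable M"
    using ts c by (intro inc_sum_measurable) force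
  have "integrable M (\<lambda>w. (inc_sum ts w)\<^sup>2) \<longleftrightarrow> integrable M (\<lambda>w. (grid_sum p \<eta> m w)\<^sup>2)"
    by (rule integrable_cong_AE) (use ae in auto)
  then show "integrable M (\<lambda>w. (inc_sum ts w)\<^sup>2)" using g by simp
  have "(LINT w|M. (inc_sum ts w)\<^sup>2) = (LINT w|M. (grid_sum p \<eta> m w)\<^sup>2)"
    by (rule integral_cong_AE) (use ae in auto)
  then show "ennreal (LINT w|M. (inc_sum ts w)\<^sup>2) = L2sq lborel (inc_fun ts)"
    using g V by simp
  have AM: "A \<in> sets M" using A c sets_F_subset by auto
  have "(CLINT w|M. indicator A w *\<^sub>R iexp (inc_sum ts w)) = (CLINT w|M. indicator A w *\<^sub>R iexp (grid_sum p \<eta> m w))"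
    by (rule integral_cong_AE) (use ae AM in auto)
  then show "(CLINT w|M. indicator A w *\<^sub>R iexp (inc_sum ts w)) =
      prob A * exp (- enn2real (L2sq lborel (inc_fun ts)) / 2)"
    using g V Vn by simp
qed

end

section \<open>Finite measures on a Hilbert space and their characteristic functionals\<close>

definition halfspace :: "'a::real_inner \<times> real => 'a set" where
  "halfspace yc = {x. x \<bullet> fst yc \<le> snd yc}"

text \<open>Every open set is a countable union of closed balls around points of a dense set, and a ball is a
  countable intersection of half-spaces whose normals run through a dense set.\<close>

lemma borel_eq_halfspaces:
  "(borel :: 'a::{real_inner,second_countable_topology} measure) = sigma UNIV (range halfspace)"
proof (rule borel_eq_sigmaI1[where X="{U. open U}" and A=UNIV])
  show "(borel :: 'a measure) = sigma UNIV {U. open U}" by (rule borel_def)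
  show "halfspace yc \<in> sets borel" for yc :: "'a \<times> real"
    unfolding halfspace_def by (intro borel_closed closed_Collect_le continuous_intros)
  fix U :: "'a set" assume "U \<in> {U. open U}"
  then have U: "open U" by simp
  let ?S = "sigma_sets UNIV (range (halfspace :: 'a \<times> real => _))"
  obtain D :: "'a set" where D: "countable D" "\<And>X. open X ==> X \<noteq> {} ==> \<exists>d\<in>D. d \<in> X"
    using countable_dense_exists[where 'a='a] by blast
  then have "D \<noteq> {}" using D(2)[of UNIV] by auto
  have ball: "cball a r = (\<Inter>n. halfspace (from_nat_into D n, r * norm (from_nat_into D n) + a \<bullet> from_nat_into D n))"
    if "r \<ge> 0" for a r
  proof (intro set_eqI iffI)
    fix x assume x: "x \<in> cball a r"
    have "(x - a) \<bullet> y \<le> r * norm y" for y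
    proof -
      have "(x - a) \<bullet> y \<le> norm (x - a) * norm y" by (rule norm_cauchy_schwarz)
      also have "... \<le> r * norm y" using x by (intro mult_right_mono) (auto simp: dist_norm norm_minus_commute)
      finally show ?thesis .
    qed
    then show "x \<in> (\<Inter>n. halfspace (from_nat_into D n, r * norm (from_nat_into D n) + a \<bullet> from_nat_into D n))"
      by (simp add: halfspace_def inner_diff_left algebra_simps)
  next
    fix x assume x: "x \<in> (\<Inter>n. halfspace (from_nat_into D n, r * norm (from_nat_into D n) + a \<bullet> from_nat_into D n))"
    define v where "v = x - a"
    have "v \<bullet> v \<le> r * norm v"
    proof (rule ccontr)
      assume "\<not> ?thesis"
      moreover have "open {y. r * norm y < v \<bullet> y}" by (intro open_Collect_less continuous_intros)
      ultimately obtain d where d: "d \<in> D" "r * norm d < v \<bullet> d" using D(2)[of "{y. r * norm y < v \<bullet> y}"] by (metis (mono_tags, lifting) empty_iff mem_Collect_eq not_le)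
      then obtain n where "d = from_nat_into D n" using from_nat_into_surj[OF D(1)] by metis
      then have "x \<bullet> d \<le> r * norm d + a \<bullet> d" using x by (simp add: halfspace_def)
      then show False using d by (simp add: v_def inner_diff_left)
    qed
    then have "norm v * norm v \<le> r * norm v" by (simp add: power2_norm_eq_inner[symmetric] power2_eq_square)
    then have "norm v \<le> r" using that by (cases "norm v = 0") auto
    then show "x \<in> cball a r" by (simp add: v_def dist_norm norm_minus_commute)
  qed
  have cb: "cball a r \<in> ?S" if "r \<ge> 0" for a r
    unfolding ball[OF that] by (intro sigma_sets_Inter sigma_sets.Basic) auto
  define B where "B = (\<lambda>(a, r). cball a r) ` {(a, r). a \<in> D \<and> r \<in> \<rat> \<and> r \<ge> 0 \<and> cball a r \<subseteq> U}"
  have "countable {(a, r::real). a \<in> D \<and> r \<in> \<rat> \<and> r \<ge> 0 \<and> cball a r \<subseteq> U}"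
    by (rule countable_subset[of _ "D \<times> \<rat>"]) (auto intro: countable_SIGMA D countable_rat)
  then have "countable B" by (simp add: B_def)
  moreover have "b \<in> ?S" if "b \<in> B" for b using that cb by (auto simp: B_def)
  ultimately have "\<Union>B \<in> ?S" by (rule sigma_sets_UNION)
  moreover have "\<Union>B = U"
  proof
    show "\<Union>B \<subseteq> U" by (auto simp: B_def)
    show "U \<subseteq> \<Union>B"
    proof
      fix x assume "x \<in> U"
      then obtain e where e: "e > 0" "ball x e \<subseteq> U" using U by (meson openE)
      obtain r where r: "r \<in> \<rat>" "0 < r" "r < e / 2" using Rats_dense_in_real[of 0 "e/2"] e by auto
      obtain d where d: "d \<in> D" "d \<in> ball x r" using D(2)[of "ball x r"] r by auto
      have "cball d r \<subseteq> ball x e"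
      proof
        fix y assume "y \<in> cball d r"
        then show "y \<in> ball x e" using d r dist_triangle[of x y d] by simp
      qed
      then have "cball d r \<in> B" using d(1) r e(2) unfolding B_def
        by (intro image_eqI[where x="(d, r)"]) auto
      moreover have "x \<in> cball d r" using d by (simp add: dist_commute)
      ultimately show "x \<in> \<Union>B" by blast
    qed
  qed
  ultimately show "U \<in> sets (sigma UNIV (range halfspace))" by simp
qed

text \<open>Normalisation reduces this to Levy's theorem for probability measures.\<close>

lemma finite_measure_real_char_unique:
  fixes m1 m2 :: "real measure"
  assumes "finite_measure m1" "finite_measure m2" "sets m1 = sets borel" "sets m2 = sets borel"
    and ch: "\<And>t. (CLINT x|m1. iexp (t * x)) = (CLINT x|m2. iexp (t * x))"
  shows "m1 = m2"
proof -
  interpret m1: finite_measure m1 by fact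
  interpret m2: finite_measure m2 by fact
  have sp: "space m1 = UNIV" "space m2 = UNIV" using assms(3,4)[THEN sets_eq_imp_space_eq] by simp_all
  have [measurable_cong]: "sets m1 = sets borel" "sets m2 = sets borel" by fact+
  have "measure m1 UNIV = measure m2 UNIV" using ch[of 0] sp by simp
  then have tot: "emeasure m1 UNIV = emeasure m2 UNIV" by (simp add: m1.emeasure_eq_measure m2.emeasure_eq_measure)
  define c where "c = measure m1 UNIV"
  have c1: "emeasure m1 UNIV = ennreal c" "emeasure m2 UNIV = ennreal c" "c \<ge> 0"
    using tot by (simp_all add: c_def m1.emeasure_eq_measure)
  show ?thesis
  proof (cases "c = 0")
    case True
    show ?thesis
    proof (rule measure_eqI)
      show "sets m1 = sets m2" using assms by simp
      fix A assume "A \<in> sets m1"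
      have "emeasure m1 A \<le> emeasure m1 UNIV" "emeasure m2 A \<le> emeasure m2 UNIV"
        using emeasure_space[of m1 A] emeasure_space[of m2 A] sp by simp_all
      then show "emeasure m1 A = emeasure m2 A" using c1 True by simp
    qed
  next
    case False
    then have cpos: "c > 0" using c1 by simp
    define n where "n m = density m (\<lambda>_. ennreal (1 / c))" for m :: "real measure"
    have dens: "real_distribution (n m)" if "sets m = sets borel" "emeasure m UNIV = ennreal c" for m
    proof -
      have "space m = UNIV" using sets_eq_imp_space_eq[OF that(1)] by simp
      then have "emeasure (n m) (space (n m)) = 1"
        using that cpos by (simp add: n_def emeasure_density_const ennreal_mult'[symmetric])
      then show ?thesis using that
        by (intro real_distribution.intro prob_spaceI real_distribution_axioms.intro) (simp_all add: n_def)
    qed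
    have chn: "char (n m) t = (1 / c) *\<^sub>R (CLINT x|m. iexp (t * x))" if "sets m = sets borel" for m t
      unfolding char_def n_def using cpos that
      by (subst integral_density) (auto simp: measurable_cong_sets[OF that refl])
    have "char (n m1) = char (n m2)"
      by (rule ext) (simp only: chn[OF assms(3)] chn[OF assms(4)] ch)
    then have "n m1 = n m2"
      by (intro Levy_uniqueness) (auto intro!: dens simp: assms c1)
    moreover have "emeasure m A = ennreal c * emeasure (n m) A" if "A \<in> sets borel" "sets m = sets borel" for m A
    proof -
      have "emeasure (n m) A = ennreal (1 / c) * emeasure m A"
        using that by (simp add: n_def emeasure_density_const)
      then have "ennreal c * emeasure (n m) A = (ennreal c * ennreal (1 / c)) * emeasure m A" by (simp add: mult.assoc)
      also have "ennreal c * ennreal (1 / c) = 1" using cpos by (simp add: ennreal_mult'[symmetric])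
      finally show ?thesis by simp
    qed
    ultimately show ?thesis by (intro measure_eqI) (auto simp: assms)
  qed
qed

lemma weighted_real_char_unique:
  fixes \<mu> \<nu> :: "'a::{real_inner,second_countable_topology} measure" and g :: "'a => real"
  assumes fin: "finite_measure \<mu>" "finite_measure \<nu>" and sets: "sets \<mu> = sets borel" "sets \<nu> = sets borel"
    and g: "g \<in> borel_measurable borel" "\<And>x. 0 \<le> g x" "\<And>x. g x \<le> K"
    and ch: "\<And>t. (CLINT x|\<mu>. g x *\<^sub>R iexp (t * (y \<bullet> x))) = (CLINT x|\<nu>. g x *\<^sub>R iexp (t * (y \<bullet> x)))"
    and B: "B \<in> sets borel"
  shows "(LINT x|\<mu>. g x * indicator B (y \<bullet> x)) = (LINT x|\<nu>. g x * indicator B (y \<bullet> x))"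
proof -
  define N where "N m = distr (density m g) borel (\<lambda>x. y \<bullet> x)" for m :: "'a measure"
  have finN: "finite_measure (N m)" if "finite_measure m" "sets m = sets borel" for m
  proof -
    interpret finite_measure m by fact
    have [measurable_cong]: "sets m = sets borel" by fact
    have "(\<integral>\<^sup>+ x. ennreal (g x) \<partial>m) \<le> (\<integral>\<^sup>+ x. ennreal K \<partial>m)" using g by (intro nn_integral_mono ennreal_leI)
    also have "... < \<infinity>" by (simp add: emeasure_finite less_top[symmetric] ennreal_mult_eq_top_iff)
    finally have "emeasure (density m g) (space (density m g)) \<noteq> \<infinity>"
      using g(1) by (simp add: emeasure_density cong: nn_integral_cong)
    then have "finite_measure (density m g)" by (rule finite_measureI)
    then show ?thesis unfolding N_def by (rule finite_measure.finite_measure_distr) (simp add: measurable_cong_sets[OF that(2) refl])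
  qed
  have chN: "(CLINT r|N m. iexp (t * r)) = (CLINT x|m. g x *\<^sub>R iexp (t * (y \<bullet> x)))"
    if "sets m = sets borel" for m t
  proof -
    have [measurable_cong]: "sets m = sets borel" by fact
    have [measurable]: "g \<in> borel_measurable borel" by fact
    have "(CLINT r|N m. iexp (t * r)) = (CLINT x|density m g. iexp (t * (y \<bullet> x)))"
      unfolding N_def by (subst integral_distr) auto
    also have "... = (CLINT x|m. g x *\<^sub>R iexp (t * (y \<bullet> x)))"
      using g by (subst integral_density) auto
    finally show ?thesis .
  qed
  have eqN: "N \<mu> = N \<nu>"
    by (rule finite_measure_real_char_unique) (use finN fin sets chN ch in "auto simp: N_def")
  have "(LINT x|m. g x * indicator B (y \<bullet> x)) = (LINT r|N m. indicator B r)"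
    if "sets m = sets borel" for m
  proof -
    have [measurable_cong]: "sets m = sets borel" by fact
    have [measurable]: "g \<in> borel_measurable borel" "B \<in> sets borel" by fact+
    have "(LINT r|N m. indicator B r :: real) = (LINT x|density m g. indicator B (y \<bullet> x))"
      unfolding N_def by (subst integral_distr) auto
    also have "... = (LINT x|m. g x *\<^sub>R indicator B (y \<bullet> x))"
      using g by (subst integral_density) auto
    finally show ?thesis by simp
  qed
  then show ?thesis using eqN sets by simp
qed

text \<open>Equality of the characteristic functionals survives the insertion of a half-space
  indicator.  For a fixed frequency \<open>z\<close> the weights \<open>1 + cos \<langle>z, x\<rangle>\<close> and \<open>1 + sin \<langle>z, x\<rangle>\<close> are nonnegative,
  and one-dimensional uniqueness applies to the weighted laws of \<open>\<langle>y, x\<rangle>\<close>.\<close>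

lemma char_functional_insert:
  fixes \<mu> \<nu> :: "'a::{real_inner,second_countable_topology} measure"
  assumes fin: "finite_measure \<mu>" "finite_measure \<nu>" and sets: "sets \<mu> = sets borel" "sets \<nu> = sets borel"
    and C: "C \<in> sets borel" and B: "B \<in> sets borel"
    and ch: "\<And>z. (CLINT x|\<mu>. indicator C x *\<^sub>R iexp (z \<bullet> x)) = (CLINT x|\<nu>. indicator C x *\<^sub>R iexp (z \<bullet> x))"
  shows "(CLINT x|\<mu>. indicator (C \<inter> {x. y \<bullet> x \<in> B}) x *\<^sub>R iexp (z \<bullet> x)) =
    (CLINT x|\<nu>. indicator (C \<inter> {x. y \<bullet> x \<in> B}) x *\<^sub>R iexp (z \<bullet> x))"
proof -
  have n1: "norm (iexp r) = 1" for r :: real by (simp add: norm_exp_eq_Re)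
  have int: "integrable m (\<lambda>x. indicator C x *\<^sub>R (w * iexp (v \<bullet> x)))" if "m \<in> {\<mu>, \<nu>}" for m w v
  proof -
    have s: "sets m = sets borel" "finite_measure m" using that sets fin by auto
    interpret finite_measure m by fact
    have [measurable_cong]: "sets m = sets borel" by fact
    show ?thesis
      by (rule integrable_const_bound[of _ "norm w"])
        (use C in "auto simp: norm_mult n1 split: split_indicator")
  qed
  have comb: "(CLINT x|\<mu>. indicator C x *\<^sub>R (w0 * iexp (v0 \<bullet> x) + (w1 * iexp (v1 \<bullet> x) + w2 * iexp (v2 \<bullet> x)))) =
      (CLINT x|\<nu>. indicator C x *\<^sub>R (w0 * iexp (v0 \<bullet> x) + (w1 * iexp (v1 \<bullet> x) + w2 * iexp (v2 \<bullet> x))))" for w0 w1 w2 v0 v1 v2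
  proof -
    have "(CLINT x|m. indicator C x *\<^sub>R (w0 * iexp (v0 \<bullet> x) + (w1 * iexp (v1 \<bullet> x) + w2 * iexp (v2 \<bullet> x)))) =
       w0 * (CLINT x|m. indicator C x *\<^sub>R iexp (v0 \<bullet> x)) + (w1 * (CLINT x|m. indicator C x *\<^sub>R iexp (v1 \<bullet> x)) +
       w2 * (CLINT x|m. indicator C x *\<^sub>R iexp (v2 \<bullet> x)))" if m: "m \<in> {\<mu>, \<nu>}" for m
    proof -
      have "(CLINT x|m. indicator C x *\<^sub>R (w * iexp (v \<bullet> x))) = w * (CLINT x|m. indicator C x *\<^sub>R iexp (v \<bullet> x))" for w v
        by (subst integral_mult_right_zero[symmetric]) (simp add: mult.left_commute scaleR_conv_of_real)
      then show ?thesis unfolding scaleR_add_right using int[OF m]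
        by (simp only: Bochner_Integration.integral_add Bochner_Integration.integrable_add)
    qed
    then show ?thesis by (simp add: ch)
  qed
  have cos_c: "complex_of_real (cos r) = (1/2) * iexp r + (1/2) * iexp (- r)" for r
    by (simp add: cos_of_real[symmetric] cos_exp_eq field_simps)
  have sin_c: "complex_of_real (sin r) = (- \<i> / 2) * iexp r + (\<i> / 2) * iexp (- r)" for r
    by (simp add: sin_of_real[symmetric] sin_exp_eq field_simps)
  have mg: "(\<lambda>x. indicator C x * f (z \<bullet> x)) \<in> borel_measurable borel" if "f \<in> borel_measurable borel" for f :: "real => real"
    using C that by measurable
  have W: "(LINT x|\<mu>. (indicator C x * f (z \<bullet> x)) * indicator B (y \<bullet> x)) = (LINT x|\<nu>. (indicator C x * f (z \<bullet> x)) * indicator B (y \<bullet> x))"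
    if f: "f \<in> borel_measurable borel" "\<And>r. 0 \<le> f r" "\<And>r. f r \<le> 2"
      and fe: "\<And>r. complex_of_real (f r) = 1 + (w1 * iexp r + w2 * iexp (- r))" for f w1 w2
  proof (rule weighted_real_char_unique[OF fin sets mg[OF f(1)] _ _ _ B, of 2])
    fix x show "0 \<le> indicator C x * f (z \<bullet> x)" "indicator C x * f (z \<bullet> x) \<le> 2"
      using f by (auto simp: indicator_def)
  next
    fix t
    have "(indicator C x * f (z \<bullet> x)) *\<^sub>R iexp (t * (y \<bullet> x)) =
       indicator C x *\<^sub>R (1 * iexp ((t *\<^sub>R y) \<bullet> x) + (w1 * iexp ((z + t *\<^sub>R y) \<bullet> x) + w2 * iexp ((- z + t *\<^sub>R y) \<bullet> x)))" for x
      by (simp add: scaleR_conv_of_real fe inner_add_left algebra_simps flip: exp_add)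
    then show "(CLINT x|\<mu>. (indicator C x * f (z \<bullet> x)) *\<^sub>R iexp (t * (y \<bullet> x))) =
      (CLINT x|\<nu>. (indicator C x * f (z \<bullet> x)) *\<^sub>R iexp (t * (y \<bullet> x)))" by (simp only: comb)
  qed
  let ?I = "\<lambda>x. indicator C x * indicator B (y \<bullet> x) :: real"
  have W1: "(LINT x|\<mu>. ?I x) = (LINT x|\<nu>. ?I x)"
    using W[of "\<lambda>_. 1" 0 0] by simp
  have Wc: "(LINT x|\<mu>. ?I x + ?I x * cos (z \<bullet> x)) = (LINT x|\<nu>. ?I x + ?I x * cos (z \<bullet> x))"
    using W[of "\<lambda>r. 1 + cos r" "1/2" "1/2"] cos_ge_minus_one cos_le_one
    by (simp add: cos_c algebra_simps add_increasing2) (smt (verit) cos_ge_minus_one cos_le_one)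
  have Ws: "(LINT x|\<mu>. ?I x + ?I x * sin (z \<bullet> x)) = (LINT x|\<nu>. ?I x + ?I x * sin (z \<bullet> x))"
    using W[of "\<lambda>r. 1 + sin r" "- \<i> / 2" "\<i> / 2"] sin_ge_minus_one sin_le_one
    by (simp add: sin_c algebra_simps) (smt (verit) sin_ge_minus_one sin_le_one)
  have meas: "?I \<in> borel_measurable borel" using C B by measurable
  have intr: "integrable m ?I" "integrable m (\<lambda>x. ?I x * cos (z \<bullet> x))" "integrable m (\<lambda>x. ?I x * sin (z \<bullet> x))"
    if "m \<in> {\<mu>, \<nu>}" for m
  proof -
    have s: "sets m = sets borel" "finite_measure m" using that sets fin by auto
    interpret finite_measure m by fact
    have [measurable_cong]: "sets m = sets borel" by fact
    have mI: "?I \<in> borel_measurable m" using meas by (simp only: measurable_cong_sets[OF s(1) refl])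
    have mc: "(\<lambda>x. z \<bullet> x) \<in> borel_measurable m" by measurable
    show "integrable m ?I"
      by (rule integrable_const_bound[OF _ mI, of 1]) (auto simp: indicator_def)
    show "integrable m (\<lambda>x. ?I x * cos (z \<bullet> x))"
      by (rule integrable_const_bound[of _ 1])
        (auto simp: indicator_def intro!: borel_measurable_times[OF mI, unfolded indicator_def] measurable_compose[OF mc])
    show "integrable m (\<lambda>x. ?I x * sin (z \<bullet> x))"
      by (rule integrable_const_bound[of _ 1])
        (auto simp: indicator_def intro!: borel_measurable_times[OF mI, unfolded indicator_def] measurable_compose[OF mc])
  qed
  have ec: "(LINT x|\<mu>. ?I x * cos (z \<bullet> x)) = (LINT x|\<nu>. ?I x * cos (z \<bullet> x))"
    using W1 Wc intr by simp
  have es: "(LINT x|\<mu>. ?I x * sin (z \<bullet> x)) = (LINT x|\<nu>. ?I x * sin (z \<bullet> x))"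
    using W1 Ws intr by simp
  have dec: "(CLINT x|m. indicator (C \<inter> {x. y \<bullet> x \<in> B}) x *\<^sub>R iexp (z \<bullet> x)) =
     of_real (LINT x|m. ?I x * cos (z \<bullet> x)) + \<i> * of_real (LINT x|m. ?I x * sin (z \<bullet> x))" if m: "m \<in> {\<mu>, \<nu>}" for m
  proof -
    have "indicator (C \<inter> {x. y \<bullet> x \<in> B}) x *\<^sub>R iexp (z \<bullet> x) =
       complex_of_real (?I x * cos (z \<bullet> x)) + \<i> * complex_of_real (?I x * sin (z \<bullet> x))" for x
      by (simp add: indicator_def cis_conv_exp[symmetric] complex_eq_iff)
    then show ?thesis using intr[OF m] by (simp only: Bochner_Integration.integral_add integrable_mult_right
        integrable_of_real integral_mult_right_zero integral_complex_of_real)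
  qed
  show ?thesis using dec[of \<mu>] dec[of \<nu>] ec es by simp
qed

text \<open>Inserting half-spaces one at a time shows that both measures agree on finite intersections of
  half-spaces, which generate the Borel sets.\<close>

theorem char_functional_unique:
  fixes \<mu> \<nu> :: "'a::{real_inner,second_countable_topology} measure"
  assumes fin: "finite_measure \<mu>" "finite_measure \<nu>" and sets: "sets \<mu> = sets borel" "sets \<nu> = sets borel"
    and ch: "\<And>z. (CLINT x|\<mu>. iexp (z \<bullet> x)) = (CLINT x|\<nu>. iexp (z \<bullet> x))"
  shows "\<mu> = \<nu>"
proof -
  interpret mu: finite_measure \<mu> by fact
  interpret nu: finite_measure \<nu> by fact
  have sp: "space \<mu> = UNIV" "space \<nu> = UNIV" using sets[THEN sets_eq_imp_space_eq] by simp_all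
  define E :: "'a set set" where "E = {\<Inter>A | A. finite A \<and> A \<subseteq> range halfspace}"
  have hs: "halfspace yc \<in> sets borel" for yc :: "'a \<times> real"
    unfolding halfspace_def by (intro borel_closed closed_Collect_le continuous_intros)
  have main: "\<Inter>A \<in> sets borel \<and> (\<forall>z. (CLINT x|\<mu>. indicator (\<Inter>A) x *\<^sub>R iexp (z \<bullet> x)) = (CLINT x|\<nu>. indicator (\<Inter>A) x *\<^sub>R iexp (z \<bullet> x)))"
    if "finite A" "A \<subseteq> range halfspace" for A :: "'a set set"
    using that
  proof (induction A)
    case empty
    then show ?case using ch by simp
  next
    case (insert H A)
    then obtain y c where H: "H = halfspace (y, c)" by auto
    have IH: "\<Inter>A \<in> sets borel"
      "\<And>z. (CLINT x|\<mu>. indicator (\<Inter>A) x *\<^sub>R iexp (z \<bullet> x)) = (CLINT x|\<nu>. indicator (\<Inter>A) x *\<^sub>R iexp (z \<bullet> x))"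
      using insert by auto
    have "\<Inter>(insert H A) = \<Inter>A \<inter> {x. y \<bullet> x \<in> {..c}}" by (auto simp: H halfspace_def inner_commute)
    then show ?case
      using char_functional_insert[OF fin sets IH(1) _ IH(2), of "{..c}" y] IH(1) hs[of "(y, c)"] H by auto
  qed
  show ?thesis
  proof (rule measure_eqI_generator_eq[where E=E and \<Omega>=UNIV and A="\<lambda>_. UNIV"])
    show "Int_stable E"
    proof (rule Int_stableI)
      fix a b assume "a \<in> E" "b \<in> E"
      then obtain A B where "finite A" "A \<subseteq> range halfspace" "a = \<Inter>A" "finite B" "B \<subseteq> range halfspace" "b = \<Inter>B"
        by (auto simp: E_def)
      then show "a \<inter> b \<in> E" unfolding E_def by (intro CollectI exI[of _ "A \<union> B"]) auto
    qed
    have "range (halfspace :: 'a \<times> real => _) \<subseteq> E" unfolding E_def by (auto intro!: exI[of _ "{halfspace (a, b)}" for a b])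
    moreover have "E \<subseteq> sets borel" using main by (auto simp: E_def)
    ultimately have "sigma_sets UNIV E = sets borel"
      by (metis (no_types, lifting) borel_eq_halfspaces sets.sigma_sets_subset sets_measure_of sigma_sets_mono'
          space_borel subset_UNIV subset_antisym Pow_UNIV)
    then show "sets \<mu> = sigma_sets UNIV E" "sets \<nu> = sigma_sets UNIV E" using sets by simp_all
    show "range (\<lambda>_::nat. UNIV) \<subseteq> E" unfolding E_def by (auto intro!: exI[of _ "{}"])
    fix X assume "X \<in> E"
    then obtain A where A: "X = \<Inter>A" "finite A" "A \<subseteq> range halfspace" by (auto simp: E_def)
    have "X \<in> sets borel" using main A by auto
    have "(CLINT x|\<mu>. indicator X x *\<^sub>R iexp (0 \<bullet> x)) = (CLINT x|\<nu>. indicator X x *\<^sub>R iexp (0 \<bullet> x))"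
      using main A by blast
    moreover have "(CLINT x|m. indicator X x *\<^sub>R iexp (0 \<bullet> x)) = of_real (LINT x|m. indicator X x)" for m :: "'a measure"
      unfolding integral_complex_of_real[symmetric] by (simp add: scaleR_conv_of_real)
    ultimately have "measure \<mu> X = measure \<nu> X" using \<open>X \<in> sets borel\<close> sets sp by simp
    then show "emeasure \<mu> X = emeasure \<nu> X" by (simp add: mu.emeasure_eq_measure nu.emeasure_eq_measure)
  qed auto
qed

section \<open>Stochastic integrals of deterministic integrands\<close>

lemma norm_add_sq_le: "(norm (a + b :: 'a::real_normed_vector))\<^sup>2 \<le> 2 * (norm a)\<^sup>2 + 2 * (norm b)\<^sup>2"
proof -
  have "(norm (a + b))\<^sup>2 \<le> (norm a + norm b)\<^sup>2" by (intro power_mono norm_triangle_ineq) simp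
  also have "... \<le> 2 * (norm a)\<^sup>2 + 2 * (norm b)\<^sup>2"
    using zero_le_power2[of "norm a - norm b"] by (simp add: power2_sum power2_diff)
  finally show ?thesis .
qed

lemma ennreal_norm_add_sq_le:
  "ennreal ((norm (a + b :: 'a::real_normed_vector))\<^sup>2) \<le> 2 * ennreal ((norm a)\<^sup>2) + 2 * ennreal ((norm b)\<^sup>2)"
proof -
  have "ennreal ((norm (a + b))\<^sup>2) \<le> ennreal (2 * (norm a)\<^sup>2 + 2 * (norm b)\<^sup>2)"
    by (intro ennreal_leI norm_add_sq_le)
  also have "... = 2 * ennreal ((norm a)\<^sup>2) + 2 * ennreal ((norm b)\<^sup>2)"
    by (simp add: ennreal_mult)
  finally show ?thesis .
qed

lemma nn_integral_norm_add_sq_le: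
  fixes f g :: "'a => 'b::{real_normed_vector,second_countable_topology}"
  assumes [measurable]: "f \<in> borel_measurable M" "g \<in> borel_measurable M"
  shows "L2sq M (\<lambda>x. f x + g x) \<le>
    2 * (L2sq M f) + 2 * (L2sq M g)"
proof -
  have "L2sq M (\<lambda>x. f x + g x) \<le> (\<integral>\<^sup>+ x. 2 * ennreal ((norm (f x))\<^sup>2) + 2 * ennreal ((norm (g x))\<^sup>2) \<partial>M)"
    by (intro nn_integral_mono ennreal_norm_add_sq_le)
  also have "... = 2 * (L2sq M f) + 2 * (L2sq M g)"
    by (subst nn_integral_add) (auto simp: nn_integral_cmult)
  finally show ?thesis .
qed

lemma tendsto_zero_ennreal_add2:
  fixes f g :: "nat => ennreal"
  assumes "f \<longlonglongrightarrow> 0" "g \<longlonglongrightarrow> 0"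
  shows "(\<lambda>n. 2 * f n + 2 * g n) \<longlonglongrightarrow> 0"
proof -
  have "(\<lambda>n. 2 * f n) \<longlonglongrightarrow> 2 * 0" "(\<lambda>n. 2 * g n) \<longlonglongrightarrow> 2 * 0"
    by (rule ennreal_tendsto_cmult[OF _ assms(1)], simp, rule ennreal_tendsto_cmult[OF _ assms(2)], simp)
  then show ?thesis using tendsto_add[of "\<lambda>n. 2 * f n" 0 sequentially "\<lambda>n. 2 * g n" 0] by simp
qed

lemma tendsto_zero_ennrealI:
  fixes f :: "nat => ennreal"
  assumes "\<And>\<epsilon>. \<epsilon> > 0 ==> \<exists>N. \<forall>n\<ge>N. f n \<le> ennreal \<epsilon>"
  shows "f \<longlonglongrightarrow> 0"
proof (rule order_tendstoI)
  fix a :: ennreal assume "0 < a"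
  then obtain b where b: "0 < b" "b < a" using dense by blast
  then obtain e where "b = ennreal e" "e > 0" by (cases b) auto
  with b assms[of e] show "eventually (\<lambda>n. f n < a) sequentially"
    unfolding eventually_sequentially by (meson order.strict_trans1)
qed auto

lemma tendsto_zero_ennreal_le:
  fixes f g :: "nat => ennreal"
  assumes "g \<longlonglongrightarrow> 0" "\<And>n. f n \<le> g n"
  shows "f \<longlonglongrightarrow> 0"
  by (rule tendsto_sandwich[OF _ _ tendsto_const assms(1)]) (use assms(2) in auto)

subsection \<open>Mean square limits\<close>

lemma L2_limit_AE_subseq:
  fixes f :: "nat => 'a => 'b::{banach,second_countable_topology}"
  assumes [measurable]: "Z \<in> borel_measurable M" "\<And>n. f n \<in> borel_measurable M"
    and lim: "(\<lambda>n. L2sq M (\<lambda>x. Z x - f n x)) \<longlonglongrightarrow> 0"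
  shows "\<exists>r::nat => nat. strict_mono r \<and> (AE x in M. (\<lambda>n. f (r n) x) \<longlonglongrightarrow> Z x)"
proof -
  let ?d = "\<lambda>n. L2sq M (\<lambda>x. Z x - f n x)"
  have "eventually (\<lambda>n. ?d n < 1) sequentially" using lim by (rule order_tendstoD) simp
  then obtain N where N: "\<And>n. n \<ge> N ==> ?d n < 1" by (auto simp: eventually_sequentially)
  define v where "v n x = (norm (Z x - f (n + N) x))\<^sup>2" for n x
  have int: "integrable M (v n)" for n
  proof (rule integrableI_bounded)
    show "v n \<in> borel_measurable M" unfolding v_def by measurable
    have "?d (n + N) < \<infinity>" using N[of "n + N"] by (rule order.strict_trans) (simp_all)
    then show "L1 M (v n) < \<infinity>" by (simp add: v_def)
  qed
  have "(\<lambda>n. LINT x|M. norm (v n x)) \<longlonglongrightarrow> 0"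
  proof -
    have "ennreal (LINT x|M. norm (v n x)) = ?d (n + N)" for n
      using nn_integral_eq_integral[OF int[of n]] by (simp add: v_def[abs_def])
    then have "(\<lambda>n. ennreal (LINT x|M. norm (v n x))) \<longlonglongrightarrow> 0"
      using LIMSEQ_ignore_initial_segment[OF lim, of N] by simp
    then show ?thesis using tendsto_ennreal_iff[of "\<lambda>n. LINT x|M. norm (v n x)" sequentially 0] by simp
  qed
  from tendsto_L1_AE_subseq[OF int this]
  obtain r where r: "strict_mono r" "AE x in M. (\<lambda>n. v (r n) x) \<longlonglongrightarrow> 0" by blast
  have "AE x in M. (\<lambda>n. f (r n + N) x) \<longlonglongrightarrow> Z x"
    using r(2)
  proof eventually_elim
    case (elim x)
    then have "(\<lambda>n. sqrt (v (r n) x)) \<longlonglongrightarrow> sqrt 0" by (intro tendsto_intros)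
    then have "(\<lambda>n. norm (f (r n + N) x - Z x)) \<longlonglongrightarrow> 0" by (simp add: v_def norm_minus_commute)
    then show ?case by (simp add: tendsto_norm_zero_iff LIM_zero_iff)
  qed
  moreover have "strict_mono (\<lambda>n. r n + N)" using r(1) by (simp add: strict_mono_def)
  ultimately show ?thesis by blast
qed

text \<open>A subsequence with summable increments converges almost surely, and Fatou's lemma turns the almost
  sure limit into the mean square limit.\<close>

lemma (in prob_space) L2_complete:
  fixes f :: "nat => 'a => 'b::{banach,second_countable_topology}"
  assumes [measurable]: "\<And>n. f n \<in> borel_measurable M"
    and cau: "\<And>\<epsilon>. \<epsilon> > 0 ==> \<exists>N. \<forall>m\<ge>N. \<forall>n\<ge>N. L2sq M (\<lambda>x. f m x - f n x) \<le> ennreal \<epsilon>"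
  shows "\<exists>Z \<in> borel_measurable M. (\<lambda>n. L2sq M (\<lambda>x. Z x - f n x)) \<longlonglongrightarrow> 0"
proof -
  have "\<exists>N. \<forall>m\<ge>N. \<forall>n\<ge>N. L2sq M (\<lambda>x. f m x - f n x) \<le> ennreal ((1/4) ^ k)" for k :: nat
    by (rule cau) simp
  then obtain N where N: "\<And>k m n. m \<ge> N k ==> n \<ge> N k ==> (L2sq M (\<lambda>x. f m x - f n x)) \<le> ennreal ((1/4) ^ k)"
    by metis
  define r where "r k = (\<Sum>j\<le>k. N j) + k" for k
  have rN: "N j \<le> r k" if "j \<le> k" for j k
    unfolding r_def using that member_le_sum[of j "{..k}" N] by simp
  define u where "u k x = f (r k) x" for k x
  have [measurable]: "u k \<in> borel_measurable M" for k unfolding u_def by measurable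
  define d where "d k x = norm (u (Suc k) x - u k x)" for k x
  have [measurable]: "d k \<in> borel_measurable M" for k unfolding d_def by measurable
  have d2: "(\<integral>\<^sup>+ x. ennreal ((d k x)\<^sup>2) \<partial>M) \<le> ennreal ((1/4) ^ k)" for k
    unfolding d_def u_def by (rule N) (auto intro!: rN)
  have d1: "(\<integral>\<^sup>+ x. ennreal (d k x) \<partial>M) \<le> ennreal (2 * (1/2) ^ k)" for k
  proof -
    have le: "d k x \<le> (1/2) ^ k + 2 ^ k * (d k x)\<^sup>2" for x
    proof -
      have "0 \<le> 2 ^ k * (d k x - (1/2) ^ k)\<^sup>2" by simp
      also have "... = 2 ^ k * (d k x)\<^sup>2 - 2 * d k x + (1/2) ^ k"
        by (simp add: power2_diff algebra_simps power2_eq_square flip: power_mult_distrib)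
      finally show ?thesis using zero_le_power2[of "d k x"] by (simp add: d_def) (smt (verit) norm_ge_zero)
    qed
    have "(\<integral>\<^sup>+ x. ennreal (d k x) \<partial>M) \<le> (\<integral>\<^sup>+ x. ennreal ((1/2) ^ k) + ennreal (2 ^ k) * ennreal ((d k x)\<^sup>2) \<partial>M)"
      by (intro nn_integral_mono) (auto simp: ennreal_mult[symmetric] ennreal_plus[symmetric] simp del: ennreal_plus intro!: ennreal_leI le)
    also have "... = ennreal ((1/2) ^ k) + ennreal (2 ^ k) * (\<integral>\<^sup>+ x. ennreal ((d k x)\<^sup>2) \<partial>M)"
      by (subst nn_integral_add) (auto simp: nn_integral_cmult emeasure_space_1)
    also have "... \<le> ennreal ((1/2) ^ k) + ennreal (2 ^ k) * ennreal ((1/4) ^ k)"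
      by (intro add_left_mono mult_left_mono d2) simp
    also have "... = ennreal (2 * (1/2) ^ k)"
      by (simp add: ennreal_mult[symmetric] ennreal_plus[symmetric] del: ennreal_plus flip: power_mult_distrib)
    finally show ?thesis .
  qed
  have "(\<integral>\<^sup>+ x. (\<Sum>k. ennreal (d k x)) \<partial>M) = (\<Sum>k. \<integral>\<^sup>+ x. ennreal (d k x) \<partial>M)"
    by (rule nn_integral_suminf) measurable
  also have "... \<le> (\<Sum>k. ennreal (2 * (1/2) ^ k))" by (intro suminf_le d1) auto
  also have "... = ennreal (\<Sum>k. 2 * (1/2) ^ k)"
    by (rule suminf_ennreal2) (auto intro!: summable_mult summable_geometric)
  also have "... < \<infinity>" by simp
  finally have "AE x in M. (\<Sum>k. ennreal (d k x)) \<noteq> \<infinity>" by (intro nn_integral_PInf_AE) auto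
  then have conv: "AE x in M. convergent (\<lambda>k. u k x)"
  proof eventually_elim
    case (elim x)
    then have "summable (\<lambda>k. d k x)" by (intro summable_suminf_not_top) (auto simp: d_def)
    then have "summable (\<lambda>k. u (Suc k) x - u k x)" unfolding d_def by (rule summable_norm_cancel)
    then have "convergent (\<lambda>n. \<Sum>k<n. u (Suc k) x - u k x)" by (simp add: summable_iff_convergent)
    then have "convergent (\<lambda>n. u n x - u 0 x)"
      using sum_lessThan_telescope[of "\<lambda>k. u k x"] by simp
    then show ?case by (simp add: convergent_diff_const_right_iff)
  qed
  define Z where "Z x = lim (\<lambda>k. u k x)" for x
  have Zm [measurable]: "Z \<in> borel_measurable M" unfolding Z_def[abs_def] by measurable
  have lim: "AE x in M. (\<lambda>k. u k x) \<longlonglongrightarrow> Z x"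
    using conv by eventually_elim (simp add: Z_def convergent_LIMSEQ_iff)
  have bound: "L2sq M (\<lambda>x. Z x - f n x) \<le> ennreal ((1/4) ^ k)" if "n \<ge> N k" for n k
  proof -
    have "L2sq M (\<lambda>x. Z x - f n x) =
        (\<integral>\<^sup>+ x. liminf (\<lambda>j. ennreal ((norm (u j x - f n x))\<^sup>2)) \<partial>M)"
    proof (rule nn_integral_cong_AE, use lim in eventually_elim)
      case (elim x)
      then have "(\<lambda>j. ennreal ((norm (u j x - f n x))\<^sup>2)) \<longlonglongrightarrow> ennreal ((norm (Z x - f n x))\<^sup>2)"
        by (intro tendsto_intros tendsto_ennrealI)
      then show ?case by (rule lim_imp_Liminf[OF sequentially_bot, symmetric])
    qed
    also have "... \<le> liminf (\<lambda>j. L2sq M (\<lambda>x. u j x - f n x))"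
      by (rule nn_integral_liminf) measurable
    also have "... \<le> limsup (\<lambda>j. L2sq M (\<lambda>x. u j x - f n x))"
      by (rule Liminf_le_Limsup) simp
    also have "... \<le> ennreal ((1/4) ^ k)"
    proof (rule Limsup_bounded)
      show "\<forall>\<^sub>F j in sequentially. L2sq M (\<lambda>x. u j x - f n x) \<le> ennreal ((1/4) ^ k)"
        using eventually_ge_at_top[of k]
      proof eventually_elim
        case (elim j)
        then show ?case unfolding u_def using that rN[OF elim] by (intro N) auto
      qed
    qed
    finally show ?thesis .
  qed
  have "(\<lambda>n. L2sq M (\<lambda>x. Z x - f n x)) \<longlonglongrightarrow> 0"
  proof (rule tendsto_zero_ennrealI)
    fix \<epsilon> :: real assume "\<epsilon> > 0"
    then obtain k where "(1/4) ^ k < \<epsilon>" using real_arch_pow_inv[of \<epsilon> "1/4"] by auto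
    then have "ennreal ((1/4) ^ k) \<le> ennreal \<epsilon>" by (intro ennreal_leI) simp
    then show "\<exists>N. \<forall>n\<ge>N. L2sq M (\<lambda>x. Z x - f n x) \<le> ennreal \<epsilon>"
      using bound[of k] by (meson order_trans)
  qed
  then show ?thesis using Zm by blast
qed

subsection \<open>Elementary integrands\<close>

definition elem_proj :: "'h::real_inner => ('xi::real_vector, 'h) elementary => (real \<times> real \<times> 'xi) list" where
  "elem_proj y es = map (\<lambda>(a, b, \<xi>, h). (a, b, (y \<bullet> h) *\<^sub>R \<xi>)) es"

definition elem_shift :: "real => ('xi, 'h) elementary => ('xi, 'h) elementary" where
  "elem_shift t es = map (\<lambda>(a, b, \<xi>, h). (a + t, b + t, \<xi>, h)) es"

definition elem_map :: "('h => 'h) => ('xi, 'h) elementary => ('xi, 'h) elementary" where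
  "elem_map T es = map (\<lambda>(a, b, \<xi>, h). (a, b, \<xi>, T h)) es"

lemma elem_fun_Cons: "elem_fun ((a, b, \<xi>, h) # es) s v = (indicator {a<..b} s * (\<xi> \<bullet> v)) *\<^sub>R h + elem_fun es s v"
  by (simp add: elem_fun_def)

lemma elem_fun_append: "elem_fun (es @ es') s v = elem_fun es s v + elem_fun es' s v"
  by (simp add: elem_fun_def)

lemma elem_integral_append: "elem_integral W (es @ es') w = elem_integral W es w + elem_integral W es' w"
  by (simp add: elem_integral_def)

lemma elem_fun_map:
  fixes T :: "'h::real_normed_vector \<Rightarrow>\<^sub>L 'h"
  shows "elem_fun (elem_map T es) s v = T (elem_fun es s v)"
  by (induction es) (auto simp: elem_fun_def elem_map_def blinfun.zero_right blinfun.add_right blinfun.scaleR_right)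

lemma elem_integral_map:
  fixes T :: "'h::real_normed_vector \<Rightarrow>\<^sub>L 'h"
  shows "elem_integral W (elem_map T es) w = T (elem_integral W es w)"
  by (induction es) (auto simp: elem_integral_def elem_map_def blinfun.zero_right blinfun.add_right blinfun.scaleR_right)

lemma elem_fun_shift: "elem_fun (elem_shift t es) s v = elem_fun es (s - t) v"
  by (induction es) (auto simp: elem_fun_def elem_shift_def indicator_def)

lemma elem_on_shift:
  assumes "elem_on h es" "0 \<le> t" shows "elem_on (t + h) (elem_shift t es)"
  unfolding elem_on_def
proof clarify
  fix a b \<xi> k assume "(a, b, \<xi>, k) \<in> set (elem_shift t es)"
  then obtain a' b' where "(a', b', \<xi>, k) \<in> set es" "a = a' + t" "b = b' + t"
    by (auto simp: elem_shift_def)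
  then show "0 \<le> a \<and> a \<le> b \<and> b \<le> t + h" using assms by (auto simp: elem_on_def)
qed

lemma inc_fun_shift: "inc_fun (elem_proj y (elem_shift t es)) s = inc_fun (elem_proj y es) (s - t)"
  by (induction es) (auto simp: inc_fun_def elem_proj_def elem_shift_def indicator_def)

lemma inc_fun_measurable: "inc_fun ts \<in> borel_measurable (borel :: real measure)"
  for ts :: "(real \<times> real \<times> 'a::{real_normed_vector,second_countable_topology}) list"
proof (induction ts)
  case Nil then show ?case by (simp add: inc_fun_def[abs_def])
next
  case (Cons e es)
  obtain a b \<xi> where "e = (a, b, \<xi>)" by (cases e)
  with Cons show ?case by (simp add: inc_fun_def[abs_def])
qed

lemma elem_fun_measurable [measurable]: "(\<lambda>s. elem_fun es s v :: 'h::{real_normed_vector,second_countable_topology}) \<in> borel_measurable borel"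
proof (induction es)
  case Nil then show ?case by (simp add: elem_fun_def)
next
  case (Cons e es)
  obtain a b \<xi> h where "e = (a, b, \<xi>, h)" by (cases e)
  with Cons show ?case by (simp add: elem_fun_Cons)
qed

lemma elem_fun_outside:
  assumes "elem_on t es" "\<not> (0 < s \<and> s \<le> t)" shows "elem_fun es s v = 0"
  using assms(1)
proof (induction es)
  case Nil then show ?case by (simp add: elem_fun_def)
next
  case (Cons e es)
  obtain a b \<xi> h where "e = (a, b, \<xi>, h)" by (cases e)
  with Cons assms(2) show ?case by (auto simp: elem_fun_Cons elem_on_def indicator_def)
qed

lemma hs_norm_sq_add_le:
  fixes A B :: "'a::{real_inner,second_countable_topology} => 'b::real_inner"
  shows "hs_norm_sq (\<lambda>v. A v + B v) \<le> 2 * hs_norm_sq A + 2 * hs_norm_sq B"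
proof -
  have "hs_norm_sq (\<lambda>v. A v + B v) \<le> (\<integral>\<^sup>+ e. 2 * ennreal ((norm (A e))\<^sup>2) + 2 * ennreal ((norm (B e))\<^sup>2) \<partial>count_space some_basis)"
    unfolding hs_norm_sq_eq by (intro nn_integral_mono ennreal_norm_add_sq_le)
  also have "... = 2 * hs_norm_sq A + 2 * hs_norm_sq B"
    unfolding hs_norm_sq_eq by (subst nn_integral_add) (auto simp: nn_integral_cmult)
  finally show ?thesis .
qed

lemma hs_norm_sq_uminus:
  fixes A :: "'a::{real_inner,second_countable_topology} => 'b::real_inner"
  shows "hs_norm_sq (\<lambda>v. - A v) = hs_norm_sq A" unfolding hs_norm_sq_eq by simp

lemma hs_norm_sq_measurable:
  fixes \<Phi> :: "'c => 'a::{real_inner,second_countable_topology} => 'b::{real_inner,second_countable_topology}"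
  assumes [measurable]: "\<And>v. (\<lambda>s. \<Phi> s v) \<in> borel_measurable N"
  shows "(\<lambda>s. hs_norm_sq (\<Phi> s)) \<in> borel_measurable N"
proof -
  have c: "countable (some_basis :: 'a set)" by (rule countable_orthonormal_basis[OF orthonormal_some_basis])
  interpret sigma_finite_measure "count_space (some_basis :: 'a set)" using c by (rule sigma_finite_measure_count_space_countable)
  show ?thesis unfolding hs_norm_sq_eq
  proof (rule borel_measurable_nn_integral)
    show "(\<lambda>(s, e). ennreal ((norm (\<Phi> s e))\<^sup>2)) \<in> borel_measurable (N \<Otimes>\<^sub>M count_space some_basis)"
      by (subst measurable_pair_swap_iff) (rule measurable_pair_measure_countable1[OF c], simp)
  qed
qed

context filtered_BM
begin

lemma inner_elem_fun: "y \<bullet> elem_fun es s v = inc_fun (elem_proj y es) s \<bullet> v"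
  by (induction es) (auto simp: elem_fun_def inc_fun_def elem_proj_def inner_add_right inner_add_left)

lemma inner_elem_integral:
  assumes "\<And>a b \<xi> h. (a, b, \<xi>, h) \<in> set es ==> 0 \<le> a \<and> 0 \<le> b"
  shows "AE w in M. y \<bullet> elem_integral W es w = inc_sum (elem_proj y es) w"
  using assms
proof (induction es)
  case Nil then show ?case by (simp add: elem_integral_def inc_sum_def elem_proj_def)
next
  case (Cons e es)
  obtain a b \<xi> h where e: "e = (a, b, \<xi>, h)" by (cases e)
  have ab: "0 \<le> a" "0 \<le> b" using Cons.prems[of a b \<xi> h] e by auto
  have "AE w in M. y \<bullet> elem_integral W es w = inc_sum (elem_proj y es) w"
    by (rule Cons.IH) (metis Cons.prems list.set_intros(2))
  moreover have "AE w in M. W a ((y \<bullet> h) *\<^sub>R \<xi>) w = (y \<bullet> h) * W a \<xi> w"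
    "AE w in M. W b ((y \<bullet> h) *\<^sub>R \<xi>) w = (y \<bullet> h) * W b \<xi> w"
    using W_linear[OF ab(1), of "y \<bullet> h" \<xi> 0 0] W_linear[OF ab(2), of "y \<bullet> h" \<xi> 0 0] by simp_all
  ultimately show ?case
    by eventually_elim (simp add: e elem_integral_def inc_sum_def elem_proj_def inner_add_right algebra_simps)
qed

lemma elem_integral_measurable:
  fixes es :: "('xi, 'h::{real_inner,banach,second_countable_topology}) elementary"
  assumes "elem_on t es" "t \<ge> 0"
  shows "elem_integral W es \<in> borel_measurable (F t)"
  using assms(1)
proof (induction es)
  case Nil then show ?case by (simp add: elem_integral_def[abs_def])
next
  case (Cons e es)
  obtain a b \<xi> h where e: "e = (a, b, \<xi>, h)" by (cases e)
  have ab: "0 \<le> a" "a \<le> t" "0 \<le> b" "b \<le> t" using Cons.prems e by (auto simp: elem_on_def)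
  have "W a \<xi> \<in> borel_measurable (F t)" "W b \<xi> \<in> borel_measurable (F t)"
    using measurable_F_mono[OF W_measurable_F] ab by auto
  moreover have "elem_integral W es \<in> borel_measurable (F t)" using Cons by (auto simp: elem_on_def)
  moreover have "elem_integral W (e # es) = (\<lambda>w. (W b \<xi> w - W a \<xi> w) *\<^sub>R h + elem_integral W es w)"
    by (simp add: elem_integral_def[abs_def] e)
  ultimately show ?case by simp
qed

text \<open>The Ito isometry follows from the scalar case by expanding both sides in orthonormal bases.\<close>

lemma elem_isometry:
  fixes es :: "('xi, 'h::{real_inner,banach,second_countable_topology}) elementary"
  assumes es: "elem_on t es" "t \<ge> 0"
  shows "L2sq M (elem_integral W es) = (\<integral>\<^sup>+ s. hs_norm_sq (elem_fun es s) \<partial>lborel)"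
proof -
  let ?BH = "some_basis :: 'h set" and ?BX = "some_basis :: 'xi set"
  have BH: "orthonormal_basis ?BH" and BX: "orthonormal_basis ?BX" by (rule orthonormal_some_basis)+
  have cH: "countable ?BH" and cX: "countable ?BX"
    using BH BX by (auto intro: countable_orthonormal_basis)
  have [measurable]: "elem_integral W es \<in> borel_measurable M"
    using elem_integral_measurable[OF es] es by (auto intro: measurable_F)
  have pos: "0 \<le> a \<and> a \<le> b" if "(a, b, \<xi>, h) \<in> set es" for a b \<xi> h
    using es(1) that by (auto simp: elem_on_def)
  have pos': "0 \<le> a \<and> a \<le> b" if "(a, b, \<xi>) \<in> set (elem_proj y es)" for a b \<xi> y
    using that pos by (auto simp: elem_proj_def)
  have E: "{} \<in> sets (F 0)" by simp
  have scal: "(\<integral>\<^sup>+ w. ennreal ((elem_integral W es w \<bullet> y)\<^sup>2) \<partial>M) = L2sq lborel (\<lambda>s. inc_fun (elem_proj y es) s)" for y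
  proof -
    have "AE w in M. y \<bullet> elem_integral W es w = inc_sum (elem_proj y es) w"
      using pos by (intro inner_elem_integral) force
    then have "(\<integral>\<^sup>+ w. ennreal ((elem_integral W es w \<bullet> y)\<^sup>2) \<partial>M) = (\<integral>\<^sup>+ w. ennreal ((inc_sum (elem_proj y es) w)\<^sup>2) \<partial>M)"
      by (intro nn_integral_cong_AE) (auto simp: inner_commute)
    also have "... = ennreal (LINT w|M. (inc_sum (elem_proj y es) w)\<^sup>2)"
      by (rule nn_integral_eq_integral[OF inc_sum_gaussian(1)[OF order_refl E pos']]) auto
    also have "... = L2sq lborel (\<lambda>s. inc_fun (elem_proj y es) s)"
      by (rule inc_sum_gaussian(2)[OF order_refl E pos']) auto
    finally show ?thesis .
  qed
  have "L2sq M (elem_integral W es) =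
      (\<integral>\<^sup>+ w. \<integral>\<^sup>+ e. ennreal ((elem_integral W es w \<bullet> e)\<^sup>2) \<partial>count_space ?BH \<partial>M)"
    by (simp add: parseval[OF BH])
  also have "... = (\<integral>\<^sup>+ e. \<integral>\<^sup>+ w. ennreal ((elem_integral W es w \<bullet> e)\<^sup>2) \<partial>M \<partial>count_space ?BH)"
    by (rule nn_integral_count_space_nn_integral[OF cH]) measurable
  also have "... = (\<integral>\<^sup>+ e. \<integral>\<^sup>+ s. ennreal ((norm (inc_fun (elem_proj e es) s))\<^sup>2) \<partial>lborel \<partial>count_space ?BH)"
    by (simp add: scal)
  also have "... = (\<integral>\<^sup>+ s. \<integral>\<^sup>+ e. ennreal ((norm (inc_fun (elem_proj e es) s))\<^sup>2) \<partial>count_space ?BH \<partial>lborel)"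
    by (rule nn_integral_count_space_nn_integral[OF cH, symmetric])
      (use inc_fun_measurable in measurable)
  also have "... = (\<integral>\<^sup>+ s. \<integral>\<^sup>+ e. \<integral>\<^sup>+ f. ennreal ((elem_fun es s f \<bullet> e)\<^sup>2) \<partial>count_space ?BX \<partial>count_space ?BH \<partial>lborel)"
    unfolding parseval[OF BX, symmetric] inner_elem_fun[symmetric] by (simp add: inner_commute)
  also have "... = (\<integral>\<^sup>+ s. \<integral>\<^sup>+ f. \<integral>\<^sup>+ e. ennreal ((elem_fun es s f \<bullet> e)\<^sup>2) \<partial>count_space ?BH \<partial>count_space ?BX \<partial>lborel)"
    by (intro nn_integral_cong nn_integral_count_space_nn_integral[OF cX]) simp
  also have "... = (\<integral>\<^sup>+ s. hs_norm_sq (elem_fun es s) \<partial>lborel)"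
    by (simp add: hs_norm_sq_eq parseval[OF BH])
  finally show ?thesis .
qed

text \<open>The scalar product with \<open>y\<close> reduces an elementary integral to a Gaussian sum of increments, whose law
  depends on the integrand only through its norm and hence is unchanged by a time shift.\<close>

lemma elem_integral_shift_char:
  fixes es :: "('xi, 'h::{real_inner,banach,second_countable_topology}) elementary"
  assumes es: "elem_on h es" "h \<ge> 0" and t: "t \<ge> 0" "A \<in> sets (F t)"
  shows "(CLINT w|M. indicator A w *\<^sub>R iexp (y \<bullet> elem_integral W (elem_shift t es) w)) =
    prob A * (CLINT w|M. iexp (y \<bullet> elem_integral W es w))"
proof -
  have n1: "(\<lambda>x::real. iexp x) \<in> borel_measurable borel" by (intro borel_measurable_continuous_onI continuous_intros)
  have gen: "(CLINT w|M. indicator A w *\<^sub>R iexp (y \<bullet> elem_integral W (elem_shift t es) w)) =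
    prob A * exp (- enn2real (L2sq lborel (\<lambda>s. inc_fun (elem_proj y es) s)) / 2)"
    if t: "t \<ge> 0" "A \<in> sets (F t)" for t A
  proof -
    let ?sh = "elem_shift t es"
    have on: "elem_on (t + h) ?sh" by (rule elem_on_shift[OF es(1) t(1)])
    have pos: "t \<le> a \<and> a \<le> b" if mem: "(a, b, \<xi>, k) \<in> set ?sh" for a b \<xi> k
    proof -
      obtain a' b' where "(a', b', \<xi>, k) \<in> set es" "a = a' + t" "b = b' + t"
        using mem by (auto simp: elem_shift_def)
      then show ?thesis using es(1) by (auto simp: elem_on_def)
    qed
    have pos': "t \<le> a \<and> a \<le> b" if mem: "(a, b, \<xi>) \<in> set (elem_proj y ?sh)" for a b \<xi>
    proof -
      obtain \<xi>' k where "(a, b, \<xi>', k) \<in> set ?sh" using mem by (auto simp: elem_proj_def)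
      then show ?thesis by (rule pos)
    qed
    have ae: "AE w in M. y \<bullet> elem_integral W ?sh w = inc_sum (elem_proj y ?sh) w"
      using pos t by (intro inner_elem_integral) force
    have AM: "A \<in> sets M" using t sets_F_subset by auto
    have m1: "(\<lambda>w. y \<bullet> elem_integral W ?sh w) \<in> borel_measurable M"
    proof -
      have "elem_integral W ?sh \<in> borel_measurable M"
        using elem_integral_measurable[OF on] es t by (auto intro: measurable_F)
      then show ?thesis by measurable
    qed
    have m2: "inc_sum (elem_proj y ?sh) \<in> borel_measurable M"
      using pos' t by (intro inc_sum_measurable) force
    have "(CLINT w|M. indicator A w *\<^sub>R iexp (y \<bullet> elem_integral W ?sh w)) =
       (CLINT w|M. indicator A w *\<^sub>R iexp (inc_sum (elem_proj y ?sh) w))"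
    proof (rule integral_cong_AE)
      show "AE w in M. indicator A w *\<^sub>R iexp (y \<bullet> elem_integral W ?sh w) = indicator A w *\<^sub>R iexp (inc_sum (elem_proj y ?sh) w)"
        using ae by eventually_elim simp
    qed (use AM measurable_compose[OF m1 n1] measurable_compose[OF m2 n1] in "auto intro!: borel_measurable_scaleR")
    also have "... = prob A * exp (- enn2real (L2sq lborel (\<lambda>s. inc_fun (elem_proj y ?sh) s)) / 2)"
      by (rule inc_sum_gaussian(3)[OF t pos'])
    also have "L2sq lborel (\<lambda>s. inc_fun (elem_proj y ?sh) s) =
        L2sq lborel (\<lambda>s. inc_fun (elem_proj y es) (- t + 1 * s))"
      by (simp add: inc_fun_shift)
    also have "... = L2sq lborel (\<lambda>s. inc_fun (elem_proj y es) s)"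
    proof -
      have "(\<lambda>s. ennreal ((norm (inc_fun (elem_proj y es) s))\<^sup>2)) \<in> borel_measurable borel"
        using inc_fun_measurable[of "elem_proj y es"] by measurable
      from nn_integral_real_affine[OF this, of 1 "- t"] show ?thesis by simp
    qed
    finally show ?thesis .
  qed
  have "elem_shift 0 es = es" by (induction es) (auto simp: elem_shift_def)
  then have "(CLINT w|M. indicator (space M) w *\<^sub>R iexp (y \<bullet> elem_integral W es w)) =
     exp (- enn2real (L2sq lborel (\<lambda>s. inc_fun (elem_proj y es) s)) / 2)"
    using gen[of 0 "space M"] sets.top[of "F 0"] by (simp add: prob_space)
  moreover have "(CLINT w|M. indicator (space M) w *\<^sub>R iexp (y \<bullet> elem_integral W es w)) = (CLINT w|M. iexp (y \<bullet> elem_integral W es w))"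
    by (intro Bochner_Integration.integral_cong) auto
  ultimately show ?thesis using gen[OF t] by simp
qed

end

section \<open>The stochastic convolution\<close>

lemma elem_fun_concat: "elem_fun (concat (map g xs)) s v = (\<Sum>x\<leftarrow>xs. elem_fun (g x) s v)"
  by (induction xs) (auto simp: elem_fun_append, simp add: elem_fun_def)

lemma elem_fun_basis_list:
  assumes "orthonormal_basis B" "set fs \<subseteq> B" "distinct fs" "e \<in> B"
  shows "elem_fun (map (\<lambda>f. (a, b, f, k f)) fs) s e = (if e \<in> set fs then indicator {a<..b} s *\<^sub>R k e else 0)"
  using assms(2,3)
proof (induction fs)
  case Nil then show ?case by (simp add: elem_fun_def)
next
  case (Cons f fs)
  then have "f \<bullet> e = (if f = e then 1 else 0)" using orthonormal_basis_inner[OF assms(1) _ assms(4)] by auto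
  then show ?case using Cons by (auto simp: elem_fun_Cons)
qed

locale stochastic_convolution = filtered_BM M F W
  for M :: "'w measure" and F :: "real => 'w measure"
    and W :: "real => 'xi::{real_inner,banach,second_countable_topology} => 'w => real" +
  fixes S :: "real => 'h::{real_inner,banach,second_countable_topology} \<Rightarrow>\<^sub>L 'h"
    and \<sigma> :: "'xi \<Rightarrow>\<^sub>L 'h"
  assumes C0: "C0_semigroup S"
    and hs_finite: "t \<ge> 0 ==> (\<integral>\<^sup>+ s\<in>{0..t}. hs_norm_sq (\<lambda>v. S s (\<sigma> v)) \<partial>lborel) < \<infinity>"
begin

lemma S_0 [simp]: "S 0 x = x"
  using C0 by (simp add: C0_semigroup_def)

lemma S_add: "0 \<le> s ==> 0 \<le> t ==> S (s + t) x = S s (S t x)"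
  using C0 by (simp add: C0_semigroup_def)

lemma S_continuous: "continuous_on {0..} (\<lambda>t. S t x)"
  using C0 by (simp add: C0_semigroup_def)

lemma S_tendsto: "(f \<longlongrightarrow> t) G ==> 0 \<le> t ==> eventually (\<lambda>n. 0 \<le> f n) G ==> ((\<lambda>n. S (f n) x) \<longlongrightarrow> S t x) G"
  by (rule continuous_on_tendsto_compose[OF S_continuous]) auto

lemma S_bounded:
  obtains C where "C \<ge> 1" "\<And>r x. 0 \<le> r ==> r \<le> T ==> norm (S r x) \<le> C * norm x"
proof -
  obtain C where C: "C \<ge> 1" "\<And>r. 0 \<le> r ==> r \<le> T ==> norm (S r) \<le> C" using C0_semigroup_bounded[OF C0] by blast
  have "norm (S r x) \<le> C * norm x" if "0 \<le> r" "r \<le> T" for r x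
    by (rule order_trans[OF norm_blinfun]) (use C(2)[OF that] in "simp add: mult_right_mono")
  then show ?thesis using C(1) that by blast
qed

definition N :: "real => real measure" where "N t = restrict_space lborel {0..t}"

lemma nn_integral_N: "(\<integral>\<^sup>+ s\<in>{0..t}. f s \<partial>lborel) = (\<integral>\<^sup>+ s. f s \<partial>N t)"
  by (simp add: N_def nn_integral_restrict_space)

lemma measurable_N_continuous: "continuous_on {0..t} f ==> f \<in> borel_measurable (N t)"
  unfolding N_def using borel_measurable_continuous_on_restrict[of "{0..t}" f]
  by (simp add: measurable_cong_sets[OF sets_restrict_space_cong[OF sets_lborel] refl])

lemma measurable_N_borel: "f \<in> borel_measurable borel ==> f \<in> borel_measurable (N t)"
  unfolding N_def by (rule measurable_restrict_space1) simp

abbreviation \<Phi> :: "real => real => 'xi => 'h" where "\<Phi> t s v \<equiv> S (t - s) (\<sigma> v)"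

abbreviation Z :: "real => 'w => 'h" where "Z t \<equiv> stoch_conv M W S \<sigma> t"

definition approximates :: "real => (nat => ('xi, 'h) elementary) => bool" where
  "approximates t es \<longleftrightarrow> (\<forall>n. elem_on t (es n)) \<and>
     (\<lambda>n. \<integral>\<^sup>+ s. hs_norm_sq (\<lambda>v. \<Phi> t s v - elem_fun (es n) s v) \<partial>N t) \<longlonglongrightarrow> 0"

lemma \<Phi>_measurable: "(\<lambda>s. \<Phi> t s v) \<in> borel_measurable (N t)"
  by (rule measurable_N_continuous, rule continuous_on_compose2[OF S_continuous])
    (auto intro!: continuous_intros)

lemma diff_measurable: "(\<lambda>s. \<Phi> t s v - elem_fun es s v) \<in> borel_measurable (N t)"
  using \<Phi>_measurable measurable_N_borel[OF elem_fun_measurable] by measurable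

lemma diff_hs_measurable: "(\<lambda>s. hs_norm_sq (\<lambda>v. \<Phi> t s v - elem_fun es s v)) \<in> borel_measurable (N t)"
  by (rule hs_norm_sq_measurable) (rule diff_measurable)

lemma hs_finite_reversed: "t \<ge> 0 ==> (\<integral>\<^sup>+ s. hs_norm_sq (\<Phi> t s) \<partial>N t) < \<infinity>"
proof -
  assume t: "t \<ge> 0"
  let ?g = "\<lambda>s. hs_norm_sq (\<lambda>v. S s (\<sigma> v)) * indicator {0..t} s"
  have "(\<lambda>s. hs_norm_sq (\<lambda>v. S s (\<sigma> v))) \<in> borel_measurable (restrict_space borel {0..t})"
    by (rule hs_norm_sq_measurable)
      (auto intro!: borel_measurable_continuous_on_restrict continuous_on_subset[OF S_continuous])
  then have g: "?g \<in> borel_measurable borel"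
    by (subst (asm) borel_measurable_restrict_space_iff_ennreal) auto
  have "(\<integral>\<^sup>+ s. hs_norm_sq (\<Phi> t s) \<partial>N t) = (\<integral>\<^sup>+ s. ?g (t + (-1) * s) \<partial>lborel)"
    unfolding nn_integral_N[symmetric]
    by (intro nn_integral_cong) (auto split: split_indicator)
  also have "... = (\<integral>\<^sup>+ s. ?g s \<partial>lborel)"
    using nn_integral_real_affine[OF g, of "-1" t] by simp
  also have "... < \<infinity>" using hs_finite[OF t] by simp
  finally show ?thesis .
qed

text \<open>The integrand is frozen at the left end point of each cell of a uniform grid and restricted to
  finitely many basis vectors.  Freezing costs a factor: \<open>S (t - a)\<close> is \<open>S (s - a)\<close> after \<open>S (t - s)\<close>, so the
  local bound on the semigroup dominates the approximants by the integrand itself.\<close>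

lemma approximates_exists:
  assumes t: "t \<ge> 0"
  shows "\<exists>es. approximates t es"
proof -
  let ?B = "some_basis :: 'xi set"
  have B: "orthonormal_basis ?B" by (rule orthonormal_some_basis)
  have cB: "countable ?B" by (rule countable_orthonormal_basis[OF B])
  define Bn where "Bn n = {f \<in> ?B. to_nat_on ?B f < n}" for n
  have fin: "finite (Bn n)" for n
  proof -
    have "inj_on (to_nat_on ?B) (Bn n)" using inj_on_to_nat_on[OF cB] by (rule inj_on_subset) (auto simp: Bn_def)
    moreover have "to_nat_on ?B ` Bn n \<subseteq> {..<n}" by (auto simp: Bn_def)
    ultimately show ?thesis using finite_imageD finite_subset by blast
  qed
  then have "\<exists>l. set l = Bn n \<and> distinct l" for n using finite_distinct_list by blast
  then obtain fs where fs: "\<And>n. set (fs n) = Bn n" "\<And>n. distinct (fs n)" by metis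
  define m where "m n = real (Suc n)" for n
  define es where "es n = concat (map (\<lambda>j. map (\<lambda>f. (real j * t / m n, (real j + 1) * t / m n, f, S (t - real j * t / m n) (\<sigma> f))) (fs n)) [0..<Suc n])" for n
  have m: "m n > 0" for n by (simp add: m_def)
  have on: "elem_on t (es n)" for n
    unfolding elem_on_def
  proof clarify
    fix a b \<xi> k assume "(a, b, \<xi>, k) \<in> set (es n)"
    then obtain j where j: "j \<le> n" "a = real j * t / m n" "b = (real j + 1) * t / m n"
      by (auto simp: es_def less_Suc_eq_le simp del: upt_Suc)
    have "(real j + 1) * t \<le> m n * t" using j t by (intro mult_right_mono) (auto simp: m_def)
    then show "0 \<le> a \<and> a \<le> b \<and> b \<le> t" using t m[of n] unfolding j
      by (simp add: divide_right_mono pos_divide_le_eq mult.commute) (simp add: algebra_simps)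
  qed
  define r where "r n s = real_of_int (\<lceil>s * m n / t\<rceil> - 1) * t / m n" for n s
  have r: "s - t / m n \<le> r n s" "r n s < s" "0 \<le> r n s" if "0 < s" "s \<le> t" for n s
  proof -
    have tp: "t > 0" using that by simp
    define x where "x = s * m n / t"
    have s: "s = x * (t / m n)" using tp m[of n] by (simp add: x_def)
    have w: "t / m n > 0" using tp m[of n] by simp
    have rx: "r n s = (real_of_int \<lceil>x\<rceil> - 1) * (t / m n)" by (simp add: r_def x_def)
    have x: "real_of_int \<lceil>x\<rceil> - 1 < x" "x \<le> real_of_int \<lceil>x\<rceil>" by linarith+
    have "(x - 1) * (t / m n) \<le> r n s" unfolding rx using x w by (intro mult_right_mono) auto
    moreover have "(x - 1) * (t / m n) = x * (t / m n) - t / m n" by (simp only: left_diff_distrib mult_1)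
    ultimately show "s - t / m n \<le> r n s" using s by linarith
    have "r n s < x * (t / m n)" unfolding rx using x w by (intro mult_strict_right_mono)
    then show "r n s < s" using s by linarith
    have "0 < s * m n / t" using that tp m[of n] by simp
    then have "0 < \<lceil>s * m n / t\<rceil>" by simp
    then show "0 \<le> r n s" using tp m[of n] by (simp add: r_def)
  qed
  have val: "elem_fun (es n) s e = (if e \<in> Bn n then S (t - r n s) (\<sigma> e) else 0)"
    if s: "0 < s" "s \<le> t" and e: "e \<in> ?B" for n s e
  proof -
    have tp: "t > 0" using s by simp
    define c where "c = nat (\<lceil>s * m n / t\<rceil> - 1)"
    have cp: "1 \<le> \<lceil>s * m n / t\<rceil>" using s tp m[of n] by (simp add: one_le_ceiling)
    have "s * m n / t \<le> m n" using s tp m[of n] by (simp add: field_simps)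
    then have "\<lceil>s * m n / t\<rceil> \<le> int (Suc n)" by (simp add: ceiling_le_iff m_def)
    then have cn: "c < Suc n" using cp by (simp add: c_def)
    have ind: "indicator {real j * t / m n<..(real j + 1) * t / m n} s = (if j = c then 1 else (0::real))" for j
    proof -
      have "s \<in> {real j * t / m n<..(real j + 1) * t / m n} \<longleftrightarrow> real j < s * m n / t \<and> s * m n / t \<le> real j + 1"
        using tp m[of n] by (auto simp: field_simps)
      also have "... \<longleftrightarrow> \<lceil>s * m n / t\<rceil> = int j + 1" by (subst ceiling_eq_iff) auto
      also have "... \<longleftrightarrow> j = c" using cp by (auto simp: c_def)
      finally show ?thesis by (simp add: indicator_def)
    qed
    have rc: "r n s = real c * t / m n" using cp by (simp add: r_def c_def)
    have "elem_fun (es n) s e = (\<Sum>j\<leftarrow>[0..<Suc n]. if e \<in> Bn n then indicator {real j * t / m n<..(real j + 1) * t / m n} s *\<^sub>R S (t - real j * t / m n) (\<sigma> e) else 0)"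
      unfolding es_def elem_fun_concat
      by (intro arg_cong[where f=sum_list] map_cong refl)
        (subst elem_fun_basis_list[OF B _ fs(2) e], auto simp: fs Bn_def)
    also have "... = (\<Sum>j<Suc n. if e \<in> Bn n then indicator {real j * t / m n<..(real j + 1) * t / m n} s *\<^sub>R S (t - real j * t / m n) (\<sigma> e) else 0)"
      by (simp only: sum_list_distinct_conv_sum_set distinct_upt set_upt atLeast0LessThan)
    also have "... = (\<Sum>j<Suc n. if j = c then (if e \<in> Bn n then S (t - real j * t / m n) (\<sigma> e) else 0) else 0)"
      unfolding ind by (intro sum.cong) auto
    also have "... = (if e \<in> Bn n then S (t - r n s) (\<sigma> e) else 0)" using cn by (simp add: rc)
    finally show ?thesis .
  qed
  obtain C where C: "C \<ge> 1" "\<And>r x. 0 \<le> r ==> r \<le> t ==> norm (S r x) \<le> C * norm x" using S_bounded by blast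
  let ?D = "\<lambda>n s e. ennreal ((norm (\<Phi> t s e - elem_fun (es n) s e))\<^sup>2)"
  have dom: "?D n s e \<le> ennreal ((1 + C)\<^sup>2) * ennreal ((norm (\<Phi> t s e))\<^sup>2)" if s: "0 < s" "s \<le> t" and e: "e \<in> ?B" for n s e
  proof -
    have "norm (elem_fun (es n) s e) \<le> C * norm (\<Phi> t s e)"
    proof (cases "e \<in> Bn n")
      case True
      have "S (t - r n s) (\<sigma> e) = S (s - r n s) (\<Phi> t s e)"
        using r[OF s, of n] s S_add[of "s - r n s" "t - s" "\<sigma> e"] by simp
      then show ?thesis using val[OF s e] True C(2)[of "s - r n s"] r[OF s, of n] s by simp
    next
      case False
      then show ?thesis using val[OF s e] C(1) by simp
    qed
    then have "norm (\<Phi> t s e - elem_fun (es n) s e) \<le> (1 + C) * norm (\<Phi> t s e)"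
      using norm_triangle_ineq4[of "\<Phi> t s e" "elem_fun (es n) s e"] by (simp add: algebra_simps)
    then have "(norm (\<Phi> t s e - elem_fun (es n) s e))\<^sup>2 \<le> ((1 + C) * norm (\<Phi> t s e))\<^sup>2" by (intro power_mono) auto
    then show ?thesis by (simp add: ennreal_mult[symmetric] power_mult_distrib ennreal_leI)
  qed
  have lim: "(\<lambda>n. ?D n s e) \<longlonglongrightarrow> 0" if s: "0 < s" "s \<le> t" and e: "e \<in> ?B" for s e
  proof -
    have mlim: "(\<lambda>n. t / m n) \<longlonglongrightarrow> 0"
      unfolding m_def using tendsto_mult[OF tendsto_const LIMSEQ_inverse_real_of_nat, of t] by (simp add: field_simps)
    have "(\<lambda>n. r n s) \<longlonglongrightarrow> s"
    proof (rule tendsto_sandwich[OF _ _ _ tendsto_const])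
      show "(\<lambda>n. s - t / m n) \<longlonglongrightarrow> s" using tendsto_diff[OF tendsto_const mlim, of s] by simp
    qed (use r[OF s] in "auto intro!: always_eventually less_imp_le")
    then have "(\<lambda>n. S (t - r n s) (\<sigma> e)) \<longlonglongrightarrow> \<Phi> t s e"
      using s r(2)[OF s] by (intro S_tendsto tendsto_intros always_eventually) (auto intro: less_imp_le order_trans)
    moreover have "eventually (\<lambda>n. elem_fun (es n) s e = S (t - r n s) (\<sigma> e)) sequentially"
      using eventually_gt_at_top[of "to_nat_on ?B e"] by eventually_elim (simp add: val[OF s e] Bn_def e)
    ultimately have "(\<lambda>n. elem_fun (es n) s e) \<longlonglongrightarrow> \<Phi> t s e"
      by (simp add: tendsto_cong)
    then have "(\<lambda>n. (norm (\<Phi> t s e - elem_fun (es n) s e))\<^sup>2) \<longlonglongrightarrow> (norm (\<Phi> t s e - \<Phi> t s e))\<^sup>2"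
      by (intro tendsto_intros)
    then show ?thesis by (simp add: ennreal_tendsto_0_iff)
  qed
  have inner: "(\<lambda>n. hs_norm_sq (\<lambda>v. \<Phi> t s v - elem_fun (es n) s v)) \<longlonglongrightarrow> 0"
    if s: "0 < s" "s \<le> t" and f: "hs_norm_sq (\<Phi> t s) < \<infinity>" for s
  proof -
    have "(\<lambda>n. \<integral>\<^sup>+ e. ?D n s e \<partial>count_space ?B) \<longlonglongrightarrow> (\<integral>\<^sup>+ e. 0 \<partial>count_space ?B)"
    proof (rule nn_integral_dominated_convergence[where w="\<lambda>e. ennreal ((1 + C)\<^sup>2) * ennreal ((norm (\<Phi> t s e))\<^sup>2)"])
      show "(\<integral>\<^sup>+ e. ennreal ((1 + C)\<^sup>2) * ennreal ((norm (\<Phi> t s e))\<^sup>2) \<partial>count_space ?B) < \<infinity>"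
        using f by (subst nn_integral_cmult) (auto simp: hs_norm_sq_eq ennreal_mult_less_top)
    qed (use dom[OF s] lim[OF s] in "auto simp: AE_count_space")
    then show ?thesis by (simp add: hs_norm_sq_eq)
  qed
  have hsD: "hs_norm_sq (\<lambda>v. \<Phi> t s v - elem_fun (es n) s v) \<le> ennreal ((1 + C)\<^sup>2) * hs_norm_sq (\<Phi> t s)" if "0 < s" "s \<le> t" for n s
    unfolding hs_norm_sq_eq by (subst nn_integral_cmult[symmetric]) (auto intro!: nn_integral_mono dom that)
  have pos: "AE s in N t. 0 < s \<and> s \<le> t"
  proof -
    have "AE s in lborel. s \<noteq> (0::real)" by (rule AE_lborel_singleton)
    then have "AE s in lborel. s \<in> {0..t} --> 0 < s \<and> s \<le> t" by eventually_elim auto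
    then show ?thesis unfolding N_def by (subst AE_restrict_space_iff) auto
  qed
  have [measurable]: "(\<lambda>s. hs_norm_sq (\<Phi> t s)) \<in> borel_measurable (N t)"
    by (rule hs_norm_sq_measurable) (rule \<Phi>_measurable)
  have "(\<lambda>n. \<integral>\<^sup>+ s. hs_norm_sq (\<lambda>v. \<Phi> t s v - elem_fun (es n) s v) \<partial>N t) \<longlonglongrightarrow> (\<integral>\<^sup>+ s. 0 \<partial>N t)"
  proof (rule nn_integral_dominated_convergence[where w="\<lambda>s. ennreal ((1 + C)\<^sup>2) * hs_norm_sq (\<Phi> t s)"])
    show "(\<lambda>s. hs_norm_sq (\<lambda>v. \<Phi> t s v - elem_fun (es n) s v)) \<in> borel_measurable (N t)" for n
      by (rule hs_norm_sq_measurable) (rule diff_measurable)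
    show "AE s in N t. hs_norm_sq (\<lambda>v. \<Phi> t s v - elem_fun (es n) s v) \<le> ennreal ((1 + C)\<^sup>2) * hs_norm_sq (\<Phi> t s)" for n
      using pos by eventually_elim (use hsD in auto)
    show "(\<integral>\<^sup>+ s. ennreal ((1 + C)\<^sup>2) * hs_norm_sq (\<Phi> t s) \<partial>N t) < \<infinity>"
      using hs_finite_reversed[OF t] by (subst nn_integral_cmult) (auto simp: ennreal_mult_less_top)
    have "AE s in N t. hs_norm_sq (\<Phi> t s) \<noteq> \<infinity>"
      using hs_finite_reversed[OF t] by (intro nn_integral_PInf_AE) auto
    with pos show "AE s in N t. (\<lambda>n. hs_norm_sq (\<lambda>v. \<Phi> t s v - elem_fun (es n) s v)) \<longlonglongrightarrow> 0"
      by eventually_elim (use inner in "auto simp: less_top")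
  qed measurable
  then show ?thesis using on unfolding approximates_def by (intro exI[of _ es]) simp
qed

lemma elem_diff_isometry:
  assumes "elem_on t es" "elem_on t es'" "t \<ge> 0"
  shows "L2sq M (\<lambda>w. elem_integral W es w - elem_integral W es' w) \<le>
    2 * (\<integral>\<^sup>+ s. hs_norm_sq (\<lambda>v. \<Phi> t s v - elem_fun es s v) \<partial>N t) +
    2 * (\<integral>\<^sup>+ s. hs_norm_sq (\<lambda>v. \<Phi> t s v - elem_fun es' s v) \<partial>N t)"
proof -
  let ?es = "es @ elem_map (blinfun_apply (- id_blinfun)) es'"
  have on: "elem_on t ?es" using assms by (auto simp: elem_on_def elem_map_def)
  have f: "elem_fun ?es s v = elem_fun es s v - elem_fun es' s v" for s v
    unfolding elem_fun_append elem_fun_map by (simp add: blinfun.minus_left)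
  have i: "elem_integral W ?es w = elem_integral W es w - elem_integral W es' w" for w
    unfolding elem_integral_append elem_integral_map by (simp add: blinfun.minus_left)
  have zero: "hs_norm_sq (elem_fun ?es s) = 0" if "s \<notin> {0..t}" for s
    using elem_fun_outside[OF on, of s] that by (simp add: hs_norm_sq_eq)
  have "(\<integral>\<^sup>+ s. hs_norm_sq (elem_fun ?es s) \<partial>lborel) = (\<integral>\<^sup>+ s. hs_norm_sq (elem_fun ?es s) \<partial>N t)"
    unfolding nn_integral_N[symmetric] by (intro nn_integral_cong) (auto simp: zero split: split_indicator)
  also have "... \<le> (\<integral>\<^sup>+ s. 2 * hs_norm_sq (\<lambda>v. \<Phi> t s v - elem_fun es' s v) + 2 * hs_norm_sq (\<lambda>v. - (\<Phi> t s v - elem_fun es s v)) \<partial>N t)"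
  proof (intro nn_integral_mono)
    fix s
    have "elem_fun ?es s = (\<lambda>v. (\<Phi> t s v - elem_fun es' s v) + (- (\<Phi> t s v - elem_fun es s v)))" by (auto simp: f)
    then show "hs_norm_sq (elem_fun ?es s) \<le> 2 * hs_norm_sq (\<lambda>v. \<Phi> t s v - elem_fun es' s v) + 2 * hs_norm_sq (\<lambda>v. - (\<Phi> t s v - elem_fun es s v))"
      using hs_norm_sq_add_le[of "\<lambda>v. \<Phi> t s v - elem_fun es' s v" "\<lambda>v. - (\<Phi> t s v - elem_fun es s v)"] by simp
  qed
  also have "... = 2 * (\<integral>\<^sup>+ s. hs_norm_sq (\<lambda>v. \<Phi> t s v - elem_fun es' s v) \<partial>N t) +
    2 * (\<integral>\<^sup>+ s. hs_norm_sq (\<lambda>v. \<Phi> t s v - elem_fun es s v) \<partial>N t)"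
    unfolding hs_norm_sq_uminus
    using diff_hs_measurable[of t es] diff_hs_measurable[of t es']
    by (simp add: nn_integral_add nn_integral_cmult)
  finally show ?thesis using elem_isometry[OF on assms(3)] by (simp add: i add.commute)
qed

lemma elem_integral_measurable_M: "elem_on t es ==> t \<ge> 0 ==> elem_integral W es \<in> borel_measurable M" for es :: "('xi, 'h) elementary"
  using elem_integral_measurable measurable_F by blast

lemma is_stoch_integral_stoch_conv:
  assumes t: "t \<ge> 0"
  shows "is_stoch_integral M W (\<Phi> t) t (Z t)"
proof -
  obtain es where es: "approximates t es" using approximates_exists[OF t] by blast
  then have on: "\<And>n. elem_on t (es n)"
    and lim: "(\<lambda>n. \<integral>\<^sup>+ s. hs_norm_sq (\<lambda>v. \<Phi> t s v - elem_fun (es n) s v) \<partial>N t) \<longlonglongrightarrow> 0"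
    by (auto simp: approximates_def)
  have "\<exists>Y \<in> borel_measurable M. (\<lambda>n. L2sq M (\<lambda>w. Y w - elem_integral W (es n) w)) \<longlonglongrightarrow> 0"
  proof (rule L2_complete)
    show "elem_integral W (es n) \<in> borel_measurable M" for n by (rule elem_integral_measurable_M[OF on t])
    fix \<epsilon> :: real assume "\<epsilon> > 0"
    then have "eventually (\<lambda>n. (\<integral>\<^sup>+ s. hs_norm_sq (\<lambda>v. \<Phi> t s v - elem_fun (es n) s v) \<partial>N t) < ennreal (\<epsilon> / 4)) sequentially"
      by (intro order_tendstoD(2)[OF lim]) simp
    then obtain K where K: "\<And>n. n \<ge> K ==> (\<integral>\<^sup>+ s. hs_norm_sq (\<lambda>v. \<Phi> t s v - elem_fun (es n) s v) \<partial>N t) < ennreal (\<epsilon> / 4)"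
      by (auto simp: eventually_sequentially)
    have "L2sq M (\<lambda>w. elem_integral W (es m) w - elem_integral W (es n) w) \<le> ennreal \<epsilon>"
      if "m \<ge> K" "n \<ge> K" for m n
    proof -
      have "L2sq M (\<lambda>w. elem_integral W (es m) w - elem_integral W (es n) w) \<le> 2 * ennreal (\<epsilon> / 4) + 2 * ennreal (\<epsilon> / 4)"
        by (rule order_trans[OF elem_diff_isometry[OF on on t]])
          (intro add_mono mult_left_mono less_imp_le K that; simp)
      also have "2 * ennreal (\<epsilon> / 4) = ennreal (\<epsilon> / 2)"
        using ennreal_mult[of 2 "\<epsilon> / 4"] \<open>\<epsilon> > 0\<close> by simp
      also have "ennreal (\<epsilon> / 2) + ennreal (\<epsilon> / 2) = ennreal \<epsilon>" using \<open>\<epsilon> > 0\<close> by (simp flip: ennreal_plus)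
      finally show ?thesis .
    qed
    then show "\<exists>K. \<forall>m\<ge>K. \<forall>n\<ge>K. L2sq M (\<lambda>w. elem_integral W (es m) w - elem_integral W (es n) w) \<le> ennreal \<epsilon>" by blast
  qed
  then have "\<exists>Y. is_stoch_integral M W (\<Phi> t) t Y"
    unfolding is_stoch_integral_def nn_integral_N using on lim by blast
  then show ?thesis unfolding stoch_conv_def stoch_integral_def by (rule someI_ex)
qed

lemma Z_measurable_M: "t \<ge> 0 ==> Z t \<in> borel_measurable M"
  using is_stoch_integral_stoch_conv by (simp add: is_stoch_integral_def)

text \<open>The integral does not depend on the approximating sequence, so a convenient one may be chosen.\<close>

lemma approximates_limit:
  assumes t: "t \<ge> 0" and es: "approximates t es"
  shows "(\<lambda>n. L2sq M (\<lambda>w. Z t w - elem_integral W (es n) w)) \<longlonglongrightarrow> 0"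
proof -
  obtain es' where on': "\<And>n. elem_on t (es' n)"
    and lim': "(\<lambda>n. \<integral>\<^sup>+ s. hs_norm_sq (\<lambda>v. \<Phi> t s v - elem_fun (es' n) s v) \<partial>N t) \<longlonglongrightarrow> 0"
    and L: "(\<lambda>n. L2sq M (\<lambda>w. Z t w - elem_integral W (es' n) w)) \<longlonglongrightarrow> 0"
    using is_stoch_integral_stoch_conv[OF t] unfolding is_stoch_integral_def nn_integral_N by blast
  have on: "\<And>n. elem_on t (es n)"
    and lim: "(\<lambda>n. \<integral>\<^sup>+ s. hs_norm_sq (\<lambda>v. \<Phi> t s v - elem_fun (es n) s v) \<partial>N t) \<longlonglongrightarrow> 0"
    using es by (auto simp: approximates_def)
  have d: "(\<lambda>n. L2sq M (\<lambda>w. elem_integral W (es' n) w - elem_integral W (es n) w)) \<longlonglongrightarrow> 0"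
    by (rule tendsto_zero_ennreal_le[OF tendsto_zero_ennreal_add2[OF lim' lim]]) (rule elem_diff_isometry[OF on' on t])
  show ?thesis
  proof (rule tendsto_zero_ennreal_le[OF tendsto_zero_ennreal_add2[OF L d]])
    fix n
    show "L2sq M (\<lambda>w. Z t w - elem_integral W (es n) w)
      \<le> 2 * (L2sq M (\<lambda>w. Z t w - elem_integral W (es' n) w)) +
        2 * (L2sq M (\<lambda>w. elem_integral W (es' n) w - elem_integral W (es n) w))"
      using nn_integral_norm_add_sq_le[of "\<lambda>w. Z t w - elem_integral W (es' n) w" M "\<lambda>w. elem_integral W (es' n) w - elem_integral W (es n) w"]
        Z_measurable_M[OF t] elem_integral_measurable_M[OF on t] elem_integral_measurable_M[OF on' t] by simp
  qed
qed

text \<open>Completeness of the filtration lets a process be replaced by a version of it.\<close>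

lemma measurable_F_null:
  fixes f :: "'w => 'b::topological_space"
  assumes t: "t \<ge> 0" and f: "f \<in> borel_measurable M" and g: "g \<in> borel_measurable (F t)"
    and ae: "AE w in M. f w = g w"
  shows "f \<in> borel_measurable (F t)"
proof (rule measurableI)
  obtain K where K: "K \<in> null_sets M" "{w \<in> space M. f w \<noteq> g w} \<subseteq> K" using ae by (auto elim!: AE_E2 simp: eventually_ae_filter)
  fix B :: "'b set" assume B: "B \<in> sets borel"
  have KF: "K \<in> sets (F t)" using K null_sets_F[OF t] by auto
  have "f -` B \<inter> space M \<inter> K \<in> null_sets M"
    using measurable_sets[OF f B] K(1) by (intro null_sets_subset[OF K(1)]) auto
  then have 1: "f -` B \<inter> space M \<inter> K \<in> sets (F t)" using null_sets_F[OF t] by auto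
  have "g -` B \<inter> space M \<in> sets (F t)" using measurable_sets[OF g B] t by simp
  then have "(g -` B \<inter> space M - K) \<union> (f -` B \<inter> space M \<inter> K) \<in> sets (F t)" using KF 1 by auto
  moreover have "(g -` B \<inter> space M - K) \<union> (f -` B \<inter> space M \<inter> K) = f -` B \<inter> space M" using K(2) by auto
  ultimately show "f -` B \<inter> space (F t) \<in> sets (F t)" using t by simp
qed simp

lemma Z_measurable_F:
  assumes t: "t \<ge> 0" shows "Z t \<in> borel_measurable (F t)"
proof -
  obtain es where es: "approximates t es" using approximates_exists[OF t] by blast
  then have on: "\<And>n. elem_on t (es n)" by (auto simp: approximates_def)
  obtain r where r: "AE w in M. (\<lambda>n. elem_integral W (es (r n)) w) \<longlonglongrightarrow> Z t w"
    using L2_limit_AE_subseq[OF Z_measurable_M[OF t] elem_integral_measurable_M[OF on t] approximates_limit[OF t es]] by blast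
  show ?thesis
  proof (rule measurable_F_null[OF t Z_measurable_M[OF t]])
    show "(\<lambda>w. lim (\<lambda>n. elem_integral W (es (r n)) w)) \<in> borel_measurable (F t)"
      by (rule borel_measurable_lim_metric) (rule elem_integral_measurable[OF on t])
    show "AE w in M. Z t w = lim (\<lambda>n. elem_integral W (es (r n)) w)"
      using r by eventually_elim (simp add: limI)
  qed
qed

end

lemma hs_norm_sq_bound:
  fixes A :: "'a::{real_inner,second_countable_topology} => 'b::real_inner" and T :: "'b => 'b"
  assumes "C \<ge> 0" "\<And>x. norm (T x) \<le> C * norm x"
  shows "hs_norm_sq (\<lambda>v. T (A v)) \<le> ennreal (C\<^sup>2) * hs_norm_sq A"
proof -
  have "ennreal ((norm (T (A e)))\<^sup>2) \<le> ennreal (C\<^sup>2) * ennreal ((norm (A e))\<^sup>2)" for e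
  proof -
    have "(norm (T (A e)))\<^sup>2 \<le> (C * norm (A e))\<^sup>2" using assms by (intro power_mono) auto
    then show ?thesis by (simp add: ennreal_mult[symmetric] power_mult_distrib ennreal_leI)
  qed
  then show ?thesis unfolding hs_norm_sq_eq
    by (subst nn_integral_cmult[symmetric]) (auto intro!: nn_integral_mono)
qed

context stochastic_convolution
begin

text \<open>The noise that enters during \<open>(a, a + h]\<close>, as seen at time \<open>a + h\<close>.\<close>

definition incr :: "real => real => 'w => 'h" where
  "incr a h w = Z (a + h) w - S h (Z a w)"

lemma incr_measurable: "a \<ge> 0 ==> h \<ge> 0 ==> incr a h \<in> borel_measurable M"
  unfolding incr_def[abs_def]
  by (intro borel_measurable_diff Z_measurable_M borel_measurable_continuous_on[OF _ Z_measurable_M])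
    (auto intro!: linear_continuous_on blinfun.bounded_linear_right)

text \<open>Splitting the integrand of \<open>Z (a + h)\<close> at time \<open>a\<close>: the part before \<open>a\<close> gives \<open>S h (Z a)\<close>, and the part
  after \<open>a\<close> is an integral over \<open>(a, a + h]\<close> of the time-shifted integrand of \<open>Z h\<close>.\<close>

lemma incr_approx:
  assumes a: "a \<ge> 0" and h: "h \<ge> 0" and es: "approximates h es"
  shows "(\<lambda>n. L2sq M (\<lambda>w. incr a h w - elem_integral W (elem_shift a (es n)) w)) \<longlonglongrightarrow> 0"
proof -
  obtain es' where es': "approximates a es'" using approximates_exists[OF a] by blast
  have on: "\<And>n. elem_on h (es n)" and on': "\<And>n. elem_on a (es' n)"
    and lim: "(\<lambda>n. \<integral>\<^sup>+ s. hs_norm_sq (\<lambda>v. \<Phi> h s v - elem_fun (es n) s v) \<partial>N h) \<longlonglongrightarrow> 0"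
    and lim': "(\<lambda>n. \<integral>\<^sup>+ s. hs_norm_sq (\<lambda>v. \<Phi> a s v - elem_fun (es' n) s v) \<partial>N a) \<longlonglongrightarrow> 0"
    using es es' by (auto simp: approximates_def)
  obtain C where C: "C \<ge> 1" "\<And>r x. 0 \<le> r ==> r \<le> h ==> norm (S r x) \<le> C * norm x" using S_bounded by blast
  define c where "c n = elem_map (blinfun_apply (S h)) (es' n) @ elem_shift a (es n)" for n
  have onc: "elem_on (a + h) (c n)" for n
  proof -
    have "elem_on (a + h) (elem_shift a (es n))" by (rule elem_on_shift[OF on a])
    moreover have "elem_on (a + h) (elem_map (blinfun_apply (S h)) (es' n))"
      using on'[of n] h by (fastforce simp: elem_on_def elem_map_def)
    ultimately show ?thesis by (auto simp: c_def elem_on_def)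
  qed
  have fc: "elem_fun (c n) s v = S h (elem_fun (es' n) s v) + elem_fun (es n) (s - a) v" for n s v
    by (simp add: c_def elem_fun_append elem_fun_map elem_fun_shift)
  have ic: "elem_integral W (c n) w = S h (elem_integral W (es' n) w) + elem_integral W (elem_shift a (es n)) w" for n w
    by (simp add: c_def elem_integral_append elem_integral_map)
  let ?g = "\<lambda>n s. hs_norm_sq (\<lambda>v. \<Phi> a s v - elem_fun (es' n) s v)"
  let ?k = "\<lambda>n s. hs_norm_sq (\<lambda>v. \<Phi> h s v - elem_fun (es n) s v)"
  have gm: "(\<lambda>s. ?g n s * indicator {0..a} s) \<in> borel_measurable borel" for n
    using diff_hs_measurable[of a "es' n"] unfolding N_def
    by (subst (asm) borel_measurable_restrict_space_iff_ennreal) auto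
  have km: "(\<lambda>s. ?k n s * indicator {0..h} s) \<in> borel_measurable borel" for n
    using diff_hs_measurable[of h "es n"] unfolding N_def
    by (subst (asm) borel_measurable_restrict_space_iff_ennreal) auto
  have le: "(\<integral>\<^sup>+ s. hs_norm_sq (\<lambda>v. \<Phi> (a + h) s v - elem_fun (c n) s v) \<partial>N (a + h)) \<le>
      ennreal (C\<^sup>2) * (\<integral>\<^sup>+ s. ?g n s \<partial>N a) + (\<integral>\<^sup>+ s. ?k n s \<partial>N h)" for n
  proof -
    have pw: "hs_norm_sq (\<lambda>v. \<Phi> (a + h) s v - elem_fun (c n) s v) * indicator {0..a + h} s \<le>
       ennreal (C\<^sup>2) * (?g n s * indicator {0..a} s) + ?k n (- a + 1 * s) * indicator {0..h} (- a + 1 * s)" for s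
    proof (cases "s \<in> {0..a + h}")
      case True
      show ?thesis
      proof (cases "s \<le> a")
        case sa: True
        have "elem_fun (es n) (s - a) v = 0" for v using elem_fun_outside[OF on] sa by simp
        moreover have "\<Phi> (a + h) s v = S h (\<Phi> a s v)" for v
          using S_add[of h "a - s" "\<sigma> v"] h sa by (simp add: algebra_simps)
        ultimately have "hs_norm_sq (\<lambda>v. \<Phi> (a + h) s v - elem_fun (c n) s v) =
            hs_norm_sq (\<lambda>v. S h (\<Phi> a s v - elem_fun (es' n) s v))"
          by (simp add: fc blinfun.diff_right)
        also have "... \<le> ennreal (C\<^sup>2) * ?g n s"
          using C h by (intro hs_norm_sq_bound) auto
        finally show ?thesis using True sa by (simp add: add_increasing2)
      next
        case sa: False
        have "elem_fun (es' n) s v = 0" for v using elem_fun_outside[OF on'] sa by simp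
        then have "hs_norm_sq (\<lambda>v. \<Phi> (a + h) s v - elem_fun (c n) s v) = ?k n (s - a)"
          by (simp add: fc blinfun.zero_right algebra_simps)
        then show ?thesis using True sa by (simp add: add_increasing)
      qed
    qed simp
    have "(\<integral>\<^sup>+ s. hs_norm_sq (\<lambda>v. \<Phi> (a + h) s v - elem_fun (c n) s v) \<partial>N (a + h)) \<le>
       (\<integral>\<^sup>+ s. ennreal (C\<^sup>2) * (?g n s * indicator {0..a} s) + ?k n (- a + 1 * s) * indicator {0..h} (- a + 1 * s) \<partial>lborel)"
      unfolding nn_integral_N[symmetric] by (intro nn_integral_mono pw)
    also have "... = ennreal (C\<^sup>2) * (\<integral>\<^sup>+ s. ?g n s * indicator {0..a} s \<partial>lborel) +
        (\<integral>\<^sup>+ s. ?k n (- a + 1 * s) * indicator {0..h} (- a + 1 * s) \<partial>lborel)"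
      using gm[of n] measurable_compose[OF _ km[of n], of "\<lambda>s. - a + 1 * s" borel]
      by (simp add: nn_integral_add nn_integral_cmult)
    also have "(\<integral>\<^sup>+ s. ?k n (- a + 1 * s) * indicator {0..h} (- a + 1 * s) \<partial>lborel) = (\<integral>\<^sup>+ s. ?k n s * indicator {0..h} s \<partial>lborel)"
      using nn_integral_real_affine[OF km[of n], of 1 "- a"] by simp
    finally show ?thesis by (simp add: nn_integral_N)
  qed
  have appc: "approximates (a + h) c"
    unfolding approximates_def
  proof (intro conjI allI onc)
    have "(\<lambda>n. ennreal (C\<^sup>2) * (\<integral>\<^sup>+ s. ?g n s \<partial>N a) + (\<integral>\<^sup>+ s. ?k n s \<partial>N h)) \<longlonglongrightarrow> ennreal (C\<^sup>2) * 0 + 0"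
      by (intro tendsto_add ennreal_tendsto_cmult lim lim') simp
    then show "(\<lambda>n. \<integral>\<^sup>+ s. hs_norm_sq (\<lambda>v. \<Phi> (a + h) s v - elem_fun (c n) s v) \<partial>N (a + h)) \<longlonglongrightarrow> 0"
      by (intro tendsto_zero_ennreal_le[OF _ le]) simp
  qed
  have L1: "(\<lambda>n. L2sq M (\<lambda>w. Z (a + h) w - elem_integral W (c n) w)) \<longlonglongrightarrow> 0"
    using a h by (intro approximates_limit[OF _ appc]) simp
  have Sm: "(\<lambda>w. S h (f w)) \<in> borel_measurable M" if "f \<in> borel_measurable M" for f
    by (intro borel_measurable_continuous_on[OF _ that] linear_continuous_on blinfun.bounded_linear_right)
  have m': "(\<lambda>w. Z a w - elem_integral W (es' n) w) \<in> borel_measurable M" for n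
    using Z_measurable_M[OF a] elem_integral_measurable_M[OF on' a] by measurable
  have L2: "(\<lambda>n. L2sq M (\<lambda>w. S h (Z a w - elem_integral W (es' n) w))) \<longlonglongrightarrow> 0"
  proof (rule tendsto_zero_ennreal_le)
    have "(\<lambda>n. ennreal (C\<^sup>2) * (L2sq M (\<lambda>w. Z a w - elem_integral W (es' n) w))) \<longlonglongrightarrow> ennreal (C\<^sup>2) * 0"
      by (intro ennreal_tendsto_cmult approximates_limit[OF a es']) simp
    then show "(\<lambda>n. ennreal (C\<^sup>2) * (L2sq M (\<lambda>w. Z a w - elem_integral W (es' n) w))) \<longlonglongrightarrow> 0" by simp
    fix n
    have "ennreal ((norm (S h x))\<^sup>2) \<le> ennreal (C\<^sup>2) * ennreal ((norm x)\<^sup>2)" for x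
    proof -
      have "(norm (S h x))\<^sup>2 \<le> (C * norm x)\<^sup>2" using C(2)[of h x] h by (intro power_mono) auto
      then show ?thesis by (simp add: ennreal_mult[symmetric] power_mult_distrib ennreal_leI)
    qed
    then show "L2sq M (\<lambda>w. S h (Z a w - elem_integral W (es' n) w)) \<le>
      ennreal (C\<^sup>2) * (L2sq M (\<lambda>w. Z a w - elem_integral W (es' n) w))"
      using m'[of n] by (subst nn_integral_cmult[symmetric]) (auto intro!: nn_integral_mono)
  qed
  show ?thesis
  proof (rule tendsto_zero_ennreal_le[OF tendsto_zero_ennreal_add2[OF L1 L2]])
    fix n
    have e: "incr a h w - elem_integral W (elem_shift a (es n)) w =
        (Z (a + h) w - elem_integral W (c n) w) + - S h (Z a w - elem_integral W (es' n) w)" for w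
      by (simp add: incr_def ic blinfun.diff_right)
    have m1: "(\<lambda>w. Z (a + h) w - elem_integral W (c n) w) \<in> borel_measurable M"
      using Z_measurable_M[of "a + h"] elem_integral_measurable_M[OF onc] a h by (intro borel_measurable_diff) auto
    have m2: "(\<lambda>w. - S h (Z a w - elem_integral W (es' n) w)) \<in> borel_measurable M"
      by (intro borel_measurable_uminus Sm m')
    show "L2sq M (\<lambda>w. incr a h w - elem_integral W (elem_shift a (es n)) w)
      \<le> 2 * (L2sq M (\<lambda>w. Z (a + h) w - elem_integral W (c n) w)) +
        2 * (L2sq M (\<lambda>w. S h (Z a w - elem_integral W (es' n) w)))"
      unfolding e using nn_integral_norm_add_sq_le[OF m1 m2] by simp
  qed
qed

lemma incr_char:
  assumes a: "a \<ge> 0" and h: "h \<ge> 0" and A: "A \<in> sets (F a)"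
  shows "(CLINT w|M. indicator A w *\<^sub>R iexp (y \<bullet> incr a h w)) = prob A * (CLINT w|M. iexp (y \<bullet> Z h w))"
proof -
  obtain es where es: "approximates h es" using approximates_exists[OF h] by blast
  then have on: "\<And>n. elem_on h (es n)" by (simp add: approximates_def)
  have AM: "A \<in> sets M" using A sets_F_subset[OF a] by auto
  obtain r where r: "strict_mono r" "AE w in M. (\<lambda>n. elem_integral W (es (r n)) w) \<longlonglongrightarrow> Z h w"
    using L2_limit_AE_subseq[OF Z_measurable_M[OF h] elem_integral_measurable_M[OF on h] approximates_limit[OF h es]] by blast
  have n1: "norm (iexp t) = 1" for t :: real by (simp add: norm_exp_eq_Re)
  have ie: "(\<lambda>t::real. iexp t) \<in> borel_measurable borel" by (intro borel_measurable_continuous_onI continuous_intros)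
  have m: "(\<lambda>x. iexp (y \<bullet> g x)) \<in> borel_measurable M" if "g \<in> borel_measurable M" for g :: "'w => 'h"
  proof -
    have "(\<lambda>x. y \<bullet> g x) \<in> borel_measurable M" using that by measurable
    from measurable_compose[OF this ie] show ?thesis .
  qed
  have lim2: "(\<lambda>n. CLINT w|M. iexp (y \<bullet> elem_integral W (es (r n)) w)) \<longlonglongrightarrow> (CLINT w|M. iexp (y \<bullet> Z h w))"
  proof (rule integral_dominated_convergence[where w="\<lambda>_. 1"])
    show "AE x in M. (\<lambda>n. iexp (y \<bullet> elem_integral W (es (r n)) x)) \<longlonglongrightarrow> iexp (y \<bullet> Z h x)"
      using r(2) by eventually_elim (intro tendsto_intros)
    show "AE x in M. norm (iexp (y \<bullet> elem_integral W (es (r i)) x)) \<le> 1" for i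
      by (rule AE_I2) (simp only: n1 order_refl)
  qed (auto intro!: m Z_measurable_M h elem_integral_measurable_M[OF on])
  have meas_sh: "elem_integral W (elem_shift a (es n)) \<in> borel_measurable M" for n
    using elem_integral_measurable_M[OF elem_on_shift[OF on a]] a h by simp
  have lim_r: "(\<lambda>n. L2sq M (\<lambda>w. incr a h w - elem_integral W (elem_shift a (es (r n))) w)) \<longlonglongrightarrow> 0"
    using LIMSEQ_subseq_LIMSEQ[OF incr_approx[OF a h es] r(1)] by (simp add: comp_def)
  obtain q where q: "strict_mono q" "AE w in M. (\<lambda>n. elem_integral W (elem_shift a (es (r (q n)))) w) \<longlonglongrightarrow> incr a h w"
    using L2_limit_AE_subseq[OF incr_measurable[OF a h] meas_sh lim_r] by blast
  have lim1: "(\<lambda>n. CLINT w|M. indicator A w *\<^sub>R iexp (y \<bullet> elem_integral W (elem_shift a (es (r (q n)))) w)) \<longlonglongrightarrow>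
      (CLINT w|M. indicator A w *\<^sub>R iexp (y \<bullet> incr a h w))"
  proof (rule integral_dominated_convergence[where w="\<lambda>_. 1"])
    show "AE x in M. (\<lambda>n. indicator A x *\<^sub>R iexp (y \<bullet> elem_integral W (elem_shift a (es (r (q n)))) x)) \<longlonglongrightarrow> indicator A x *\<^sub>R iexp (y \<bullet> incr a h x)"
      using q(2) by eventually_elim (intro tendsto_intros)
    show "AE x in M. norm (indicator A x *\<^sub>R iexp (y \<bullet> elem_integral W (elem_shift a (es (r (q i)))) x)) \<le> 1" for i
      by (rule AE_I2) (simp only: norm_scaleR n1, simp add: indicator_def)
  qed (use AM in "auto intro!: borel_measurable_scaleR m incr_measurable a h meas_sh")
  have "(\<lambda>n. prob A * (CLINT w|M. iexp (y \<bullet> elem_integral W (es (r (q n))) w))) \<longlonglongrightarrow>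
      (CLINT w|M. indicator A w *\<^sub>R iexp (y \<bullet> incr a h w))"
    using lim1 by (simp only: elem_integral_shift_char[OF on h a A])
  moreover have "(\<lambda>n. prob A * (CLINT w|M. iexp (y \<bullet> elem_integral W (es (r (q n))) w))) \<longlonglongrightarrow> prob A * (CLINT w|M. iexp (y \<bullet> Z h w))"
    using LIMSEQ_subseq_LIMSEQ[OF lim2 q(1)] by (intro tendsto_intros) (simp add: comp_def)
  ultimately show ?thesis by (rule LIMSEQ_unique)
qed

text \<open>Both sides are finite measures in \<open>B\<close> with the same characteristic functional.\<close>

lemma incr_law:
  assumes a: "a \<ge> 0" and h: "h \<ge> 0" and A: "A \<in> sets (F a)" and B: "B \<in> sets borel"
  shows "prob (A \<inter> (incr a h -` B \<inter> space M)) = prob A * prob (Z h -` B \<inter> space M)"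
proof -
  have AM: "A \<in> sets M" using A sets_F_subset[OF a] by auto
  have [measurable]: "A \<in> sets M" "incr a h \<in> borel_measurable M" "Z h \<in> borel_measurable M"
    by (fact AM, rule incr_measurable[OF a h], rule Z_measurable_M[OF h])
  have ie: "(\<lambda>x. iexp (z \<bullet> x)) \<in> borel_measurable borel" for z :: 'h
    by (intro borel_measurable_continuous_onI continuous_intros)
  define m1 where "m1 = distr (density M (\<lambda>w. ennreal (indicator A w))) borel (incr a h)"
  define m2 where "m2 = distr (density M (\<lambda>_. ennreal (prob A))) borel (Z h)"
  have fin: "finite_measure (density M (\<lambda>w. ennreal (indicator A w)))" "finite_measure (density M (\<lambda>_. ennreal (prob A)))"
    by (auto intro!: finite_measureI simp: emeasure_density emeasure_density_const emeasure_space_1 nn_integral_cmult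
        ennreal_indicator emeasure_eq_measure prob_space cong: nn_integral_cong)
  have "m1 = m2"
  proof (rule char_functional_unique)
    show "finite_measure m1" "finite_measure m2" unfolding m1_def m2_def
      by (auto intro!: finite_measure.finite_measure_distr fin)
    show "sets m1 = sets borel" "sets m2 = sets borel" by (simp_all add: m1_def m2_def)
    fix z :: 'h
    have "(CLINT x|m1. iexp (z \<bullet> x)) = (CLINT w|M. indicator A w *\<^sub>R iexp (z \<bullet> incr a h w))"
      unfolding m1_def by (subst integral_distr[OF _ ie], simp, subst integral_density)
        (auto intro!: measurable_compose[OF _ ie])
    also have "... = prob A * (CLINT w|M. iexp (z \<bullet> Z h w))" by (rule incr_char[OF a h A])
    also have "... = (CLINT x|m2. iexp (z \<bullet> x))"
      unfolding m2_def by (subst integral_distr[OF _ ie], simp, subst integral_density)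
        (auto intro!: measurable_compose[OF _ ie] simp: scaleR_conv_of_real)
    finally show "(CLINT x|m1. iexp (z \<bullet> x)) = (CLINT x|m2. iexp (z \<bullet> x))" .
  qed
  then have "emeasure m1 B = emeasure m2 B" by simp
  moreover have "emeasure m1 B = emeasure M (A \<inter> (incr a h -` B \<inter> space M))"
    unfolding m1_def using B
    by (subst emeasure_distr) (auto simp: emeasure_density ennreal_indicator indicator_inter_arith[symmetric])
  moreover have "emeasure m2 B = ennreal (prob A) * emeasure M (Z h -` B \<inter> space M)"
    unfolding m2_def using B by (subst emeasure_distr) (auto simp: emeasure_density_const)
  ultimately show ?thesis by (simp add: emeasure_eq_measure ennreal_mult[symmetric])
qed

text \<open>The Markov property: given the past up to time \<open>a\<close>, the new noise over a time step \<open>h\<close> is an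
  independent copy of \<open>Z h\<close>.\<close>

lemma incr_markov:
  fixes f :: "'c \<times> 'h => real"
  assumes a: "a \<ge> 0" and h: "h \<ge> 0" and K: "K \<in> F a \<rightarrow>\<^sub>M L" and f: "f \<in> borel_measurable (L \<Otimes>\<^sub>M borel)"
    and bd: "\<And>x. \<bar>f x\<bar> \<le> c"
  shows "(LINT w|M. f (K w, incr a h w)) = (LINT w|M. (LINT w'|M. f (K w, Z h w')))"
proof -
  have KM [measurable]: "K \<in> M \<rightarrow>\<^sub>M L" using K a by (rule measurable_F)
  have [measurable]: "incr a h \<in> borel_measurable M" "Z h \<in> borel_measurable M" "f \<in> borel_measurable (L \<Otimes>\<^sub>M borel)"
    by (rule incr_measurable[OF a h], rule Z_measurable_M[OF h], rule f)
  let ?D = "distr M L K" and ?E = "distr M borel (Z h)"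
  interpret D: prob_space ?D by (rule prob_space_distr) measurable
  interpret E: prob_space ?E by (rule prob_space_distr) measurable
  interpret DE: pair_prob_space ?D ?E ..
  have eq: "?D \<Otimes>\<^sub>M ?E = distr M (L \<Otimes>\<^sub>M borel) (\<lambda>w. (K w, incr a h w))"
  proof (rule pair_measure_eqI)
    show "sigma_finite_measure ?D" "sigma_finite_measure ?E" by unfold_locales
    show "sets (?D \<Otimes>\<^sub>M ?E) = sets (distr M (L \<Otimes>\<^sub>M borel) (\<lambda>w. (K w, incr a h w)))" by (simp cong: sets_pair_measure_cong)
    fix A B assume AB: "A \<in> sets ?D" "B \<in> sets ?E"
    then have A: "A \<in> sets L" and B: "B \<in> sets borel" by simp_all
    have KA: "K -` A \<inter> space M \<in> sets (F a)" using measurable_sets[OF K A] a by simp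
    have "emeasure ?D A * emeasure ?E B = ennreal (prob (K -` A \<inter> space M) * prob (Z h -` B \<inter> space M))"
      using A B by (simp add: emeasure_distr emeasure_eq_measure ennreal_mult)
    also have "... = ennreal (prob ((K -` A \<inter> space M) \<inter> (incr a h -` B \<inter> space M)))"
      by (simp add: incr_law[OF a h KA B])
    also have "... = emeasure (distr M (L \<Otimes>\<^sub>M borel) (\<lambda>w. (K w, incr a h w))) (A \<times> B)"
      using A B by (subst emeasure_distr) (auto simp: emeasure_eq_measure intro!: arg_cong[where f=prob])
    finally show "emeasure ?D A * emeasure ?E B = emeasure (distr M (L \<Otimes>\<^sub>M borel) (\<lambda>w. (K w, incr a h w))) (A \<times> B)" .
  qed
  have fm: "f \<in> borel_measurable (?D \<Otimes>\<^sub>M ?E)" by (simp cong: measurable_cong_sets sets_pair_measure_cong)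
  have int: "integrable (?D \<Otimes>\<^sub>M ?E) f"
    by (rule DE.integrable_const_bound[of _ c]) (use bd fm in auto)
  have "(LINT w|M. f (K w, incr a h w)) = (LINT p|distr M (L \<Otimes>\<^sub>M borel) (\<lambda>w. (K w, incr a h w)). f p)"
    by (subst integral_distr) auto
  also have "... = (LINT p|(?D \<Otimes>\<^sub>M ?E). f p)" by (simp add: eq)
  also have "... = (LINT k|?D. LINT z|?E. f (k, z))" by (rule DE.integral_fst'[OF int, symmetric])
  also have "... = (LINT w|M. LINT z|?E. f (K w, z))" by (subst integral_distr) auto
  also have "... = (LINT w|M. (LINT w'|M. f (K w, Z h w')))"
    by (intro Bochner_Integration.integral_cong refl) (subst integral_distr, auto)
  finally show ?thesis .
qed

end

section \<open>Previous-block averages\<close>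

definition Leb :: "real => real measure" where "Leb T = restrict_space lborel {0<..T}"

lemma space_Leb [simp]: "space (Leb T) = {0<..T}" by (simp add: Leb_def space_restrict_space)

lemma measurable_Leb: "f \<in> borel \<rightarrow>\<^sub>M L ==> f \<in> Leb T \<rightarrow>\<^sub>M L"
  unfolding Leb_def by (rule measurable_restrict_space1) simp

lemma emeasure_Leb: "A \<in> sets borel ==> emeasure (Leb T) (A \<inter> {0<..T}) = emeasure lborel (A \<inter> {0<..T})"
  unfolding Leb_def by (rule emeasure_restrict_space) auto

lemma finite_Leb: "finite_measure (Leb T)"
proof (rule finite_measureI)
  show "emeasure (Leb T) (space (Leb T)) \<noteq> \<infinity>"
    using emeasure_Leb[of UNIV T] by simp (cases "0 \<le> T"; simp)
qed

lemma AE_Leb_neq: "AE s in Leb T. s \<noteq> a"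
  unfolding Leb_def by (subst AE_restrict_space_iff) (use AE_lborel_singleton[of a] in auto)

lemma nn_integral_Leb: "(\<integral>\<^sup>+ s. f s \<partial>Leb T) = (\<integral>\<^sup>+ s. f s * indicator {0<..T} s \<partial>lborel)"
  unfolding Leb_def by (simp add: nn_integral_restrict_space)

lemma L1_le_powr:
  assumes p: "1 < p" and f: "f \<in> borel_measurable borel" and T: "0 \<le> T"
  shows "(\<integral>\<^sup>+ s\<in>{0..T}. ennreal (norm (f s)) \<partial>lborel) \<le> ennreal T + (\<integral>\<^sup>+ s\<in>{0..T}. ennreal (norm (f s) powr p) \<partial>lborel)"
proof -
  have "y \<le> 1 + y powr p" if "0 \<le> y" for y :: real
  proof (cases "y \<le> 1")
    case False
    then have "y powr 1 \<le> y powr p" using p by (intro powr_mono) auto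
    then show ?thesis using False by simp
  qed (simp add: add_increasing2)
  then have "ennreal (norm (f s)) \<le> 1 + ennreal (norm (f s) powr p)" for s by (simp flip: ennreal_plus ennreal_1)
  then have "(\<integral>\<^sup>+ s\<in>{0..T}. ennreal (norm (f s)) \<partial>lborel) \<le>
      (\<integral>\<^sup>+ s. indicator {0..T} s + ennreal (norm (f s) powr p) * indicator {0..T} s \<partial>lborel)"
    by (intro nn_integral_mono) (auto simp: indicator_def)
  also have "... = ennreal T + (\<integral>\<^sup>+ s\<in>{0..T}. ennreal (norm (f s) powr p) \<partial>lborel)"
    using f T by (subst nn_integral_add) auto
  finally show ?thesis .
qed

lemma L1_Leb_le_powr:
  assumes "1 < p" "f \<in> borel_measurable borel" "0 \<le> T"
  shows "L1 (Leb T) f \<le> ennreal T + (\<integral>\<^sup>+ s\<in>{0..T}. ennreal (norm (f s) powr p) \<partial>lborel)"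
  unfolding nn_integral_Leb
  by (rule order_trans[OF _ L1_le_powr[OF assms]]) (auto intro!: nn_integral_mono simp: indicator_def)

lemma integral_Leb:
  fixes f :: "real => 'b::{banach,second_countable_topology}"
  shows "(LINT s|Leb T. f s) = (LINT s:{0<..T}|lborel. f s)"
  unfolding Leb_def set_lebesgue_integral_def by (rule integral_restrict_space) simp

text \<open>With the blocks \<open>((j - 1) T/(n + 1), j T/(n + 1)]\<close>: \<open>r\<close> lies in the block just before that of \<open>s\<close>.\<close>

definition prev_block :: "real => nat => real => real => bool" where
  "prev_block T n s r \<longleftrightarrow> \<lceil>r * real (Suc n) / T\<rceil> + 1 = \<lceil>s * real (Suc n) / T\<rceil>"

definition block_avg :: "real => nat => (real => 'a) => real => 'a::{banach,second_countable_topology}" where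
  "block_avg T n f s = (LINT r|Leb T. (of_bool (prev_block T n s r) * (real (Suc n) / T)) *\<^sub>R f r)"

lemma prev_block_pred: "Measurable.pred (borel \<Otimes>\<^sub>M borel) (\<lambda>p. prev_block T n (fst p) (snd p))"
  unfolding prev_block_def by measurable

lemma prev_block_measurable1 [measurable]: "Measurable.pred (Leb T') (\<lambda>s. prev_block T n s r)"
  by (rule measurable_Leb) (simp add: prev_block_def)

lemma prev_block_measurable2 [measurable]: "Measurable.pred (Leb T') (\<lambda>r. prev_block T n s r)"
  by (rule measurable_Leb) (simp add: prev_block_def)

lemma id_Leb: "(\<lambda>s. s) \<in> Leb T \<rightarrow>\<^sub>M borel"
  by (rule measurable_Leb) simp

lemma prev_block_measurable_pair [measurable]: "Measurable.pred (Leb T' \<Otimes>\<^sub>M Leb T'') (\<lambda>p. prev_block T n (fst p) (snd p))"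
proof -
  note id_Leb [measurable]
  have "(\<lambda>p. (fst p, snd p)) \<in> Leb T' \<Otimes>\<^sub>M Leb T'' \<rightarrow>\<^sub>M (borel :: real measure) \<Otimes>\<^sub>M (borel :: real measure)" by measurable
  from measurable_compose[OF this prev_block_pred[of T n]] show ?thesis by simp
qed

context
  fixes T :: real and n :: nat
  assumes T: "T > 0"
begin

lemma block_iff: "\<lceil>r * real (Suc n) / T\<rceil> = j \<longleftrightarrow> (real_of_int j - 1) * (T / real (Suc n)) < r \<and> r \<le> real_of_int j * (T / real (Suc n))"
proof -
  have "\<lceil>r * real (Suc n) / T\<rceil> = j \<longleftrightarrow> real_of_int j - 1 < r * real (Suc n) / T \<and> r * real (Suc n) / T \<le> real_of_int j"
    by (rule ceiling_eq_iff)
  also have "... \<longleftrightarrow> (real_of_int j - 1) * (T / real (Suc n)) < r \<and> r \<le> real_of_int j * (T / real (Suc n))"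
    using T by (simp add: pos_less_divide_eq pos_divide_le_eq pos_divide_less_eq pos_le_divide_eq)
  finally show ?thesis .
qed

lemma prev_block_near: "prev_block T n s r ==> \<bar>r - s\<bar> \<le> 2 * T / real (Suc n)"
proof -
  assume "prev_block T n s r"
  define j where "j = \<lceil>r * real (Suc n) / T\<rceil>"
  define w where "w = T / real (Suc n)"
  have "\<lceil>s * real (Suc n) / T\<rceil> = j + 1" using \<open>prev_block T n s r\<close> by (simp add: prev_block_def j_def)
  from this[unfolded block_iff] have s: "real_of_int j * w < s" "s \<le> (real_of_int j + 1) * w" by (simp_all add: w_def)
  have r: "(real_of_int j - 1) * w < r" "r \<le> real_of_int j * w"
    using block_iff[of r j, THEN iffD1, OF j_def[symmetric]] by (simp_all add: w_def)
  have "\<bar>r - s\<bar> \<le> 2 * w" using s r by (simp add: algebra_simps abs_le_iff)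
  then show ?thesis by (simp add: w_def)
qed

text \<open>Each \<open>r\<close> contributes to the averages over one block only, so the averaging kernel has mass at most
  \<open>1\<close> in \<open>s\<close> as well; this makes averaging a contraction in \<open>L\<^sup>1\<close>.\<close>

lemma block_kernel_le1: "(\<integral>\<^sup>+ s. ennreal (of_bool (prev_block T n s r) * (real (Suc n) / T)) \<partial>Leb T) \<le> 1"
proof -
  define j where "j = \<lceil>r * real (Suc n) / T\<rceil>"
  let ?w = "T / real (Suc n)"
  let ?I = "{real_of_int j * ?w<..(real_of_int j + 1) * ?w}"
  have w: "?w > 0" using T by simp
  have "(\<integral>\<^sup>+ s. ennreal (of_bool (prev_block T n s r) * (real (Suc n) / T)) \<partial>Leb T) \<le>
     (\<integral>\<^sup>+ s. ennreal (real (Suc n) / T) * indicator ?I s \<partial>lborel)"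
    unfolding nn_integral_Leb
  proof (intro nn_integral_mono)
    fix s
    have "prev_block T n s r \<longleftrightarrow> s \<in> ?I" using block_iff[of s "j + 1"] by (auto simp: prev_block_def j_def)
    then show "ennreal (of_bool (prev_block T n s r) * (real (Suc n) / T)) * indicator {0<..T} s \<le> ennreal (real (Suc n) / T) * indicator ?I s"
      by (auto simp: indicator_def)
  qed
  also have "... = ennreal (real (Suc n) / T) * ennreal ?w"
  proof -
    have "emeasure lborel {x * v<..(x + 1) * v} = ennreal v" if "v > 0" for x v :: real
      using that by (subst emeasure_lborel_Ioc) (auto simp: algebra_simps)
    from this[OF w] show ?thesis by (subst nn_integral_cmult_indicator) (simp_all only: sets_lborel greaterThanAtMost_borel)
  qed
  also have "... = 1" using T by (simp add: ennreal_mult[symmetric])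
  finally show ?thesis .
qed

lemma block_kernel_1:
  assumes s: "T / real (Suc n) < s" "s \<le> T"
  shows "(LINT r|Leb T. of_bool (prev_block T n s r) * (real (Suc n) / T)) = 1"
proof -
  define j where "j = \<lceil>s * real (Suc n) / T\<rceil>"
  let ?w = "T / real (Suc n)"
  let ?I = "{(real_of_int j - 2) * ?w<..(real_of_int j - 1) * ?w}"
  have w: "?w > 0" using T by simp
  have js: "(real_of_int j - 1) * ?w < s" "s \<le> real_of_int j * ?w" using block_iff[of s j] by (auto simp: j_def)
  have "1 * ?w < real_of_int j * ?w" using s js by linarith
  then have "1 < real_of_int j" using w by (rule mult_right_less_imp_less[OF _ less_imp_le])
  then have "2 \<le> j" by linarith
  then have j2: "2 \<le> real_of_int j" by simp
  have sub: "?I \<subseteq> {0<..T}"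
  proof
    fix r assume "r \<in> ?I"
    moreover have "0 \<le> (real_of_int j - 2) * ?w" using j2 w by (intro mult_nonneg_nonneg) auto
    ultimately show "r \<in> {0<..T}" using js s by auto
  qed
  have eq: "of_bool (prev_block T n s r) = (indicator ?I r :: real)" for r
    using block_iff[of r "j - 1"] by (auto simp: prev_block_def j_def indicator_def)
  have "(LINT r|Leb T. of_bool (prev_block T n s r) * (real (Suc n) / T)) = (LINT r|lborel. indicator ?I r *\<^sub>R (real (Suc n) / T))"
    unfolding integral_Leb set_lebesgue_integral_def eq
    by (intro Bochner_Integration.integral_cong refl) (use sub in "auto simp: indicator_def")
  also have "... = measure lborel ?I * (real (Suc n) / T)" by simp
  also have "measure lborel ?I = ?w"
  proof -
    have "measure lborel {(x - 2) * v<..(x - 1) * v} = v" if "v > 0" for x v :: real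
      using that by (subst measure_lborel_Ioc) (auto simp: algebra_simps)
    from this[OF w] show ?thesis .
  qed
  finally show ?thesis using T by simp
qed

lemma block_integrable:
  fixes f :: "real => 'b::{banach,second_countable_topology}"
  assumes f: "integrable (Leb T) f"
  shows "integrable (Leb T) (\<lambda>r. (of_bool (prev_block T n s r) * (real (Suc n) / T)) *\<^sub>R f r)"
proof (rule Bochner_Integration.integrable_bound)
  show "integrable (Leb T) (\<lambda>r. (real (Suc n) / T) *\<^sub>R f r)" using f by (intro integrable_scaleR_right)
  show "(\<lambda>r. (of_bool (prev_block T n s r) * (real (Suc n) / T)) *\<^sub>R f r) \<in> borel_measurable (Leb T)"
    using borel_measurable_integrable[OF f] by measurable
  show "AE r in Leb T. norm ((of_bool (prev_block T n s r) * (real (Suc n) / T)) *\<^sub>R f r) \<le> norm ((real (Suc n) / T) *\<^sub>R f r)"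
    using T by (intro AE_I2) auto
qed

lemma block_avg_measurable:
  assumes [measurable]: "f \<in> borel_measurable (Leb T)"
  shows "block_avg T n f \<in> borel_measurable (Leb T)"
proof -
  interpret finite_measure "Leb T" by (rule finite_Leb)
  have "(\<lambda>s. LINT r|Leb T. (of_bool (prev_block T n s r) * (real (Suc n) / T)) *\<^sub>R f r) \<in> borel_measurable (Leb T)"
  proof (rule borel_measurable_lebesgue_integral)
    have "(\<lambda>p. (of_bool (prev_block T n (fst p) (snd p)) * (real (Suc n) / T)) *\<^sub>R f (snd p)) \<in> borel_measurable (Leb T \<Otimes>\<^sub>M Leb T)"
      by measurable
    then show "(\<lambda>(s, r). (of_bool (prev_block T n s r) * (real (Suc n) / T)) *\<^sub>R f r) \<in> borel_measurable (Leb T \<Otimes>\<^sub>M Leb T)"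
      by (simp add: case_prod_unfold)
  qed
  then show ?thesis by (simp add: block_avg_def[abs_def])
qed

lemma block_avg_contraction:
  assumes f: "integrable (Leb T) f"
  shows "L1 (Leb T) (block_avg T n f) \<le> L1 (Leb T) f"
proof -
  interpret finite_measure "Leb T" by (rule finite_Leb)
  interpret P: pair_sigma_finite "Leb T" "Leb T" ..
  have [measurable]: "f \<in> borel_measurable (Leb T)" using f by simp
  let ?k = "\<lambda>s r. of_bool (prev_block T n s r) * (real (Suc n) / T)"
  have kpos: "0 \<le> ?k s r" for s r using T by simp
  have "L1 (Leb T) (block_avg T n f) \<le> (\<integral>\<^sup>+ s. \<integral>\<^sup>+ r. ennreal (?k s r) * ennreal (norm (f r)) \<partial>Leb T \<partial>Leb T)"
  proof (intro nn_integral_mono)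
    fix s
    have "ennreal (norm (block_avg T n f s)) \<le> L1 (Leb T) (\<lambda>r. ?k s r *\<^sub>R f r)"
      unfolding block_avg_def by (rule integral_norm_bound_ennreal[OF block_integrable[OF f]])
    also have "... = (\<integral>\<^sup>+ r. ennreal (?k s r) * ennreal (norm (f r)) \<partial>Leb T)"
      using kpos T by (intro nn_integral_cong) (simp add: ennreal_mult[symmetric])
    finally show "ennreal (norm (block_avg T n f s)) \<le> (\<integral>\<^sup>+ r. ennreal (?k s r) * ennreal (norm (f r)) \<partial>Leb T)" .
  qed
  also have "... = (\<integral>\<^sup>+ r. \<integral>\<^sup>+ s. ennreal (?k s r) * ennreal (norm (f r)) \<partial>Leb T \<partial>Leb T)"
  proof -
    have "(\<lambda>p. ennreal (?k (fst p) (snd p)) * ennreal (norm (f (snd p)))) \<in> borel_measurable (Leb T \<Otimes>\<^sub>M Leb T)" by measurable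
    then show ?thesis by (intro P.Fubini'[symmetric]) (simp add: case_prod_unfold)
  qed
  also have "... = (\<integral>\<^sup>+ r. (\<integral>\<^sup>+ s. ennreal (?k s r) \<partial>Leb T) * ennreal (norm (f r)) \<partial>Leb T)"
    by (intro nn_integral_cong nn_integral_multc) measurable
  also have "... \<le> (\<integral>\<^sup>+ r. 1 * ennreal (norm (f r)) \<partial>Leb T)"
    by (intro nn_integral_mono mult_right_mono block_kernel_le1) simp
  finally show ?thesis by simp
qed

lemma block_avg_add:
  assumes "integrable (Leb T) f" "integrable (Leb T) g"
  shows "block_avg T n (\<lambda>s. f s + g s) s = block_avg T n f s + block_avg T n g s"
  unfolding block_avg_def scaleR_add_right
  by (rule Bochner_Integration.integral_add) (intro block_integrable assms)+

lemma block_avg_diff: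
  assumes "integrable (Leb T) f" "integrable (Leb T) g"
  shows "block_avg T n (\<lambda>s. f s - g s) s = block_avg T n f s - block_avg T n g s"
  unfolding block_avg_def scaleR_diff_right
  by (rule Bochner_Integration.integral_diff) (intro block_integrable assms)+

end

definition block_conv :: "real => (real => 'a::{banach,second_countable_topology}) => bool" where
  "block_conv T f \<longleftrightarrow> integrable (Leb T) f \<and> (\<lambda>n. L1 (Leb T) (\<lambda>s. block_avg T n f s - f s)) \<longlonglongrightarrow> 0"

lemma block_conv_limit:
  assumes T: "T > 0" and g: "\<And>i. block_conv T (g i)" and f: "integrable (Leb T) f"
    and lim: "(\<lambda>i. L1 (Leb T) (\<lambda>s. g i s - f s)) \<longlonglongrightarrow> 0"
  shows "block_conv T f"
  unfolding block_conv_def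
proof (intro conjI f tendsto_zero_ennrealI)
  fix \<epsilon> :: real assume "\<epsilon> > 0"
  have "eventually (\<lambda>i. L1 (Leb T) (\<lambda>s. g i s - f s) < ennreal (\<epsilon> / 3)) sequentially"
    using \<open>\<epsilon> > 0\<close> by (intro order_tendstoD(2)[OF lim]) simp
  then obtain i where i: "L1 (Leb T) (\<lambda>s. g i s - f s) < ennreal (\<epsilon> / 3)"
    by (auto simp: eventually_sequentially)
  have gi: "integrable (Leb T) (g i)" using g by (simp add: block_conv_def)
  have "eventually (\<lambda>n. L1 (Leb T) (\<lambda>s. block_avg T n (g i) s - g i s) < ennreal (\<epsilon> / 3)) sequentially"
    using \<open>\<epsilon> > 0\<close> g[of i] by (intro order_tendstoD(2)[of _ 0]) (auto simp: block_conv_def)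
  then obtain K where K: "\<And>n. n \<ge> K ==> (L1 (Leb T) (\<lambda>s. block_avg T n (g i) s - g i s)) < ennreal (\<epsilon> / 3)"
    by (auto simp: eventually_sequentially)
  have [measurable]: "f \<in> borel_measurable (Leb T)" "g i \<in> borel_measurable (Leb T)" using f gi by auto
  have [measurable]: "block_avg T n f \<in> borel_measurable (Leb T)" "block_avg T n (g i) \<in> borel_measurable (Leb T)" for n
    by (auto intro!: block_avg_measurable T)
  show "\<exists>K. \<forall>n\<ge>K. L1 (Leb T) (\<lambda>s. block_avg T n f s - f s) \<le> ennreal \<epsilon>"
  proof (intro exI[of _ K] allI impI)
    fix n assume "n \<ge> K"
    have tri: "ennreal (norm (block_avg T n f s - f s)) \<le> ennreal (norm (block_avg T n f s - block_avg T n (g i) s)) +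
       (ennreal (norm (block_avg T n (g i) s - g i s)) + ennreal (norm (g i s - f s)))" for s
    proof -
      have "norm (block_avg T n f s - f s) \<le> norm (block_avg T n f s - block_avg T n (g i) s) +
          (norm (block_avg T n (g i) s - g i s) + norm (g i s - f s))"
        using norm_triangle_ineq[of "block_avg T n f s - block_avg T n (g i) s" "(block_avg T n (g i) s - g i s) + (g i s - f s)"]
          norm_triangle_ineq[of "block_avg T n (g i) s - g i s" "g i s - f s"] by simp
      then show ?thesis by (simp add: ennreal_plus[symmetric] ennreal_leI del: ennreal_plus)
    qed
    have "L1 (Leb T) (\<lambda>s. block_avg T n f s - f s) \<le>
       (\<integral>\<^sup>+ s. ennreal (norm (block_avg T n f s - block_avg T n (g i) s)) +
       (ennreal (norm (block_avg T n (g i) s - g i s)) + ennreal (norm (g i s - f s))) \<partial>Leb T)"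
      by (intro nn_integral_mono tri)
    also have "... = L1 (Leb T) (\<lambda>s. block_avg T n f s - block_avg T n (g i) s) +
       ((L1 (Leb T) (\<lambda>s. block_avg T n (g i) s - g i s)) + L1 (Leb T) (\<lambda>s. g i s - f s))"
      by (subst nn_integral_add, measurable, subst nn_integral_add, measurable)
    also have "L1 (Leb T) (\<lambda>s. block_avg T n f s - block_avg T n (g i) s) \<le> L1 (Leb T) (\<lambda>s. f s - g i s)"
      using block_avg_contraction[OF T Bochner_Integration.integrable_diff[OF f gi], of n] by (simp add: block_avg_diff[OF T f gi])
    also have "L1 (Leb T) (\<lambda>s. f s - g i s) \<le> ennreal (\<epsilon> / 3)"
      using i by (simp add: norm_minus_commute)
    also have "ennreal (\<epsilon> / 3) + ((L1 (Leb T) (\<lambda>s. block_avg T n (g i) s - g i s)) + L1 (Leb T) (\<lambda>s. g i s - f s)) \<le>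
       ennreal (\<epsilon> / 3) + (ennreal (\<epsilon> / 3) + ennreal (\<epsilon> / 3))"
      by (intro add_left_mono add_mono less_imp_le i K \<open>n \<ge> K\<close>)
    also have "... = ennreal \<epsilon>" using \<open>\<epsilon> > 0\<close> by (simp add: ennreal_plus[symmetric] del: ennreal_plus)
    finally show "L1 (Leb T) (\<lambda>s. block_avg T n f s - f s) \<le> ennreal \<epsilon>" by (simp add: add_mono)
  qed
qed

lemma block_conv_add:
  assumes T: "T > 0" and f: "block_conv T f" and g: "block_conv T g"
  shows "block_conv T (\<lambda>s. f s + g s)"
proof -
  have fi: "integrable (Leb T) f" and gi: "integrable (Leb T) g" using f g by (auto simp: block_conv_def)
  have [measurable]: "f \<in> borel_measurable (Leb T)" "g \<in> borel_measurable (Leb T)" using fi gi by auto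
  have [measurable]: "block_avg T n f \<in> borel_measurable (Leb T)" "block_avg T n g \<in> borel_measurable (Leb T)" for n
    by (auto intro!: block_avg_measurable T)
  have "(\<lambda>n. L1 (Leb T) (\<lambda>s. block_avg T n f s - f s) + L1 (Leb T) (\<lambda>s. block_avg T n g s - g s)) \<longlonglongrightarrow> 0 + 0"
    using f g by (intro tendsto_add) (auto simp: block_conv_def)
  then have lim0: "(\<lambda>n. L1 (Leb T) (\<lambda>s. block_avg T n f s - f s) + L1 (Leb T) (\<lambda>s. block_avg T n g s - g s)) \<longlonglongrightarrow> 0"
    by simp
  have "(\<lambda>n. L1 (Leb T) (\<lambda>s. block_avg T n (\<lambda>s. f s + g s) s - (f s + g s))) \<longlonglongrightarrow> 0"
  proof (rule tendsto_zero_ennreal_le[OF lim0])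
    fix n
    have tri: "ennreal (norm (block_avg T n (\<lambda>s. f s + g s) s - (f s + g s))) \<le>
        ennreal (norm (block_avg T n f s - f s)) + ennreal (norm (block_avg T n g s - g s))" for s
      unfolding block_avg_add[OF T fi gi]
      using norm_triangle_ineq[of "block_avg T n f s - f s" "block_avg T n g s - g s"]
      by (simp add: ennreal_plus[symmetric] ennreal_leI algebra_simps del: ennreal_plus)
    have "L1 (Leb T) (\<lambda>s. block_avg T n (\<lambda>s. f s + g s) s - (f s + g s)) \<le>
      (\<integral>\<^sup>+ s. ennreal (norm (block_avg T n f s - f s)) + ennreal (norm (block_avg T n g s - g s)) \<partial>Leb T)"
      by (intro nn_integral_mono tri)
    also have "... = L1 (Leb T) (\<lambda>s. block_avg T n f s - f s) + L1 (Leb T) (\<lambda>s. block_avg T n g s - g s)"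
      by (rule nn_integral_add) measurable
    finally show "L1 (Leb T) (\<lambda>s. block_avg T n (\<lambda>s. f s + g s) s - (f s + g s)) \<le>
      L1 (Leb T) (\<lambda>s. block_avg T n f s - f s) + L1 (Leb T) (\<lambda>s. block_avg T n g s - g s)" .
  qed
  then show ?thesis using fi gi by (simp add: block_conv_def)
qed

lemma block_conv_const_dominated:
  assumes T: "T > 0" and f: "\<And>i. block_conv T (f i)" and w: "integrable (Leb T) w"
    and g: "g \<in> borel_measurable (Leb T)"
    and lim: "\<And>s. s \<in> {0<..T} ==> (\<lambda>i. f i s) \<longlonglongrightarrow> g s"
    and bd: "\<And>i s. s \<in> {0<..T} ==> norm (f i s) \<le> w s"
  shows "block_conv T g"
proof -
  have bdg: "norm (g s) \<le> w s" if "s \<in> {0<..T}" for s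
    by (rule tendsto_upperbound[OF tendsto_norm[OF lim[OF that]]]) (use bd that in auto)
  have wpos: "0 \<le> w s" if "s \<in> {0<..T}" for s using bdg[OF that] norm_ge_zero order_trans by blast
  have gi: "integrable (Leb T) g"
    by (rule Bochner_Integration.integrable_bound[OF w g]) (use bdg in "auto intro!: AE_I2 order_trans[OF bdg]")
  have [measurable]: "f i \<in> borel_measurable (Leb T)" for i using f[of i] by (auto simp: block_conv_def)
  have [measurable]: "w \<in> borel_measurable (Leb T)" "g \<in> borel_measurable (Leb T)" using w g by auto
  have "(\<lambda>i. L1 (Leb T) (\<lambda>s. f i s - g s)) \<longlonglongrightarrow> (\<integral>\<^sup>+ s. 0 \<partial>Leb T)"
  proof (rule nn_integral_dominated_convergence[where w="\<lambda>s. ennreal (2 * w s)"])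
    show "AE s in Leb T. ennreal (norm (f i s - g s)) \<le> ennreal (2 * w s)" for i
    proof (rule AE_I2)
      fix s assume s: "s \<in> space (Leb T)"
      then have "norm (f i s - g s) \<le> 2 * w s"
        using norm_triangle_ineq4[of "f i s" "g s"] bd[of s i] bdg[of s] by simp
      then show "ennreal (norm (f i s - g s)) \<le> ennreal (2 * w s)" by (rule ennreal_leI)
    qed
    show "(\<integral>\<^sup>+ s. ennreal (2 * w s) \<partial>Leb T) < \<infinity>"
    proof -
      have "(\<integral>\<^sup>+ s. ennreal (2 * w s) \<partial>Leb T) = ennreal (LINT s|Leb T. 2 * w s)"
        by (rule nn_integral_eq_integral) (use w wpos in auto)
      then show ?thesis by simp
    qed
    show "AE s in Leb T. (\<lambda>i. ennreal (norm (f i s - g s))) \<longlonglongrightarrow> 0"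
    proof (rule AE_I2)
      fix s assume "s \<in> space (Leb T)"
      then have "(\<lambda>i. norm (f i s - g s)) \<longlonglongrightarrow> 0"
        using lim[of s] by (simp add: LIM_zero_iff tendsto_norm_zero_iff)
      then show "(\<lambda>i. ennreal (norm (f i s - g s))) \<longlonglongrightarrow> 0" by (simp add: ennreal_tendsto_0_iff)
    qed
  qed measurable
  then show ?thesis by (intro block_conv_limit[OF T f gi]) simp
qed

lemma block_conv_scaled:
  assumes T: "T > 0" and f: "block_conv T (f :: real => real)"
  shows "block_conv T (\<lambda>s. f s *\<^sub>R c)"
proof -
  have fi: "integrable (Leb T) f" using f by (simp add: block_conv_def)
  have av: "block_avg T n (\<lambda>s. f s *\<^sub>R c) s = block_avg T n f s *\<^sub>R c" for n s
    unfolding block_avg_def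
    using integral_scaleR_left[OF block_integrable[OF T fi, of n s], of c] by (simp add: mult.assoc)
  have m: "(\<lambda>s. ennreal (norm (block_avg T n f s - f s))) \<in> borel_measurable (Leb T)" for n
    using block_avg_measurable[OF T, of f n] borel_measurable_integrable[OF fi] by measurable
  have "L1 (Leb T) (\<lambda>s. block_avg T n (\<lambda>s. f s *\<^sub>R c) s - f s *\<^sub>R c) =
     ennreal (norm c) * (L1 (Leb T) (\<lambda>s. block_avg T n f s - f s))" for n
    unfolding av by (subst nn_integral_cmult[OF m, symmetric])
      (simp add: scaleR_diff_left[symmetric] ennreal_mult[symmetric] mult.commute)
  moreover have "(\<lambda>n. ennreal (norm c) * (L1 (Leb T) (\<lambda>s. block_avg T n f s - f s))) \<longlonglongrightarrow> ennreal (norm c) * 0"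
    using f by (intro ennreal_tendsto_cmult) (auto simp: block_conv_def)
  ultimately show ?thesis using fi by (simp add: block_conv_def integrable_scaleR_left)
qed

lemma block_conv_indicator_atMost:
  assumes T: "T > 0"
  shows "block_conv T (indicator {..a} :: real => real)"
proof -
  interpret finite_measure "Leb T" by (rule finite_Leb)
  let ?f = "indicator {..a} :: real => real"
  have [measurable]: "?f \<in> borel_measurable (Leb T)" by (rule measurable_Leb) simp
  have fi: "integrable (Leb T) ?f"
    by (rule integrable_const_bound[of _ 1]) (auto simp: indicator_def)
  have le1: "\<bar>block_avg T n ?f s\<bar> \<le> 1" if s: "s \<in> {0<..T}" for n s
  proof -
    have "\<bar>block_avg T n ?f s\<bar> \<le> (LINT r|Leb T. \<bar>(of_bool (prev_block T n s r) * (real (Suc n) / T)) *\<^sub>R ?f r\<bar>)"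
      unfolding block_avg_def by (rule integral_abs_bound)
    also have "... \<le> (LINT r|Leb T. of_bool (prev_block T n s r) * (real (Suc n) / T))"
    proof (rule integral_mono)
      show "integrable (Leb T) (\<lambda>r. \<bar>(of_bool (prev_block T n s r) * (real (Suc n) / T)) *\<^sub>R ?f r\<bar>)"
        by (intro integrable_abs block_integrable T fi)
      show "integrable (Leb T) (\<lambda>r. of_bool (prev_block T n s r) * (real (Suc n) / T))"
        using block_integrable[OF T, of "\<lambda>_. 1::real" n s] by simp
    qed (use T in "auto simp: indicator_def")
    also have "... \<le> 1"
    proof (cases "T / real (Suc n) < s")
      case True
      then show ?thesis using block_kernel_1[OF T, of n s] s by simp
    next
      case False
      have "\<not> prev_block T n s r" if "r \<in> {0<..T}" for r
      proof
        assume "prev_block T n s r"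
        have "0 < \<lceil>r * real (Suc n) / T\<rceil>" using that T by simp
        moreover have "s * real (Suc n) / T \<le> 1" using False T by (simp add: field_simps)
        then have "\<lceil>s * real (Suc n) / T\<rceil> \<le> 1" by (simp add: ceiling_le_iff)
        ultimately show False using \<open>prev_block T n s r\<close> unfolding prev_block_def by linarith
      qed
      then have "(LINT r|Leb T. of_bool (prev_block T n s r) * (real (Suc n) / T)) = (LINT r|Leb T. 0)"
        by (intro Bochner_Integration.integral_cong) auto
      also have "(LINT r|Leb T. 0::real) = 0" by simp
      finally show ?thesis by linarith
    qed
    finally show ?thesis .
  qed
  have pt: "(\<lambda>n. block_avg T n ?f s) \<longlonglongrightarrow> ?f s" if s: "s \<in> {0<..T}" "s \<noteq> a" for s
  proof -
    have "(\<lambda>n. 2 * T * inverse (real (Suc n))) \<longlonglongrightarrow> 2 * T * 0"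
      by (intro tendsto_mult tendsto_const LIMSEQ_inverse_real_of_nat)
    then have "eventually (\<lambda>n. 2 * T * inverse (real (Suc n)) < min s \<bar>s - a\<bar>) sequentially"
      using s by (intro order_tendstoD) auto
    then have "eventually (\<lambda>n. block_avg T n ?f s = ?f s) sequentially"
    proof eventually_elim
      case (elim n)
      then have n: "2 * T / real (Suc n) < s" "2 * T / real (Suc n) < \<bar>s - a\<bar>" by (simp_all add: divide_inverse)
      have "block_avg T n ?f s = (LINT r|Leb T. (of_bool (prev_block T n s r) * (real (Suc n) / T)) *\<^sub>R ?f s)"
        unfolding block_avg_def
      proof (intro Bochner_Integration.integral_cong refl)
        fix r
        have "?f r = ?f s" if "prev_block T n s r"
          using prev_block_near[OF T that] n(2) by (auto simp: indicator_def)
        then show "(of_bool (prev_block T n s r) * (real (Suc n) / T)) *\<^sub>R ?f r = (of_bool (prev_block T n s r) * (real (Suc n) / T)) *\<^sub>R ?f s"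
          by auto
      qed
      also have "... = ?f s"
      proof -
        have "T / real (Suc n) < s" using n(1) T by (smt (verit) divide_pos_pos of_nat_0_less_iff zero_less_Suc add_divide_distrib)
        then show ?thesis using block_kernel_1[OF T, of n s] s by simp
      qed
      finally show ?case .
    qed
    then show ?thesis by (rule tendsto_eventually)
  qed
  have "(\<lambda>n. L1 (Leb T) (\<lambda>s. block_avg T n ?f s - ?f s)) \<longlonglongrightarrow> (\<integral>\<^sup>+ s. 0 \<partial>Leb T)"
  proof (rule nn_integral_dominated_convergence[where w="\<lambda>_. 2"])
    show "AE s in Leb T. ennreal (norm (block_avg T n ?f s - ?f s)) \<le> 2" for n
    proof (rule AE_I2)
      fix s assume "s \<in> space (Leb T)"
      then have "\<bar>block_avg T n ?f s - ?f s\<bar> \<le> 2" using le1[of s n] by (auto simp: indicator_def)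
      then have "ennreal \<bar>block_avg T n ?f s - ?f s\<bar> \<le> ennreal 2" by (rule ennreal_leI)
      then show "ennreal (norm (block_avg T n ?f s - ?f s)) \<le> 2" by simp
    qed
    show "(\<integral>\<^sup>+ s. 2 \<partial>Leb T) < \<infinity>" 
    proof -
      have "emeasure (Leb T) {0<..T} < \<infinity>" using emeasure_finite[of "{0<..T}"] by (simp add: less_top[symmetric])
      then show ?thesis by (simp add: ennreal_mult_less_top)
    qed
    have "AE s in Leb T. s \<noteq> a \<and> s \<in> {0<..T}" using AE_Leb_neq[of a T] AE_space[of "Leb T"] by simp
    then show "AE s in Leb T. (\<lambda>n. ennreal (norm (block_avg T n ?f s - ?f s))) \<longlonglongrightarrow> 0"
    proof eventually_elim
      case (elim s)
      then show ?case using pt[of s] by (simp add: ennreal_tendsto_0_iff LIM_zero_iff tendsto_rabs_zero_iff)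
    qed
  qed (use block_avg_measurable[OF T, of ?f] in measurable)
  then show ?thesis using fi by (simp add: block_conv_def)
qed

text \<open>The averages over the previous block look only into the past and converge in \<open>L\<^sup>1\<close>: this is
  clear for indicators of half-lines, extends to Borel sets by a Dynkin argument, and to integrable
  functions because averaging is a contraction.\<close>

lemma block_conv_integrable:
  assumes T: "T > 0" and f: "integrable (Leb T) f"
  shows "block_conv T f"
proof -
  interpret finite_measure "Leb T" by (rule finite_Leb)
  have c1: "integrable (Leb T) (\<lambda>_. 1::real)" by simp
  have ind: "block_conv T (indicator A :: real => real)" if "A \<in> sets borel" for A
  proof -
    have Int: "Int_stable (range (\<lambda>a::real. {..a}))" by (auto simp: Int_stable_def)
    have mem: "A \<in> sigma_sets UNIV (range (\<lambda>a::real. {..a}))" using that unfolding borel_eq_atMost by simp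
    have Pw: "range (\<lambda>a::real. {..a}) \<subseteq> Pow UNIV" by simp
    show ?thesis
    proof (rule sigma_sets_induct_disjoint[where P="\<lambda>A. block_conv T (indicator A :: real => real)", OF Int Pw mem])
      fix A assume "A \<in> range (\<lambda>a::real. {..a})"
      then show "block_conv T (indicator A :: real => real)" using block_conv_indicator_atMost[OF T] by auto
    next
      show "block_conv T (indicator {} :: real => real)" by (simp add: block_conv_def block_avg_def indicator_def)
    next
      fix A :: "real set" assume compl: "block_conv T (indicator A :: real => real)"
      have "block_conv T (indicator UNIV :: real => real)"
      proof (rule block_conv_const_dominated[OF T block_conv_indicator_atMost[OF T, of T] c1])
        show "(\<lambda>i::nat. indicator {..T} s) \<longlonglongrightarrow> indicator UNIV s" if "s \<in> {0<..T}" for s :: real using that by simp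
      qed (auto simp: indicator_def)
      from block_conv_add[OF T this block_conv_scaled[OF T compl, of "-1"]]
      have "block_conv T (\<lambda>s. indicator UNIV s + indicator A s *\<^sub>R (-1) :: real)" .
      moreover have "(\<lambda>s. indicator UNIV s + indicator A s *\<^sub>R (-1) :: real) = indicator (UNIV - A)"
        by (auto simp: indicator_def)
      ultimately show "block_conv T (indicator (UNIV - A) :: real => real)" by simp
    next
      fix A :: "nat => real set"
      assume union: "disjoint_family A" "range A \<subseteq> sigma_sets UNIV (range (\<lambda>a::real. {..a}))"
        "\<And>i. block_conv T (indicator (A i) :: real => real)"
      have sets: "A i \<in> sets borel" for i using union(2) unfolding borel_eq_atMost by auto
      have part: "block_conv T (\<lambda>s. \<Sum>j<i. indicator (A j) s :: real)" for i
      proof (induction i)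
        case 0 show ?case by (simp add: block_conv_def block_avg_def)
      next
        case (Suc i)
        then show ?case using block_conv_add[OF T Suc union(3)[of i]] by simp
      qed
      have eq: "(\<Sum>j<i. indicator (A j) s) = (indicator (\<Union>j<i. A j) s :: real)" for i s
        by (rule indicator_UN_disjoint[symmetric]) (use union(1) in "auto simp: disjoint_family_on_def")
      show "block_conv T (indicator (\<Union>i. A i) :: real => real)"
      proof (rule block_conv_const_dominated[OF T part c1])
        show "(\<lambda>i. \<Sum>j<i. indicator (A j) s :: real) \<longlonglongrightarrow> indicator (\<Union>i. A i) s" for s
        proof (cases "s \<in> (\<Union>i. A i)")
          case True
          then obtain j where j: "s \<in> A j" by auto
          have "eventually (\<lambda>i. (\<Sum>j<i. indicator (A j) s :: real) = indicator (\<Union>i. A i) s) sequentially"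
            unfolding eq using eventually_gt_at_top[of j] by eventually_elim (use j in "auto simp: indicator_def")
          then show ?thesis by (rule tendsto_eventually)
        qed (simp add: eq indicator_def)
        show "indicator (\<Union>i. A i) \<in> borel_measurable (Leb T)" by (rule measurable_Leb) (use sets in simp)
        show "norm (\<Sum>j<i. indicator (A j) s :: real) \<le> 1" for i s unfolding eq by (simp add: indicator_def)
      qed
    qed
  qed
  from f show ?thesis
  proof (induction rule: integrable_induct)
    case (base A c)
    then obtain B where B: "B \<in> sets borel" "A = B \<inter> {0<..T}" by (auto simp: Leb_def sets_restrict_space)
    show ?case
    proof (rule block_conv_const_dominated[OF T block_conv_scaled[OF T ind[OF B(1)], of c], where w="\<lambda>_. norm c"])
      show "(\<lambda>s. indicator A s *\<^sub>R c) \<in> borel_measurable (Leb T)" using base by measurable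
      show "(\<lambda>i::nat. indicator B s *\<^sub>R c) \<longlonglongrightarrow> indicator A s *\<^sub>R c" if "s \<in> {0<..T}" for s
        using that B by (simp add: indicator_def)
    qed (auto simp: indicator_def)
  next
    case (add f g)
    then show ?case by (intro block_conv_add T)
  next
    case (lim f s)
    have bc: "block_conv T (s i)" for i using lim by blast
    show ?case
      by (rule block_conv_const_dominated[where f=s and w="\<lambda>x. 2 * norm (f x)", OF T bc])
        (use lim in auto)
  qed
qed

section \<open>The drift convolution\<close>

lemma nn_integral_powr_singular:
  assumes "\<gamma> < 1" "T \<ge> 0"
  shows "(\<integral>\<^sup>+ s. ennreal (s powr (- \<gamma>)) * indicator {0<..T} s \<partial>lborel) = ennreal (T powr (1 - \<gamma>) / (1 - \<gamma>))"
proof -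
  let ?f = "\<lambda>s::real. if s \<in> {0..T} then s powr (- \<gamma>) else 0"
  have "((\<lambda>s. s powr (- \<gamma>)) has_integral (T powr (- \<gamma> + 1) / (- \<gamma> + 1))) {0..T}"
    by (rule has_integral_powr_from_0) (use assms in auto)
  then have "(?f has_integral (T powr (1 - \<gamma>) / (1 - \<gamma>))) UNIV"
    by (subst has_integral_restrict_UNIV) (simp add: algebra_simps)
  then have "(\<integral>\<^sup>+ s. ennreal (?f s) \<partial>lborel) = ennreal (T powr (1 - \<gamma>) / (1 - \<gamma>))"
    by (intro nn_integral_has_integral_lborel) auto
  moreover have "ennreal (s powr (- \<gamma>)) * indicator {0<..T} s = ennreal (?f s)" for s
    by (auto simp: indicator_def)
  ultimately show ?thesis by simp
qed

lemma nn_integral_powr_singular_reflected: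
  assumes "\<gamma> < 1" "d \<ge> 0"
  shows "(\<integral>\<^sup>+ s. ennreal ((t - s) powr (- \<gamma>)) * indicator {t - d..<t} s \<partial>lborel) = ennreal (d powr (1 - \<gamma>) / (1 - \<gamma>))"
proof -
  have m: "(\<lambda>s. ennreal ((t - s) powr (- \<gamma>)) * indicator {t - d..<t} s) \<in> borel_measurable borel" by measurable
  have "(\<integral>\<^sup>+ s. ennreal ((t - s) powr (- \<gamma>)) * indicator {t - d..<t} s \<partial>lborel) =
     (\<integral>\<^sup>+ s. ennreal (s powr (- \<gamma>)) * indicator {0<..d} s \<partial>lborel)"
    unfolding nn_integral_real_affine[OF m, of "-1" t, simplified]
    by (intro nn_integral_cong) (auto simp: indicator_def)
  then show ?thesis using nn_integral_powr_singular[OF assms] by simp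
qed

lemma youngs_inequality_eps:
  fixes p q :: real
  assumes pq: "p > 1" "q > 1" "1 / p + 1 / q = 1" and "\<eta> > 0"
  obtains K where "K \<ge> 0" "\<And>a b. 0 \<le> a ==> 0 \<le> b ==> a * b \<le> \<eta> * a powr p + K * b powr q"
proof -
  define c where "c = (\<eta> * p) powr (1 / p)"
  have c: "c > 0" "c powr p = \<eta> * p" using assms by (auto simp: c_def powr_powr)
  have "a * b \<le> \<eta> * a powr p + ((1 / c) powr q / q) * b powr q" if "0 \<le> a" "0 \<le> b" for a b
  proof -
    have "a * b = (c * a) * ((1 / c) * b)" using c by simp
    also have "... \<le> (c * a) powr p / p + ((1 / c) * b) powr q / q"
      using that c pq by (intro Youngs_inequality) auto
    also have "... = \<eta> * a powr p + ((1 / c) powr q / q) * b powr q"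
      using that c pq by (subst (1 2) powr_mult) auto
    finally show ?thesis .
  qed
  then show ?thesis using pq by (intro that[of "(1 / c) powr q / q"]) auto
qed

locale drift = stochastic_convolution M F W S \<sigma>
  for M :: "'w measure" and F :: "real => 'w measure"
    and W :: "real => 'xi::{real_inner,banach,second_countable_topology} => 'w => real"
    and S :: "real => 'h::{real_inner,banach,second_countable_topology} \<Rightarrow>\<^sub>L 'h"
    and \<sigma> :: "'xi \<Rightarrow>\<^sub>L 'h" +
  fixes E :: "real => 'k::{real_inner,banach,second_countable_topology} \<Rightarrow>\<^sub>L 'h"
    and cG aG \<beta> :: real
  assumes E_add: "0 \<le> r ==> 0 < s ==> E (r + s) k = S r (E s k)"
    and cG: "cG > 0" and \<beta>: "0 \<le> \<beta>" "\<beta> < 1"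
    and E_norm: "s > 0 ==> norm (E s) \<le> cG * max (s powr (- \<beta>)) 1 * exp (aG * s)"
begin

lemma E_bound:
  obtains c where "c > 0" "\<And>s k. 0 < s ==> s \<le> T ==> norm (E s k) \<le> c * s powr (- \<beta>) * norm k"
proof -
  define c where "c = cG * max 1 (T powr \<beta>) * exp (\<bar>aG\<bar> * \<bar>T\<bar>)"
  have "norm (E s k) \<le> c * s powr (- \<beta>) * norm k" if s: "0 < s" "s \<le> T" for s k
  proof -
    have "1 \<le> T powr \<beta> * s powr (- \<beta>)"
    proof -
      have "1 = s powr \<beta> * s powr (- \<beta>)" using s by (simp add: powr_add[symmetric])
      also have "... \<le> T powr \<beta> * s powr (- \<beta>)" using s \<beta> by (intro mult_right_mono powr_mono2) auto
      finally show ?thesis .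
    qed
    moreover have "T powr \<beta> * s powr (- \<beta>) \<le> max 1 (T powr \<beta>) * s powr (- \<beta>)"
      "1 * s powr (- \<beta>) \<le> max 1 (T powr \<beta>) * s powr (- \<beta>)" by (intro mult_right_mono; simp)+
    ultimately have "max (s powr (- \<beta>)) 1 \<le> max 1 (T powr \<beta>) * s powr (- \<beta>)" by linarith
    moreover have "aG * s \<le> \<bar>aG\<bar> * \<bar>T\<bar>" using s by (intro mult_mono) auto
    then have "exp (aG * s) \<le> exp (\<bar>aG\<bar> * \<bar>T\<bar>)" by simp
    ultimately have "max (s powr (- \<beta>)) 1 * exp (aG * s) \<le> (max 1 (T powr \<beta>) * s powr (- \<beta>)) * exp (\<bar>aG\<bar> * \<bar>T\<bar>)"
      by (intro mult_mono) auto
    then have "cG * (max (s powr (- \<beta>)) 1 * exp (aG * s)) \<le> cG * ((max 1 (T powr \<beta>) * s powr (- \<beta>)) * exp (\<bar>aG\<bar> * \<bar>T\<bar>))"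
      using cG by (intro mult_left_mono) auto
    also have "... = c * s powr (- \<beta>)" by (simp add: c_def mult_ac)
    finally have "norm (E s) \<le> c * s powr (- \<beta>)" using E_norm[OF s(1)] by (simp add: mult.assoc)
    then have "norm (E s) * norm k \<le> c * s powr (- \<beta>) * norm k" by (rule mult_right_mono) simp
    then show ?thesis using norm_blinfun[of "E s" k] by linarith
  qed
  moreover have "c > 0" using cG by (simp add: c_def)
  ultimately show ?thesis using that by blast
qed

lemma E_continuous: "continuous_on {0<..} (\<lambda>s. E s k)"
proof -
  have "isCont (\<lambda>s. E s k) s" if "s > 0" for s
  proof -
    have "continuous_on {s / 2<..} (\<lambda>r. S (r - s / 2) (E (s / 2) k))"
      by (rule continuous_on_compose2[OF S_continuous]) (auto intro!: continuous_intros)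
    then have "continuous_on {s / 2<..} (\<lambda>r. E r k)"
    proof (rule continuous_on_eq)
      fix r assume "r \<in> {s / 2<..}"
      then show "S (r - s / 2) (E (s / 2) k) = E r k" using E_add[of "r - s / 2" "s / 2" k] that by simp
    qed
    then show ?thesis using that by (simp add: continuous_on_eq_continuous_at)
  qed
  then show ?thesis by (auto intro: continuous_at_imp_continuous_on)
qed

lemma E_tendsto:
  assumes s: "s > 0" and f: "(f \<longlongrightarrow> s) G"
  shows "((\<lambda>n. E (f n) k) \<longlongrightarrow> E s k) G"
  using f
proof (rule isCont_tendsto_compose[rotated])
  show "isCont (\<lambda>s. E s k) s" using E_continuous s by (auto simp: continuous_on_eq_continuous_at)
qed

text \<open>The values of \<open>E\<close> at nonpositive times are arbitrary and need not be measurable in time.\<close>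

definition E0 :: "real => 'k => 'h" where "E0 s k = (if 0 < s then E s k else 0)"

text \<open>\<open>E\<close> is jointly continuous on positive times: strong continuity together with a local bound on the norm.\<close>

lemma E0_measurable [measurable]: "(\<lambda>p. E0 (fst p) (snd p)) \<in> borel_measurable (borel \<Otimes>\<^sub>M borel)"
proof -
  have cont: "continuous_on ({0<..} \<times> UNIV) (\<lambda>p. E (fst p) (snd p))"
  proof (rule continuous_at_imp_continuous_on, clarify)
    fix s :: real and k :: 'k assume s: "0 < s"
    obtain c where c: "c > 0" "\<And>r k. 0 < r ==> r \<le> 2 * s ==> norm (E r k) \<le> c * r powr (- \<beta>) * norm k"
      using E_bound by blast
    show "isCont (\<lambda>p. E (fst p) (snd p)) (s, k)"
      unfolding continuous_at
    proof (rule LIM_zero_cancel, rule tendsto_norm_zero_cancel)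
      let ?G = "at (s, k)"
      have f: "(fst \<longlongrightarrow> s) ?G" "(snd \<longlongrightarrow> k) ?G" by (auto intro!: tendsto_eq_intros)
      show "((\<lambda>p. norm (E (fst p) (snd p) - E (fst (s, k)) (snd (s, k)))) \<longlongrightarrow> 0) ?G"
      proof (rule Lim_null_comparison)
        have "eventually (\<lambda>p. 0 < fst p) ?G" "eventually (\<lambda>p. fst p < 2 * s) ?G"
          using order_tendstoD[OF f(1), of 0] order_tendstoD[OF f(1), of "2 * s"] s by auto
        then show "eventually (\<lambda>p. norm (norm (E (fst p) (snd p) - E (fst (s, k)) (snd (s, k)))) \<le>
            c * fst p powr (- \<beta>) * norm (snd p - k) + norm (E (fst p) k - E s k)) ?G"
        proof eventually_elim
          case (elim p)
          have "E (fst p) (snd p) - E s k = E (fst p) (snd p - k) + (E (fst p) k - E s k)"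
            by (simp add: blinfun.diff_right)
          then have "norm (E (fst p) (snd p) - E s k) \<le> norm (E (fst p) (snd p - k)) + norm (E (fst p) k - E s k)"
            by (metis norm_triangle_ineq)
          then show ?case using c(2)[of "fst p" "snd p - k"] elim by simp
        qed
        have "((\<lambda>p. c * fst p powr (- \<beta>) * norm (snd p - k) + norm (E (fst p) k - E s k)) \<longlongrightarrow>
            c * s powr (- \<beta>) * norm (k - k) + norm (E s k - E s k)) ?G"
          by (intro tendsto_intros f E_tendsto s) (use s in auto)
        then show "((\<lambda>p. c * fst p powr (- \<beta>) * norm (snd p - k) + norm (E (fst p) k - E s k)) \<longlongrightarrow> 0) ?G" by simp
      qed
    qed
  qed
  have "(\<lambda>p. indicator ({0<..} \<times> UNIV) p *\<^sub>R E (fst p) (snd p)) \<in> borel_measurable (borel :: (real \<times> 'k) measure)"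
    by (rule borel_measurable_continuous_on_indicator[OF _ cont]) (auto intro!: borel_open open_Times)
  moreover have "(\<lambda>p. indicator ({0<..} \<times> UNIV) p *\<^sub>R E (fst p) (snd p)) = (\<lambda>p. E0 (fst p) (snd p))"
    by (auto simp: E0_def indicator_def)
  ultimately show ?thesis by (simp add: borel_prod)
qed

lemma E0_compose [measurable (raw)]:
  assumes "f \<in> borel_measurable N'" "g \<in> borel_measurable N'"
  shows "(\<lambda>x. E0 (f x) (g x)) \<in> borel_measurable N'"
  using measurable_compose[OF measurable_Pair[OF assms] E0_measurable] by simp

definition B :: "real => 'k => 'h" where
  "B h k = (LINT s:{0<..h}|lborel. E s k)"

definition conv :: "(real => 'k) => real => 'h" where
  "conv l t = (LINT s:{0..<t}|lborel. E (t - s) (l s))"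

lemma conv_E0: "indicator {0..<t} s *\<^sub>R E (t - s) (l s) = indicator {0..<t} s *\<^sub>R E0 (t - s) (l s)"
  by (auto simp: E0_def indicator_def)

lemma conv_integrand_measurable:
  "l \<in> borel_measurable borel ==> (\<lambda>s. indicator {0..<t} s *\<^sub>R E (t - s) (l s)) \<in> borel_measurable borel"
  unfolding conv_E0 by measurable

lemma B_integrable: "h \<ge> 0 ==> set_integrable lborel {0<..h} (\<lambda>s. E s k)"
proof -
  assume h: "h \<ge> 0"
  obtain c where c: "c > 0" "\<And>s k. 0 < s ==> s \<le> h ==> norm (E s k) \<le> c * s powr (- \<beta>) * norm k" using E_bound by blast
  have eq: "indicator {0<..h} s *\<^sub>R E s k = indicator {0<..h} s *\<^sub>R E0 s k" for s by (auto simp: E0_def indicator_def)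
  show ?thesis unfolding set_integrable_def
  proof (rule integrableI_bounded)
    show "(\<lambda>s. indicator {0<..h} s *\<^sub>R E s k) \<in> borel_measurable lborel" unfolding eq by measurable
    have "L1 lborel (\<lambda>s. indicator {0<..h} s *\<^sub>R E s k) \<le>
        (\<integral>\<^sup>+ s. ennreal (c * norm k) * (ennreal (s powr (- \<beta>)) * indicator {0<..h} s) \<partial>lborel)"
    proof (intro nn_integral_mono)
      fix s
      show "ennreal (norm (indicator {0<..h} s *\<^sub>R E s k)) \<le> ennreal (c * norm k) * (ennreal (s powr (- \<beta>)) * indicator {0<..h} s)"
      proof (cases "s \<in> {0<..h}")
        case True
        then have "norm (E s k) \<le> (c * norm k) * s powr (- \<beta>)" using c(2)[of s k] by (simp add: mult_ac)
        then show ?thesis using True c by (simp add: ennreal_mult[symmetric] ennreal_leI)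
      qed simp
    qed
    also have "... = ennreal (c * norm k) * ennreal (h powr (1 - \<beta>) / (1 - \<beta>))"
      by (subst nn_integral_cmult) (use nn_integral_powr_singular[OF \<beta>(2) h] in auto)
    also have "... < \<infinity>" by (simp add: ennreal_mult_less_top)
    finally show "L1 lborel (\<lambda>s. indicator {0<..h} s *\<^sub>R E s k) < \<infinity>" .
  qed
qed

lemma B_bound:
  assumes "T \<ge> 0"
  obtains c where "c > 0" "\<And>h k. 0 \<le> h ==> h \<le> T ==> norm (B h k) \<le> c * h powr (1 - \<beta>) * norm k"
proof -
  obtain c where c: "c > 0" "\<And>s k. 0 < s ==> s \<le> T ==> norm (E s k) \<le> c * s powr (- \<beta>) * norm k" using E_bound by blast
  have "norm (B h k) \<le> c / (1 - \<beta>) * h powr (1 - \<beta>) * norm k" if h: "0 \<le> h" "h \<le> T" for h k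
  proof -
    have "ennreal (norm (B h k)) \<le> L1 lborel (\<lambda>s. indicator {0<..h} s *\<^sub>R E s k)"
      unfolding B_def set_lebesgue_integral_def
      by (rule integral_norm_bound_ennreal) (use B_integrable[OF h(1)] in "simp add: set_integrable_def")
    also have "... \<le> (\<integral>\<^sup>+ s. ennreal (c * norm k) * (ennreal (s powr (- \<beta>)) * indicator {0<..h} s) \<partial>lborel)"
    proof (intro nn_integral_mono)
      fix s
      show "ennreal (norm (indicator {0<..h} s *\<^sub>R E s k)) \<le> ennreal (c * norm k) * (ennreal (s powr (- \<beta>)) * indicator {0<..h} s)"
      proof (cases "s \<in> {0<..h}")
        case True
        then have "norm (E s k) \<le> (c * norm k) * s powr (- \<beta>)" using c(2)[of s k] h by (simp add: mult_ac)
        then show ?thesis using True c by (simp add: ennreal_mult[symmetric] ennreal_leI)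
      qed simp
    qed
    also have "... = ennreal (c * norm k) * ennreal (h powr (1 - \<beta>) / (1 - \<beta>))"
      by (subst nn_integral_cmult) (use nn_integral_powr_singular[OF \<beta>(2) h(1)] in auto)
    also have "... = ennreal (c / (1 - \<beta>) * h powr (1 - \<beta>) * norm k)"
      using c \<beta> by (simp add: ennreal_mult[symmetric] mult.commute mult.left_commute)
    finally show ?thesis using c \<beta> by (subst (asm) ennreal_le_iff) auto
  qed
  moreover have "c / (1 - \<beta>) > 0" using c \<beta> by simp
  ultimately show ?thesis using that by blast
qed

lemma B_diff: "h \<ge> 0 ==> B h (k - k') = B h k - B h k'"
  unfolding B_def blinfun.diff_right by (rule set_integral_diff(2)) (auto intro: B_integrable)

lemma B_continuous: "h \<ge> 0 ==> continuous_on UNIV (B h)"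
proof -
  assume h: "h \<ge> 0"
  obtain c where c: "c > 0" "\<And>k. norm (B h k) \<le> c * h powr (1 - \<beta>) * norm k" using B_bound[OF h] h by (metis order_refl)
  have "(c * h powr (1 - \<beta>))-lipschitz_on UNIV (B h)"
    by (rule lipschitz_onI) (use c in "auto simp: dist_norm B_diff[OF h, symmetric]")
  then show ?thesis by (rule lipschitz_on_continuous_on)
qed

lemma B_measurable: "h \<ge> 0 ==> f \<in> borel_measurable N' ==> (\<lambda>x. B h (f x)) \<in> borel_measurable N'"
  by (rule borel_measurable_continuous_on[OF B_continuous])

lemma B_tendsto_0:
  assumes "(f \<longlongrightarrow> 0) G" "eventually (\<lambda>n. 0 \<le> f n) G"
  shows "((\<lambda>n. B (f n) k) \<longlongrightarrow> 0) G"
proof -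
  obtain c where c: "c > 0" "\<And>h. 0 \<le> h ==> h \<le> 1 ==> norm (B h k) \<le> c * h powr (1 - \<beta>) * norm k" using B_bound[of 1] by (metis zero_le_one)
  show ?thesis
  proof (rule Lim_null_comparison)
    have "eventually (\<lambda>n. f n < 1) G" using assms(1) by (rule order_tendstoD) simp
    with assms(2) show "eventually (\<lambda>n. norm (B (f n) k) \<le> c * f n powr (1 - \<beta>) * norm k) G"
      by eventually_elim (use c in auto)
    have "((\<lambda>n. f n powr (1 - \<beta>)) \<longlongrightarrow> 0) G"
      using assms \<beta> by (intro tendsto_zero_powrI[OF assms(1) tendsto_const]) auto
    then have "((\<lambda>n. c * f n powr (1 - \<beta>) * norm k) \<longlongrightarrow> c * 0 * norm k) G" by (intro tendsto_intros)
    then show "((\<lambda>n. c * f n powr (1 - \<beta>) * norm k) \<longlongrightarrow> 0) G" by simp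
  qed
qed

text \<open>On a time interval where the control is constant, the drift evolves by the semigroup and \<open>B\<close>.\<close>

lemma conv_cell:
  assumes a: "0 \<le> a" "a \<le> t" and l: "\<And>s. a < s ==> s < t ==> l s = k"
    and int: "set_integrable lborel {0..<a} (\<lambda>s. E (a - s) (l s))"
    and lm: "l \<in> borel_measurable borel"
  shows "conv l t = S (t - a) (conv l a) + B (t - a) k"
    and "set_integrable lborel {0..<t} (\<lambda>s. E (t - s) (l s))"
proof -
  let ?f1 = "\<lambda>s. S (t - a) (indicator {0..<a} s *\<^sub>R E (a - s) (l s))"
  let ?f2 = "\<lambda>s. indicator {0<..t - a} (t - s) *\<^sub>R E (t - s) k"
  have i1: "integrable lborel ?f1"
    using int by (intro integrable_bounded_linear[OF blinfun.bounded_linear_right]) (simp add: set_integrable_def)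
  have i0: "integrable lborel (\<lambda>s. indicator {0<..t - a} s *\<^sub>R E s k)"
    using B_integrable[of "t - a" k] a by (simp add: set_integrable_def)
  have i2: "integrable lborel ?f2"
    using lborel_integrable_real_affine[OF i0, of "-1" t] by simp
  have e2: "integral\<^sup>L lborel ?f2 = B (t - a) k"
    using lborel_integral_real_affine[of "-1" "\<lambda>s. indicator {0<..t - a} s *\<^sub>R E s k" t]
    by (simp add: B_def set_lebesgue_integral_def)
  have e1: "integral\<^sup>L lborel ?f1 = S (t - a) (conv l a)"
    unfolding conv_def set_lebesgue_integral_def
    using int by (intro integral_bounded_linear[OF blinfun.bounded_linear_right]) (simp add: set_integrable_def)
  have ae: "AE s in lborel. indicator {0..<t} s *\<^sub>R E (t - s) (l s) = ?f1 s + ?f2 s"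
    using AE_lborel_singleton[of a]
  proof eventually_elim
    case (elim s)
    consider "s < 0" | "0 \<le> s" "s < a" | "a < s" "s < t" | "t \<le> s" "a < s" using elim by linarith
    then show ?case
    proof cases
      case 2
      have "E (t - s) (l s) = S (t - a) (E (a - s) (l s))"
        using E_add[of "t - a" "a - s" "l s"] 2 a by simp
      then show ?thesis using 2 a by (simp add: indicator_def)
    next
      case 3
      then show ?thesis using l a by (simp add: indicator_def blinfun.zero_right)
    qed (use a in "auto simp: indicator_def blinfun.zero_right")
  qed
  have m: "(\<lambda>s. indicator {0..<t} s *\<^sub>R E (t - s) (l s)) \<in> borel_measurable lborel"
    using conv_integrand_measurable[OF lm] by simp
  have i12: "integrable lborel (\<lambda>s. ?f1 s + ?f2 s)" using i1 i2 by (rule Bochner_Integration.integrable_add)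
  have "conv l t = integral\<^sup>L lborel (\<lambda>s. ?f1 s + ?f2 s)"
    unfolding conv_def set_lebesgue_integral_def
    by (rule integral_cong_AE[OF m _ ae]) (rule borel_measurable_integrable[OF i12])
  also have "... = S (t - a) (conv l a) + B (t - a) k"
    using Bochner_Integration.integral_add[OF i1 i2] by (simp only: e1 e2)
  finally show "conv l t = S (t - a) (conv l a) + B (t - a) k" .
  show "set_integrable lborel {0..<t} (\<lambda>s. E (t - s) (l s))"
    unfolding set_integrable_def
    by (subst integrable_cong_AE[OF m _ ae]) (use i12 borel_measurable_integrable[OF i12] in auto)
qed

lemma conv_const: "0 \<le> t ==> conv (\<lambda>_. k) t = B t k"
proof -
  assume t: "0 \<le> t"
  have "conv (\<lambda>_. k) t = S (t - 0) (conv (\<lambda>_. k) 0) + B (t - 0) k"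
    by (rule conv_cell(1)) (use t in "auto simp: set_integrable_def")
  moreover have "conv (\<lambda>_. k) 0 = 0" by (simp add: conv_def set_lebesgue_integral_def)
  ultimately show ?thesis by (simp add: blinfun.zero_right)
qed

lemma B_add: "0 \<le> r ==> 0 \<le> h ==> B (r + h) k = S h (B r k) + B h k"
proof -
  assume rh: "0 \<le> r" "0 \<le> h"
  have "set_integrable lborel {0..<r} (\<lambda>s. E (r - s) k)"
    using conv_cell(2)[of 0 r "\<lambda>_. k" k] rh by (auto simp: set_integrable_def)
  then have "conv (\<lambda>_. k) (r + h) = S (r + h - r) (conv (\<lambda>_. k) r) + B (r + h - r) k"
    using rh by (intro conv_cell(1)) auto
  then show ?thesis using rh by (simp add: conv_const)
qed

text \<open>Hoelder's inequality, used through Young's: since \<open>\<beta> q < 1\<close> for the conjugate exponent \<open>q\<close> of \<open>p\<close>,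
  the singularity of \<open>E\<close> contributes uniformly little near the upper limit.\<close>

lemma conv_young:
  assumes p: "1 / (1 - \<beta>) < p" and l: "l \<in> borel_measurable borel" and T: "T \<ge> 0"
    and P: "(\<integral>\<^sup>+ s\<in>{0..T}. ennreal (norm (l s) powr p) \<partial>lborel) \<le> ennreal P" "P \<ge> 0" and \<epsilon>: "\<epsilon> > 0"
  obtains K \<kappa> where "K \<ge> 0" "\<kappa> > 0" "\<And>t d. 0 \<le> t ==> t \<le> T ==> 0 \<le> d ==>
     (L1 lborel (\<lambda>s. indicator ({0..<t} \<inter> {t - d..<t}) s *\<^sub>R E (t - s) (l s))) \<le> ennreal (\<epsilon> + K * d powr \<kappa>)"
proof -
  have p1: "p > 1" using p \<beta> by (smt (verit) le_divide_eq_1_pos)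
  define q where "q = p / (p - 1)"
  have q: "q > 1" "1 / p + 1 / q = 1" using p1 by (auto simp: q_def field_simps)
  have "1 < p * (1 - \<beta>)" using p \<beta> by (simp add: divide_less_eq)
  then have bq: "\<beta> * q < 1" using p1 by (simp add: q_def field_simps)
  obtain c where c: "c > 0" "\<And>s k. 0 < s ==> s \<le> T ==> norm (E s k) \<le> c * s powr (- \<beta>) * norm k" using E_bound by blast
  define \<eta> where "\<eta> = \<epsilon> / (c * (P + 1))"
  have \<eta>: "\<eta> > 0" using \<epsilon> c P by (simp add: \<eta>_def)
  have \<eta>P: "c * \<eta> * P \<le> \<epsilon>"
  proof -
    have "c * \<eta> = \<epsilon> / (P + 1)" using c P by (simp add: \<eta>_def)
    then have "c * \<eta> * P = \<epsilon> * (P / (P + 1))" by simp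
    also have "... \<le> \<epsilon> * 1" using \<epsilon> P by (intro mult_left_mono) auto
    finally show ?thesis by simp
  qed
  obtain K where K: "K \<ge> 0" "\<And>a b. 0 \<le> a ==> 0 \<le> b ==> a * b \<le> \<eta> * a powr p + K * b powr q"
    using youngs_inequality_eps[OF p1 q \<eta>] by blast
  define g where "g = \<beta> * q"
  have g: "g < 1" using bq by (simp add: g_def)
  have bound: "L1 lborel (\<lambda>s. indicator ({0..<t} \<inter> {t - d..<t}) s *\<^sub>R E (t - s) (l s)) \<le> ennreal (\<epsilon> + c * K / (1 - g) * d powr (1 - g))"
    if t: "0 \<le> t" "t \<le> T" and d: "0 \<le> d" for t d
  proof -
    have pw: "ennreal (norm (indicator ({0..<t} \<inter> {t - d..<t}) s *\<^sub>R E (t - s) (l s))) \<le>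
       ennreal (c * \<eta>) * (ennreal (norm (l s) powr p) * indicator {0..T} s) + ennreal (c * K) * (ennreal ((t - s) powr (- g)) * indicator {t - d..<t} s)" for s
    proof (cases "s \<in> {0..<t} \<inter> {t - d..<t}")
      case True
      then have s: "0 \<le> s" "s < t" "t - d \<le> s" by auto
      have "norm (E (t - s) (l s)) \<le> c * ((t - s) powr (- \<beta>) * norm (l s))"
        using c(2)[of "t - s" "l s"] s t by (simp add: mult.assoc)
      also have "... \<le> c * (\<eta> * norm (l s) powr p + K * ((t - s) powr (- \<beta>)) powr q)"
        using K(2)[of "norm (l s)" "(t - s) powr (- \<beta>)"] c by (intro mult_left_mono) (auto simp: mult.commute)
      also have "((t - s) powr (- \<beta>)) powr q = (t - s) powr (- g)" by (simp add: powr_powr g_def)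
      finally have "norm (E (t - s) (l s)) \<le> c * \<eta> * norm (l s) powr p + c * K * (t - s) powr (- g)"
        by (simp add: algebra_simps)
      then have "ennreal (norm (E (t - s) (l s))) \<le> ennreal (c * \<eta>) * ennreal (norm (l s) powr p) + ennreal (c * K) * ennreal ((t - s) powr (- g))"
        using c \<eta> K by (simp add: ennreal_mult[symmetric] ennreal_plus[symmetric] ennreal_leI del: ennreal_plus)
      then show ?thesis using s t True by simp
    qed simp
    have m1: "(\<lambda>s. ennreal (norm (l s) powr p) * indicator {0..T} s) \<in> borel_measurable lborel" using l by measurable
    have m2: "(\<lambda>s. ennreal ((t - s) powr (- g)) * indicator {t - d..<t} s) \<in> borel_measurable lborel" by measurable
    have "L1 lborel (\<lambda>s. indicator ({0..<t} \<inter> {t - d..<t}) s *\<^sub>R E (t - s) (l s)) \<le>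
       ennreal (c * \<eta>) * (\<integral>\<^sup>+ s. ennreal (norm (l s) powr p) * indicator {0..T} s \<partial>lborel) +
       ennreal (c * K) * (\<integral>\<^sup>+ s. ennreal ((t - s) powr (- g)) * indicator {t - d..<t} s \<partial>lborel)"
    proof -
      have "L1 lborel (\<lambda>s. indicator ({0..<t} \<inter> {t - d..<t}) s *\<^sub>R E (t - s) (l s)) \<le>
        (\<integral>\<^sup>+ s. ennreal (c * \<eta>) * (ennreal (norm (l s) powr p) * indicator {0..T} s) + ennreal (c * K) * (ennreal ((t - s) powr (- g)) * indicator {t - d..<t} s) \<partial>lborel)"
        by (intro nn_integral_mono pw)
      also have "... = (\<integral>\<^sup>+ s. ennreal (c * \<eta>) * (ennreal (norm (l s) powr p) * indicator {0..T} s) \<partial>lborel) + (\<integral>\<^sup>+ s. ennreal (c * K) * (ennreal ((t - s) powr (- g)) * indicator {t - d..<t} s) \<partial>lborel)"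
        by (rule nn_integral_add) (intro borel_measurable_times_ennreal borel_measurable_const m1 m2)+
      finally show ?thesis unfolding nn_integral_cmult[OF m1] nn_integral_cmult[OF m2] .
    qed
    also have "... \<le> ennreal (c * \<eta>) * ennreal P + ennreal (c * K) * ennreal (d powr (1 - g) / (1 - g))"
      using P(1) nn_integral_powr_singular_reflected[OF g d, of t] by (intro add_mono mult_left_mono) auto
    also have "... = ennreal (c * \<eta> * P + c * K / (1 - g) * d powr (1 - g))"
      using c \<eta> K P g by (simp add: ennreal_mult[symmetric] ennreal_plus[symmetric] del: ennreal_plus)
    also have "... \<le> ennreal (\<epsilon> + c * K / (1 - g) * d powr (1 - g))"
      using \<eta>P by (intro ennreal_leI) simp
    finally show ?thesis .
  qed
  show ?thesis using c K g by (intro that[of "c * K / (1 - g)" "1 - g", OF _ _ bound]) auto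
qed

lemma conv_set_integrable:
  assumes p: "1 / (1 - \<beta>) < p" and l: "l \<in> borel_measurable borel"
    and P: "(\<integral>\<^sup>+ s\<in>{0..T}. ennreal (norm (l s) powr p) \<partial>lborel) < \<infinity>" and t: "0 \<le> t" "t \<le> T"
  shows "set_integrable lborel {0..<t} (\<lambda>s. E (t - s) (l s))"
  unfolding set_integrable_def
proof (rule integrableI_bounded)
  show "(\<lambda>s. indicator {0..<t} s *\<^sub>R E (t - s) (l s)) \<in> borel_measurable lborel"
    using conv_integrand_measurable[OF l] by simp
  obtain P' where P': "(\<integral>\<^sup>+ s\<in>{0..T}. ennreal (norm (l s) powr p) \<partial>lborel) = ennreal P'" "P' \<ge> 0"
    using P by (cases "(\<integral>\<^sup>+ s\<in>{0..T}. ennreal (norm (l s) powr p) \<partial>lborel)") auto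
  obtain K \<kappa> where K: "K \<ge> 0" "\<kappa> > 0" "\<And>t d. 0 \<le> t ==> t \<le> T ==> 0 \<le> d ==>
     (L1 lborel (\<lambda>s. indicator ({0..<t} \<inter> {t - d..<t}) s *\<^sub>R E (t - s) (l s))) \<le> ennreal (1 + K * d powr \<kappa>)"
    using conv_young[OF p l _ eq_refl[OF P'(1)] P'(2), of 1] t by auto
  have "{0..<t} \<inter> {t - t..<t} = {0..<t}" by auto
  then show "L1 lborel (\<lambda>s. indicator {0..<t} s *\<^sub>R E (t - s) (l s)) < \<infinity>"
    using K(3)[OF t t(1)] by (auto intro: order_le_less_trans)
qed

text \<open>The integral without its last piece of length \<open>d\<close> is continuous, because there the kernel is bounded;
  by the previous estimates it converges uniformly as \<open>d \<rightarrow> 0\<close>.\<close>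

lemma conv_continuous:
  assumes p: "1 / (1 - \<beta>) < p" and l: "l \<in> borel_measurable borel"
    and P: "(\<integral>\<^sup>+ s\<in>{0..T}. ennreal (norm (l s) powr p) \<partial>lborel) < \<infinity>" and T: "T \<ge> 0"
  shows "continuous_on {0..T} (conv l)"
proof -
  have p1: "p > 1" using p \<beta> by (smt (verit) le_divide_eq_1_pos)
  obtain P' where P': "(\<integral>\<^sup>+ s\<in>{0..T}. ennreal (norm (l s) powr p) \<partial>lborel) = ennreal P'" "P' \<ge> 0"
    using P by (cases "(\<integral>\<^sup>+ s\<in>{0..T}. ennreal (norm (l s) powr p) \<partial>lborel)") auto
  obtain c where c: "c > 0" "\<And>s k. 0 < s ==> s \<le> T ==> norm (E s k) \<le> c * s powr (- \<beta>) * norm k" using E_bound by blast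
  define J where "J d t = (LINT s|lborel. indicator {0..t - d} s *\<^sub>R E (t - s) (l s))" for d t
  have li: "integrable lborel (\<lambda>s. indicator {0..T} s *\<^sub>R norm (l s))"
  proof (rule integrableI_bounded)
    show "(\<lambda>s. indicator {0..T} s *\<^sub>R norm (l s)) \<in> borel_measurable lborel" using l by measurable
    have "L1 lborel (\<lambda>s. indicator {0..T} s *\<^sub>R norm (l s)) = (\<integral>\<^sup>+ s\<in>{0..T}. ennreal (norm (l s)) \<partial>lborel)"
      by (intro nn_integral_cong) (auto simp: indicator_def)
    also note L1_le_powr[OF p1 l T]
    also have "ennreal T + (\<integral>\<^sup>+ s\<in>{0..T}. ennreal (norm (l s) powr p) \<partial>lborel) < \<infinity>" using P by simp
    finally show "L1 lborel (\<lambda>s. indicator {0..T} s *\<^sub>R norm (l s)) < \<infinity>" .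
  qed
  have Jm: "(\<lambda>s. indicator {0..t - d} s *\<^sub>R E (t - s) (l s)) \<in> borel_measurable lborel" if "d > 0" for t d
  proof -
    have eq: "(\<lambda>s. indicator {0..t - d} s *\<^sub>R E (t - s) (l s)) = (\<lambda>s. indicator {0..t - d} s *\<^sub>R E0 (t - s) (l s))"
      using that by (auto simp: E0_def indicator_def)
    show ?thesis unfolding eq using l by measurable
  qed
  have Jbd: "norm (indicator {0..t - d} s *\<^sub>R E (t - s) (l s)) \<le> c * d powr (- \<beta>) * (indicator {0..T} s *\<^sub>R norm (l s))"
    if "d > 0" "t \<le> T" for d t s
  proof (cases "s \<in> {0..t - d}")
    case True
    have "norm (E (t - s) (l s)) \<le> c * (t - s) powr (- \<beta>) * norm (l s)" using c(2)[of "t - s" "l s"] True that by simp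
    also have "... \<le> c * d powr (- \<beta>) * norm (l s)"
      using True that c \<beta> by (intro mult_right_mono mult_left_mono powr_mono2') auto
    finally show ?thesis using True that by simp
  qed (use c in simp)
  have Jint: "integrable lborel (\<lambda>s. indicator {0..t - d} s *\<^sub>R E (t - s) (l s))" if "d > 0" "t \<le> T" for d t
    by (rule Bochner_Integration.integrable_bound[OF integrable_mult_right[OF li, of "c * d powr (- \<beta>)"] Jm[OF that(1)]])
      (use Jbd[OF that] in "auto intro!: AE_I2 intro: order_trans[OF _ abs_ge_self]")
  have Jcont: "continuous_on {0..T} (J d)" if d: "d > 0" for d
    unfolding continuous_on_sequentially
  proof (intro allI ballI impI, elim conjE)
    fix x t assume t: "t \<in> {0..T}" and x: "\<forall>n::nat. x n \<in> {0..T}" "x \<longlonglongrightarrow> t"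
    show "(J d \<circ> x) \<longlonglongrightarrow> J d t"
      unfolding J_def comp_def
    proof (rule integral_dominated_convergence[where w="\<lambda>s. c * d powr (- \<beta>) * (indicator {0..T} s *\<^sub>R norm (l s))"])
      show "AE s in lborel. (\<lambda>n. indicator {0..x n - d} s *\<^sub>R E (x n - s) (l s)) \<longlonglongrightarrow> indicator {0..t - d} s *\<^sub>R E (t - s) (l s)"
        using AE_lborel_singleton[of "t - d"]
      proof eventually_elim
        case (elim s)
        show ?case
        proof (cases "s < t - d")
          case True
          then have "eventually (\<lambda>n. s + d < x n) sequentially" using x(2) by (intro order_tendstoD) auto
          then have e: "eventually (\<lambda>n. indicator {0..x n - d} s *\<^sub>R E (x n - s) (l s) = indicator {0..t - d} s *\<^sub>R E (x n - s) (l s)) sequentially"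
            by eventually_elim (use True in "auto simp: indicator_def")
          have "(\<lambda>n. indicator {0..t - d} s *\<^sub>R E (x n - s) (l s)) \<longlonglongrightarrow> indicator {0..t - d} s *\<^sub>R E (t - s) (l s)"
            by (intro tendsto_intros E_tendsto x) (use True d in simp)
          then show ?thesis using tendsto_cong[OF e] by simp
        next
          case False
          then have "t < s + d" using elim by simp
          then have "eventually (\<lambda>n. x n < s + d) sequentially" using x(2) by (intro order_tendstoD) auto
          then have "eventually (\<lambda>n. indicator {0..x n - d} s *\<^sub>R E (x n - s) (l s) = indicator {0..t - d} s *\<^sub>R E (t - s) (l s)) sequentially"
            by eventually_elim (use False elim in "auto simp: indicator_def")
          then show ?thesis by (rule tendsto_eventually)
        qed
      qed
    qed (use Jm[OF d] Jbd[OF d] x li in auto)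
  qed
  have "uniform_limit {0..T} (\<lambda>n. J (1 / real (Suc n))) (conv l) sequentially"
  proof (rule uniform_limitI)
    fix e :: real assume "e > 0"
    then have "e / 4 > 0" by simp
    then obtain K \<kappa> where K: "K \<ge> 0" "\<kappa> > 0" "\<And>t d. 0 \<le> t ==> t \<le> T ==> 0 \<le> d ==>
     (L1 lborel (\<lambda>s. indicator ({0..<t} \<inter> {t - d..<t}) s *\<^sub>R E (t - s) (l s))) \<le> ennreal (e / 4 + K * d powr \<kappa>)"
      using conv_young[OF p l T eq_refl[OF P'(1)] P'(2)] by blast
    have "(\<lambda>n. inverse (real (Suc n)) powr \<kappa>) \<longlonglongrightarrow> 0"
      by (rule tendsto_zero_powrI[OF LIMSEQ_inverse_real_of_nat tendsto_const]) (use K in auto)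
    then have "(\<lambda>n. K * (1 / real (Suc n)) powr \<kappa>) \<longlonglongrightarrow> K * 0" by (intro tendsto_intros) (simp add: inverse_eq_divide)
    then have "eventually (\<lambda>n. K * (1 / real (Suc n)) powr \<kappa> < e / 4) sequentially" using \<open>e > 0\<close> by (intro order_tendstoD) auto
    then show "eventually (\<lambda>n. \<forall>t\<in>{0..T}. dist (J (1 / real (Suc n)) t) (conv l t) < e) sequentially"
    proof eventually_elim
      case (elim n)
      define d where "d = 1 / real (Suc n)"
      have d: "d > 0" by (simp add: d_def)
      show ?case
      proof
        fix t assume "t \<in> {0..T}"
        then have t: "0 \<le> t" "t \<le> T" by auto
        have i: "integrable lborel (\<lambda>s. indicator {0..<t} s *\<^sub>R E (t - s) (l s))"
          using conv_set_integrable[OF p l P t] by (simp add: set_integrable_def)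
        have "conv l t - J d t = (LINT s|lborel. indicator {0..<t} s *\<^sub>R E (t - s) (l s) - indicator {0..t - d} s *\<^sub>R E (t - s) (l s))"
          unfolding conv_def J_def set_lebesgue_integral_def
          by (rule Bochner_Integration.integral_diff[OF i Jint[OF d t(2)], symmetric])
        then have "ennreal (norm (conv l t - J d t)) \<le> L1 lborel (\<lambda>s. indicator {0..<t} s *\<^sub>R E (t - s) (l s) - indicator {0..t - d} s *\<^sub>R E (t - s) (l s))"
          using integral_norm_bound_ennreal[OF Bochner_Integration.integrable_diff[OF i Jint[OF d t(2)]]] by simp
        also have "... \<le> L1 lborel (\<lambda>s. indicator ({0..<t} \<inter> {t - d..<t}) s *\<^sub>R E (t - s) (l s))"
          using d by (intro nn_integral_mono ennreal_leI) (auto simp: indicator_def)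
        also have "... \<le> ennreal (e / 4 + K * d powr \<kappa>)" using K(3)[OF t] d by simp
        also have "... \<le> ennreal (e / 2)" using elim by (intro ennreal_leI) (simp add: d_def)
        finally have "norm (conv l t - J d t) \<le> e / 2" using \<open>e > 0\<close> by (subst (asm) ennreal_le_iff) auto
        then show "dist (J (1 / real (Suc n)) t) (conv l t) < e" using \<open>e > 0\<close> by (simp add: d_def dist_norm norm_minus_commute)
      qed
    qed
  qed
  then show ?thesis by (rule uniform_limit_theorem[rotated]) (use Jcont in auto)
qed

lemma conv_measurable_param:
  assumes f: "f \<in> borel_measurable N'" and l: "(\<lambda>p. l (fst p) (snd p)) \<in> borel_measurable (N' \<Otimes>\<^sub>M borel)"
  shows "(\<lambda>x. conv (l x) (f x)) \<in> borel_measurable N'"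
proof -
  have [measurable]: "f \<in> borel_measurable N'" "(\<lambda>p. l (fst p) (snd p)) \<in> borel_measurable (N' \<Otimes>\<^sub>M borel)" by fact+
  have "(\<lambda>p. (if 0 \<le> snd p \<and> snd p < f (fst p) then 1 else 0) *\<^sub>R E0 (f (fst p) - snd p) (l (fst p) (snd p))) \<in> borel_measurable (N' \<Otimes>\<^sub>M borel)"
    by measurable
  then have "(\<lambda>p. (if 0 \<le> snd p \<and> snd p < f (fst p) then 1 else 0) *\<^sub>R E0 (f (fst p) - snd p) (l (fst p) (snd p))) \<in> borel_measurable (N' \<Otimes>\<^sub>M lborel)"
    by (simp cong: measurable_cong_sets sets_pair_measure_cong)
  then have "(\<lambda>x. LINT s|lborel. (if 0 \<le> s \<and> s < f x then 1 else 0) *\<^sub>R E0 (f x - s) (l x s)) \<in> borel_measurable N'"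
    by (intro sigma_finite_measure.borel_measurable_lebesgue_integral[OF sigma_finite_lborel]) (simp add: case_prod_unfold)
  moreover have "conv (l x) (f x) = (LINT s|lborel. (if 0 \<le> s \<and> s < f x then 1 else 0) *\<^sub>R E0 (f x - s) (l x s))" for x
    unfolding conv_def set_lebesgue_integral_def conv_E0
    by (intro Bochner_Integration.integral_cong refl) (auto simp: indicator_def)
  ultimately show ?thesis by simp
qed

lemma norm_conv_le: "ennreal (norm (conv l t)) \<le> L1 lborel (\<lambda>s. indicator {0..<t} s *\<^sub>R E (t - s) (l s))"
proof (cases "integrable lborel (\<lambda>s. indicator {0..<t} s *\<^sub>R E (t - s) (l s))")
  case True
  then show ?thesis unfolding conv_def set_lebesgue_integral_def by (rule integral_norm_bound_ennreal)
next
  case False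
  then show ?thesis by (simp add: conv_def set_lebesgue_integral_def not_integrable_integral_eq)
qed

text \<open>Young's convolution inequality in \<open>L\<^sup>1\<close>.\<close>

lemma conv_L1:
  assumes T: "T \<ge> 0"
  obtains C where "C > 0" "\<And>l. l \<in> borel_measurable borel ==>
     (L1 (Leb T) (conv l)) \<le> ennreal C * (L1 (Leb T) l)"
proof -
  obtain c where c: "c > 0" "\<And>s k. 0 < s ==> s \<le> T ==> norm (E s k) \<le> c * s powr (- \<beta>) * norm k" using E_bound by blast
  define C where "C = c * (T powr (1 - \<beta>) / (1 - \<beta>))"
  have bnd: "L1 (Leb T) (conv l) \<le> ennreal C * (L1 (Leb T) l)"
    if l[measurable]: "l \<in> borel_measurable borel" for l
  proof -
    let ?k = "\<lambda>t s. ennreal c * (ennreal ((t - s) powr (- \<beta>)) * indicator {0<..T} (t - s))"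
    let ?l = "\<lambda>s. ennreal (norm (l s)) * indicator {0<..T} s"
    have "L1 (Leb T) (conv l) \<le> (\<integral>\<^sup>+ t. \<integral>\<^sup>+ s. ?k t s * ?l s \<partial>lborel \<partial>lborel)"
      unfolding nn_integral_Leb
    proof (intro nn_integral_mono)
      fix t
      show "ennreal (norm (conv l t)) * indicator {0<..T} t \<le> (\<integral>\<^sup>+ s. ?k t s * ?l s \<partial>lborel)"
      proof (cases "t \<in> {0<..T}")
        case True
        have "ennreal (norm (conv l t)) \<le> L1 lborel (\<lambda>s. indicator {0..<t} s *\<^sub>R E (t - s) (l s))"
          by (rule norm_conv_le)
        also have "... \<le> (\<integral>\<^sup>+ s. ?k t s * ?l s \<partial>lborel)"
        proof (rule nn_integral_mono_AE, use AE_lborel_singleton[of 0] in eventually_elim)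
          case (elim s)
          show ?case
          proof (cases "0 < s \<and> s < t")
            case s: True
            have "norm (E (t - s) (l s)) \<le> c * (t - s) powr (- \<beta>) * norm (l s)" using c(2)[of "t - s" "l s"] s True by simp
            then have "ennreal (norm (E (t - s) (l s))) \<le> ennreal c * ennreal ((t - s) powr (- \<beta>)) * ennreal (norm (l s))"
              using c by (simp add: ennreal_mult[symmetric] ennreal_leI)
            then show ?thesis using s True by (simp add: indicator_def)
          next
            case False
            then show ?thesis using elim by (auto simp: indicator_def)
          qed
        qed
        finally show ?thesis using True by simp
      qed simp
    qed
    also have "... = (\<integral>\<^sup>+ s. \<integral>\<^sup>+ t. ?k t s * ?l s \<partial>lborel \<partial>lborel)"
      by (rule lborel_pair.Fubini'[symmetric]) simp
    also have "... = (\<integral>\<^sup>+ s. ennreal C * ?l s \<partial>lborel)"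
    proof (intro nn_integral_cong)
      fix s
      have "(\<integral>\<^sup>+ t. ?k t s * ?l s \<partial>lborel) = (\<integral>\<^sup>+ t. ?k t s \<partial>lborel) * ?l s"
        by (rule nn_integral_multc) measurable
      also have "(\<integral>\<^sup>+ t. ?k t s \<partial>lborel) = ennreal c * (\<integral>\<^sup>+ t. ennreal ((t - s) powr (- \<beta>)) * indicator {0<..T} (t - s) \<partial>lborel)"
        by (rule nn_integral_cmult) measurable
      also have "(\<integral>\<^sup>+ t. ennreal ((t - s) powr (- \<beta>)) * indicator {0<..T} (t - s) \<partial>lborel) = (\<integral>\<^sup>+ t. ennreal (t powr (- \<beta>)) * indicator {0<..T} t \<partial>lborel)"
        using nn_integral_real_affine[of "\<lambda>t. ennreal (t powr (- \<beta>)) * indicator {0<..T} t" 1 "- s"] by simp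
      also have "... = ennreal (T powr (1 - \<beta>) / (1 - \<beta>))" by (rule nn_integral_powr_singular[OF \<beta>(2) T])
      also have "ennreal c * ... = ennreal C" using c \<beta> by (simp add: C_def ennreal_mult[symmetric])
      finally show "(\<integral>\<^sup>+ t. ?k t s * ?l s \<partial>lborel) = ennreal C * ?l s" .
    qed
    also have "... = ennreal C * (L1 (Leb T) l)"
      unfolding nn_integral_Leb by (rule nn_integral_cmult) measurable
    finally show ?thesis .
  qed
  have "L1 (Leb T) (conv l) \<le> ennreal (C + 1) * (L1 (Leb T) l)"
    if "l \<in> borel_measurable borel" for l
    by (rule order_trans[OF bnd[OF that]]) (intro mult_right_mono ennreal_leI; simp)
  moreover have "C + 1 > 0" using c \<beta> by (simp add: C_def add_nonneg_pos)
  ultimately show ?thesis using that by blast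
qed

end

section \<open>Locally uniform difference quotients\<close>

text \<open>Continuous convergence of \<open>Q h\<close> to \<open>g\<close> as \<open>h\<close> decreases to \<open>0\<close>.\<close>

definition loc_unif :: "(real => 'a::metric_space => 'b::metric_space) => ('a => 'b) => bool" where
  "loc_unif Q g \<longleftrightarrow> (\<forall>y. \<forall>\<epsilon>>0. \<exists>\<delta>>0. \<forall>h y'. 0 < h \<and> h < \<delta> \<and> dist y' y < \<delta> --> dist (Q h y') (g y) < \<epsilon>)"

lemma loc_unifI_sequential:
  assumes "\<And>h y y0. (\<And>n::nat. 0 < h n) ==> h \<longlonglongrightarrow> 0 ==> y \<longlonglongrightarrow> y0 ==> (\<And>n. h (Suc n) < h n) ==> (\<lambda>n. Q (h n) (y n)) \<longlonglongrightarrow> g y0"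
  shows "loc_unif Q g"
  unfolding loc_unif_def
proof (intro allI impI, rule ccontr)
  fix y0 and \<epsilon> :: real assume "\<epsilon> > 0"
  assume neg: "\<not> (\<exists>\<delta>>0. \<forall>h y'. 0 < h \<and> h < \<delta> \<and> dist y' y0 < \<delta> --> dist (Q h y') (g y0) < \<epsilon>)"
  then have ex: "\<exists>p. 0 < fst p \<and> fst p < \<delta> \<and> dist (snd p) y0 < \<delta> \<and> \<not> dist (Q (fst p) (snd p)) (g y0) < \<epsilon>" if "\<delta> > 0" for \<delta>
    using that by force
  have "\<exists>p. \<forall>n. (0 < fst (p n) \<and> fst (p n) < 1 / real (Suc n) \<and> dist (snd (p n)) y0 < 1 / real (Suc n) \<and>
      \<not> dist (Q (fst (p n)) (snd (p n))) (g y0) < \<epsilon>) \<and> fst (p (Suc n)) < fst (p n)"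
  proof (rule dependent_nat_choice)
    show "\<exists>p. 0 < fst p \<and> fst p < 1 / real (Suc 0) \<and> dist (snd p) y0 < 1 / real (Suc 0) \<and> \<not> dist (Q (fst p) (snd p)) (g y0) < \<epsilon>"
      using ex[of 1] by simp
    fix p n assume p: "0 < fst p \<and> fst p < 1 / real (Suc n) \<and> dist (snd p) y0 < 1 / real (Suc n) \<and> \<not> dist (Q (fst p) (snd p)) (g y0) < \<epsilon>"
    have "0 < min (1 / real (Suc (Suc n))) (fst p)" using p by simp
    from ex[OF this] obtain q where "0 < fst q" "fst q < min (1 / real (Suc (Suc n))) (fst p)"
      "dist (snd q) y0 < min (1 / real (Suc (Suc n))) (fst p)" "\<not> dist (Q (fst q) (snd q)) (g y0) < \<epsilon>" by blast
    then show "\<exists>q. (0 < fst q \<and> fst q < 1 / real (Suc (Suc n)) \<and> dist (snd q) y0 < 1 / real (Suc (Suc n)) \<and>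
       \<not> dist (Q (fst q) (snd q)) (g y0) < \<epsilon>) \<and> fst q < fst p" by (intro exI[of _ q]) simp
  qed
  then obtain p where p: "\<And>n. 0 < fst (p n)" "\<And>n. fst (p n) < 1 / real (Suc n)" "\<And>n. dist (snd (p n)) y0 < 1 / real (Suc n)"
    "\<And>n. \<not> dist (Q (fst (p n)) (snd (p n))) (g y0) < \<epsilon>" "\<And>n::nat. fst (p (Suc n)) < fst (p n)" by blast
  have inv: "(\<lambda>n. 1 / real (Suc n)) \<longlonglongrightarrow> 0" using LIMSEQ_inverse_real_of_nat by (simp add: inverse_eq_divide)
  have h0: "(\<lambda>n. fst (p n)) \<longlonglongrightarrow> 0"
    by (rule tendsto_sandwich[OF _ _ tendsto_const inv]) (use p in "auto intro!: always_eventually less_imp_le")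
  have "(\<lambda>n. dist (snd (p n)) y0) \<longlonglongrightarrow> 0"
    by (rule tendsto_sandwich[OF _ _ tendsto_const inv]) (use p in "auto intro!: always_eventually less_imp_le")
  then have "(\<lambda>n. snd (p n)) \<longlonglongrightarrow> y0" by (simp add: tendsto_dist_iff[symmetric])
  from assms[OF p(1) h0 this p(5)] have "(\<lambda>n. Q (fst (p n)) (snd (p n))) \<longlonglongrightarrow> g y0" .
  then have "eventually (\<lambda>n. dist (Q (fst (p n)) (snd (p n))) (g y0) < \<epsilon>) sequentially" using \<open>\<epsilon> > 0\<close> by (rule tendstoD)
  then show False using p(4) by (auto simp: eventually_sequentially)
qed

lemma loc_unif_tendsto:
  assumes Q: "loc_unif Q g" and h: "\<And>n::nat. 0 < h n" "h \<longlonglongrightarrow> 0" and y: "y \<longlonglongrightarrow> y0"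
  shows "(\<lambda>n. Q (h n) (y n)) \<longlonglongrightarrow> g y0"
proof (rule tendstoI)
  fix \<epsilon> :: real assume "\<epsilon> > 0"
  then obtain \<delta> where \<delta>: "\<delta> > 0" "\<And>h y'. 0 < h ==> h < \<delta> ==> dist y' y0 < \<delta> ==> dist (Q h y') (g y0) < \<epsilon>"
    using Q unfolding loc_unif_def by meson
  have "eventually (\<lambda>n. h n < \<delta>) sequentially" using order_tendstoD(2)[OF h(2) \<delta>(1)] .
  moreover have "eventually (\<lambda>n. dist (y n) y0 < \<delta>) sequentially" using tendstoD[OF y \<delta>(1)] .
  ultimately show "eventually (\<lambda>n. dist (Q (h n) (y n)) (g y0) < \<epsilon>) sequentially"
    by eventually_elim (use \<delta>(2) h(1) in auto)
qed

text \<open>Continuous convergence is uniform along a compact piece of path.  The shift \<open>p h\<close> is there because the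
  difference quotient is taken at the end point minus the drift increment.\<close>

lemma loc_unif_grid:
  fixes y :: "real => 'a::real_normed_vector" and g :: "'a => 'b::metric_space"
  assumes Q: "loc_unif Q g" and g: "continuous_on UNIV g" and y: "continuous_on {a..b} y"
    and p: "(p \<longlongrightarrow> 0) (at_right 0)" and \<epsilon>: "\<epsilon> > 0"
  shows "\<exists>\<delta>>0. \<forall>h r s. 0 < h \<and> h < \<delta> \<and> r \<in> {a..b} \<and> s \<in> {a..b} \<and> \<bar>r - s\<bar> \<le> h --> dist (Q h (y r - p h)) (g (y s)) < \<epsilon>"
proof (rule ccontr)
  assume neg: "\<not> ?thesis"
  have "\<exists>h r s. 0 < h \<and> h < 1 / real (Suc n) \<and> r \<in> {a..b} \<and> s \<in> {a..b} \<and> \<bar>r - s\<bar> \<le> h \<and> \<not> dist (Q h (y r - p h)) (g (y s)) < \<epsilon>" for n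
  proof -
    have "1 / real (Suc n) > 0" by simp
    then show ?thesis using neg by blast
  qed
  then obtain h r s where *: "\<And>n. 0 < h n" "\<And>n. h n < 1 / real (Suc n)" "\<And>n. r n \<in> {a..b}" "\<And>n. s n \<in> {a..b}"
    "\<And>n. \<bar>r n - s n\<bar> \<le> h n" "\<And>n::nat. \<not> dist (Q (h n) (y (r n) - p (h n))) (g (y (s n))) < \<epsilon>" by metis
  have inv: "(\<lambda>n. 1 / real (Suc n)) \<longlonglongrightarrow> 0" using LIMSEQ_inverse_real_of_nat by (simp add: inverse_eq_divide)
  have h0: "h \<longlonglongrightarrow> 0"
    by (rule tendsto_sandwich[OF _ _ tendsto_const inv]) (use * in "auto intro!: always_eventually less_imp_le")
  obtain l f where l: "l \<in> {a..b}" "strict_mono f" "(s \<circ> f) \<longlonglongrightarrow> l"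
    using compact_Icc[of a b, unfolded compact_def] *(4) by blast
  have hf: "(\<lambda>n. h (f n)) \<longlonglongrightarrow> 0" using LIMSEQ_subseq_LIMSEQ[OF h0 l(2)] by (simp add: comp_def)
  have sf: "(\<lambda>n. s (f n)) \<longlonglongrightarrow> l" using l(3) by (simp add: comp_def)
  have "(\<lambda>n. r (f n) - s (f n)) \<longlonglongrightarrow> 0"
    by (rule Lim_null_comparison[OF always_eventually hf]) (use *(5) in auto)
  from tendsto_add[OF this sf] have rf: "(\<lambda>n. r (f n)) \<longlonglongrightarrow> l" by simp
  have yr: "(\<lambda>n. y (r (f n))) \<longlonglongrightarrow> y l"
    by (rule continuous_on_tendsto_compose[OF y rf l(1)]) (use * in auto)
  have ys: "(\<lambda>n. y (s (f n))) \<longlonglongrightarrow> y l"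
    by (rule continuous_on_tendsto_compose[OF y sf l(1)]) (use * in auto)
  have "filterlim (\<lambda>n. h (f n)) (at_right 0) sequentially"
    by (rule tendsto_imp_filterlim_at_right[OF hf]) (use * in auto)
  from filterlim_compose[OF p this] have "(\<lambda>n. p (h (f n))) \<longlonglongrightarrow> 0" .
  from tendsto_diff[OF yr this] have "(\<lambda>n. y (r (f n)) - p (h (f n))) \<longlonglongrightarrow> y l" by simp
  from loc_unif_tendsto[OF Q _ hf this] have A: "(\<lambda>n. Q (h (f n)) (y (r (f n)) - p (h (f n)))) \<longlonglongrightarrow> g (y l)" using * by simp
  have B: "(\<lambda>n. g (y (s (f n)))) \<longlonglongrightarrow> g (y l)"
    by (rule continuous_on_tendsto_compose[OF g ys]) auto
  from tendsto_dist[OF A B] have "(\<lambda>n. dist (Q (h (f n)) (y (r (f n)) - p (h (f n)))) (g (y (s (f n))))) \<longlonglongrightarrow> 0" by simp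
  then have "eventually (\<lambda>n. dist (Q (h (f n)) (y (r (f n)) - p (h (f n)))) (g (y (s (f n)))) < \<epsilon>) sequentially"
    using \<epsilon> by (rule order_tendstoD)
  then show False using *(6) by (auto simp: eventually_sequentially)
qed

lemma riemann_sum_bound:
  fixes G :: "real => real"
  assumes h: "h > 0" and G: "continuous_on {a..a + real n * h} G"
    and c: "\<And>i s. i < n ==> a + real i * h \<le> s ==> s \<le> a + real (Suc i) * h ==> \<bar>c i - G s\<bar> \<le> \<epsilon>"
  shows "\<bar>(\<Sum>i<n. h * c i) - integral {a..a + real n * h} G\<bar> \<le> \<epsilon> * (real n * h)"
  using G c
proof (induction n)
  case 0 then show ?case by simp
next
  case (Suc n)
  let ?m = "a + real n * h" and ?e = "a + real (Suc n) * h"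
  have le: "a \<le> ?m" "?m \<le> ?e" using h by (auto simp: algebra_simps)
  have c1: "continuous_on {a..?m} G" and c2: "continuous_on {?m..?e} G"
    using Suc.prems(1) le by (auto intro: continuous_on_subset)
  have IH: "\<bar>(\<Sum>i<n. h * c i) - integral {a..?m} G\<bar> \<le> \<epsilon> * (real n * h)"
    by (rule Suc.IH[OF c1]) (use Suc.prems(2) in auto)
  have split: "integral {a..?e} G = integral {a..?m} G + integral {?m..?e} G"
    by (rule Henstock_Kurzweil_Integration.integral_combine[symmetric])
      (use le Suc.prems(1) in "auto intro: integrable_continuous_real")
  have "\<bar>h * c n - integral {?m..?e} G\<bar> \<le> \<epsilon> * h"
  proof -
    have i: "G integrable_on {?m..?e}" using c2 by (rule integrable_continuous_real)
    have he: "?e - ?m = h" by (simp add: algebra_simps)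
    have "h * c n - integral {?m..?e} G = integral {?m..?e} (\<lambda>s. c n - G s)"
      using i le he by (subst Henstock_Kurzweil_Integration.integral_diff) (auto simp: mult.commute)
    also have "norm ... \<le> \<epsilon> * (?e - ?m)"
    proof (rule integral_bound[OF le(2)])
      show "continuous_on {?m..?e} (\<lambda>s. c n - G s)" by (intro continuous_intros c2)
    qed (use Suc.prems(2)[of n] in auto)
    finally show ?thesis using he by simp
  qed
  moreover have "\<epsilon> * (real (Suc n) * h) = \<epsilon> * (real n * h) + \<epsilon> * h" by (simp add: algebra_simps)
  ultimately show ?case unfolding split sum.lessThan_Suc using IH by linarith
qed

lemma closed_sequence_with_limit:
  fixes h :: "nat => real" assumes "h \<longlonglongrightarrow> l" shows "closed (insert l (range h))"
  using compact_sequence_with_limit[OF assms] by (rule compact_imp_closed)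

text \<open>A sequence \<open>y n \<longlonglongrightarrow> y0\<close> is put on one continuous path that passes through \<open>y n\<close> at time \<open>h n\<close>.\<close>

lemma continuous_path_through:
  fixes y :: "nat => 'a::real_inner" and h :: "nat => real"
  assumes h: "\<And>n. 0 < h n" "h \<longlonglongrightarrow> 0" "\<And>n. h (Suc n) < h n" and y: "y \<longlonglongrightarrow> y0"
  obtains z where "continuous_on UNIV z" "z 0 = y0" "\<And>n. z (h n) = y n"
proof -
  have dec: "h n < h m" if "m < n" for m n using that h(3) by (induction n) (auto simp: less_Suc_eq intro: less_trans)
  have inj: "h m = h n ==> m = n" for m n using dec[of m n] dec[of n m] by (cases m n rule: linorder_cases) auto
  define S where "S = insert 0 (range h)"
  define f where "f s = (if s = 0 then y0 else y (inv h s))" for s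
  have f0: "f 0 = y0" by (simp add: f_def)
  have fh: "f (h n) = y n" for n
  proof -
    have "inj h" using inj by (auto simp: inj_def)
    then show ?thesis using h(1)[of n] by (simp add: f_def)
  qed
  have "continuous_on S f"
    unfolding continuous_on_iff
  proof (intro ballI allI impI)
    fix s and e :: real assume s: "s \<in> S" and e: "e > 0"
    show "\<exists>d>0. \<forall>s'\<in>S. dist s' s < d --> dist (f s') (f s) < e"
    proof (cases "s = 0")
      case True
      obtain K where K: "\<And>n. n \<ge> K ==> dist (y n) y0 < e" using y e by (auto simp: lim_sequentially)
      show ?thesis
      proof (intro exI[of _ "h K"] conjI ballI impI h)
        fix s' assume s': "s' \<in> S" "dist s' s < h K"
        show "dist (f s') (f s) < e"
        proof (cases "s' = 0")
          case False
          then obtain n where n: "s' = h n" using s' by (auto simp: S_def)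
          then have "h n < h K" using s' True by simp
          then have "n \<ge> K" using dec[of n K] by (metis not_le order.asym)
          then show ?thesis using K n True by (simp add: fh f0)
        qed (use True e in simp)
      qed
    next
      case False
      then obtain n where n: "s = h n" using s by (auto simp: S_def)
      define d where "d = min (h n - h (Suc n)) (if n = 0 then 1 else h (n - 1) - h n)"
      have "d > 0" using h(3) dec[of "n - 1" n] by (auto simp: d_def)
      moreover have "s' = s" if s': "s' \<in> S" "dist s' s < d" for s'
      proof -
        consider "s' = 0" | m where "s' = h m" using s' by (auto simp: S_def)
        then show ?thesis
        proof cases
          case 1
          then show ?thesis using s' n h(1)[of n] h(1)[of "Suc n"] by (auto simp: d_def dist_real_def)
        next
          case 2
          show ?thesis
          proof (cases m n rule: linorder_cases)
            case less
            then have "m = n - 1 \<or> m < n - 1" by linarith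
            then have "h (n - 1) \<le> h m" using dec[of m "n - 1"] by (auto intro: less_imp_le)
            then show ?thesis using s' n 2 less by (auto simp: d_def dist_real_def split: if_splits)
          next
            case greater
            then have "h m \<le> h (Suc n)" using dec[of "Suc n" m] by (cases "m = Suc n") auto
            then show ?thesis using s' n 2 by (auto simp: d_def dist_real_def)
          qed (simp add: 2 n)
        qed
      qed
      ultimately show ?thesis using e by (metis dist_self)
    qed
  qed
  moreover have "closedin (top_of_set UNIV) S"
    using closed_sequence_with_limit[OF h(2)] by (simp add: S_def)
  ultimately obtain z where "continuous_on UNIV z" "\<And>s. s \<in> S ==> z s = f s"
    using Dugundji[of "UNIV :: 'a set" UNIV S f] by (metis convex_UNIV UNIV_not_empty subset_UNIV)
  then show ?thesis by (intro that[of z]) (auto simp: S_def f0 fh)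
qed

context drift
begin

definition quot :: "('h => real) => 'k => real => 'h => real" where
  "quot \<phi> k h z = (\<phi> (z + B h k) - \<phi> z) / h"

text \<open>The defining limit of the class \<open>\<S>\<close> along all continuous paths is the same as locally uniform
  convergence of the difference quotients.\<close>

lemma quot_loc_unif:
  assumes "\<And>z. continuous_on {0..} z ==>
     ((\<lambda>t. (\<phi> (z t + (LINT s:{0<..t}|lborel. E s k)) - \<phi> (z t)) / t) \<longlongrightarrow> D (z 0) \<bullet> k) (at_right 0)"
  shows "loc_unif (quot \<phi> k) (\<lambda>y. D y \<bullet> k)"
proof (rule loc_unifI_sequential)
  fix h :: "nat => real" and y :: "nat => 'h" and y0
  assume h: "\<And>n. 0 < h n" "h \<longlonglongrightarrow> 0" "\<And>n. h (Suc n) < h n" and y: "y \<longlonglongrightarrow> y0"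
  obtain z where z: "continuous_on UNIV z" "z 0 = y0" "\<And>n. z (h n) = y n"
    using continuous_path_through[of h y y0] h y by blast
  have "((\<lambda>t. quot \<phi> k t (z t)) \<longlongrightarrow> D y0 \<bullet> k) (at_right 0)"
    using assms[OF continuous_on_subset[OF z(1) subset_UNIV]] by (simp add: quot_def B_def z(2))
  moreover have "filterlim h (at_right 0) sequentially"
    by (rule tendsto_imp_filterlim_at_right[OF h(2)]) (use h in auto)
  ultimately have "(\<lambda>n. quot \<phi> k (h n) (z (h n))) \<longlonglongrightarrow> D y0 \<bullet> k" by (rule filterlim_compose)
  then show "(\<lambda>n. quot \<phi> k (h n) (y n)) \<longlonglongrightarrow> D y0 \<bullet> k" by (simp add: z(3))
qed

end

section \<open>Dynkin's formula for the uncontrolled process\<close>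

text \<open>The noise enters only through a version with continuous paths; the class \<open>\<S>\<close> says nothing along
  discontinuous ones.\<close>

locale continuous_noise = drift M F W S \<sigma> E cG aG \<beta>
  for M :: "'w measure" and F W and S :: "real => 'h::{real_inner,banach,second_countable_topology} \<Rightarrow>\<^sub>L 'h" and \<sigma>
    and E :: "real => 'k::{real_inner,banach,second_countable_topology} \<Rightarrow>\<^sub>L 'h" and cG aG \<beta> +
  fixes Y :: "real => 'w => 'h"
  assumes Y_continuous: "w \<in> space M ==> continuous_on {0..} (\<lambda>t. Y t w)"
    and Y_measurable_M: "t \<ge> 0 ==> Y t \<in> borel_measurable M"
    and Y_version: "t \<ge> 0 ==> AE w in M. Y t w = stoch_conv M W S \<sigma> t w"
begin

lemma Y_measurable_F: "t \<ge> 0 ==> Y t \<in> borel_measurable (F t)"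
  by (rule measurable_F_null[OF _ Y_measurable_M Z_measurable_F Y_version])

lemma elem_integral_on_0: "elem_on 0 es ==> elem_integral W es w = 0"
proof (induction es)
  case Nil then show ?case by (simp add: elem_integral_def)
next
  case (Cons e es)
  obtain a b \<xi> k where e: "e = (a, b, \<xi>, k)" by (cases e)
  have "a = 0" "b = 0" using Cons.prems e by (auto simp: elem_on_def)
  moreover have "elem_integral W es w = 0" using Cons by (auto simp: elem_on_def)
  ultimately show ?case by (simp add: e elem_integral_def)
qed

lemma Y_0: "AE w in M. Y 0 w = 0"
proof -
  obtain es where es: "approximates 0 es" using approximates_exists[of 0] by auto
  then have "elem_integral W (es n) w = 0" for n w by (simp add: approximates_def elem_integral_on_0)
  then have "L2sq M (Z 0) = 0"
    using approximates_limit[OF _ es] by (simp add: LIMSEQ_const_iff)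
  then have "AE w in M. ennreal ((norm (Z 0 w))\<^sup>2) = 0"
    using Z_measurable_M[of 0] by (subst (asm) nn_integral_0_iff_AE) auto
  with Y_version[of 0] show ?thesis by auto
qed

lemma S_measurable: "f \<in> borel_measurable L ==> (\<lambda>x. S h (f x)) \<in> borel_measurable L"
  by (rule borel_measurable_continuous_on) (auto intro!: linear_continuous_on blinfun.bounded_linear_right)

lemma Y_markov:
  fixes f :: "'c \<times> 'h => real"
  assumes a: "a \<ge> 0" and h: "h \<ge> 0" and K: "K \<in> F a \<rightarrow>\<^sub>M L" and f: "f \<in> borel_measurable (L \<Otimes>\<^sub>M borel)"
    and bd: "\<And>x. \<bar>f x\<bar> \<le> c"
  shows "(LINT w|M. f (K w, Y (a + h) w - S h (Y a w))) = (LINT w|M. (LINT w'|M. f (K w, Y h w')))"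
proof -
  have KM [measurable]: "K \<in> M \<rightarrow>\<^sub>M L" using K a by (rule measurable_F)
  have [measurable]: "Y (a + h) \<in> borel_measurable M" "Y h \<in> borel_measurable M" "(\<lambda>w. S h (Y a w)) \<in> borel_measurable M"
    "incr a h \<in> borel_measurable M" "stoch_conv M W S \<sigma> h \<in> borel_measurable M" "f \<in> borel_measurable (L \<Otimes>\<^sub>M borel)"
    using a h by (auto intro!: Y_measurable_M S_measurable incr_measurable Z_measurable_M f)
  have "AE w in M. Y (a + h) w = Z (a + h) w" "AE w in M. Y a w = Z a w"
    using a h by (auto intro!: Y_version)
  then have "AE w in M. Y (a + h) w - S h (Y a w) = incr a h w" by eventually_elim (simp add: incr_def)
  then have "(LINT w|M. f (K w, Y (a + h) w - S h (Y a w))) = (LINT w|M. f (K w, incr a h w))"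
    by (intro integral_cong_AE) auto
  also have "... = (LINT w|M. (LINT w'|M. f (K w, Z h w')))" by (rule incr_markov[OF a h K f bd])
  also have "... = (LINT w|M. (LINT w'|M. f (K w, Y h w')))"
  proof (rule Bochner_Integration.integral_cong[OF refl])
    fix w assume w: "w \<in> space M"
    then have [measurable]: "K w \<in> space L" using measurable_space[OF KM] by auto
    show "(LINT w'|M. f (K w, Z h w')) = (LINT w'|M. f (K w, Y h w'))"
    proof (rule integral_cong_AE)
    show "(\<lambda>w'. f (K w, Z h w')) \<in> borel_measurable M" "(\<lambda>w'. f (K w, Y h w')) \<in> borel_measurable M" by measurable
    show "AE w' in M. f (K w, Z h w') = f (K w, Y h w')" using Y_version[OF h] by eventually_elim simp
    qed
  qed
  finally show ?thesis .
qed

definition P :: "real => ('h => real) => 'h => real" where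
  "P t f x = (LINT w|M. f (S t x + Y t w))"

lemma P0_eq: "t \<ge> 0 ==> continuous_on UNIV f ==> P0 M W S \<sigma> t f x = P t f x"
  unfolding P0_def P_def
proof (rule integral_cong_AE)
  assume t: "t \<ge> 0" and f: "continuous_on UNIV f"
  have m: "(\<lambda>w. f (S t x + g w)) \<in> borel_measurable M" if "g \<in> borel_measurable M" for g
    by (rule borel_measurable_continuous_on[OF f]) (use that in simp)
  show "(\<lambda>w. f (S t x + Z t w)) \<in> borel_measurable M" "(\<lambda>w. f (S t x + Y t w)) \<in> borel_measurable M"
    using t by (auto intro!: m Z_measurable_M Y_measurable_M)
  show "AE w in M. f (S t x + Z t w) = f (S t x + Y t w)" using Y_version[OF t] by eventually_elim simp
qed

lemma S_joint_tendsto: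
  assumes t: "\<And>n. 0 \<le> t n" "t \<longlonglongrightarrow> t0" "0 \<le> t0" and y: "y \<longlonglongrightarrow> y0"
  shows "(\<lambda>n. S (t n) (y n)) \<longlonglongrightarrow> S t0 y0"
proof -
  obtain T where T: "\<And>n. \<bar>t n\<bar> \<le> T" using convergent_imp_Bseq[of t] t(2) by (auto simp: convergent_def Bseq_def)
  obtain C where C: "C \<ge> 1" "\<And>r x. 0 \<le> r ==> r \<le> T ==> norm (S r x) \<le> C * norm x" using S_bounded by blast
  have "(\<lambda>n. C * norm (y n - y0)) \<longlonglongrightarrow> C * norm (y0 - y0)" by (intro tendsto_intros y)
  then have lim: "(\<lambda>n. C * norm (y n - y0)) \<longlonglongrightarrow> 0" by simp
  have "t n \<le> T" for n using T[of n] by linarith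
  then have "\<forall>n. norm (S (t n) (y n - y0)) \<le> C * norm (y n - y0)" using C(2) t(1) by blast
  then have "(\<lambda>n. S (t n) (y n - y0)) \<longlonglongrightarrow> 0"
    by (rule Lim_null_comparison[OF always_eventually lim])
  moreover have "(\<lambda>n. S (t n) y0) \<longlonglongrightarrow> S t0 y0" by (rule S_tendsto) (use t in auto)
  ultimately have "(\<lambda>n. S (t n) (y n - y0) + S (t n) y0) \<longlonglongrightarrow> 0 + S t0 y0" by (rule tendsto_add)
  then show ?thesis by (simp add: blinfun.diff_right)
qed

lemma P_tendsto:
  assumes f: "continuous_on UNIV f" "\<And>x. \<bar>f x\<bar> \<le> c" and t: "\<And>n. 0 \<le> t n" "t \<longlonglongrightarrow> t0" "0 \<le> t0" and y: "y \<longlonglongrightarrow> y0"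
  shows "(\<lambda>n. P (t n) f (y n)) \<longlonglongrightarrow> P t0 f y0"
  unfolding P_def
proof (rule integral_dominated_convergence[where w="\<lambda>_. c"])
  have m: "(\<lambda>w. f (S t x + Y t w)) \<in> borel_measurable M" if "t \<ge> 0" for t x
    by (rule borel_measurable_continuous_on[OF f(1)]) (use Y_measurable_M[OF that] in simp)
  show "(\<lambda>w. f (S t0 y0 + Y t0 w)) \<in> borel_measurable M" "(\<lambda>w. f (S (t n) (y n) + Y (t n) w)) \<in> borel_measurable M" for n
    using m t by auto
  show "AE w in M. (\<lambda>n. f (S (t n) (y n) + Y (t n) w)) \<longlonglongrightarrow> f (S t0 y0 + Y t0 w)"
  proof (rule AE_I2)
    fix w assume "w \<in> space M"
    then have "(\<lambda>n. Y (t n) w) \<longlonglongrightarrow> Y t0 w"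
      by (intro continuous_on_tendsto_compose[OF Y_continuous t(2)]) (use t in auto)
    then have "(\<lambda>n. S (t n) (y n) + Y (t n) w) \<longlonglongrightarrow> S t0 y0 + Y t0 w" by (intro tendsto_add S_joint_tendsto t y)
    then show "(\<lambda>n. f (S (t n) (y n) + Y (t n) w)) \<longlonglongrightarrow> f (S t0 y0 + Y t0 w)"
      by (intro continuous_on_tendsto_compose[OF f(1)]) auto
  qed
qed (use f in auto)

lemma P_0: "continuous_on UNIV f ==> P 0 f x = f x"
proof -
  assume f: "continuous_on UNIV f"
  have "(LINT w|M. f (S 0 x + Y 0 w)) = (LINT w|M. f x)"
  proof (rule integral_cong_AE)
    show "(\<lambda>w. f (S 0 x + Y 0 w)) \<in> borel_measurable M"
      by (rule borel_measurable_continuous_on[OF f]) (use Y_measurable_M[of 0] in simp)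
    show "AE w in M. f (S 0 x + Y 0 w) = f x" using Y_0 by eventually_elim simp
  qed simp
  then show ?thesis by (simp add: P_def prob_space)
qed

lemma P_bound: "(\<And>x. \<bar>f x\<bar> \<le> c) ==> \<bar>P t f x\<bar> \<le> c" if "c \<ge> 0"
proof -
  assume f: "\<And>x. \<bar>f x\<bar> \<le> c"
  have "norm (P t f x) \<le> c" unfolding P_def
  proof (cases "integrable M (\<lambda>w. f (S t x + Y t w))")
    case True
    have "norm (LINT w|M. f (S t x + Y t w)) \<le> (LINT w|M. c)"
      by (rule order_trans[OF integral_norm_bound integral_mono]) (use True f in auto)
    then show "norm (LINT w|M. f (S t x + Y t w)) \<le> c" by (simp add: prob_space)
  qed (simp add: not_integrable_integral_eq that)
  then show ?thesis by simp
qed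

lemma P_continuous: "continuous_on UNIV f ==> (\<And>x. \<bar>f x\<bar> \<le> c) ==> t \<ge> 0 ==> continuous_on UNIV (P t f)"
proof -
  assume f: "continuous_on UNIV f" "\<And>x. \<bar>f x\<bar> \<le> c" and t: "t \<ge> 0"
  show ?thesis
    unfolding continuous_on_sequentially[of UNIV "P t f"] comp_def
    using P_tendsto[OF f, of "\<lambda>_. t" t] t by auto
qed

lemma P_semigroup:
  assumes f: "continuous_on UNIV f" "\<And>x. \<bar>f x\<bar> \<le> c" and t: "t \<ge> 0" and h: "h \<ge> 0"
  shows "P (t + h) f x = (LINT w|M. P h f (S t x + Y t w))"
proof -
  let ?K = "\<lambda>w. S t x + Y t w"
  have K: "?K \<in> borel_measurable (F t)" using Y_measurable_F[OF t] by simp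
  have fm: "(\<lambda>p. f (S h (fst p) + snd p)) \<in> borel_measurable (borel \<Otimes>\<^sub>M borel)"
    by (rule borel_measurable_continuous_on[OF f(1)]) (auto intro!: borel_measurable_add S_measurable)
  have "P (t + h) f x = (LINT w|M. f (S h (?K w) + (Y (t + h) w - S h (Y t w))))"
    unfolding P_def using S_add[OF h t, of x] by (simp add: blinfun.add_right add.commute[of t h])
  also have "... = (LINT w|M. (LINT w'|M. f (S h (?K w) + Y h w')))"
    using Y_markov[OF t h K fm f(2)] by simp
  finally show ?thesis by (simp add: P_def)
qed

text \<open>Averaging the difference quotients of \<open>v t = P t \<phi> x\<close> over \<open>t\<close> gives \<open>v\<close> back in the limit, by continuity of \<open>v\<close>
  alone, while dominated convergence identifies the limit of the averages.\<close>

lemma dynkin: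
  assumes \<phi>: "continuous_on UNIV \<phi>" "\<And>x. \<bar>\<phi> x\<bar> \<le> c" and \<psi>: "continuous_on UNIV \<psi>" "\<And>x. \<bar>\<psi> x\<bar> \<le> c'"
    and gen: "\<And>x. (\<lambda>n. (P (1 / real (Suc n)) \<phi> x - \<phi> x) / (1 / real (Suc n))) \<longlonglongrightarrow> \<psi> x"
    and bd: "\<And>n x. \<bar>(P (1 / real (Suc n)) \<phi> x - \<phi> x) / (1 / real (Suc n))\<bar> \<le> C"
    and \<tau>: "\<tau> \<ge> 0"
  shows "P \<tau> \<phi> x - \<phi> x = integral {0..\<tau>} (\<lambda>t. P t \<psi> x)"
proof -
  define v where "v t = P t \<phi> x" for t
  have meas: "(\<lambda>w. f (S t x + Y t w)) \<in> borel_measurable M" if "continuous_on UNIV f" "t \<ge> 0" for f :: "'h => real" and t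
    by (rule borel_measurable_continuous_on[OF that(1)]) (use Y_measurable_M[OF that(2)] in simp)
  have c': "c' \<ge> 0" using \<psi>(2)[of 0] by simp
  have vcont: "continuous_on {0..} v"
    unfolding continuous_on_sequentially comp_def v_def by (auto intro!: P_tendsto[OF \<phi>])
  define V where "V t = integral {0..t} v" for t
  have vint: "v integrable_on {a..b}" if "0 \<le> a" for a b
    by (rule integrable_continuous_real) (use that in "auto intro: continuous_on_subset[OF vcont]")
  define h where "h n = 1 / real (Suc n)" for n
  have h: "h n > 0" for n by (simp add: h_def)
  have hlim: "h \<longlonglongrightarrow> 0" using LIMSEQ_inverse_real_of_nat by (simp add: h_def[abs_def] inverse_eq_divide)
  have vD: "(\<lambda>n. (V (t + h n) - V t) / h n) \<longlonglongrightarrow> v t" if t: "t \<ge> 0" for t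
  proof -
    have "(V has_real_derivative v t) (at t within {0..t + 1})"
      unfolding V_def by (rule integral_has_real_derivative) (use t in "auto intro: continuous_on_subset[OF vcont]")
    then have lim: "((\<lambda>s. (V s - V t) / (s - t)) \<longlongrightarrow> v t) (at t within {0..t + 1})"
      by (simp add: has_field_derivative_iff)
    have "filterlim (\<lambda>n. t + h n) (at t within {0..t + 1}) sequentially"
      unfolding filterlim_at
    proof
      show "\<forall>\<^sub>F n in sequentially. t + h n \<in> {0..t + 1} \<and> t + h n \<noteq> t"
        using h t by (intro always_eventually) (auto simp: h_def divide_le_eq)
      show "(\<lambda>n. t + h n) \<longlonglongrightarrow> t" using tendsto_add[OF tendsto_const hlim, of t] by simp
    qed
    from filterlim_compose[OF lim this] show ?thesis by simp
  qed
  have V0: "V 0 = 0" by (simp add: V_def)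
  have avg: "integral {0..\<tau>} (\<lambda>t. (v (t + h n) - v t) / h n) = (V (\<tau> + h n) - V \<tau>) / h n - (V (0 + h n) - V 0) / h n" for n
  proof -
    have sh: "integral {0..\<tau>} (\<lambda>t. v (t + h n)) = integral {0 + h n..\<tau> + h n} v"
    proof -
      have "(v has_integral integral {0 + h n..\<tau> + h n} v) (cbox (0 + h n) (\<tau> + h n))"
        using vint[of "0 + h n" "\<tau> + h n"] h[of n] by (auto intro: integrable_integral)
      then have "((v \<circ> (+) (h n)) has_integral integral {0 + h n..\<tau> + h n} v) (cbox 0 \<tau>)"
        by (simp only: has_integral_shift_cbox_iff)
      then show ?thesis by (simp add: comp_def add.commute integral_unique)
    qed
    have "integral {0..\<tau> + h n} v = integral {0..h n} v + integral {h n..\<tau> + h n} v"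
      by (rule Henstock_Kurzweil_Integration.integral_combine[symmetric]) (use h[of n] \<tau> vint in auto)
    then have "integral {h n..\<tau> + h n} v = V (\<tau> + h n) - V (h n)" by (simp add: V_def)
    moreover have "(\<lambda>t. v (t + h n)) integrable_on {0..\<tau>}"
      by (rule integrable_continuous_real, rule continuous_on_compose2[OF vcont]) (use h[of n] in "auto intro!: continuous_intros")
    ultimately have "integral {0..\<tau>} (\<lambda>t. v (t + h n) - v t) = V (\<tau> + h n) - V (h n) - V \<tau>"
      using vint[of 0 \<tau>] by (subst Henstock_Kurzweil_Integration.integral_diff) (auto simp: sh V_def)
    moreover have "integral {0..\<tau>} (\<lambda>t. (v (t + h n) - v t) / h n) = integral {0..\<tau>} (\<lambda>t. v (t + h n) - v t) / h n"
      unfolding divide_inverse by (rule Henstock_Kurzweil_Integration.integral_mult_left)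
    ultimately show ?thesis using V0 by (simp add: diff_divide_distrib)
  qed
  have q: "(v (t + h n) - v t) / h n = (LINT w|M. (P (h n) \<phi> (S t x + Y t w) - \<phi> (S t x + Y t w)) / h n)" if t: "t \<ge> 0" for t n
  proof -
    have "c \<ge> 0" using \<phi>(2)[of 0] by simp
    have i1: "integrable M (\<lambda>w. P (h n) \<phi> (S t x + Y t w))"
      by (rule integrable_const_bound[of _ c])
        (use P_bound[OF \<open>c \<ge> 0\<close> \<phi>(2)] meas[OF P_continuous[OF \<phi> less_imp_le[OF h]] t] in auto)
    have i2: "integrable M (\<lambda>w. \<phi> (S t x + Y t w))"
      by (rule integrable_const_bound[of _ c]) (use \<phi>(2) meas[OF \<phi>(1) t] in auto)
    have "v (t + h n) = (LINT w|M. P (h n) \<phi> (S t x + Y t w))"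
      unfolding v_def by (rule P_semigroup[OF \<phi> t less_imp_le[OF h]])
    then show ?thesis using Bochner_Integration.integral_diff[OF i1 i2] by (simp add: v_def P_def)
  qed
  have lim1: "(\<lambda>n. integral {0..\<tau>} (\<lambda>t. (v (t + h n) - v t) / h n)) \<longlonglongrightarrow> integral {0..\<tau>} (\<lambda>t. P t \<psi> x)"
  proof (rule dominated_convergence(2)[where h="\<lambda>_. C"])
    show "(\<lambda>t. (v (t + h n) - v t) / h n) integrable_on {0..\<tau>}" for n
    proof (rule integrable_continuous_real)
      have "continuous_on {0..\<tau>} (\<lambda>t. v (t + h n))"
        by (rule continuous_on_compose2[OF vcont]) (use h[of n] in "auto intro!: continuous_intros")
      moreover have "continuous_on {0..\<tau>} v" by (rule continuous_on_subset[OF vcont]) auto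
      ultimately show "continuous_on {0..\<tau>} (\<lambda>t. (v (t + h n) - v t) / h n)"
        using h[of n] by (intro continuous_intros) auto
    qed
    show "norm ((v (t + h n) - v t) / h n) \<le> C" if "t \<in> {0..\<tau>}" for n t
    proof -
      have t: "t \<ge> 0" using that by simp
      have "(\<lambda>w. (P (h n) \<phi> (S t x + Y t w) - \<phi> (S t x + Y t w)) / h n) \<in> borel_measurable M"
        using meas[OF P_continuous[OF \<phi> less_imp_le[OF h]] t] meas[OF \<phi>(1) t] by measurable
      then have "integrable M (\<lambda>w. (P (h n) \<phi> (S t x + Y t w) - \<phi> (S t x + Y t w)) / h n)"
        by (intro integrable_const_bound[of _ C]) (use bd[of n] in "auto simp: h_def")
      then have "norm (LINT w|M. (P (h n) \<phi> (S t x + Y t w) - \<phi> (S t x + Y t w)) / h n) \<le> (LINT w|M. C)"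
        by (intro order_trans[OF integral_norm_bound integral_mono]) (use bd[of n] in "auto simp: h_def")
      then show ?thesis unfolding q[OF t] by (simp add: prob_space)
    qed
    show "(\<lambda>n. (v (t + h n) - v t) / h n) \<longlonglongrightarrow> P t \<psi> x" if "t \<in> {0..\<tau>}" for t
    proof -
      have t: "t \<ge> 0" using that by simp
      have "(\<lambda>n. LINT w|M. (P (h n) \<phi> (S t x + Y t w) - \<phi> (S t x + Y t w)) / h n) \<longlonglongrightarrow> P t \<psi> x"
        unfolding P_def[of t]
      proof (rule integral_dominated_convergence[where w="\<lambda>_. C"])
        show "(\<lambda>w. \<psi> (S t x + Y t w)) \<in> borel_measurable M" by (rule meas[OF \<psi>(1) t])
        show "(\<lambda>w. (P (h n) \<phi> (S t x + Y t w) - \<phi> (S t x + Y t w)) / h n) \<in> borel_measurable M" for n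
          using meas[OF P_continuous[OF \<phi> less_imp_le[OF h]] t] meas[OF \<phi>(1) t] by measurable
        show "AE w in M. (\<lambda>n. (P (h n) \<phi> (S t x + Y t w) - \<phi> (S t x + Y t w)) / h n) \<longlonglongrightarrow> \<psi> (S t x + Y t w)"
          using gen by (auto simp: h_def)
        show "AE w in M. norm ((P (h n) \<phi> (S t x + Y t w) - \<phi> (S t x + Y t w)) / h n) \<le> C" for n
          using bd[of n] by (auto simp: h_def)
      qed simp
      then show ?thesis by (simp only: q[OF t])
    qed
  qed auto
  have "(\<lambda>n. (V (\<tau> + h n) - V \<tau>) / h n - (V (0 + h n) - V 0) / h n) \<longlonglongrightarrow> v \<tau> - v 0"
    by (intro tendsto_diff vD \<tau>) simp
  then have "v \<tau> - v 0 = integral {0..\<tau>} (\<lambda>t. P t \<psi> x)"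
    using lim1 unfolding avg by (rule LIMSEQ_unique)
  then show ?thesis by (simp add: v_def P_0[OF \<phi>(1)])
qed

text \<open>Dynkin's formula makes the generator quotients bounded and lets them converge continuously: they are
  time averages of \<open>P t \<psi>\<close>, which is jointly continuous.\<close>

lemma P_quot:
  assumes \<psi>: "continuous_on UNIV \<psi>" "\<And>x. \<bar>\<psi> x\<bar> \<le> c'"
    and dyn: "\<And>\<tau> x. \<tau> \<ge> 0 ==> P \<tau> \<phi> x - \<phi> x = integral {0..\<tau>} (\<lambda>t. P t \<psi> x)"
  shows "h \<ge> 0 ==> \<bar>P h \<phi> x - \<phi> x\<bar> \<le> c' * h"
    and "loc_unif (\<lambda>h x. (P h \<phi> x - \<phi> x) / h) \<psi>"
proof -
  have c': "c' \<ge> 0" using \<psi>(2)[of 0] by simp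
  have cont: "continuous_on {0..h} (\<lambda>t. P t \<psi> x)" for h x
    unfolding continuous_on_sequentially comp_def by (auto intro!: P_tendsto[OF \<psi>])
  show "\<bar>P h \<phi> x - \<phi> x\<bar> \<le> c' * h" if h: "h \<ge> 0"
    using integral_bound[OF h cont, of x c'] P_bound[OF c' \<psi>(2)] dyn[OF h, of x] by simp
  show "loc_unif (\<lambda>h x. (P h \<phi> x - \<phi> x) / h) \<psi>"
  proof (rule loc_unifI_sequential)
    fix h :: "nat => real" and y :: "nat => 'h" and y0
    assume h: "\<And>n. 0 < h n" "h \<longlonglongrightarrow> 0" and y: "y \<longlonglongrightarrow> y0"
    have "\<exists>t\<in>{0..h n}. \<forall>s\<in>{0..h n}. \<bar>P s \<psi> (y n) - \<psi> y0\<bar> \<le> \<bar>P t \<psi> (y n) - \<psi> y0\<bar>" for n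
      by (rule continuous_attains_sup) (use h(1)[of n] in "auto intro!: continuous_intros cont")
    then obtain t where t: "\<And>n. t n \<in> {0..h n}" "\<And>n s. s \<in> {0..h n} ==> \<bar>P s \<psi> (y n) - \<psi> y0\<bar> \<le> \<bar>P (t n) \<psi> (y n) - \<psi> y0\<bar>" by metis
    have "t \<longlonglongrightarrow> 0"
      by (rule tendsto_sandwich[OF _ _ tendsto_const h(2)]) (use t in auto)
    then have "(\<lambda>n. P (t n) \<psi> (y n)) \<longlonglongrightarrow> P 0 \<psi> y0" by (intro P_tendsto[OF \<psi>] y) (use t in auto)
    then have lim: "(\<lambda>n. \<bar>P (t n) \<psi> (y n) - \<psi> y0\<bar>) \<longlonglongrightarrow> 0"
      by (simp add: P_0[OF \<psi>(1)] tendsto_rabs_zero_iff LIM_zero_iff)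
    have "\<bar>(P (h n) \<phi> (y n) - \<phi> (y n)) / h n - \<psi> y0\<bar> \<le> \<bar>P (t n) \<psi> (y n) - \<psi> y0\<bar>" for n
    proof -
      have i: "(\<lambda>s. P s \<psi> (y n)) integrable_on {0..h n}" by (rule integrable_continuous_real[OF cont])
      have "integral {0..h n} (\<lambda>s. P s \<psi> (y n) - \<psi> y0) = (P (h n) \<phi> (y n) - \<phi> (y n)) - h n * \<psi> y0"
        using h(1)[of n] dyn[of "h n" "y n"] i by (subst Henstock_Kurzweil_Integration.integral_diff) auto
      moreover have "norm (integral {0..h n} (\<lambda>s. P s \<psi> (y n) - \<psi> y0)) \<le> \<bar>P (t n) \<psi> (y n) - \<psi> y0\<bar> * (h n - 0)"
        by (rule integral_bound) (use h(1)[of n] t in "auto intro!: continuous_intros cont")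
      ultimately have "\<bar>(P (h n) \<phi> (y n) - \<phi> (y n)) - h n * \<psi> y0\<bar> \<le> \<bar>P (t n) \<psi> (y n) - \<psi> y0\<bar> * h n" by simp
      moreover have "(P (h n) \<phi> (y n) - \<phi> (y n)) / h n - \<psi> y0 = ((P (h n) \<phi> (y n) - \<phi> (y n)) - h n * \<psi> y0) / h n"
        using h(1)[of n] by (simp add: diff_divide_distrib)
      ultimately show ?thesis using h(1)[of n] by (simp add: abs_divide pos_divide_le_eq)
    qed
    then have "(\<lambda>n. (P (h n) \<phi> (y n) - \<phi> (y n)) / h n - \<psi> y0) \<longlonglongrightarrow> 0"
      by (intro Lim_null_comparison[OF always_eventually lim]) auto
    then show "(\<lambda>n. (P (h n) \<phi> (y n) - \<phi> (y n)) / h n) \<longlonglongrightarrow> \<psi> y0" by (simp add: LIM_zero_iff)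
  qed
qed

end

section \<open>Controls that are constant on a time interval\<close>

lemma grid_sum_tendsto:
  fixes g :: "'a::real_normed_vector => real" and y :: "real => 'a"
  assumes Q: "loc_unif Q g" and g: "continuous_on UNIV g" and y: "continuous_on {a..b} y"
    and p: "(p \<longlongrightarrow> 0) (at_right 0)" and ab: "a < b"
    and h: "\<And>n. h n = (b - a) / real (Suc n)"
    and r: "\<And>n i. i < Suc n ==> a + real i * h n \<le> r n i \<and> r n i \<le> a + real (Suc i) * h n"
  shows "(\<lambda>n. \<Sum>i<Suc n. h n * Q (h n) (y (r n i) - p (h n))) \<longlonglongrightarrow> integral {a..b} (\<lambda>s. g (y s))"
    and "\<forall>\<^sub>F n in sequentially. \<forall>i<Suc n. \<bar>Q (h n) (y (r n i) - p (h n)) - g (y (r n i))\<bar> \<le> 1"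
proof -
  have hp: "h n > 0" for n using ab by (simp add: h)
  have hb: "a + real (Suc n) * h n = b" for n by (simp add: h)
  have hlim: "h \<longlonglongrightarrow> 0"
  proof -
    have "(\<lambda>n. (b - a) * inverse (real (Suc n))) \<longlonglongrightarrow> (b - a) * 0"
      by (intro tendsto_mult tendsto_const LIMSEQ_inverse_real_of_nat)
    then show ?thesis by (simp add: h[abs_def] divide_inverse)
  qed
  have cell: "a \<le> s \<and> s \<le> b" if "i < Suc n" "a + real i * h n \<le> s" "s \<le> a + real (Suc i) * h n" for i n s
  proof -
    have "real (Suc i) * h n \<le> real (Suc n) * h n" using that hp[of n] by (intro mult_right_mono) auto
    moreover have "0 \<le> real i * h n" using hp[of n] by simp
    ultimately show ?thesis using that hb[of n] by linarith
  qed
  have ev: "\<forall>\<^sub>F n in sequentially. \<forall>i<Suc n. \<forall>s. a + real i * h n \<le> s \<and> s \<le> a + real (Suc i) * h n -->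
     \<bar>Q (h n) (y (r n i) - p (h n)) - g (y s)\<bar> < \<epsilon>" if eps: "\<epsilon> > 0" for \<epsilon>
  proof -
    obtain \<delta> where \<delta>: "\<delta> > 0" "\<And>h r s. 0 < h ==> h < \<delta> ==> r \<in> {a..b} ==> s \<in> {a..b} ==> \<bar>r - s\<bar> \<le> h ==> dist (Q h (y r - p h)) (g (y s)) < \<epsilon>"
      using loc_unif_grid[OF Q g y p eps] by blast
    have "\<forall>\<^sub>F n in sequentially. h n < \<delta>" using order_tendstoD(2)[OF hlim \<delta>(1)] .
    then show ?thesis
    proof eventually_elim
      case (elim n)
      show ?case
      proof (intro allI impI)
        fix i s assume i: "i < Suc n" and s: "a + real i * h n \<le> s \<and> s \<le> a + real (Suc i) * h n"
        have "real (Suc i) * h n = real i * h n + h n" by (simp add: algebra_simps)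
        then have "\<bar>r n i - s\<bar> \<le> h n" using r[OF i] s by linarith
        then show "\<bar>Q (h n) (y (r n i) - p (h n)) - g (y s)\<bar> < \<epsilon>"
          using \<delta>(2)[OF hp elim, of "r n i" s] cell[OF i, of s] cell[OF i, of "r n i"] r[OF i] s by (simp add: dist_real_def)
      qed
    qed
  qed
  show "\<forall>\<^sub>F n in sequentially. \<forall>i<Suc n. \<bar>Q (h n) (y (r n i) - p (h n)) - g (y (r n i))\<bar> \<le> 1"
    using ev[OF zero_less_one] by eventually_elim (use r in "auto intro: less_imp_le")
  have G: "continuous_on {a..b} (\<lambda>s. g (y s))" by (rule continuous_on_compose2[OF g y]) auto
  show "(\<lambda>n. \<Sum>i<Suc n. h n * Q (h n) (y (r n i) - p (h n))) \<longlonglongrightarrow> integral {a..b} (\<lambda>s. g (y s))"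
  proof (rule tendstoI)
    fix e :: real assume e: "e > 0"
    define \<epsilon> where "\<epsilon> = e / (2 * (b - a))"
    have \<epsilon>: "\<epsilon> > 0" using e ab by (simp add: \<epsilon>_def)
    have canc: "e / (2 * d) * d = e / 2" if "d \<noteq> 0" for d using that by simp
    show "\<forall>\<^sub>F n in sequentially. dist (\<Sum>i<Suc n. h n * Q (h n) (y (r n i) - p (h n))) (integral {a..b} (\<lambda>s. g (y s))) < e"
      using ev[OF \<epsilon>]
    proof eventually_elim
      case (elim n)
      have "\<bar>(\<Sum>i<Suc n. h n * Q (h n) (y (r n i) - p (h n))) - integral {a..a + real (Suc n) * h n} (\<lambda>s. g (y s))\<bar> \<le> \<epsilon> * (real (Suc n) * h n)"
        by (rule riemann_sum_bound[OF hp]) (use G hb[of n] elim in "auto intro: less_imp_le")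
      also have "real (Suc n) * h n = b - a" using hb[of n] by simp
      also have "\<epsilon> * (b - a) = e / 2" unfolding \<epsilon>_def by (rule canc) (use ab in simp)
      finally show ?case using e by (simp only: hb dist_real_def) simp
    qed
  qed
qed

text \<open>The indicator that the sums have not been stopped before step \<open>i\<close>.\<close>

definition alive :: "(nat => real) => real => nat => real" where
  "alive q \<theta> i = (\<Prod>j<i. if \<bar>q j\<bar> \<le> \<theta> then 1 else 0)"

lemma alive_simps [simp]: "alive q \<theta> 0 = 1" "alive q \<theta> (Suc i) = alive q \<theta> i * (if \<bar>q i\<bar> \<le> \<theta> then 1 else 0)"
  by (simp_all add: alive_def)

lemma alive_01: "alive q \<theta> i = 0 \<or> alive q \<theta> i = 1"
  by (induction i) auto

lemma alive_eq_1: "(\<And>j. j < i ==> \<bar>q j\<bar> \<le> \<theta>) ==> alive q \<theta> i = 1"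
  by (simp add: alive_def)

text \<open>The stopped increments telescope to the increment up to the stopping index.\<close>

lemma alive_telescope:
  assumes x: "\<And>i. \<bar>x i\<bar> \<le> c"
  shows "\<bar>\<Sum>i<m. alive q \<theta> i * (x (Suc i) - x i)\<bar> \<le> 2 * c"
proof -
  have "\<exists>j. (\<Sum>i<m. alive q \<theta> i * (x (Suc i) - x i)) = x j - x 0 \<and> (alive q \<theta> m = 1 --> j = m)"
  proof (induction m)
    case (Suc m)
    then obtain j where j: "(\<Sum>i<m. alive q \<theta> i * (x (Suc i) - x i)) = x j - x 0" "alive q \<theta> m = 1 --> j = m" by blast
    show ?case
    proof (cases "alive q \<theta> m = 1")
      case True
      then show ?thesis using j by (intro exI[of _ "Suc m"]) auto
    next
      case False
      then have "alive q \<theta> m = 0" using alive_01 by blast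
      then show ?thesis using j by (intro exI[of _ j]) auto
    qed
  qed simp
  then obtain j where "(\<Sum>i<m. alive q \<theta> i * (x (Suc i) - x i)) = x j - x 0" by blast
  then show ?thesis using x[of j] x[of 0] by linarith
qed

text \<open>Only the last increment before stopping can exceed the threshold, and it is bounded anyway.\<close>

lemma alive_sum_bound:
  assumes q: "\<And>i. \<bar>h * q i\<bar> \<le> d" and h: "h \<ge> 0" and \<theta>: "\<theta> \<ge> 0"
  shows "\<bar>\<Sum>i<m. alive q \<theta> i * (h * q i)\<bar> \<le> real m * (h * \<theta>) + d"
proof -
  have d: "d \<ge> 0" using q[of 0] by linarith
  have "\<bar>\<Sum>i<m. alive q \<theta> i * (h * q i)\<bar> \<le> real m * (h * \<theta>) + d * (1 - alive q \<theta> m)"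
  proof (induction m)
    case (Suc m)
    have ht: "0 \<le> h * \<theta>" using h \<theta> by simp
    consider "alive q \<theta> m = 0" | "alive q \<theta> m = 1" "\<bar>q m\<bar> \<le> \<theta>" | "alive q \<theta> m = 1" "\<not> \<bar>q m\<bar> \<le> \<theta>" using alive_01 by blast
    then show ?case
    proof cases
      case 1
      then show ?thesis using Suc ht by (simp add: algebra_simps)
    next
      case 2
      have "\<bar>h * q m\<bar> \<le> h * \<theta>" using 2 h by (simp add: abs_mult mult_left_mono)
      then show ?thesis using Suc 2 by (simp add: algebra_simps)
    next
      case 3
      then show ?thesis using Suc q[of m] ht by (simp add: algebra_simps)
    qed
  qed simp
  also have "... \<le> real m * (h * \<theta>) + d" using d alive_01[of q \<theta> m] by auto
  finally show ?thesis .
qed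

lemma continuous_on_atLeast:
  fixes f :: "real => 'a::topological_space"
  assumes "\<And>T. T \<ge> 0 ==> continuous_on {0..T} f"
  shows "continuous_on {0..} f"
  unfolding continuous_on_eq_continuous_within
proof
  fix t :: real assume t: "t \<in> {0..}"
  have "continuous (at t within {0..t + 1}) f" using assms[of "t + 1"] t by (auto simp: continuous_on_eq_continuous_within)
  moreover have "at t within {0..t + 1} = at t within {0..}"
    using t by (intro at_within_nhd[of t "{..<t + 1}"]) auto
  ultimately show "continuous (at t within {0..}) f" by (simp add: continuous_within)
qed

context continuous_noise
begin

text \<open>The state on \<open>[a, \<infinity>)\<close> when it starts at time \<open>a\<close> in \<open>V\<close> and the control has the constant value \<open>k\<close>.\<close>

definition path :: "real => ('w => 'h) => ('w => 'k) => real => 'w => 'h" where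
  "path a V k t w = S (t - a) (V w) + (Y t w - S (t - a) (Y a w)) + B (t - a) (k w)"

lemma B_0 [simp]: "B 0 k = 0" by (simp add: B_def set_lebesgue_integral_def)

lemma path_start [simp]: "path a V k a w = V w" by (simp add: path_def)

lemma path_step:
  assumes "a \<le> t" "0 \<le> h"
  shows "path a V k (t + h) w = S h (path a V k t w) + (Y (t + h) w - S h (Y t w)) + B h (k w)"
proof -
  have S: "S (t + h - a) x = S h (S (t - a) x)" for x using S_add[of h "t - a" x] assms by (simp add: algebra_simps)
  have B': "B (t + h - a) x = S h (B (t - a) x) + B h x" for x using B_add[of "t - a" h x] assms by (simp add: algebra_simps)
  show ?thesis unfolding path_def S B' by (simp add: blinfun.add_right blinfun.diff_right)
qed

lemma path_measurable:
  assumes a: "0 \<le> a" "a \<le> t" and V: "V \<in> borel_measurable (F a)" and k: "k \<in> borel_measurable (F a)"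
  shows "path a V k t \<in> borel_measurable (F t)"
proof -
  have "V \<in> borel_measurable (F t)" "k \<in> borel_measurable (F t)" "Y a \<in> borel_measurable (F t)" "Y t \<in> borel_measurable (F t)"
    using a V k Y_measurable_F by (auto intro: measurable_F_mono)
  then show ?thesis unfolding path_def[abs_def] using a
    by (intro borel_measurable_add borel_measurable_diff S_measurable B_measurable) auto
qed

lemma B_path_continuous: "continuous_on {0..} (\<lambda>t. B t k)"
proof -
  define p where "p = 1 / (1 - \<beta>) + 1"
  have p: "1 / (1 - \<beta>) < p" by (simp add: p_def)
  show ?thesis
  proof (rule continuous_on_atLeast)
    fix T :: real assume T: "T \<ge> 0"
    have "(\<integral>\<^sup>+ s\<in>{0..T}. ennreal (norm k powr p) \<partial>lborel) < \<infinity>"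
      using T by (subst nn_integral_cmult_indicator) (auto simp: ennreal_mult_less_top)
    then have "continuous_on {0..T} (conv (\<lambda>_. k))" using T by (intro conv_continuous[OF p]) auto
    then show "continuous_on {0..T} (\<lambda>t. B t k)" by (rule continuous_on_eq) (simp add: conv_const)
  qed
qed

lemma path_continuous:
  assumes a: "0 \<le> a" and w: "w \<in> space M"
  shows "continuous_on {a..} (\<lambda>t. path a V k t w)"
proof -
  have "continuous_on {a..} (\<lambda>t. S (t - a) x)" for x
    by (rule continuous_on_compose2[OF S_continuous]) (auto intro!: continuous_intros)
  moreover have "continuous_on {a..} (\<lambda>t. Y t w)"
    by (rule continuous_on_subset[OF Y_continuous[OF w]]) (use a in auto)
  moreover have "continuous_on {a..} (\<lambda>t. B (t - a) x)" for x
    by (rule continuous_on_compose2[OF B_path_continuous]) (auto intro!: continuous_intros)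
  ultimately show ?thesis unfolding path_def by (intro continuous_on_add continuous_on_diff)
qed

text \<open>The formula on an interval with constant control.  The increments of \<open>\<phi>\<close> along a grid split into
  a martingale difference, a generator term and a difference quotient in direction \<open>k\<close>.  The
  difference quotients converge uniformly along each path, but no bound that is uniform in \<open>w\<close> is at
  hand; hence the sums are stopped at the first quotient that exceeds its limiting bound by \<open>1\<close>.
  Along each path the stopping disappears on fine grids, and the stopped sums are dominated.\<close>

lemma cell_formula:
  assumes \<phi>: "continuous_on UNIV \<phi>" "\<And>x. \<bar>\<phi> x\<bar> \<le> c" and \<psi>: "continuous_on UNIV \<psi>" "\<And>x. \<bar>\<psi> x\<bar> \<le> c'"
    and dyn: "\<And>\<tau> x. \<tau> \<ge> 0 ==> P \<tau> \<phi> x - \<phi> x = integral {0..\<tau>} (\<lambda>t. P t \<psi> x)"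
    and D: "continuous_on UNIV D" "\<And>x. norm (D x) \<le> cD" and quot: "\<And>k. loc_unif (quot \<phi> k) (\<lambda>y. D y \<bullet> k)"
    and ab: "0 \<le> a" "a < b" and V: "V \<in> borel_measurable (F a)" and k: "k \<in> borel_measurable (F a)"
    and ki: "integrable M (\<lambda>w. norm (k w))"
  shows "(LINT w|M. \<phi> (path a V k b w)) - (LINT w|M. \<phi> (V w)) =
     (LINT w|M. integral {a..b} (\<lambda>t. \<psi> (path a V k t w) + D (path a V k t w) \<bullet> k w))"
    and "integrable M (\<lambda>w. integral {a..b} (\<lambda>t. \<psi> (path a V k t w) + D (path a V k t w) \<bullet> k w))"
proof -
  have cp: "c \<ge> 0" "c' \<ge> 0" "cD \<ge> 0" using \<phi>(2)[of 0] \<psi>(2)[of 0] D(2)[of 0] norm_ge_zero[of "D 0"] by linarith+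
  define h where "h n = (b - a) / real (Suc n)" for n
  have hp: "h n > 0" for n using ab by (simp add: h_def)
  have hb: "a + real (Suc n) * h n = b" for n by (simp add: h_def)
  define t where "t n i = a + real i * h n" for n i
  have t_Suc: "t n (Suc i) = t n i + h n" for n i by (simp add: t_def algebra_simps)
  have ta: "a \<le> t n i" for n i using hp[of n] by (simp add: t_def)
  have t0: "0 \<le> t n i" for n i using ta[of n i] ab by linarith
  have tmono: "t n i \<le> t n j" if "i \<le> j" for n i j using that hp[of n] by (simp add: t_def)
  define X where "X n i w = path a V k (t n i) w" for n i w
  define q where "q n i w = quot \<phi> (k w) (h n) (X n (Suc i) w - B (h n) (k w))" for n i w
  define \<theta> where "\<theta> w = cD * norm (k w) + 1" for w
  have \<theta>p: "\<theta> w \<ge> 0" for w using cp by (simp add: \<theta>_def)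
  define \<kappa> where "\<kappa> n i w = alive (\<lambda>j. q n j w) (\<theta> w) i" for n i w
  have Xm: "X n i \<in> borel_measurable (F (t n i))" for n i
    unfolding X_def[abs_def] by (rule path_measurable[OF ab(1) ta V k])
  have km: "k \<in> borel_measurable (F (t n i))" for n i
    by (rule measurable_F_mono[OF k ab(1) ta])
  have \<phi>m: "(\<lambda>w. \<phi> (f w)) \<in> borel_measurable L" if "f \<in> borel_measurable L" for f and L :: "'z measure"
    by (rule borel_measurable_continuous_on[OF \<phi>(1) that])
  have \<phi>m': "(\<lambda>w. \<phi> (f w)) \<in> borel_measurable L" if "f \<in> borel_measurable L" for f and L :: "'w measure"
    by (rule borel_measurable_continuous_on[OF \<phi>(1) that])
  have Pm: "(\<lambda>w. P (h n) \<phi> (f w)) \<in> borel_measurable L" if "f \<in> borel_measurable L" for f n and L :: "'w measure"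
    by (rule borel_measurable_continuous_on[OF P_continuous[OF \<phi> less_imp_le[OF hp]] that])
  have qm: "q n i \<in> borel_measurable (F (t n (Suc i)))" for n i
    unfolding q_def[abs_def] quot_def using hp[of n]
    by (intro borel_measurable_divide borel_measurable_diff borel_measurable_add \<phi>m' Xm km B_measurable) auto
  have \<theta>m: "\<theta> \<in> borel_measurable (F (t n i))" for n i
    unfolding \<theta>_def[abs_def] using km[of n i] by measurable
  have \<kappa>m: "\<kappa> n i \<in> borel_measurable (F (t n i))" for n i
    unfolding \<kappa>_def[abs_def] alive_def
  proof (rule borel_measurable_prod)
    fix j assume "j \<in> {..<i}"
    then have [measurable]: "q n j \<in> borel_measurable (F (t n i))"
      by (intro measurable_F_mono[OF qm t0 tmono]) auto
    have [measurable]: "\<theta> \<in> borel_measurable (F (t n i))" by (rule \<theta>m)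
    show "(\<lambda>w. if \<bar>q n j w\<bar> \<le> \<theta> w then 1 else 0::real) \<in> borel_measurable (F (t n i))" by measurable
  qed
  have XM [measurable]: "X n i \<in> borel_measurable M" and qM [measurable]: "q n i \<in> borel_measurable M"
    and \<kappa>M [measurable]: "\<kappa> n i \<in> borel_measurable M" for n i
    using measurable_F[OF Xm t0] measurable_F[OF qm t0] measurable_F[OF \<kappa>m t0] by auto
  have kM [measurable]: "k \<in> borel_measurable M" using measurable_F[OF k ab(1)] .
  have VM [measurable]: "V \<in> borel_measurable M" using measurable_F[OF V ab(1)] .
  have hq: "h n * q n i w = \<phi> (X n (Suc i) w) - \<phi> (X n (Suc i) w - B (h n) (k w))" for n i w
    using hp[of n] by (simp add: q_def quot_def)
  have \<kappa>01: "\<kappa> n i w = 0 \<or> \<kappa> n i w = 1" for n i w unfolding \<kappa>_def by (rule alive_01)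
  have \<kappa>b: "\<bar>\<kappa> n i w * z\<bar> \<le> c" if "\<bar>z\<bar> \<le> c" for n i w z
    using \<kappa>01[of n i w] that cp(1) by (elim disjE) simp_all
  have \<kappa>1: "\<bar>\<kappa> n i w\<bar> \<le> 1" for n i w using \<kappa>01[of n i w] by auto
  \<comment> \<open>The noise after \<open>t n i\<close> is independent of \<open>\<kappa> n i\<close> and \<open>X n i\<close>, so the conditional mean is \<open>P (h n) \<phi>\<close>.\<close>
  have Xpre: "X n (Suc i) w - B (h n) (k w) = S (h n) (X n i w) + (Y (t n i + h n) w - S (h n) (Y (t n i) w))" for n i w
    unfolding X_def t_Suc using path_step[OF ta less_imp_le[OF hp]] by simp
  have i1: "integrable M (\<lambda>w. \<kappa> n i w * \<phi> (X n (Suc i) w - B (h n) (k w)))" for n i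
  proof (rule integrable_const_bound[of _ c])
    show "AE w in M. norm (\<kappa> n i w * \<phi> (X n (Suc i) w - B (h n) (k w))) \<le> c"
      unfolding real_norm_def by (intro AE_I2 \<kappa>b \<phi>(2))
    show "(\<lambda>w. \<kappa> n i w * \<phi> (X n (Suc i) w - B (h n) (k w))) \<in> borel_measurable M"
      using hp[of n] by (intro borel_measurable_times \<phi>m' borel_measurable_diff B_measurable XM \<kappa>M kM) auto
  qed
  have i2: "integrable M (\<lambda>w. \<kappa> n i w * P (h n) \<phi> (X n i w))" for n i
  proof (rule integrable_const_bound[of _ c])
    show "AE w in M. norm (\<kappa> n i w * P (h n) \<phi> (X n i w)) \<le> c"
      unfolding real_norm_def by (intro AE_I2 \<kappa>b P_bound[OF cp(1) \<phi>(2)])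
    show "(\<lambda>w. \<kappa> n i w * P (h n) \<phi> (X n i w)) \<in> borel_measurable M"
      by (intro borel_measurable_times Pm XM \<kappa>M)
  qed
  have mart: "(LINT w|M. \<kappa> n i w * \<phi> (X n (Suc i) w - B (h n) (k w))) = (LINT w|M. \<kappa> n i w * P (h n) \<phi> (X n i w))" for n i
  proof -
    let ?K = "\<lambda>w. (\<kappa> n i w, X n i w)"
    let ?f = "\<lambda>p :: (real \<times> 'h) \<times> 'h. (if fst (fst p) = 1 then 1 else 0) * \<phi> (S (h n) (snd (fst p)) + snd p)"
    have K: "?K \<in> F (t n i) \<rightarrow>\<^sub>M borel \<Otimes>\<^sub>M borel" using \<kappa>m Xm by measurable
    have fm: "?f \<in> borel_measurable ((borel \<Otimes>\<^sub>M borel) \<Otimes>\<^sub>M borel)"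
    proof (intro borel_measurable_times)
      show "(\<lambda>p :: (real \<times> 'h) \<times> 'h. if fst (fst p) = 1 then 1 else 0 :: real) \<in> borel_measurable ((borel \<Otimes>\<^sub>M borel) \<Otimes>\<^sub>M borel)" by measurable
      show "(\<lambda>p :: (real \<times> 'h) \<times> 'h. \<phi> (S (h n) (snd (fst p)) + snd p)) \<in> borel_measurable ((borel \<Otimes>\<^sub>M borel) \<Otimes>\<^sub>M borel)"
        by (rule borel_measurable_continuous_on[OF \<phi>(1)]) (intro borel_measurable_add S_measurable, measurable)
    qed
    have fb: "\<bar>?f p\<bar> \<le> c" for p using \<phi>(2) cp by auto
    have \<kappa>if: "(if \<kappa> n i w = 1 then 1 else 0) = \<kappa> n i w" for w using \<kappa>01[of n i w] by auto
    show ?thesis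
      using Y_markov[OF t0 less_imp_le[OF hp] K fm fb] unfolding Xpre by (simp add: \<kappa>if P_def)
  qed
  define Ms where "Ms n w = (\<Sum>i<Suc n. \<kappa> n i w * \<phi> (X n (Suc i) w - B (h n) (k w)) - \<kappa> n i w * P (h n) \<phi> (X n i w))" for n w
  have Mi: "integrable M (Ms n)" for n
    unfolding Ms_def[abs_def] by (intro Bochner_Integration.integrable_sum Bochner_Integration.integrable_diff i1 i2)
  have M0: "(LINT w|M. Ms n w) = 0" for n
    unfolding Ms_def using i1 i2 mart by (subst Bochner_Integration.integral_sum) auto
  define As where "As n w = (\<Sum>i<Suc n. \<kappa> n i w * (\<phi> (X n (Suc i) w) - \<phi> (X n i w)))" for n w
  define Qs where "Qs n w = (\<Sum>i<Suc n. \<kappa> n i w * (h n * q n i w))" for n w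
  define Ps where "Ps n w = (\<Sum>i<Suc n. \<kappa> n i w * (h n * ((P (h n) \<phi> (X n i w) - \<phi> (X n i w)) / h n)))" for n w
  have split: "As n w = Ms n w + (Qs n w + Ps n w)" for n w
  proof -
    have hz: "h n * (z / h n) = z" for z using hp[of n] by simp
    show ?thesis
      unfolding As_def Ms_def Qs_def Ps_def sum.distrib[symmetric] hq hz by (intro sum.cong refl) (simp add: algebra_simps)
  qed
  \<comment> \<open>The stopped sums are dominated, uniformly in \<open>n\<close>, by a constant plus a multiple of \<open>\<parallel>k\<parallel>\<close>.\<close>
  have Ab: "\<bar>As n w\<bar> \<le> 2 * c" for n w
    unfolding As_def \<kappa>_def by (rule alive_telescope) (rule \<phi>(2))
  have Qb: "\<bar>Qs n w\<bar> \<le> (b - a) * \<theta> w + 2 * c" for n w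
  proof -
    have "\<bar>Qs n w\<bar> \<le> real (Suc n) * (h n * \<theta> w) + 2 * c"
      unfolding Qs_def \<kappa>_def
    proof (rule alive_sum_bound)
      show "\<bar>h n * q n i w\<bar> \<le> 2 * c" for i
        unfolding hq using \<phi>(2)[of "X n (Suc i) w"] \<phi>(2)[of "X n (Suc i) w - B (h n) (k w)"] by linarith
    qed (use hp[of n] \<theta>p in auto)
    also have "real (Suc n) * (h n * \<theta> w) = (b - a) * \<theta> w" by (simp add: h_def)
    finally show ?thesis .
  qed
  have Pb: "\<bar>Ps n w\<bar> \<le> (b - a) * c'" for n w
  proof -
    have "\<bar>Ps n w\<bar> \<le> (\<Sum>i<Suc n. c' * h n)"
      unfolding Ps_def
    proof (rule order_trans[OF sum_abs sum_mono])
      fix i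
      have "\<bar>\<kappa> n i w\<bar> * \<bar>P (h n) \<phi> (X n i w) - \<phi> (X n i w)\<bar> \<le> 1 * (c' * h n)"
        by (intro mult_mono \<kappa>1 P_quot(1)[OF \<psi> dyn]) (use hp[of n] in auto)
      then show "\<bar>\<kappa> n i w * (h n * ((P (h n) \<phi> (X n i w) - \<phi> (X n i w)) / h n))\<bar> \<le> c' * h n"
        using hp[of n] by (simp add: abs_mult)
    qed
    also have "... = (b - a) * c'" by (simp add: h_def)
    finally show ?thesis .
  qed
  \<comment> \<open>Along one path the stopping is inactive on fine grids, and what remains are Riemann sums.\<close>
  let ?y = "\<lambda>w s. path a V k s w"
  have ycont: "continuous_on {a..b} (?y w)" if "w \<in> space M" for w
    by (rule continuous_on_subset[OF path_continuous[OF ab(1) that]]) auto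
  have Plim: "(\<lambda>n. Ps n w) \<longlonglongrightarrow> integral {a..b} (\<lambda>s. \<psi> (?y w s))"
    and Qlim: "(\<lambda>n. Qs n w) \<longlonglongrightarrow> integral {a..b} (\<lambda>s. D (?y w s) \<bullet> k w)"
    and Alim: "(\<lambda>n. As n w) \<longlonglongrightarrow> \<phi> (path a V k b w) - \<phi> (V w)" if w: "w \<in> space M" for w
  proof -
    have gD: "continuous_on UNIV (\<lambda>y. D y \<bullet> k w)" by (intro continuous_intros D)
    have pB: "((\<lambda>h. B h (k w)) \<longlongrightarrow> 0) (at_right 0)"
      by (rule B_tendsto_0) (auto intro!: tendsto_eq_intros eventually_at_rightI[of 0 1])
    have grid1: "a + real i * h n \<le> t n (Suc i) \<and> t n (Suc i) \<le> a + real (Suc i) * h n" for n i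
      using hp[of n] by (simp add: t_def algebra_simps)
    have grid2: "a + real i * h n \<le> t n i \<and> t n i \<le> a + real (Suc i) * h n" for n i
      using hp[of n] by (simp add: t_def algebra_simps)
    have qeq: "quot \<phi> (k w) (h n) (?y w (t n (Suc i)) - B (h n) (k w)) = q n i w" for n i
      by (simp add: q_def X_def)
    note gq = grid_sum_tendsto[where r="\<lambda>n i. t n (Suc i)", OF quot gD ycont[OF w] pB ab(2) h_def grid1, unfolded qeq]
    note gp = grid_sum_tendsto[where r=t and p="\<lambda>_. 0", OF P_quot(2)[OF \<psi> dyn] \<psi>(1) ycont[OF w] tendsto_const ab(2) h_def grid2]
    have one: "\<forall>\<^sub>F n in sequentially. \<forall>i\<le>Suc n. \<kappa> n i w = 1"
      using gq(2)
    proof eventually_elim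
      case (elim n)
      have "\<bar>q n i w\<bar> \<le> \<theta> w" if "i < Suc n" for i
      proof -
        have "\<bar>D (?y w (t n (Suc i))) \<bullet> k w\<bar> \<le> cD * norm (k w)"
          by (rule order_trans[OF Cauchy_Schwarz_ineq2 mult_right_mono[OF D(2)]]) simp
        then show ?thesis using elim that by (auto simp: \<theta>_def abs_le_iff dest!: spec[of _ i])
      qed
      then show ?case unfolding \<kappa>_def by (auto intro!: alive_eq_1)
    qed
    have "\<forall>\<^sub>F n in sequentially. (\<Sum>i<Suc n. h n * q n i w) = Qs n w"
      using one by eventually_elim (simp add: Qs_def)
    then show "(\<lambda>n. Qs n w) \<longlonglongrightarrow> integral {a..b} (\<lambda>s. D (?y w s) \<bullet> k w)"
      using gq(1) by (rule Lim_transform_eventually[rotated])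
    have "\<forall>\<^sub>F n in sequentially. (\<Sum>i<Suc n. h n * ((P (h n) \<phi> (?y w (t n i) - 0) - \<phi> (?y w (t n i) - 0)) / h n)) = Ps n w"
      using one by eventually_elim (simp add: Ps_def X_def)
    then show "(\<lambda>n. Ps n w) \<longlonglongrightarrow> integral {a..b} (\<lambda>s. \<psi> (?y w s))"
      using gp(1) by (rule Lim_transform_eventually[rotated])
    have "\<forall>\<^sub>F n in sequentially. As n w = \<phi> (path a V k b w) - \<phi> (V w)"
      using one
    proof eventually_elim
      case (elim n)
      then have "As n w = (\<Sum>i<Suc n. \<phi> (X n (Suc i) w) - \<phi> (X n i w))" by (simp add: As_def)
      also have "... = \<phi> (X n (Suc n) w) - \<phi> (X n 0 w)" by (rule sum_lessThan_telescope)
      also have "X n (Suc n) w = path a V k b w" unfolding X_def t_def hb ..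
      also have "X n 0 w = V w" by (simp add: X_def t_def)
      finally show ?case .
    qed
    then show "(\<lambda>n. As n w) \<longlonglongrightarrow> \<phi> (path a V k b w) - \<phi> (V w)" by (rule tendsto_eventually)
  qed
  have AM: "As n \<in> borel_measurable M" and QM: "Qs n \<in> borel_measurable M" and PM: "Ps n \<in> borel_measurable M" for n
    unfolding As_def[abs_def] Qs_def[abs_def] Ps_def[abs_def]
    by (intro borel_measurable_sum borel_measurable_times borel_measurable_diff borel_measurable_divide \<phi>m' Pm XM \<kappa>M qM borel_measurable_const)+
  have \<theta>i: "integrable M (\<lambda>w. (b - a) * \<theta> w + 2 * c)" unfolding \<theta>_def using ki by simp
  have endM: "(\<lambda>w. \<phi> (path a V k b w)) \<in> borel_measurable M" "(\<lambda>w. \<phi> (V w)) \<in> borel_measurable M"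
    using measurable_F[OF path_measurable[OF ab(1) less_imp_le[OF ab(2)] V k]] ab by (auto intro!: \<phi>m')
  have limM: "(\<lambda>w. integral {a..b} (\<lambda>s. \<psi> (?y w s))) \<in> borel_measurable M"
     "(\<lambda>w. integral {a..b} (\<lambda>s. D (?y w s) \<bullet> k w)) \<in> borel_measurable M"
    by (rule borel_measurable_LIMSEQ_real[OF Plim PM], assumption, rule borel_measurable_LIMSEQ_real[OF Qlim QM])
  have EA: "(\<lambda>n. LINT w|M. As n w) \<longlonglongrightarrow> (LINT w|M. \<phi> (path a V k b w) - \<phi> (V w))"
    by (rule integral_dominated_convergence[where w="\<lambda>_. 2 * c"]) (use endM AM Alim Ab in auto)
  have limQ: "AE w in M. (\<lambda>n. Qs n w) \<longlonglongrightarrow> integral {a..b} (\<lambda>s. D (?y w s) \<bullet> k w)"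
    and limP: "AE w in M. (\<lambda>n. Ps n w) \<longlonglongrightarrow> integral {a..b} (\<lambda>s. \<psi> (?y w s))"
    by (intro AE_I2 Qlim Plim; assumption)+
  have bQ: "AE w in M. norm (Qs n w) \<le> (b - a) * \<theta> w + 2 * c" and bP: "AE w in M. norm (Ps n w) \<le> (b - a) * c'" for n
    unfolding real_norm_def by (intro AE_I2 Qb Pb)+
  have ci: "integrable M (\<lambda>_. (b - a) * c')" by simp
  note EQ = integral_dominated_convergence[OF limM(2) QM \<theta>i limQ bQ]
  note EP = integral_dominated_convergence[OF limM(1) PM ci limP bP]
  note iQ = integrable_dominated_convergence[OF limM(2) QM \<theta>i limQ bQ]
  note iP = integrable_dominated_convergence[OF limM(1) PM ci limP bP]
  note iQn = integrable_dominated_convergence2[OF limM(2) QM \<theta>i limQ bQ]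
  note iPn = integrable_dominated_convergence2[OF limM(1) PM ci limP bP]
  have eqn: "(LINT w|M. As n w) = (LINT w|M. Qs n w) + (LINT w|M. Ps n w)" for n
    unfolding split using Mi iQn iPn M0 by simp
  have "(\<lambda>n. LINT w|M. As n w) \<longlonglongrightarrow> (LINT w|M. integral {a..b} (\<lambda>s. D (?y w s) \<bullet> k w)) + (LINT w|M. integral {a..b} (\<lambda>s. \<psi> (?y w s)))"
    unfolding eqn by (intro tendsto_add EQ EP)
  with EA have lim_eq: "(LINT w|M. \<phi> (path a V k b w) - \<phi> (V w)) =
      (LINT w|M. integral {a..b} (\<lambda>s. D (?y w s) \<bullet> k w)) + (LINT w|M. integral {a..b} (\<lambda>s. \<psi> (?y w s)))"
    by (rule LIMSEQ_unique)
  have both: "integral {a..b} (\<lambda>s. \<psi> (?y w s) + D (?y w s) \<bullet> k w) =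
      integral {a..b} (\<lambda>s. D (?y w s) \<bullet> k w) + integral {a..b} (\<lambda>s. \<psi> (?y w s))" if w: "w \<in> space M" for w
  proof -
    have "(\<lambda>s. \<psi> (?y w s)) integrable_on {a..b}" "(\<lambda>s. D (?y w s) \<bullet> k w) integrable_on {a..b}"
      by (auto intro!: integrable_continuous_real continuous_intros continuous_on_compose2[OF \<psi>(1) ycont[OF w]] continuous_on_compose2[OF D(1) ycont[OF w]])
    then show ?thesis by (simp add: Henstock_Kurzweil_Integration.integral_add)
  qed
  have i\<phi>: "integrable M (\<lambda>w. \<phi> (path a V k b w))" "integrable M (\<lambda>w. \<phi> (V w))"
    by (rule integrable_const_bound[of _ c]; use endM \<phi>(2) in auto)+
  have sumi: "integrable M (\<lambda>w. integral {a..b} (\<lambda>s. D (?y w s) \<bullet> k w) + integral {a..b} (\<lambda>s. \<psi> (?y w s)))"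
    by (intro Bochner_Integration.integrable_add iQ iP)
  have e: "(LINT w|M. integral {a..b} (\<lambda>s. \<psi> (?y w s) + D (?y w s) \<bullet> k w)) =
     (LINT w|M. integral {a..b} (\<lambda>s. D (?y w s) \<bullet> k w) + integral {a..b} (\<lambda>s. \<psi> (?y w s)))"
    by (intro Bochner_Integration.integral_cong refl both)
  show "(LINT w|M. \<phi> (path a V k b w)) - (LINT w|M. \<phi> (V w)) =
     (LINT w|M. integral {a..b} (\<lambda>t. \<psi> (path a V k t w) + D (path a V k t w) \<bullet> k w))"
    unfolding e Bochner_Integration.integral_add[OF iQ iP] lim_eq[symmetric] Bochner_Integration.integral_diff[OF i\<phi>] ..
  show "integrable M (\<lambda>w. integral {a..b} (\<lambda>t. \<psi> (path a V k t w) + D (path a V k t w) \<bullet> k w))"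
    using sumi by (rule Bochner_Integration.integrable_cong[THEN iffD1, rotated -1]) (simp_all add: both)
qed

end

section \<open>Approximation of a control by step controls\<close>

text \<open>The process is the limit of its values at the next grid point, a countable family of times.\<close>

lemma continuous_process_measurable:
  fixes Z :: "real => 'w => 'a::metric_space"
  assumes cont: "\<And>w. w \<in> space M ==> continuous_on {0..} (\<lambda>t. Z t w)"
    and meas: "\<And>t. t \<ge> 0 ==> Z t \<in> borel_measurable M"
  shows "(\<lambda>q. Z (fst q) (snd q)) \<in> borel_measurable (Leb T \<Otimes>\<^sub>M M)"
proof (rule borel_measurable_LIMSEQ_metric)
  fix n :: nat
  have [measurable]: "fst \<in> borel_measurable (Leb T \<Otimes>\<^sub>M M)" by (rule measurable_compose[OF measurable_fst id_Leb])
  have "(\<lambda>q. Z (real i / real (Suc n)) (snd q)) \<in> borel_measurable (Leb T \<Otimes>\<^sub>M M)" for i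
    by (rule measurable_compose[OF measurable_snd meas]) simp
  then show "(\<lambda>q. Z (real (nat \<lceil>fst q * real (Suc n)\<rceil>) / real (Suc n)) (snd q)) \<in> borel_measurable (Leb T \<Otimes>\<^sub>M M)"
    by (rule measurable_compose_countable) measurable
next
  fix q assume q: "q \<in> space (Leb T \<Otimes>\<^sub>M M)"
  then have s: "0 < fst q" and w: "snd q \<in> space M" by (auto simp: space_pair_measure)
  define r where "r n = real (nat \<lceil>fst q * real (Suc n)\<rceil>) / real (Suc n)" for n
  have r: "fst q \<le> r n" "r n \<le> fst q + inverse (real (Suc n))" for n
  proof -
    have "0 < fst q * real (Suc n)" using s by simp
    then have e: "real (nat \<lceil>fst q * real (Suc n)\<rceil>) = real_of_int \<lceil>fst q * real (Suc n)\<rceil>" by linarith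
    then have e2: "fst q * real (Suc n) \<le> real (nat \<lceil>fst q * real (Suc n)\<rceil>)" "real (nat \<lceil>fst q * real (Suc n)\<rceil>) \<le> fst q * real (Suc n) + 1"
      by linarith+
    have "fst q \<le> r n" unfolding r_def using e2(1) by (simp only: pos_le_divide_eq of_nat_0_less_iff zero_less_Suc)
    moreover have "r n \<le> (fst q * real (Suc n) + 1) / real (Suc n)"
      unfolding r_def using e2(2) by (rule divide_right_mono) simp
    ultimately show "fst q \<le> r n" "r n \<le> fst q + inverse (real (Suc n))"
      by (simp_all add: add_divide_distrib inverse_eq_divide)
  qed
  have "r \<longlonglongrightarrow> fst q"
  proof (rule tendsto_sandwich[of "\<lambda>_. fst q" r _ "\<lambda>n. fst q + inverse (real (Suc n))"])
    show "(\<lambda>n. fst q + inverse (real (Suc n))) \<longlonglongrightarrow> fst q"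
      by (rule LIMSEQ_inverse_real_of_nat_add)
    show "(\<lambda>n. fst q) \<longlonglongrightarrow> fst q" by simp
  qed (use r in auto)
  then show "(\<lambda>n. Z (real (nat \<lceil>fst q * real (Suc n)\<rceil>) / real (Suc n)) (snd q)) \<longlonglongrightarrow> Z (fst q) (snd q)"
    unfolding r_def[symmetric]
    by (rule continuous_on_tendsto_compose[OF cont[OF w]]) (use s order_trans[OF less_imp_le[OF s] r(1)] in auto)
qed

text \<open>Here \<open>l\<close> stands for \<open>L\<close> applied to the control, modified on a null set so that all its paths are
  locally in \<open>L\<^sup>p\<close>.\<close>

locale controlled = continuous_noise M F W S \<sigma> E cG aG \<beta> Y
  for M :: "'w measure" and F W and S :: "real => 'h::{real_inner,banach,second_countable_topology} \<Rightarrow>\<^sub>L 'h" and \<sigma>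
    and E :: "real => 'k::{real_inner,banach,second_countable_topology} \<Rightarrow>\<^sub>L 'h" and cG aG \<beta> Y +
  fixes l :: "real => 'w => 'k" and T p :: real
  assumes T: "0 < T" and p: "1 / (1 - \<beta>) < p"
    and l_measurable: "(\<lambda>q. l (fst q) (snd q)) \<in> borel_measurable (borel \<Otimes>\<^sub>M M)"
    and l_adapted: "t > 0 ==> (\<lambda>q. l (fst q) (snd q)) \<in> borel_measurable (Leb t \<Otimes>\<^sub>M F t)"
    and l_p: "w \<in> space M ==> (\<integral>\<^sup>+ s\<in>{0..T}. ennreal (norm (l s w) powr p) \<partial>lborel) < \<infinity>"
    and l_1: "(\<integral>\<^sup>+ w. L1 (Leb T) (\<lambda>s. l s w) \<partial>M) < \<infinity>"
begin

abbreviation Q :: "(real \<times> 'w) measure" where "Q \<equiv> Leb T \<Otimes>\<^sub>M M"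

lemma p_gt_1: "1 < p"
proof -
  have "1 \<le> 1 / (1 - \<beta>)" using \<beta> by (simp add: field_simps)
  then show ?thesis using p by linarith
qed

lemma pair_Q: "pair_sigma_finite (Leb T) M"
proof -
  interpret L: finite_measure "Leb T" by (rule finite_Leb)
  show ?thesis by unfold_locales
qed

interpretation Q: pair_sigma_finite "Leb T" M by (rule pair_Q)

lemma measurable_Q: "f \<in> borel \<Otimes>\<^sub>M M \<rightarrow>\<^sub>M L ==> f \<in> Q \<rightarrow>\<^sub>M L"
proof -
  assume f: "f \<in> borel \<Otimes>\<^sub>M M \<rightarrow>\<^sub>M L"
  have "(\<lambda>q. (fst q, snd q)) \<in> Q \<rightarrow>\<^sub>M borel \<Otimes>\<^sub>M M"
    by (intro measurable_Pair measurable_compose[OF measurable_fst id_Leb] measurable_snd)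
  from measurable_compose[OF this f] show ?thesis by simp
qed

lemma section_borel: "(\<lambda>q. f (fst q) (snd q)) \<in> borel \<Otimes>\<^sub>M M \<rightarrow>\<^sub>M L ==> w \<in> space M ==> (\<lambda>s. f s w) \<in> borel \<rightarrow>\<^sub>M L"
  by (drule measurable_compose[OF measurable_Pair2', rotated]) simp_all

lemma nn_integral_section: "f \<in> borel_measurable Q ==> (\<lambda>w. \<integral>\<^sup>+ s. f (s, w) \<partial>Leb T) \<in> borel_measurable M" for f :: "_ => ennreal"
  using Q.M1.borel_measurable_nn_integral_fst[OF measurable_pair_swap[of f]] by simp

lemmas l_section = section_borel[OF l_measurable]

lemma l_Q [measurable]: "(\<lambda>q. l (fst q) (snd q)) \<in> borel_measurable Q" by (rule measurable_Q[OF l_measurable])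

lemma l_integrable:
  assumes w: "w \<in> space M"
  shows "integrable (Leb T) (\<lambda>s. l s w)"
  unfolding integrable_iff_bounded
proof
  show "(\<lambda>s. l s w) \<in> borel_measurable (Leb T)" by (rule measurable_Leb[OF l_section[OF w]])
  show "L1 (Leb T) (\<lambda>s. l s w) < \<infinity>"
    by (rule order.strict_trans1[OF L1_Leb_le_powr[OF p_gt_1 l_section[OF w] less_imp_le[OF T]]]) (use l_p[OF w] in simp)
qed

lemma l_integrable_Q: "integrable Q (\<lambda>q. l (fst q) (snd q))"
  unfolding integrable_iff_bounded
proof
  have "L1 Q (\<lambda>q. l (fst q) (snd q)) = (\<integral>\<^sup>+ w. L1 (Leb T) (\<lambda>s. l s w) \<partial>M)"
    by (subst Q.nn_integral_snd[symmetric]) auto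
  then show "L1 Q (\<lambda>q. l (fst q) (snd q)) < \<infinity>" using l_1 by simp
qed measurable

definition lstep :: "nat => real => 'w => 'k" where
  "lstep n s w = block_avg T n (\<lambda>r. l r w) s"

text \<open>The value of the step control on the cell with number \<open>j\<close>; it depends on the control before that cell.\<close>

definition lcell :: "nat => nat => 'w => 'k" where
  "lcell n j w = (LINT r|Leb T. (of_bool (\<lceil>r * real (Suc n) / T\<rceil> = int j) * (real (Suc n) / T)) *\<^sub>R l r w)"

lemma lstep_cell:
  assumes "real j * (T / real (Suc n)) < s" "s \<le> real (Suc j) * (T / real (Suc n))"
  shows "lstep n s w = lcell n j w"
proof -
  have "\<lceil>s * real (Suc n) / T\<rceil> = int (Suc j)" using block_iff[OF T, of s n "int (Suc j)"] assms by simp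
  then have "prev_block T n s r \<longleftrightarrow> \<lceil>r * real (Suc n) / T\<rceil> = int j" for r by (auto simp: prev_block_def)
  then show ?thesis by (simp add: lstep_def lcell_def block_avg_def)
qed

lemma lstep_measurable: "(\<lambda>q. lstep n (fst q) (snd q)) \<in> borel_measurable (borel \<Otimes>\<^sub>M M)"
proof -
  have snd_Leb: "snd \<in> borel_measurable ((borel \<Otimes>\<^sub>M M) \<Otimes>\<^sub>M Leb T)" by (rule measurable_compose[OF measurable_snd id_Leb])
  have fst1: "(\<lambda>q. fst (fst q)) \<in> borel_measurable ((borel \<Otimes>\<^sub>M M) \<Otimes>\<^sub>M Leb T)" by measurable
  have 1: "(\<lambda>q. l (snd q) (snd (fst q))) \<in> borel_measurable ((borel \<Otimes>\<^sub>M M) \<Otimes>\<^sub>M Leb T)"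
  proof -
    have "(\<lambda>q. (snd q, snd (fst q))) \<in> (borel \<Otimes>\<^sub>M M) \<Otimes>\<^sub>M Leb T \<rightarrow>\<^sub>M borel \<Otimes>\<^sub>M M"
      by (intro measurable_Pair snd_Leb) measurable
    from measurable_compose[OF this l_measurable] show ?thesis by simp
  qed
  have 2: "Measurable.pred ((borel \<Otimes>\<^sub>M M) \<Otimes>\<^sub>M Leb T) (\<lambda>q. prev_block T n (fst (fst q)) (snd q))"
    using measurable_compose[OF measurable_Pair[OF fst1 snd_Leb] prev_block_pred] by simp
  show ?thesis unfolding lstep_def block_avg_def
    by (rule Q.M1.borel_measurable_lebesgue_integral, unfold case_prod_beta')
       (intro borel_measurable_scaleR borel_measurable_times 1 borel_measurable_const measurable_compose[OF 2], simp)
qed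

lemmas lstep_section = section_borel[OF lstep_measurable]

lemma lstep_Q [measurable]: "(\<lambda>q. lstep n (fst q) (snd q)) \<in> borel_measurable Q" by (rule measurable_Q[OF lstep_measurable])

lemma norm_block_le:
  assumes w: "w \<in> space M"
  shows "norm (LINT r|Leb T. (of_bool (b r) * (real (Suc n) / T)) *\<^sub>R l r w) \<le> real (Suc n) / T * (LINT r|Leb T. norm (l r w))"
proof -
  have "norm (LINT r|Leb T. (of_bool (b r) * (real (Suc n) / T)) *\<^sub>R l r w) \<le> (LINT r|Leb T. norm ((of_bool (b r) * (real (Suc n) / T)) *\<^sub>R l r w))"
    by (rule integral_norm_bound)
  also have "... \<le> (LINT r|Leb T. real (Suc n) / T * norm (l r w))"
    using T by (intro integral_mono' integrable_mult_right integrable_norm l_integrable[OF w]) (auto simp: of_bool_def)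
  finally show ?thesis by simp
qed

lemma lstep_p:
  assumes w: "w \<in> space M"
  shows "(\<integral>\<^sup>+ s\<in>{0..T}. ennreal (norm (lstep n s w) powr p) \<partial>lborel) < \<infinity>"
proof -
  define K where "K = real (Suc n) / T * (LINT r|Leb T. norm (l r w))"
  have "(\<integral>\<^sup>+ s\<in>{0..T}. ennreal (norm (lstep n s w) powr p) \<partial>lborel) \<le> (\<integral>\<^sup>+ s\<in>{0..T}. ennreal (K powr p) \<partial>lborel)"
    using p_gt_1 norm_block_le[OF w]
    by (intro nn_integral_mono mult_right_mono ennreal_leI powr_mono2) (auto simp: lstep_def block_avg_def K_def)
  also have "... < \<infinity>" using T by (subst nn_integral_cmult_indicator) (auto simp: ennreal_mult_less_top)
  finally show ?thesis .
qed

lemmas conv_l_integrable = conv_set_integrable[OF p l_section l_p]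
  and conv_lstep_integrable = conv_set_integrable[OF p lstep_section lstep_p]

lemma lcell_measurable:
  assumes j: "j \<le> Suc n"
  shows "lcell n j \<in> borel_measurable (F (real j * (T / real (Suc n))))"
proof (cases "j = 0")
  case True
  have "lcell n j w = (LINT r|Leb T. 0)" for w
    unfolding lcell_def
  proof (rule Bochner_Integration.integral_cong[OF refl])
    fix r assume "r \<in> space (Leb T)"
    then have "0 < r * real (Suc n) / T" using T by simp
    then have "\<lceil>r * real (Suc n) / T\<rceil> \<noteq> int j" using True by linarith
    then show "(of_bool (\<lceil>r * real (Suc n) / T\<rceil> = int j) * (real (Suc n) / T)) *\<^sub>R l r w = 0" by simp
  qed
  then show ?thesis by (subst measurable_cong[where g="\<lambda>_. 0"]) auto
next
  case False
  define t where "t = real j * (T / real (Suc n))"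
  have t: "0 < t" using False T by (simp add: t_def)
  have "real j * T \<le> real (Suc n) * T" using j T by (intro mult_right_mono) auto
  then have tT: "t \<le> T" unfolding t_def by (simp add: field_simps)
  have eq: "lcell n j w = (LINT r|Leb t. (of_bool (\<lceil>r * real (Suc n) / T\<rceil> = int j) * (real (Suc n) / T)) *\<^sub>R l r w)" for w
    unfolding lcell_def integral_Leb set_lebesgue_integral_def
  proof (rule Bochner_Integration.integral_cong[OF refl])
    fix r
    have "\<lceil>r * real (Suc n) / T\<rceil> = int j ==> r \<le> t" using block_iff[OF T, of r n "int j"] by (simp add: t_def)
    then show "indicator {0<..T} r *\<^sub>R (of_bool (\<lceil>r * real (Suc n) / T\<rceil> = int j) * (real (Suc n) / T)) *\<^sub>R l r w =
      indicator {0<..t} r *\<^sub>R (of_bool (\<lceil>r * real (Suc n) / T\<rceil> = int j) * (real (Suc n) / T)) *\<^sub>R l r w"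
      using tT by (auto simp: indicator_def)
  qed
  have meas: "(\<lambda>w. LINT r|Leb t. (of_bool (\<lceil>r * real (Suc n) / T\<rceil> = int j) * (real (Suc n) / T)) *\<^sub>R l r w) \<in> borel_measurable (F t)"
  proof -
    interpret L: finite_measure "Leb t" by (rule finite_Leb)
    have snd_Leb: "snd \<in> borel_measurable (F t \<Otimes>\<^sub>M Leb t)" by (rule measurable_compose[OF measurable_snd id_Leb])
    have 1: "(\<lambda>q. l (snd q) (fst q)) \<in> borel_measurable (F t \<Otimes>\<^sub>M Leb t)"
      using measurable_compose[OF measurable_Pair[OF measurable_snd measurable_fst] l_adapted[OF t]] by simp
    have 2: "Measurable.pred (F t \<Otimes>\<^sub>M Leb t) (\<lambda>q. \<lceil>snd q * real (Suc n) / T\<rceil> = int j)"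
      by (rule measurable_compose[OF snd_Leb]) measurable
    show ?thesis using 1 2 by (intro L.borel_measurable_lebesgue_integral) (simp add: case_prod_beta)
  qed
  show ?thesis unfolding t_def[symmetric] eq[abs_def] by (rule meas)
qed

lemma lcell_integrable:
  assumes j: "j \<le> Suc n"
  shows "integrable M (\<lambda>w. norm (lcell n j w))"
proof (rule Bochner_Integration.integrable_bound)
  have "integrable M (\<lambda>w. LINT r|Leb T. norm (l r w))"
    using Q.integrable_snd[of "\<lambda>s w. norm (l s w)"] integrable_norm[OF l_integrable_Q] by (simp add: case_prod_beta')
  then show "integrable M (\<lambda>w. real (Suc n) / T * (LINT r|Leb T. norm (l r w)))" by simp
  show "(\<lambda>w. norm (lcell n j w)) \<in> borel_measurable M"
    using measurable_F[OF lcell_measurable[OF j]] T by simp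
  show "AE w in M. norm (norm (lcell n j w)) \<le> norm (real (Suc n) / T * (LINT r|Leb T. norm (l r w)))"
    using norm_block_le T by (auto simp: lcell_def abs_mult intro!: AE_I2)
qed

text \<open>Path by path the averages converge in \<open>L\<^sup>1\<close>, dominated by twice the norm of the control.\<close>

lemma lstep_L1: "(\<lambda>n. L1 Q (\<lambda>q. lstep n (fst q) (snd q) - l (fst q) (snd q))) \<longlonglongrightarrow> 0"
proof -
  have eq: "L1 Q (\<lambda>q. lstep n (fst q) (snd q) - l (fst q) (snd q)) =
    (\<integral>\<^sup>+ w. L1 (Leb T) (\<lambda>s. lstep n s w - l s w) \<partial>M)" for n
    by (subst Q.nn_integral_snd[symmetric]) auto
  have "(\<lambda>n. \<integral>\<^sup>+ w. L1 (Leb T) (\<lambda>s. lstep n s w - l s w) \<partial>M) \<longlonglongrightarrow> (\<integral>\<^sup>+ w. 0 \<partial>M)"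
  proof (rule nn_integral_dominated_convergence[where w="\<lambda>w. 2 * (L1 (Leb T) (\<lambda>s. l s w))"])
    show "(\<lambda>w. L1 (Leb T) (\<lambda>s. lstep n s w - l s w)) \<in> borel_measurable M" for n
      using nn_integral_section[of "\<lambda>q. ennreal (norm (lstep n (fst q) (snd q) - l (fst q) (snd q)))"] by simp
    have lm: "(\<lambda>w. L1 (Leb T) (\<lambda>s. l s w)) \<in> borel_measurable M"
      using nn_integral_section[of "\<lambda>q. ennreal (norm (l (fst q) (snd q)))"] by simp
    then show "(\<lambda>w. 2 * (L1 (Leb T) (\<lambda>s. l s w))) \<in> borel_measurable M" by simp
    show "(\<integral>\<^sup>+ w. 2 * (L1 (Leb T) (\<lambda>s. l s w)) \<partial>M) < \<infinity>"
      using l_1 by (subst nn_integral_cmult[OF lm]) (auto simp: ennreal_mult_less_top)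
    show "AE w in M. L1 (Leb T) (\<lambda>s. lstep n s w - l s w) \<le> 2 * (L1 (Leb T) (\<lambda>s. l s w))" for n
    proof (rule AE_I2)
      fix w assume w: "w \<in> space M"
      have m: "(\<lambda>s. lstep n s w) \<in> borel_measurable (Leb T)" "(\<lambda>s. l s w) \<in> borel_measurable (Leb T)"
        using lstep_section[OF w] l_section[OF w] by (auto intro: measurable_Leb)
      have "L1 (Leb T) (\<lambda>s. lstep n s w - l s w) \<le> (\<integral>\<^sup>+ s. ennreal (norm (lstep n s w)) + ennreal (norm (l s w)) \<partial>Leb T)"
        by (intro nn_integral_mono) (simp add: norm_triangle_ineq4 flip: ennreal_plus)
      also have "... = L1 (Leb T) (\<lambda>s. lstep n s w) + L1 (Leb T) (\<lambda>s. l s w)"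
        using m by (intro nn_integral_add) auto
      also have "... \<le> L1 (Leb T) (\<lambda>s. l s w) + L1 (Leb T) (\<lambda>s. l s w)"
        unfolding lstep_def by (intro add_right_mono block_avg_contraction l_integrable[OF w] T)
      finally show "L1 (Leb T) (\<lambda>s. lstep n s w - l s w) \<le> 2 * (L1 (Leb T) (\<lambda>s. l s w))"
        by (simp add: mult_2)
    qed
    show "AE w in M. (\<lambda>n. L1 (Leb T) (\<lambda>s. lstep n s w - l s w)) \<longlonglongrightarrow> 0"
      using block_conv_integrable[OF T l_integrable] unfolding block_conv_def lstep_def by (intro AE_I2) blast
  qed simp
  then show ?thesis by (simp add: eq)
qed

lemma conv_Q:
  assumes "(\<lambda>q. f (fst q) (snd q)) \<in> borel_measurable (borel \<Otimes>\<^sub>M M)"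
  shows "(\<lambda>q. conv (\<lambda>s. f s (snd q)) (fst q)) \<in> borel_measurable Q"
proof (rule conv_measurable_param)
  show "fst \<in> borel_measurable Q" by (rule measurable_compose[OF measurable_fst id_Leb])
  have "(\<lambda>q. (snd q, snd (fst q))) \<in> Q \<Otimes>\<^sub>M borel \<rightarrow>\<^sub>M borel \<Otimes>\<^sub>M M" by measurable
  from measurable_compose[OF this assms] show "(\<lambda>p. f (snd p) (snd (fst p))) \<in> borel_measurable (Q \<Otimes>\<^sub>M borel)" by simp
qed

lemma conv_lstep_diff:
  assumes w: "w \<in> space M" and t: "0 \<le> t" "t \<le> T"
  shows "conv (\<lambda>s. lstep n s w) t - conv (\<lambda>s. l s w) t = conv (\<lambda>s. lstep n s w - l s w) t"
  unfolding conv_def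
  by (subst set_integral_diff(2)[symmetric, OF conv_lstep_integrable[OF w w t] conv_l_integrable[OF w w t]])
     (simp add: blinfun.diff_right)

lemma conv_lstep_L1: "(\<lambda>n. L1 Q (\<lambda>q. conv (\<lambda>s. lstep n s (snd q)) (fst q) - conv (\<lambda>s. l s (snd q)) (fst q))) \<longlonglongrightarrow> 0"
proof -
  obtain C where C: "C > 0" "\<And>l. l \<in> borel_measurable borel ==>
     (L1 (Leb T) (conv l)) \<le> ennreal C * (L1 (Leb T) l)"
    using conv_L1[OF less_imp_le[OF T]] by blast
  note conv_Q[OF lstep_measurable, measurable] conv_Q[OF l_measurable, measurable]
  have le: "L1 Q (\<lambda>q. conv (\<lambda>s. lstep n s (snd q)) (fst q) - conv (\<lambda>s. l s (snd q)) (fst q))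
     \<le> ennreal C * (L1 Q (\<lambda>q. lstep n (fst q) (snd q) - l (fst q) (snd q)))" for n
  proof -
    have "L1 Q (\<lambda>q. conv (\<lambda>s. lstep n s (snd q)) (fst q) - conv (\<lambda>s. l s (snd q)) (fst q))
      = (\<integral>\<^sup>+ w. L1 (Leb T) (\<lambda>t. conv (\<lambda>s. lstep n s w) t - conv (\<lambda>s. l s w) t) \<partial>M)"
      by (subst Q.nn_integral_snd[symmetric]) auto
    also have "... = (\<integral>\<^sup>+ w. L1 (Leb T) (\<lambda>t. conv (\<lambda>s. lstep n s w - l s w) t) \<partial>M)"
      by (intro nn_integral_cong) (simp add: conv_lstep_diff)
    also have "... \<le> (\<integral>\<^sup>+ w. ennreal C * (L1 (Leb T) (\<lambda>s. lstep n s w - l s w)) \<partial>M)"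
      by (intro nn_integral_mono C(2) borel_measurable_diff lstep_section l_section)
    also have "... = ennreal C * (\<integral>\<^sup>+ w. L1 (Leb T) (\<lambda>s. lstep n s w - l s w) \<partial>M)"
      using nn_integral_section[of "\<lambda>q. ennreal (norm (lstep n (fst q) (snd q) - l (fst q) (snd q)))"]
      by (intro nn_integral_cmult) simp
    also have "(\<integral>\<^sup>+ w. L1 (Leb T) (\<lambda>s. lstep n s w - l s w) \<partial>M) =
       L1 Q (\<lambda>q. lstep n (fst q) (snd q) - l (fst q) (snd q))"
      by (subst Q.nn_integral_snd[symmetric]) auto
    finally show ?thesis .
  qed
  have "(\<lambda>n. ennreal C * (L1 Q (\<lambda>q. lstep n (fst q) (snd q) - l (fst q) (snd q)))) \<longlonglongrightarrow> ennreal C * 0"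
    by (intro ennreal_tendsto_cmult lstep_L1) simp
  then show ?thesis
    by (intro tendsto_zero_ennreal_le[OF _ le]) simp
qed

end

section \<open>The undiscounted and the discounted formula\<close>

lemma AE_Leb_dense:
  assumes P: "AE t in Leb T. R t" and a: "0 \<le> a" "a < T"
  shows "\<exists>t. a < t \<and> t < T \<and> R t"
proof (rule ccontr)
  assume n: "\<not> ?thesis"
  have "AE t in lborel. t \<in> {0<..T} --> R t"
    using P unfolding Leb_def by (subst (asm) AE_restrict_space_iff) auto
  then have "AE t in lborel. t \<notin> {a<..<T}"
    by eventually_elim (use n a in auto)
  then have "emeasure lborel {a<..<T} = 0"
    by (subst (asm) AE_iff_null_sets[symmetric]) auto
  then show False using a by simp
qed

lemma integral_Leb_exp:
  assumes s: "0 \<le> s" "s \<le> T"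
  shows "(LINT t|Leb T. of_bool (s \<le> t) * (lam * exp (- lam * t))) = exp (- lam * s) - exp (- lam * T)"
proof -
  have "(LINT t|Leb T. of_bool (s \<le> t) * (lam * exp (- lam * t))) = (LINT t|lborel. indicator {s..T} t *\<^sub>R (lam * exp (- lam * t)))"
    unfolding integral_Leb set_lebesgue_integral_def
  proof (rule integral_cong_AE)
    show "AE t in lborel. indicator {0<..T} t *\<^sub>R (of_bool (s \<le> t) * (lam * exp (- lam * t))) = indicator {s..T} t *\<^sub>R (lam * exp (- lam * t))"
      using AE_lborel_singleton[of 0] by eventually_elim (use s in "auto simp: indicator_def")
  qed measurable
  also have "... = - exp (- lam * T) - (- exp (- lam * s))"
    by (rule integral_FTC_Icc[OF s(2)])
       (auto intro!: derivative_eq_intros continuous_intros simp flip: has_real_derivative_iff_has_vector_derivative)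
  finally show ?thesis by simp
qed

text \<open>Integration by parts against \<open>exp (- lam t)\<close> in integrated form, where \<open>m\<close> is known only for almost every
  time and at the end: exchange the order of integration in the double integral over \<open>s \<le> t\<close>.\<close>

lemma discounted_integral:
  fixes m w :: "real => real"
  assumes T: "0 < T" and w: "integrable (Leb T) w"
    and m: "AE t in Leb T. m t = m0 + (LINT s|Leb T. of_bool (s \<le> t) * w s)" and mM: "m \<in> borel_measurable (Leb T)"
    and mT: "m T = m0 + (LINT s|Leb T. w s)"
  shows "exp (- lam * T) * m T = m0 + (LINT t|Leb T. exp (- lam * t) * (w t - lam * m t))"
proof -
  interpret L: finite_measure "Leb T" by (rule finite_Leb)
  interpret LL: pair_sigma_finite "Leb T" "Leb T" by unfold_locales
  note id_Leb [measurable]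
  have [measurable]: "w \<in> borel_measurable (Leb T)" using w by simp
  have f1 [measurable]: "fst \<in> borel_measurable (Leb T \<Otimes>\<^sub>M Leb T)" and f2 [measurable]: "snd \<in> borel_measurable (Leb T \<Otimes>\<^sub>M Leb T)"
    by (rule measurable_compose[OF measurable_fst id_Leb], rule measurable_compose[OF measurable_snd id_Leb])
  have w2 [measurable]: "(\<lambda>q. w (snd q)) \<in> borel_measurable (Leb T \<Otimes>\<^sub>M Leb T)"
    by (rule measurable_compose[OF measurable_snd]) measurable
  define K where "K t s = of_bool (s \<le> t) * (lam * exp (- lam * t)) * w s" for t s
  have eb: "exp (- lam * t) \<le> exp (\<bar>lam\<bar> * T)" if "t \<in> {0<..T}" for t
  proof -
    have "- lam * t \<le> \<bar>lam\<bar> * t" using that by (intro mult_right_mono) auto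
    also have "... \<le> \<bar>lam\<bar> * T" using that by (intro mult_left_mono) auto
    finally show ?thesis by simp
  qed
  have wi2: "integrable (Leb T \<Otimes>\<^sub>M Leb T) (\<lambda>q. w (snd q))"
    unfolding integrable_iff_bounded
  proof
    have "L1 (Leb T \<Otimes>\<^sub>M Leb T) (\<lambda>q. w (snd q)) = (\<integral>\<^sup>+ t. L1 (Leb T) w \<partial>Leb T)"
      by (subst L.nn_integral_fst[symmetric]) auto
    also have "... < \<infinity>"
    proof -
      have "emeasure (Leb T) {0<..T} < \<infinity>" using L.emeasure_finite[of "{0<..T}"] by (simp only: less_top[symmetric] infinity_ennreal_def simp_thms)
      then show ?thesis using w by (simp add: integrable_iff_bounded ennreal_mult_less_top)
    qed
    finally show "L1 (Leb T \<Otimes>\<^sub>M Leb T) (\<lambda>q. w (snd q)) < \<infinity>" .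
  qed measurable
  have Ki: "integrable (Leb T \<Otimes>\<^sub>M Leb T) (case_prod K)"
  proof (rule Bochner_Integration.integrable_bound)
    show "integrable (Leb T \<Otimes>\<^sub>M Leb T) (\<lambda>q. (\<bar>lam\<bar> * exp (\<bar>lam\<bar> * T)) * w (snd q))" using wi2 by simp
    show "case_prod K \<in> borel_measurable (Leb T \<Otimes>\<^sub>M Leb T)" unfolding K_def case_prod_beta' by measurable
    show "AE q in Leb T \<Otimes>\<^sub>M Leb T. norm (case_prod K q) \<le> norm (\<bar>lam\<bar> * exp (\<bar>lam\<bar> * T) * w (snd q))"
      using eb by (intro AE_I2) (auto simp: K_def case_prod_beta' space_pair_measure abs_mult of_bool_def intro!: mult_right_mono mult_left_mono)
  qed
  have ew: "integrable (Leb T) (\<lambda>t. exp (- lam * t) * w t)"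
  proof (rule Bochner_Integration.integrable_bound)
    show "integrable (Leb T) (\<lambda>t. exp (\<bar>lam\<bar> * T) * w t)" using w by simp
    show "AE t in Leb T. norm (exp (- lam * t) * w t) \<le> norm (exp (\<bar>lam\<bar> * T) * w t)"
      using eb by (intro AE_I2) (auto simp: abs_mult intro!: mult_right_mono)
  qed measurable
  have el: "integrable (Leb T) (\<lambda>t. lam * exp (- lam * t) * m0)"
  proof (rule L.integrable_const_bound)
    show "AE t in Leb T. norm (lam * exp (- lam * t) * m0) \<le> \<bar>lam\<bar> * exp (\<bar>lam\<bar> * T) * \<bar>m0\<bar>"
      using eb by (intro AE_I2) (auto simp: abs_mult intro!: mult_right_mono mult_left_mono)
  qed measurable
  have Kt: "(LINT s|Leb T. K t s) = lam * exp (- lam * t) * (LINT s|Leb T. of_bool (s \<le> t) * w s)" for t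
    unfolding K_def by (subst integral_mult_right_zero[symmetric]) (simp add: mult_ac)
  have KI: "integrable (Leb T) (\<lambda>t. LINT s|Leb T. K t s)"
    using LL.integrable_fst'[OF Ki] by simp
  have Ks: "(LINT t|Leb T. K t s) = exp (- lam * s) * w s - exp (- lam * T) * w s" if "s \<in> space (Leb T)" for s
  proof -
    have "(LINT t|Leb T. K t s) = (LINT t|Leb T. of_bool (s \<le> t) * (lam * exp (- lam * t))) * w s"
      unfolding K_def by simp
    also have "... = (exp (- lam * s) - exp (- lam * T)) * w s" using that by (subst integral_Leb_exp) auto
    finally show ?thesis by (simp add: algebra_simps)
  qed
  have "(LINT t|Leb T. exp (- lam * t) * (w t - lam * m t)) =
    (LINT t|Leb T. exp (- lam * t) * w t - (lam * exp (- lam * t) * m0 + (LINT s|Leb T. K t s)))"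
  proof (rule integral_cong_AE)
    show "AE t in Leb T. exp (- lam * t) * (w t - lam * m t) = exp (- lam * t) * w t - (lam * exp (- lam * t) * m0 + (LINT s|Leb T. K t s))"
      using m by eventually_elim (simp add: Kt algebra_simps)
    show "(\<lambda>t. exp (- lam * t) * (w t - lam * m t)) \<in> borel_measurable (Leb T)" using mM by measurable
    show "(\<lambda>t. exp (- lam * t) * w t - (lam * exp (- lam * t) * m0 + (LINT s|Leb T. K t s))) \<in> borel_measurable (Leb T)"
      using KI by measurable
  qed
  also have "... = (LINT t|Leb T. exp (- lam * t) * w t) - ((LINT t|Leb T. lam * exp (- lam * t) * m0) + (LINT t|Leb T. LINT s|Leb T. K t s))"
    by (simp only: Bochner_Integration.integral_diff[OF ew Bochner_Integration.integrable_add[OF el KI]] Bochner_Integration.integral_add[OF el KI])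
  also have "(LINT t|Leb T. LINT s|Leb T. K t s) = (LINT s|Leb T. LINT t|Leb T. K t s)"
    using LL.Fubini_integral[OF Ki] by simp
  also have "... = (LINT s|Leb T. exp (- lam * s) * w s - exp (- lam * T) * w s)"
    by (intro Bochner_Integration.integral_cong refl Ks)
  also have "... = (LINT s|Leb T. exp (- lam * s) * w s) - exp (- lam * T) * (LINT s|Leb T. w s)"
    using ew w by (subst Bochner_Integration.integral_diff) auto
  also have "(LINT t|Leb T. lam * exp (- lam * t) * m0) = (1 - exp (- lam * T)) * m0"
  proof -
    have "(LINT t|Leb T. lam * exp (- lam * t) * m0) = (LINT t|Leb T. of_bool (0 \<le> t) * (lam * exp (- lam * t)) * m0)"
      by (intro Bochner_Integration.integral_cong refl) auto
    also have "... = (LINT t|Leb T. of_bool (0 \<le> t) * (lam * exp (- lam * t))) * m0" by (rule integral_mult_left_zero)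
    finally have "(LINT t|Leb T. lam * exp (- lam * t) * m0) = (LINT t|Leb T. of_bool (0 \<le> t) * (lam * exp (- lam * t))) * m0" .
    then show ?thesis using T by (subst (asm) integral_Leb_exp) auto
  qed
  finally show ?thesis unfolding mT by (simp add: algebra_simps)
qed

locale controlled_test = controlled M F W S \<sigma> E cG aG \<beta> Y l T p
  for M :: "'w measure" and F W and S :: "real => 'h::{real_inner,banach,second_countable_topology} \<Rightarrow>\<^sub>L 'h" and \<sigma>
    and E :: "real => 'k::{real_inner,banach,second_countable_topology} \<Rightarrow>\<^sub>L 'h" and cG aG \<beta> Y l T p +
  fixes \<phi> \<psi> :: "'h => real" and D :: "'h => 'k" and c c' cD :: real and x :: 'h
  assumes \<phi>: "continuous_on UNIV \<phi>" "\<And>x. \<bar>\<phi> x\<bar> \<le> c" and \<psi>: "continuous_on UNIV \<psi>" "\<And>x. \<bar>\<psi> x\<bar> \<le> c'"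
    and dyn: "\<And>\<tau> x. \<tau> \<ge> 0 ==> P \<tau> \<phi> x - \<phi> x = integral {0..\<tau>} (\<lambda>t. P t \<psi> x)"
    and D: "continuous_on UNIV D" "\<And>x. norm (D x) \<le> cD" and quot: "\<And>k. loc_unif (quot \<phi> k) (\<lambda>y. D y \<bullet> k)"
begin

interpretation Q: pair_sigma_finite "Leb T" M by (rule pair_Q)

definition state :: "(real => 'w => 'k) => real => 'w => 'h" where
  "state m t w = S t x + Y t w + conv (\<lambda>s. m s w) t"

definition rate :: "(real => 'w => 'k) => real => 'w => real" where
  "rate m t w = \<psi> (state m t w) + D (state m t w) \<bullet> m t w"

lemma bounds_nonneg: "0 \<le> c" "0 \<le> c'" "0 \<le> cD"
  using \<phi>(2)[of 0] \<psi>(2)[of 0] D(2)[of 0] norm_ge_zero[of "D 0"] by linarith+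

lemma continuous_compose_measurable:
  "continuous_on UNIV g ==> f \<in> borel_measurable L ==> (\<lambda>y. g (f y)) \<in> borel_measurable L"
  by (rule borel_measurable_continuous_on)

lemma state_Q:
  assumes m: "(\<lambda>q. m (fst q) (snd q)) \<in> borel_measurable (borel \<Otimes>\<^sub>M M)"
  shows "(\<lambda>q. state m (fst q) (snd q)) \<in> borel_measurable Q"
proof -
  have "(\<lambda>q. S (fst q) x + Y (fst q) (snd q)) \<in> borel_measurable Q"
    by (rule continuous_process_measurable)
       (auto intro!: continuous_on_add S_continuous Y_continuous borel_measurable_add Y_measurable_M)
  then show ?thesis unfolding state_def by (rule borel_measurable_add[OF _ conv_Q[OF m]])
qed

lemma state_M:
  assumes m: "(\<lambda>q. m (fst q) (snd q)) \<in> borel_measurable (borel \<Otimes>\<^sub>M M)" and t: "0 \<le> t"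
  shows "state m t \<in> borel_measurable M"
proof -
  have "(\<lambda>w. conv (\<lambda>s. m s w) t) \<in> borel_measurable M"
  proof (rule conv_measurable_param)
    show "(\<lambda>p. m (snd p) (fst p)) \<in> borel_measurable (M \<Otimes>\<^sub>M borel)"
      using measurable_compose[OF measurable_Pair[OF measurable_snd measurable_fst] m] by simp
  qed simp
  then show ?thesis unfolding state_def[abs_def] using t by (intro borel_measurable_add Y_measurable_M) auto
qed

lemma rate_Q:
  assumes m: "(\<lambda>q. m (fst q) (snd q)) \<in> borel_measurable (borel \<Otimes>\<^sub>M M)"
  shows "(\<lambda>q. rate m (fst q) (snd q)) \<in> borel_measurable Q"
  unfolding rate_def
  by (intro borel_measurable_add borel_measurable_inner continuous_compose_measurable[OF \<psi>(1)]
      continuous_compose_measurable[OF D(1)] state_Q[OF m] measurable_Q[OF m])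

lemma inner_D_bound: "\<bar>D y \<bullet> v\<bar> \<le> cD * norm v"
  by (rule order_trans[OF Cauchy_Schwarz_ineq2 mult_right_mono[OF D(2)]]) simp

lemma finite_Q: "finite_measure Q"
  by (intro finite_measure_pair_measure finite_Leb finite_measure_axioms)

lemma rate_integrable:
  assumes m: "(\<lambda>q. m (fst q) (snd q)) \<in> borel_measurable (borel \<Otimes>\<^sub>M M)" and i: "integrable Q (\<lambda>q. m (fst q) (snd q))"
  shows "integrable Q (\<lambda>q. rate m (fst q) (snd q))"
proof (rule Bochner_Integration.integrable_bound[OF _ rate_Q[OF m]])
  interpret fQ: finite_measure Q by (rule finite_Q)
  show "integrable Q (\<lambda>q. c' + cD * norm (m (fst q) (snd q)))" using i by simp
  show "AE q in Q. norm (rate m (fst q) (snd q)) \<le> norm (c' + cD * norm (m (fst q) (snd q)))"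
  proof (rule AE_I2)
    fix q
    have "\<bar>rate m (fst q) (snd q)\<bar> \<le> c' + cD * norm (m (fst q) (snd q))"
      unfolding rate_def using \<psi>(2) inner_D_bound by (intro order_trans[OF abs_triangle_ineq add_mono])
    then show "norm (rate m (fst q) (snd q)) \<le> norm (c' + cD * norm (m (fst q) (snd q)))" by simp
  qed
qed

lemma lstep_integrable_Q: "integrable Q (\<lambda>q. lstep n (fst q) (snd q))"
  unfolding integrable_iff_bounded
proof
  have "L1 Q (\<lambda>q. lstep n (fst q) (snd q)) = (\<integral>\<^sup>+ w. L1 (Leb T) (\<lambda>s. lstep n s w) \<partial>M)"
    by (subst Q.nn_integral_snd[symmetric]) auto
  also have "... \<le> (\<integral>\<^sup>+ w. L1 (Leb T) (\<lambda>s. l s w) \<partial>M)"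
    unfolding lstep_def by (intro nn_integral_mono block_avg_contraction l_integrable T)
  also note l_1
  finally show "L1 Q (\<lambda>q. lstep n (fst q) (snd q)) < \<infinity>" .
qed measurable

lemma cell_path:
  assumes w: "w \<in> space M" and t: "real j * (T / real (Suc n)) \<le> t" "t \<le> real (Suc j) * (T / real (Suc n))" "t \<le> T"
  shows "state (lstep n) t w = path (real j * (T / real (Suc n))) (state (lstep n) (real j * (T / real (Suc n)))) (lcell n j) t w"
proof -
  define a where "a = real j * (T / real (Suc n))"
  have a: "0 \<le> a" "a \<le> t" "a \<le> T" using T t by (auto simp: a_def)
  have cc: "conv (\<lambda>s. lstep n s w) t = S (t - a) (conv (\<lambda>s. lstep n s w) a) + B (t - a) (lcell n j w)"
    by (rule conv_cell(1)[OF a(1,2) _ conv_lstep_integrable[OF w w a(1,3)] lstep_section[OF w]])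
       (use t in "auto simp: a_def intro!: lstep_cell")
  have "S t x = S (t - a) (S a x)" using S_add[of "t - a" a x] a by simp
  then show ?thesis
    unfolding a_def[symmetric] state_def path_def cc by (simp add: blinfun.add_right)
qed

lemma state_adapted:
  assumes j: "j \<le> Suc n"
  shows "state (lstep n) (real j * (T / real (Suc n))) \<in> borel_measurable (F (real j * (T / real (Suc n))))"
  using j
proof (induction j)
  case 0
  have "conv f 0 = 0" for f by (simp add: conv_def set_lebesgue_integral_def)
  then show ?case using Y_measurable_F[of 0] unfolding state_def[abs_def] by simp
next
  case (Suc j)
  define a b where "a = real j * (T / real (Suc n))" and "b = real (Suc j) * (T / real (Suc n))"
  have ab: "0 \<le> a" "a \<le> b" using T unfolding a_def b_def by (intro mult_nonneg_nonneg mult_right_mono; simp)+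
  have "real (Suc j) * T \<le> real (Suc n) * T" using Suc.prems T by (intro mult_right_mono) auto
  then have bT: "b \<le> T" unfolding b_def by (simp add: field_simps)
  have "path a (state (lstep n) a) (lcell n j) b \<in> borel_measurable (F b)"
    using path_measurable[OF ab] Suc lcell_measurable[of j n] unfolding a_def by simp
  moreover have "state (lstep n) b w = path a (state (lstep n) a) (lcell n j) b w" if "w \<in> space (F b)" for w
    using that space_F[of b] ab bT unfolding a_def by (intro cell_path) (auto simp: a_def b_def)
  ultimately show ?case unfolding b_def[symmetric] by (subst measurable_cong) auto
qed

lemma stopped_rate_integrable:
  assumes m: "(\<lambda>q. m (fst q) (snd q)) \<in> borel_measurable (borel \<Otimes>\<^sub>M M)" and i: "integrable Q (\<lambda>q. m (fst q) (snd q))"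
    and R: "Measurable.pred borel R"
  shows "integrable Q (\<lambda>q. of_bool (R (fst q)) * rate m (fst q) (snd q))"
proof (rule Bochner_Integration.integrable_bound[OF rate_integrable[OF m i]])
  have "fst \<in> borel_measurable Q" by (rule measurable_compose[OF measurable_fst id_Leb])
  from measurable_compose[OF this R]
  show "(\<lambda>q. of_bool (R (fst q)) * rate m (fst q) (snd q)) \<in> borel_measurable Q"
    using rate_Q[OF m] by measurable
qed (auto intro!: AE_I2)

text \<open>On a cell the step control is a constant known at the start of the cell.\<close>

lemma step_formula_cell:
  fixes n j :: nat
  defines "a \<equiv> real j * (T / real (Suc n))"
  assumes j: "j \<le> Suc n" and t: "a \<le> t" "t \<le> real (Suc j) * (T / real (Suc n))" "t \<le> T"
  shows "(LINT w|M. \<phi> (state (lstep n) t w)) - (LINT w|M. \<phi> (state (lstep n) a w)) =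
     (LINT q|Q. of_bool (a < fst q \<and> fst q \<le> t) * rate (lstep n) (fst q) (snd q))"
proof (cases "a = t")
  case True
  have "\<not> (a < fst q \<and> fst q \<le> t)" for q :: "real \<times> 'w" using True by auto
  then have "(LINT q|Q. of_bool (a < fst q \<and> fst q \<le> t) * rate (lstep n) (fst q) (snd q)) = (LINT q|Q. 0)"
    by (simp only: of_bool_eq(1) mult_zero_left simp_thms)
  then show ?thesis using True by simp
next
  case False
  then have at: "a < t" using t by simp
  have a: "0 \<le> a" using T by (simp add: a_def)
  let ?V = "state (lstep n) a" and ?k = "lcell n j"
  have path: "state (lstep n) s w = path a ?V ?k s w" if "w \<in> space M" "s \<in> {a..t}" for s w
    unfolding a_def by (rule cell_path) (use that t in "auto simp: a_def")
  let ?h = "\<lambda>w s. \<psi> (path a ?V ?k s w) + D (path a ?V ?k s w) \<bullet> ?k w"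
  have inner: "(LINT s|Leb T. of_bool (a < s \<and> s \<le> t) * rate (lstep n) s w) = integral {a..t} (?h w)" if w: "w \<in> space M" for w
  proof -
    have pc: "continuous_on {a..t} (\<lambda>s. path a ?V ?k s w)"
      by (rule continuous_on_subset[OF path_continuous[OF a w]]) auto
    have hc: "continuous_on {a..t} (?h w)"
      by (intro continuous_on_add continuous_on_inner continuous_on_const continuous_on_compose2[OF \<psi>(1) pc] continuous_on_compose2[OF D(1) pc]) auto
    have hi: "set_integrable lborel {a<..t} (?h w)"
      by (rule set_integrable_subset[OF borel_integrable_atLeastAtMost'[OF hc]]) auto
    have "(LINT s|Leb T. of_bool (a < s \<and> s \<le> t) * rate (lstep n) s w) = (LINT s:{a<..t}|lborel. ?h w s)"
      unfolding integral_Leb set_lebesgue_integral_def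
    proof (rule Bochner_Integration.integral_cong[OF refl])
      fix s
      show "indicator {0<..T} s *\<^sub>R (of_bool (a < s \<and> s \<le> t) * rate (lstep n) s w) = indicator {a<..t} s *\<^sub>R ?h w s"
      proof (cases "a < s \<and> s \<le> t")
        case True
        then have "lstep n s w = ?k w" using t by (intro lstep_cell) (auto simp: a_def)
        then show ?thesis using True a t path[OF w, of s] by (simp add: rate_def)
      qed auto
    qed
    also have "... = integral {a<..t} (?h w)" by (rule set_borel_integral_eq_integral(2)[OF hi])
    also have "... = integral {a..t} (?h w)"
      by (rule integral_subset_negligible) (auto intro: negligible_subset[OF negligible_sing[of a]])
    finally show ?thesis .
  qed
  have ri: "integrable Q (\<lambda>q. of_bool (a < fst q \<and> fst q \<le> t) * rate (lstep n) (fst q) (snd q))"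
    by (rule stopped_rate_integrable[OF lstep_measurable lstep_integrable_Q]) measurable
  have "(LINT q|Q. of_bool (a < fst q \<and> fst q \<le> t) * rate (lstep n) (fst q) (snd q)) =
    (LINT w|M. LINT s|Leb T. of_bool (a < s \<and> s \<le> t) * rate (lstep n) s w)"
    using Q.integral_snd[of "\<lambda>s w. of_bool (a < s \<and> s \<le> t) * rate (lstep n) s w"] ri by (simp add: case_prod_beta')
  also have "... = (LINT w|M. integral {a..t} (?h w))"
    by (intro Bochner_Integration.integral_cong refl inner)
  also have "... = (LINT w|M. \<phi> (path a ?V ?k t w)) - (LINT w|M. \<phi> (?V w))"
    by (rule cell_formula(1)[OF \<phi> \<psi> dyn D quot a at _ _ lcell_integrable[OF j], symmetric])
       (use state_adapted[OF j] lcell_measurable[OF j] in "simp_all add: a_def")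
  also have "(LINT w|M. \<phi> (path a ?V ?k t w)) = (LINT w|M. \<phi> (state (lstep n) t w))"
    using at by (intro Bochner_Integration.integral_cong refl) (simp add: path)
  finally show ?thesis by simp
qed

lemma expectation_start:
  assumes m: "(\<lambda>q. m (fst q) (snd q)) \<in> borel_measurable (borel \<Otimes>\<^sub>M M)"
  shows "(LINT w|M. \<phi> (state m 0 w)) = \<phi> x"
proof -
  have "conv f 0 = 0" for f by (simp add: conv_def set_lebesgue_integral_def)
  then have "AE w in M. \<phi> (state m 0 w) = \<phi> x" using Y_0 by (auto simp: state_def S_0)
  then have "(LINT w|M. \<phi> (state m 0 w)) = (LINT w|M. \<phi> x)"
    by (intro integral_cong_AE continuous_compose_measurable[OF \<phi>(1)] state_M[OF m]) auto
  then show ?thesis by (simp add: prob_space)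
qed

lemma step_formula_upto:
  "0 \<le> t ==> t \<le> real j * (T / real (Suc n)) ==> t \<le> T ==> j \<le> Suc n ==> (LINT w|M. \<phi> (state (lstep n) t w)) =
     \<phi> x + (LINT q|Q. of_bool (fst q \<le> t) * rate (lstep n) (fst q) (snd q))"
proof (induction j arbitrary: t)
  case 0
  then have t: "t = 0" by simp
  have "(LINT q|Q. of_bool (fst q \<le> t) * rate (lstep n) (fst q) (snd q)) = (LINT q|Q. 0)"
    by (intro Bochner_Integration.integral_cong refl) (auto simp: t space_pair_measure)
  then show ?case using expectation_start[OF lstep_measurable] by (simp add: t)
next
  case (Suc j)
  define a where "a = real j * (T / real (Suc n))"
  show ?case
  proof (cases "t \<le> a")
    case True
    then show ?thesis using Suc by (simp add: a_def)
  next
    case False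
    have a: "0 \<le> a" using T by (simp add: a_def)
    have ri: "integrable Q (\<lambda>q. of_bool (R (fst q)) * rate (lstep n) (fst q) (snd q))" if "Measurable.pred borel R" for R
      by (rule stopped_rate_integrable[OF lstep_measurable lstep_integrable_Q that])
    have "(LINT w|M. \<phi> (state (lstep n) t w)) - (LINT w|M. \<phi> (state (lstep n) a w)) =
       (LINT q|Q. of_bool (a < fst q \<and> fst q \<le> t) * rate (lstep n) (fst q) (snd q))"
      unfolding a_def by (rule step_formula_cell) (use Suc.prems False in "auto simp: a_def")
    moreover have "(LINT w|M. \<phi> (state (lstep n) a w)) = \<phi> x + (LINT q|Q. of_bool (fst q \<le> a) * rate (lstep n) (fst q) (snd q))"
      by (rule Suc.IH) (use Suc.prems False a in "auto simp: a_def")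
    moreover have "(LINT q|Q. of_bool (fst q \<le> t) * rate (lstep n) (fst q) (snd q)) =
      (LINT q|Q. of_bool (fst q \<le> a) * rate (lstep n) (fst q) (snd q)) + (LINT q|Q. of_bool (a < fst q \<and> fst q \<le> t) * rate (lstep n) (fst q) (snd q))"
    proof (subst Bochner_Integration.integral_add[symmetric])
      show "integrable Q (\<lambda>q. of_bool (fst q \<le> a) * rate (lstep n) (fst q) (snd q))" by (rule ri) measurable
      show "integrable Q (\<lambda>q. of_bool (a < fst q \<and> fst q \<le> t) * rate (lstep n) (fst q) (snd q))" by (rule ri) measurable
      show "(LINT q|Q. of_bool (fst q \<le> t) * rate (lstep n) (fst q) (snd q)) =
        (LINT q|Q. of_bool (fst q \<le> a) * rate (lstep n) (fst q) (snd q) + of_bool (a < fst q \<and> fst q \<le> t) * rate (lstep n) (fst q) (snd q))"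
        using False by (intro Bochner_Integration.integral_cong refl) (auto simp: of_bool_def)
    qed
    ultimately show ?thesis by simp
  qed
qed

lemma step_formula:
  assumes "0 \<le> t" "t \<le> T"
  shows "(LINT w|M. \<phi> (state (lstep n) t w)) =
     \<phi> x + (LINT q|Q. of_bool (fst q \<le> t) * rate (lstep n) (fst q) (snd q))"
  by (rule step_formula_upto[where j="Suc n"]) (use assms in auto)

lemma step_limit_subseq:
  obtains r :: "nat => nat" where "strict_mono r"
    "AE q in Q. (\<lambda>n. state (lstep (r n)) (fst q) (snd q)) \<longlonglongrightarrow> state l (fst q) (snd q)"
proof -
  define d where "d n q = norm (conv (\<lambda>s. lstep n s (snd q)) (fst q) - conv (\<lambda>s. l s (snd q)) (fst q))" for n and q :: "real \<times> 'w"
  have dM [measurable]: "d n \<in> borel_measurable Q" for n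
    unfolding d_def[abs_def]
    by (rule measurable_compose[OF borel_measurable_diff[OF conv_Q[OF lstep_measurable] conv_Q[OF l_measurable]] borel_measurable_norm])
  have d0: "(\<lambda>n. \<integral>\<^sup>+ q. ennreal (d n q) \<partial>Q) \<longlonglongrightarrow> 0" using conv_lstep_L1 by (simp add: d_def)
  have dpos: "0 \<le> d n q" for n q by (simp add: d_def)
  have "eventually (\<lambda>n. (\<integral>\<^sup>+ q. ennreal (d n q) \<partial>Q) < 1) sequentially" using d0 by (rule order_tendstoD) simp
  then obtain N0 where N0: "\<And>n. N0 \<le> n ==> (\<integral>\<^sup>+ q. ennreal (d n q) \<partial>Q) < 1" by (auto simp: eventually_sequentially)
  have di: "integrable Q (d (n + N0))" for n
    unfolding integrable_iff_bounded using N0[of "n + N0"] dpos by (auto simp: less_top[symmetric] intro: order.strict_trans)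
  have "(\<lambda>n. LINT q|Q. norm (d (n + N0) q)) \<longlonglongrightarrow> 0"
  proof -
    have "ennreal (LINT q|Q. norm (d (n + N0) q)) = (\<integral>\<^sup>+ q. ennreal (d (n + N0) q) \<partial>Q)" for n
      using nn_integral_eq_integral[OF di] dpos by simp
    then have "(\<lambda>n. ennreal (LINT q|Q. norm (d (n + N0) q))) \<longlonglongrightarrow> ennreal 0"
      using LIMSEQ_ignore_initial_segment[OF d0] by simp
    then show ?thesis by (subst (asm) tendsto_ennreal_iff) auto
  qed
  from tendsto_L1_AE_subseq[OF di this] obtain r where r: "strict_mono r" "AE q in Q. (\<lambda>n. d (r n + N0) q) \<longlonglongrightarrow> 0" by blast
  show thesis
  proof
    show "strict_mono (\<lambda>n. r n + N0)" using r(1) by (simp add: strict_mono_def)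
    show "AE q in Q. (\<lambda>n. state (lstep (r n + N0)) (fst q) (snd q)) \<longlonglongrightarrow> state l (fst q) (snd q)"
      using r(2)
    proof eventually_elim
      case (elim q)
      then have "(\<lambda>n. conv (\<lambda>s. lstep (r n + N0) s (snd q)) (fst q)) \<longlonglongrightarrow> conv (\<lambda>s. l s (snd q)) (fst q)"
        unfolding d_def by (subst (asm) tendsto_norm_zero_iff) (rule LIM_zero_cancel)
      then show ?case unfolding state_def by (intro tendsto_add tendsto_const)
    qed
  qed
qed

text \<open>Convergence in \<open>L\<^sup>1\<close> over time and probability gives almost sure convergence of the states along a
  subsequence only for almost every time.\<close>

lemma formula_AE:
  "AE t in Leb T. (LINT w|M. \<phi> (state l t w)) = \<phi> x + (LINT q|Q. of_bool (fst q \<le> t) * rate l (fst q) (snd q))"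
proof -
  interpret fQ: finite_measure Q by (rule finite_Q)
  obtain r :: "nat => nat" where r: "strict_mono r"
    "AE q in Q. (\<lambda>n. state (lstep (r n)) (fst q) (snd q)) \<longlonglongrightarrow> state l (fst q) (snd q)"
    by (rule step_limit_subseq)
  note ss = state_Q[OF lstep_measurable]
  have cl: "(\<lambda>n. g (z n)) \<longlonglongrightarrow> g z0" if "continuous_on UNIV g" "z \<longlonglongrightarrow> z0" for g :: "'h => 'z::metric_space" and z z0
    by (rule continuous_on_tendsto_compose[OF that]) auto
  \<comment> \<open>\<open>G\<close> has the limit control inside and is treated by dominated convergence, \<open>H\<close> by the \<open>L\<^sup>1\<close> distance of the controls.\<close>
  have rates: "(\<lambda>n. LINT q|Q. of_bool (fst q \<le> t) * rate (lstep (r n)) (fst q) (snd q)) \<longlonglongrightarrow>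
     (LINT q|Q. of_bool (fst q \<le> t) * rate l (fst q) (snd q))" for t
  proof -
    define G where "G n q = \<psi> (state (lstep (r n)) (fst q) (snd q)) + D (state (lstep (r n)) (fst q) (snd q)) \<bullet> l (fst q) (snd q)" for n q
    define H where "H n q = of_bool (fst q \<le> t) * (D (state (lstep (r n)) (fst q) (snd q)) \<bullet> (lstep (r n) (fst q) (snd q) - l (fst q) (snd q)))" for n q
    have fst_m [measurable]: "fst \<in> borel_measurable Q" by (rule measurable_compose[OF measurable_fst id_Leb])
    have GM [measurable]: "G n \<in> borel_measurable Q" for n
      unfolding G_def[abs_def] by (intro borel_measurable_add borel_measurable_inner continuous_compose_measurable[OF \<psi>(1)]
        continuous_compose_measurable[OF D(1)] ss l_Q)
    have HM [measurable]: "H n \<in> borel_measurable Q" for n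
      unfolding H_def[abs_def] by (intro borel_measurable_times borel_measurable_inner borel_measurable_diff
        continuous_compose_measurable[OF D(1)] ss l_Q lstep_Q) measurable
    note rate_Q[OF l_measurable, measurable]
    have wi: "integrable Q (\<lambda>q. c' + cD * norm (l (fst q) (snd q)))" using l_integrable_Q by simp
    have lim: "AE q in Q. (\<lambda>n. of_bool (fst q \<le> t) * G n q) \<longlonglongrightarrow> of_bool (fst q \<le> t) * rate l (fst q) (snd q)"
      using r(2) by eventually_elim (unfold G_def rate_def, intro tendsto_intros cl[OF \<psi>(1)] cl[OF D(1)], assumption+)
    have bd: "AE q in Q. norm (of_bool (fst q \<le> t) * G n q) \<le> c' + cD * norm (l (fst q) (snd q))" for n
    proof (rule AE_I2)
      fix q
      have "\<bar>G n q\<bar> \<le> c' + cD * norm (l (fst q) (snd q))"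
        unfolding G_def using \<psi>(2) inner_D_bound by (intro order_trans[OF abs_triangle_ineq add_mono])
      then show "norm (of_bool (fst q \<le> t) * G n q) \<le> c' + cD * norm (l (fst q) (snd q))" by (auto simp: of_bool_def)
    qed
    have m1: "(\<lambda>q. of_bool (fst q \<le> t) * rate l (fst q) (snd q)) \<in> borel_measurable Q" by measurable
    have m2: "(\<lambda>q. of_bool (fst q \<le> t) * G n q) \<in> borel_measurable Q" for n by measurable
    note L1 = integral_dominated_convergence[OF m1 m2 wi lim bd]
    note I1 = integrable_dominated_convergence2[OF m1 m2 wi lim bd]
    have Hb: "norm (H n q) \<le> cD * norm (lstep (r n) (fst q) (snd q) - l (fst q) (snd q))" for n q
      using inner_D_bound[of _ "lstep (r n) (fst q) (snd q) - l (fst q) (snd q)"] bounds_nonneg by (simp add: H_def of_bool_def)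
    have I3: "integrable Q (\<lambda>q. norm (lstep n (fst q) (snd q) - l (fst q) (snd q)))" for n
      by (intro integrable_norm Bochner_Integration.integrable_diff lstep_integrable_Q l_integrable_Q)
    have I2: "integrable Q (H n)" for n
      by (rule Bochner_Integration.integrable_bound[OF integrable_mult_right[OF I3, of cD "r n"]])
         (auto intro!: AE_I2 simp: order_trans[OF Hb[unfolded real_norm_def] abs_ge_self])
    have L3: "(\<lambda>n. LINT q|Q. norm (lstep (r n) (fst q) (snd q) - l (fst q) (snd q))) \<longlonglongrightarrow> 0"
    proof -
      have "(\<lambda>n. L1 Q (\<lambda>q. lstep (r n) (fst q) (snd q) - l (fst q) (snd q))) \<longlonglongrightarrow> ennreal 0"
        using LIMSEQ_subseq_LIMSEQ[OF lstep_L1 r(1)] by (simp add: comp_def)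
      then have "(\<lambda>n. ennreal (LINT q|Q. norm (lstep (r n) (fst q) (snd q) - l (fst q) (snd q)))) \<longlonglongrightarrow> ennreal (0::real)"
        by (subst (asm) nn_integral_eq_integral[OF I3]) simp_all
      then show ?thesis by (subst (asm) tendsto_ennreal_iff) auto
    qed
    have L2: "(\<lambda>n. LINT q|Q. H n q) \<longlonglongrightarrow> 0"
    proof (rule Lim_null_comparison)
      show "\<forall>\<^sub>F n in sequentially. norm (LINT q|Q. H n q) \<le> cD * (LINT q|Q. norm (lstep (r n) (fst q) (snd q) - l (fst q) (snd q)))"
      proof (rule always_eventually, rule allI)
        fix n
        have "norm (LINT q|Q. H n q) \<le> (LINT q|Q. norm (H n q))" by (rule integral_norm_bound)
        also have "... \<le> (LINT q|Q. cD * norm (lstep (r n) (fst q) (snd q) - l (fst q) (snd q)))"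
          by (intro integral_mono Hb integrable_norm I2 integrable_mult_right I3)
        finally show "norm (LINT q|Q. H n q) \<le> cD * (LINT q|Q. norm (lstep (r n) (fst q) (snd q) - l (fst q) (snd q)))" by simp
      qed
      show "(\<lambda>n. cD * (LINT q|Q. norm (lstep (r n) (fst q) (snd q) - l (fst q) (snd q)))) \<longlonglongrightarrow> 0"
        using tendsto_mult_left[OF L3, of cD] by simp
    qed
    have "(LINT q|Q. of_bool (fst q \<le> t) * rate (lstep (r n)) (fst q) (snd q)) = (LINT q|Q. of_bool (fst q \<le> t) * G n q + H n q)" for n
      by (intro Bochner_Integration.integral_cong refl) (auto simp: rate_def G_def H_def inner_diff_right of_bool_def)
    then have "(LINT q|Q. of_bool (fst q \<le> t) * rate (lstep (r n)) (fst q) (snd q)) = (LINT q|Q. of_bool (fst q \<le> t) * G n q) + (LINT q|Q. H n q)" for n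
      using I1 I2 by simp
    then show ?thesis using tendsto_add[OF L1 L2] by simp
  qed
  have "AE t in Leb T. AE w in M. (\<lambda>n. state (lstep (r n)) t w) \<longlonglongrightarrow> state l t w"
    using Q.AE_pair[OF r(2)] by simp
  then have "AE t in Leb T. (\<lambda>n. LINT w|M. \<phi> (state (lstep (r n)) t w)) \<longlonglongrightarrow> (LINT w|M. \<phi> (state l t w))"
    using AE_space
  proof eventually_elim
    case (elim t)
    then have t: "0 \<le> t" by simp
    show ?case
    proof (rule integral_dominated_convergence[where w="\<lambda>_. c"])
      show "AE w in M. (\<lambda>n. \<phi> (state (lstep (r n)) t w)) \<longlonglongrightarrow> \<phi> (state l t w)"
        using elim(1) by eventually_elim (rule cl[OF \<phi>(1)])
    qed (use \<phi>(2) in "auto intro!: continuous_compose_measurable[OF \<phi>(1)] state_M l_measurable lstep_measurable t")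
  qed
  then show ?thesis
    using AE_space
  proof eventually_elim
    case (elim t)
    then have t: "0 \<le> t" "t \<le> T" by auto
    have "(\<lambda>n. LINT w|M. \<phi> (state (lstep (r n)) t w)) \<longlonglongrightarrow> \<phi> x + (LINT q|Q. of_bool (fst q \<le> t) * rate l (fst q) (snd q))"
      unfolding step_formula[OF t] by (intro tendsto_add tendsto_const rates)
    then show ?case using elim(1) LIMSEQ_unique by blast
  qed
qed

lemma integral_rate_eq:
  "(LINT q|Q. of_bool (fst q \<le> t) * rate l (fst q) (snd q)) = (LINT s|Leb T. of_bool (s \<le> t) * (LINT w|M. rate l s w))"
  using Q.integral_fst'[OF stopped_rate_integrable[OF l_measurable l_integrable_Q, of "\<lambda>s. s \<le> t"]] by simp

lemma state_continuous:
  assumes w: "w \<in> space M"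
  shows "continuous_on {0..T} (\<lambda>t. state l t w)"
  unfolding state_def using T
  by (intro continuous_on_add continuous_on_subset[OF S_continuous] continuous_on_subset[OF Y_continuous[OF w]]
      conv_continuous[OF p l_section[OF w] l_p[OF w]]) auto

text \<open>Times at which the formula is known accumulate at \<open>T\<close>, and both sides are continuous there.\<close>

lemma formula_at_end: "(LINT w|M. \<phi> (state l T w)) = \<phi> x + (LINT s|Leb T. (LINT w|M. rate l s w))"
proof -
  let ?w = "\<lambda>s. LINT w|M. rate l s w"
  have wi: "integrable (Leb T) ?w" using Q.integrable_fst'[OF rate_integrable[OF l_measurable l_integrable_Q]] by simp
  have "\<exists>t. T - T / real (Suc (Suc n)) < t \<and> t < T \<and> (LINT w|M. \<phi> (state l t w)) = \<phi> x + (LINT s|Leb T. of_bool (s \<le> t) * ?w s)" for n :: nat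
    using formula_AE[unfolded integral_rate_eq] by (rule AE_Leb_dense) (use T in "auto simp: field_simps")
  then have "\<exists>t. \<forall>n. T - T / real (Suc (Suc n)) < t n \<and> t n < T \<and>
      (LINT w|M. \<phi> (state l (t n) w)) = \<phi> x + (LINT s|Leb T. of_bool (s \<le> t n) * ?w s)"
    by (intro choice allI)
  then obtain t where t: "\<And>n. T - T / real (Suc (Suc n)) < t n" "\<And>n. t n < T"
    "\<And>n. (LINT w|M. \<phi> (state l (t n) w)) = \<phi> x + (LINT s|Leb T. of_bool (s \<le> t n) * ?w s)" by blast
  have tlim: "t \<longlonglongrightarrow> T"
  proof (rule tendsto_sandwich[of "\<lambda>n. T - T / real (Suc (Suc n))" t _ "\<lambda>_. T"])
    show "(\<lambda>n. T - T / real (Suc (Suc n))) \<longlonglongrightarrow> T" by real_asymp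
  qed (use t in "auto intro!: always_eventually less_imp_le")
  have t0: "0 \<le> t n" for n
  proof -
    have "T / real (Suc (Suc n)) \<le> T" using T by (simp add: field_simps)
    then show ?thesis using t(1)[of n] by linarith
  qed
  have "(\<lambda>n. LINT w|M. \<phi> (state l (t n) w)) \<longlonglongrightarrow> (LINT w|M. \<phi> (state l T w))"
  proof (rule integral_dominated_convergence[where w="\<lambda>_. c"])
    show "AE w in M. (\<lambda>n. \<phi> (state l (t n) w)) \<longlonglongrightarrow> \<phi> (state l T w)"
    proof (rule AE_I2)
      fix w assume w: "w \<in> space M"
      have "(\<lambda>n. state l (t n) w) \<longlonglongrightarrow> state l T w"
        by (rule continuous_on_tendsto_compose[OF state_continuous[OF w] tlim]) (use T t0 t(2) in "auto intro!: always_eventually less_imp_le")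
      then show "(\<lambda>n. \<phi> (state l (t n) w)) \<longlonglongrightarrow> \<phi> (state l T w)"
        by (intro continuous_on_tendsto_compose[OF \<phi>(1)]) auto
    qed
  qed (use \<phi>(2) t0 T in "auto intro!: continuous_compose_measurable[OF \<phi>(1)] state_M l_measurable")
  moreover have "(\<lambda>n. LINT s|Leb T. of_bool (s \<le> t n) * ?w s) \<longlonglongrightarrow> (LINT s|Leb T. ?w s)"
  proof (rule integral_dominated_convergence[where w="\<lambda>s. \<bar>?w s\<bar>"])
    show wM: "?w \<in> borel_measurable (Leb T)" using wi by simp
    show "(\<lambda>s. of_bool (s \<le> t n) * ?w s) \<in> borel_measurable (Leb T)" for n
      using wM measurable_compose[OF id_Leb[of T], of "\<lambda>s. of_bool (s \<le> t n) :: real" borel] by (intro borel_measurable_times) auto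
    show "integrable (Leb T) (\<lambda>s. \<bar>?w s\<bar>)" using wi by simp
    show "AE s in Leb T. (\<lambda>n. of_bool (s \<le> t n) * ?w s) \<longlonglongrightarrow> ?w s"
      using AE_Leb_neq[of T T] AE_space
    proof eventually_elim
      case (elim s)
      then have "s < T" by auto
      then have "eventually (\<lambda>n. s < t n) sequentially" using tlim by (intro order_tendstoD)
      then have "eventually (\<lambda>n. of_bool (s \<le> t n) * ?w s = ?w s) sequentially" by eventually_elim simp
      then show ?case by (rule tendsto_eventually)
    qed
    show "AE s in Leb T. norm (of_bool (s \<le> t n) * ?w s) \<le> \<bar>?w s\<bar>" for n by (intro AE_I2) (simp add: of_bool_def)
  qed
  ultimately have "(\<lambda>n. LINT w|M. \<phi> (state l (t n) w)) \<longlonglongrightarrow> (LINT w|M. \<phi> (state l T w))"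
    "(\<lambda>n. LINT w|M. \<phi> (state l (t n) w)) \<longlonglongrightarrow> \<phi> x + (LINT s|Leb T. ?w s)"
    unfolding t(3) by (auto intro!: tendsto_add)
  then show ?thesis by (rule LIMSEQ_unique)
qed

theorem controlled_formula:
  "(LINT w|M. exp (- lam * T) * \<phi> (state l T w)) = \<phi> x + (LINT w|M. (LINT t|Leb T.
     exp (- lam * t) * ((\<psi> (state l t w) - lam * \<phi> (state l t w)) + l t w \<bullet> D (state l t w))))"
proof -
  interpret fQ: finite_measure Q by (rule finite_Q)
  interpret fL: finite_measure "Leb T" by (rule finite_Leb)
  let ?w = "\<lambda>s. LINT w|M. rate l s w" and ?m = "\<lambda>t. LINT w|M. \<phi> (state l t w)"
  note ri = rate_integrable[OF l_measurable l_integrable_Q]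
  have \<phi>Q: "(\<lambda>q. \<phi> (state l (fst q) (snd q))) \<in> borel_measurable Q"
    by (rule continuous_compose_measurable[OF \<phi>(1) state_Q[OF l_measurable]])
  have \<phi>i: "integrable Q (\<lambda>q. \<phi> (state l (fst q) (snd q)))"
    by (rule fQ.integrable_const_bound[of _ c]) (use \<phi>(2) \<phi>Q in "auto intro!: AE_I2")
  have wi: "integrable (Leb T) ?w" and mi: "integrable (Leb T) ?m"
    using Q.integrable_fst'[OF ri] Q.integrable_fst'[OF \<phi>i] by simp_all
  have fst_m: "fst \<in> borel_measurable Q" by (rule measurable_compose[OF measurable_fst id_Leb])
  let ?J = "\<lambda>t w. exp (- lam * t) * (rate l t w - lam * \<phi> (state l t w))"
  have Ji: "integrable Q (case_prod ?J)"
    unfolding case_prod_beta'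
  proof (rule Bochner_Integration.integrable_bound)
    show "integrable Q (\<lambda>q. exp (\<bar>lam\<bar> * T) * (rate l (fst q) (snd q) - lam * \<phi> (state l (fst q) (snd q))))"
      using ri \<phi>i by simp
    show "(\<lambda>q. exp (- lam * fst q) * (rate l (fst q) (snd q) - lam * \<phi> (state l (fst q) (snd q)))) \<in> borel_measurable Q"
      using fst_m rate_Q[OF l_measurable] \<phi>Q by measurable
    show "AE q in Q. norm (exp (- lam * fst q) * (rate l (fst q) (snd q) - lam * \<phi> (state l (fst q) (snd q))))
       \<le> norm (exp (\<bar>lam\<bar> * T) * (rate l (fst q) (snd q) - lam * \<phi> (state l (fst q) (snd q))))"
    proof (rule AE_I2)
      fix q assume "q \<in> space Q"
      then have q: "0 < fst q" "fst q \<le> T" by (auto simp: space_pair_measure)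
      have "- lam * fst q \<le> \<bar>lam\<bar> * fst q" using q by (intro mult_right_mono) auto
      also have "... \<le> \<bar>lam\<bar> * T" using q by (intro mult_left_mono) auto
      finally have "exp (- lam * fst q) \<le> exp (\<bar>lam\<bar> * T)" by simp
      then show "norm (exp (- lam * fst q) * (rate l (fst q) (snd q) - lam * \<phi> (state l (fst q) (snd q))))
       \<le> norm (exp (\<bar>lam\<bar> * T) * (rate l (fst q) (snd q) - lam * \<phi> (state l (fst q) (snd q))))"
        unfolding norm_mult by (intro mult_right_mono) auto
    qed
  qed
  have "(LINT w|M. exp (- lam * T) * \<phi> (state l T w)) = exp (- lam * T) * ?m T" by simp
  also have "... = \<phi> x + (LINT t|Leb T. exp (- lam * t) * (?w t - lam * ?m t))"
    by (rule discounted_integral[OF T wi formula_AE[unfolded integral_rate_eq] _ formula_at_end]) (use mi in simp)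
  also have "(LINT t|Leb T. exp (- lam * t) * (?w t - lam * ?m t)) = (LINT t|Leb T. LINT w|M. ?J t w)"
  proof (rule integral_cong_AE)
    show "(\<lambda>t. exp (- lam * t) * (?w t - lam * ?m t)) \<in> borel_measurable (Leb T)"
      using wi mi measurable_compose[OF id_Leb[of T], of "\<lambda>t. exp (- lam * t)" borel] by (intro borel_measurable_times borel_measurable_diff) auto
    show "(\<lambda>t. LINT w|M. ?J t w) \<in> borel_measurable (Leb T)"
      using Q.integrable_fst'[OF Ji] by simp
    show "AE t in Leb T. exp (- lam * t) * (?w t - lam * ?m t) = (LINT w|M. ?J t w)"
      using Q.AE_integrable_fst'[OF ri] Q.AE_integrable_fst'[OF \<phi>i] by eventually_elim simp
  qed
  also have "... = (LINT w|M. LINT t|Leb T. ?J t w)"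
    by (rule Q.Fubini_integral[OF Ji, symmetric])
  also have "... = (LINT w|M. (LINT t|Leb T.
     exp (- lam * t) * ((\<psi> (state l t w) - lam * \<phi> (state l t w)) + l t w \<bullet> D (state l t w))))"
    by (simp add: rate_def inner_commute algebra_simps)
  finally show ?thesis .
qed

end

section \<open>Generator, extended operator and admissible controls\<close>

text \<open>On \<open>(0, t]\<close> the weight \<open>s\<^bsup>-2\<gamma>\<^esup>\<close> is at least \<open>t\<^bsup>-2\<gamma>\<^esup>\<close>.\<close>

lemma hs_norm_sq_integrable:
  fixes S :: "real => 'h::{real_inner,banach,second_countable_topology} \<Rightarrow>\<^sub>L 'h"
    and \<sigma> :: "'xi::{real_inner,banach,second_countable_topology} \<Rightarrow>\<^sub>L 'h"
  assumes C0: "C0_semigroup S" and tr: "\<And>s. s > 0 ==> trace_class (cov_op S \<sigma> s)"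
    and \<gamma>: "0 < \<gamma>" and t: "t \<ge> 0"
    and fin: "(\<integral>\<^sup>+ s\<in>{0<..t}. ennreal (s powr (- 2 * \<gamma>) * op_trace (cov_op S \<sigma> s)) \<partial>lborel) < \<infinity>"
  shows "(\<integral>\<^sup>+ s\<in>{0..t}. hs_norm_sq (\<lambda>v. S s (\<sigma> v)) \<partial>lborel) < \<infinity>"
proof -
  define f where "f s = hs_norm_sq (\<lambda>v. S s (\<sigma> v))" for s
  have cont: "continuous_on {0..} (\<lambda>s. S s x)" for x using C0 by (simp add: C0_semigroup_def)
  have "f \<in> borel_measurable (restrict_space borel {0..t})"
    unfolding f_def[abs_def]
    by (rule hs_norm_sq_measurable) (auto intro!: borel_measurable_continuous_on_restrict continuous_on_subset[OF cont])
  then have fm: "(\<lambda>s. f s * indicator {0..t} s) \<in> borel_measurable borel"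
    by (subst (asm) borel_measurable_restrict_space_iff_ennreal) auto
  have "(\<integral>\<^sup>+ s. f s * indicator {0..t} s \<partial>lborel) = (\<integral>\<^sup>+ s. f s * indicator {0<..t} s \<partial>lborel)"
    by (rule nn_integral_cong_AE) (use AE_lborel_singleton[of 0] in "eventually_elim, auto simp: indicator_def")
  also have "... \<le> (\<integral>\<^sup>+ s. ennreal (t powr (2 * \<gamma>)) * (ennreal (s powr (- 2 * \<gamma>)) * (f s * indicator {0<..t} s)) \<partial>lborel)"
  proof (intro nn_integral_mono)
    fix s
    show "f s * indicator {0<..t} s \<le> ennreal (t powr (2 * \<gamma>)) * (ennreal (s powr (- 2 * \<gamma>)) * (f s * indicator {0<..t} s))"
    proof (cases "s \<in> {0<..t}")
      case True
      have "1 = s powr (2 * \<gamma>) * s powr (- 2 * \<gamma>)" using True by (simp flip: powr_add)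
      also have "... \<le> t powr (2 * \<gamma>) * s powr (- 2 * \<gamma>)" using True \<gamma> by (intro mult_right_mono powr_mono2) auto
      finally have "1 \<le> ennreal (t powr (2 * \<gamma>)) * ennreal (s powr (- 2 * \<gamma>))" by (simp flip: ennreal_mult ennreal_1)
      then have "1 * f s \<le> ennreal (t powr (2 * \<gamma>)) * ennreal (s powr (- 2 * \<gamma>)) * f s" by (rule mult_right_mono) simp
      then show ?thesis using True by (simp add: mult.assoc)
    qed simp
  qed
  also have "... = ennreal (t powr (2 * \<gamma>)) * (\<integral>\<^sup>+ s. ennreal (s powr (- 2 * \<gamma>)) * (f s * indicator {0<..t} s) \<partial>lborel)"
  proof (rule nn_integral_cmult)
    have "(\<lambda>s. ennreal (s powr (- 2 * \<gamma>)) * ((f s * indicator {0..t} s) * indicator {0<..t} s)) \<in> borel_measurable borel"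
      using fm by measurable
    also have "(\<lambda>s. ennreal (s powr (- 2 * \<gamma>)) * ((f s * indicator {0..t} s) * indicator {0<..t} s)) = (\<lambda>s. ennreal (s powr (- 2 * \<gamma>)) * (f s * indicator {0<..t} s))"
      by (auto simp: fun_eq_iff indicator_def)
    finally show "(\<lambda>s. ennreal (s powr (- 2 * \<gamma>)) * (f s * indicator {0<..t} s)) \<in> borel_measurable lborel" by simp
  qed
  also have "(\<integral>\<^sup>+ s. ennreal (s powr (- 2 * \<gamma>)) * (f s * indicator {0<..t} s) \<partial>lborel) =
     (\<integral>\<^sup>+ s\<in>{0<..t}. ennreal (s powr (- 2 * \<gamma>) * op_trace (cov_op S \<sigma> s)) \<partial>lborel)"
    by (intro nn_integral_cong) (auto simp: f_def indicator_def hs_norm_sq_eq_op_trace[OF tr] ennreal_mult')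
  finally show ?thesis using fin unfolding f_def by (simp add: ennreal_mult_less_top order.strict_trans1)
qed

lemma ext_op_unique:
  fixes S :: "real => 'h::real_normed_vector \<Rightarrow>\<^sub>L 'h" and A :: "'k::real_normed_vector \<Rightarrow>\<^sub>L 'h"
  assumes D: "closure D = UNIV" and A: "\<And>k. k \<in> D ==> A k = S s (G k)"
  shows "ext_op S D G s = A"
  unfolding ext_op_def
proof (rule the_equality)
  fix A' assume A': "\<forall>k\<in>D. blinfun_apply A' k = S s (G k)"
  have "closed {k. blinfun_apply A' k = blinfun_apply A k}"
    by (intro closed_Collect_eq linear_continuous_on blinfun.bounded_linear_right)
  moreover have "D \<subseteq> {k. blinfun_apply A' k = blinfun_apply A k}" using A A' by auto
  ultimately have "closure D \<subseteq> {k. blinfun_apply A' k = blinfun_apply A k}" by (rule closure_minimal[rotated])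
  then show "A' = A" using D by (auto intro!: blinfun_eqI)
qed (use A in auto)

lemma ext_op_add:
  fixes S :: "real => 'h::real_normed_vector \<Rightarrow>\<^sub>L 'h"
  assumes D: "closure D = UNIV" and ex: "\<And>s. s > 0 ==> \<exists>A :: 'k::real_normed_vector \<Rightarrow>\<^sub>L 'h. \<forall>k\<in>D. A k = S s (G k)"
    and C0: "C0_semigroup S" and r: "0 \<le> r" and s: "0 < s"
  shows "ext_op S D G (r + s) k = S r (ext_op S D G s k)"
proof -
  obtain A :: "'k \<Rightarrow>\<^sub>L 'h" where A: "\<And>k. k \<in> D ==> A k = S s (G k)" using ex[OF s] by blast
  have "ext_op S D G (r + s) = S r o\<^sub>L A"
    using C0 r s A by (intro ext_op_unique[OF D]) (simp add: C0_semigroup_def)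
  then show ?thesis using ext_op_unique[OF D, of A S s G] A by simp
qed

text \<open>The generator is computed along the times \<open>1/(n + 1)\<close>.\<close>

lemma is_A0_harmonic:
  assumes "is_A0 M W S \<sigma> \<phi> \<psi>"
  shows "pi_converges (\<lambda>n x. (P0 M W S \<sigma> (1 / real (Suc n)) \<phi> x - \<phi> x) / (1 / real (Suc n))) \<psi>"
proof -
  have "(\<forall>n. 1 / real (Suc n) > 0) \<and> decseq (\<lambda>n. 1 / real (Suc n)) \<and> (\<lambda>n. 1 / real (Suc n)) \<longlonglongrightarrow> 0"
    using LIMSEQ_inverse_real_of_nat by (simp add: decseq_def frac_le inverse_eq_divide)
  then show ?thesis by (rule assms[unfolded is_A0_def, THEN spec, THEN mp])
qed

lemma is_A0_A0:
  assumes \<phi>: "\<phi> \<in> dom_A0 M W S \<sigma>"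
  shows "is_A0 M W S \<sigma> \<phi> (A0 M W S \<sigma> \<phi>)"
proof -
  obtain \<psi> where \<psi>: "is_A0 M W S \<sigma> \<phi> \<psi>" using \<phi> by (auto simp: dom_A0_def)
  have "\<psi>' x = \<psi> x" if \<psi>': "is_A0 M W S \<sigma> \<phi> \<psi>'" for \<psi>' x
    using is_A0_harmonic[OF \<psi>] is_A0_harmonic[OF \<psi>'] unfolding pi_converges_def by (blast intro: LIMSEQ_unique)
  then show ?thesis unfolding A0_def by (intro theI[of "is_A0 M W S \<sigma> \<phi>", OF \<psi>]) auto
qed

lemma pi_converges_bound:
  assumes pc: "pi_converges fs f"
  obtains C where "\<And>n x. \<bar>fs n x\<bar> \<le> C"
proof -
  obtain C where C: "\<And>n. (SUP x. \<bar>fs n x\<bar>) \<le> C" using pc unfolding pi_converges_def bdd_above_def by auto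
  have "\<bar>fs n x\<bar> \<le> C" for n x
  proof -
    have "fs n \<in> bcontfun" using pc by (simp add: pi_converges_def)
    then have "bounded (range (fs n))" by (simp add: bcontfun_def)
    then have "bdd_above (range (\<lambda>x. \<bar>fs n x\<bar>))" by (auto simp: bounded_iff bdd_above_def)
    then have "\<bar>fs n x\<bar> \<le> (SUP x. \<bar>fs n x\<bar>)" by (intro cSUP_upper) auto
    then show ?thesis using C[of n] by linarith
  qed
  then show thesis by (rule that)
qed

lemma integral_Icc_Leb:
  fixes f :: "real => real"
  assumes f: "f \<in> borel_measurable (Leb T)"
  shows "(LINT t:{0..T}|lborel. f t) = (LINT t|Leb T. f t)"
  unfolding integral_Leb set_lebesgue_integral_def
proof (rule integral_cong_AE)
  have 1: "(\<lambda>t. indicator {0<..T} t *\<^sub>R f t) \<in> borel_measurable borel"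
    using f unfolding Leb_def by (subst (asm) borel_measurable_restrict_space_iff) (auto simp: mult.commute)
  then show "(\<lambda>t. indicator {0<..T} t *\<^sub>R f t) \<in> borel_measurable lborel" by simp
  have "(\<lambda>t. indicator {0..T} t *\<^sub>R f t) = (\<lambda>t. indicator {0<..T} t *\<^sub>R f t + indicator ({0} \<inter> {0..T}) t *\<^sub>R f 0)"
    by (auto simp: fun_eq_iff indicator_def)
  then show "(\<lambda>t. indicator {0..T} t *\<^sub>R f t) \<in> borel_measurable lborel" using 1 by simp
  show "AE t in lborel. indicator {0..T} t *\<^sub>R f t = indicator {0<..T} t *\<^sub>R f t"
    using AE_lborel_singleton[of 0] by eventually_elim (auto simp: indicator_def)
qed

lemma (in filtered_BM) prog_measurable_clamp:
  assumes u: "prog_measurable F L u" and t: "t \<ge> 0"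
  shows "(\<lambda>q. u (max 0 (min t (fst q))) (snd q)) \<in> borel \<Otimes>\<^sub>M F t \<rightarrow>\<^sub>M L"
proof -
  have "(\<lambda>q. (max 0 (min t (fst q)), snd q)) \<in> borel \<Otimes>\<^sub>M F t \<rightarrow>\<^sub>M restrict_space borel {0..t} \<Otimes>\<^sub>M F t"
    using t by (intro measurable_Pair measurable_restrict_space2) auto
  moreover have "(\<lambda>(s, w). u s w) \<in> restrict_space borel {0..t} \<Otimes>\<^sub>M F t \<rightarrow>\<^sub>M L"
    using u t unfolding prog_measurable_def by blast
  ultimately have "(\<lambda>q. case (max 0 (min t (fst q)), snd q) of (s, w) => u s w) \<in> borel \<Otimes>\<^sub>M F t \<rightarrow>\<^sub>M L"
    by (rule measurable_compose)
  then show ?thesis by simp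
qed

locale admissible_control = filtered_BM M F W
  for M :: "'w measure" and F :: "real => 'w measure"
    and W :: "real => 'xi::{real_inner,banach,second_countable_topology} => 'w => real" +
  fixes \<Lambda> :: "'u::banach set" and L :: "'u => 'k::{real_inner,banach,second_countable_topology}"
    and u :: "real => 'w => 'u" and cL p :: real
  assumes L_measurable: "L \<in> restrict_space borel \<Lambda> \<rightarrow>\<^sub>M borel"
    and cL: "0 < cL" and L_growth: "v \<in> \<Lambda> ==> norm (L v) \<le> cL * (1 + norm v)"
    and p: "1 < p" and u: "u \<in> admissible M F \<Lambda> p"
begin

lemma u_prog: "prog_measurable F (restrict_space borel \<Lambda>) u"
  and u_moment: "t \<ge> 0 ==> (\<integral>\<^sup>+ s\<in>{0..t}. (\<integral>\<^sup>+ w. ennreal (norm (u s w) powr p) \<partial>M) \<partial>lborel) < \<infinity>"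
  using u by (auto simp: admissible_def)

lemma u_in: "0 \<le> s ==> w \<in> space M ==> u s w \<in> \<Lambda>"
  using measurable_space[OF prog_measurable_clamp[OF u_prog], of s "(s, w)"]
  by (simp add: space_pair_measure space_restrict_space)

text \<open>Progressive measurability speaks of time intervals; composing with the projection to such an interval
  turns it into measurability on the whole line.\<close>

definition clamp :: "real => real => real" where "clamp t s = max 0 (min t s)"

lemma clamp_eq [simp]: "0 \<le> s ==> s \<le> t ==> clamp t s = s" by (simp add: clamp_def)

lemma Lu_measurable_F: "t \<ge> 0 ==> (\<lambda>q. L (u (clamp t (fst q)) (snd q))) \<in> borel_measurable (borel \<Otimes>\<^sub>M F t)"
  unfolding clamp_def by (rule measurable_compose[OF prog_measurable_clamp[OF u_prog] L_measurable])

lemma product_F: "t \<ge> 0 ==> f \<in> borel \<Otimes>\<^sub>M F t \<rightarrow>\<^sub>M N' ==> f \<in> borel \<Otimes>\<^sub>M M \<rightarrow>\<^sub>M N'"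
proof -
  assume t: "t \<ge> 0" and f: "f \<in> borel \<Otimes>\<^sub>M F t \<rightarrow>\<^sub>M N'"
  have "(\<lambda>q. (fst q, snd q)) \<in> borel \<Otimes>\<^sub>M M \<rightarrow>\<^sub>M borel \<Otimes>\<^sub>M F t"
    by (intro measurable_Pair measurable_fst measurable_compose[OF measurable_snd measurable_F[OF measurable_ident_sets[OF refl] t, simplified]])
  from measurable_compose[OF this f] show ?thesis by simp
qed

lemmas Lu_measurable = product_F[OF _ Lu_measurable_F]

lemma norm_u_measurable: "t \<ge> 0 ==> (\<lambda>q. norm (u (clamp t (fst q)) (snd q))) \<in> borel_measurable (borel \<Otimes>\<^sub>M M)"
proof -
  have "norm \<in> restrict_space borel \<Lambda> \<rightarrow>\<^sub>M borel" for \<Lambda> :: "'u set"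
    by (rule measurable_restrict_space1) (rule borel_measurable_continuous_onI, intro continuous_intros)
  from product_F[OF _ measurable_compose[OF prog_measurable_clamp[OF u_prog] this]]
  show "t \<ge> 0 ==> ?thesis" by (simp add: clamp_def)
qed

definition energy :: "real => 'w => ennreal" where
  "energy t w = (\<integral>\<^sup>+ s\<in>{0..t}. ennreal (norm (u s w) powr p) \<partial>lborel)"

lemma energy_clamp: "energy t w = (\<integral>\<^sup>+ s. ennreal (norm (u (clamp t s) w) powr p) * indicator {0..t} s \<partial>lborel)"
  unfolding energy_def by (intro nn_integral_cong) (auto simp: indicator_def)

lemma energy_kernel_measurable:
  "t \<ge> 0 ==> (\<lambda>q. ennreal (norm (u (clamp t (fst q)) (snd q)) powr p) * indicator {0..t} (fst q)) \<in> borel_measurable (lborel \<Otimes>\<^sub>M M)"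
proof -
  assume t: "t \<ge> 0"
  note norm_u_measurable[OF t, measurable]
  have "(\<lambda>q. ennreal (norm (u (clamp t (fst q)) (snd q)) powr p) * indicator {0..t} (fst q)) \<in> borel_measurable (borel \<Otimes>\<^sub>M M)"
    by measurable
  then show ?thesis by (simp cong: measurable_cong_sets sets_pair_measure_cong)
qed

lemma lborel_pair: "pair_sigma_finite lborel M"
  by unfold_locales

interpretation R: pair_sigma_finite lborel M by (rule lborel_pair)

lemma energy_measurable: "t \<ge> 0 ==> energy t \<in> borel_measurable M"
  unfolding energy_clamp[abs_def]
  using lborel.borel_measurable_nn_integral_fst[OF measurable_pair_swap[OF energy_kernel_measurable]] by simp

lemma energy_expectation: "t \<ge> 0 ==> (\<integral>\<^sup>+ w. energy t w \<partial>M) < \<infinity>"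
proof -
  assume t: "t \<ge> 0"
  note m = energy_kernel_measurable[OF t]
  have "(\<integral>\<^sup>+ w. energy t w \<partial>M) = (\<integral>\<^sup>+ s. (\<integral>\<^sup>+ w. ennreal (norm (u (clamp t s) w) powr p) * indicator {0..t} s \<partial>M) \<partial>lborel)"
    unfolding energy_clamp using R.nn_integral_snd[OF m] nn_integral_fst[OF m] by simp
  also have "... = (\<integral>\<^sup>+ s\<in>{0..t}. (\<integral>\<^sup>+ w. ennreal (norm (u s w) powr p) \<partial>M) \<partial>lborel)"
    by (intro nn_integral_cong) (auto simp: indicator_def)
  also have "... < \<infinity>" by (rule u_moment[OF t])
  finally show ?thesis .
qed

text \<open>The event, of probability one, that the control has finite energy up to every time.\<close>

definition good :: "'w => bool" where "good w \<longleftrightarrow> (\<forall>n::nat. energy (real n) w < \<infinity>)"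

lemma AE_good: "AE w in M. good w"
proof -
  have "AE w in M. energy (real n) w \<noteq> \<infinity>" for n :: nat
    by (rule nn_integral_PInf_AE) (use energy_measurable energy_expectation[of "real n"] in auto)
  then have "AE w in M. \<forall>n::nat. energy (real n) w \<noteq> \<infinity>" by (subst AE_all_countable) blast
  then show ?thesis by eventually_elim (simp add: good_def less_top)
qed

lemma good_pred: "Measurable.pred M good"
  unfolding good_def[abs_def] using energy_measurable by measurable

text \<open>The complement is a null set, and all null sets belong to the filtration.\<close>

lemma good_pred_F: "t \<ge> 0 ==> Measurable.pred (F t) good"
proof -
  assume t: "t \<ge> 0"
  have m: "{w \<in> space M. \<not> good w} \<in> sets M" using good_pred by measurable
  then have "{w \<in> space M. \<not> good w} \<in> null_sets M"
    using AE_good by (subst AE_iff_null[symmetric]) auto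
  then have "{w \<in> space M. \<not> good w} \<in> sets (F t)" using null_sets_F[OF t] by auto
  then have "space (F t) - {w \<in> space M. \<not> good w} \<in> sets (F t)" by (rule sets.compl_sets)
  moreover have "space (F t) - {w \<in> space M. \<not> good w} = {w \<in> space (F t). good w}" using t by auto
  ultimately show ?thesis by (simp add: pred_def)
qed

definition l :: "real => 'w => 'k" where "l s w = (if 0 \<le> s \<and> good w then L (u s w) else 0)"

lemma l_AE: "AE w in M. \<forall>s\<ge>0. l s w = L (u s w)"
  using AE_good by eventually_elim (simp add: l_def)

lemma l_measurable: "(\<lambda>q. l (fst q) (snd q)) \<in> borel_measurable (borel \<Otimes>\<^sub>M M)"
proof -
  note good_pred [measurable]
  have "(\<lambda>q. if 0 \<le> fst q \<and> good (snd q) then L (u (clamp (real i) (fst q)) (snd q)) else 0) \<in> borel_measurable (borel \<Otimes>\<^sub>M M)" for i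
    using Lu_measurable[of "real i"] by measurable
  then have "(\<lambda>q. if 0 \<le> fst q \<and> good (snd q) then L (u (clamp (real (nat \<lceil>fst q\<rceil>)) (fst q)) (snd q)) else 0) \<in> borel_measurable (borel \<Otimes>\<^sub>M M)"
    by (rule measurable_compose_countable) measurable
  also have "(\<lambda>q. if 0 \<le> fst q \<and> good (snd q) then L (u (clamp (real (nat \<lceil>fst q\<rceil>)) (fst q)) (snd q)) else 0) = (\<lambda>q. l (fst q) (snd q))"
  proof
    fix q :: "real \<times> 'w"
    have "0 \<le> fst q ==> clamp (real (nat \<lceil>fst q\<rceil>)) (fst q) = fst q" by (intro clamp_eq) linarith+
    then show "(if 0 \<le> fst q \<and> good (snd q) then L (u (clamp (real (nat \<lceil>fst q\<rceil>)) (fst q)) (snd q)) else 0) = l (fst q) (snd q)"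
      by (simp add: l_def)
  qed
  finally show ?thesis .
qed

lemma l_adapted:
  assumes t: "t > 0"
  shows "(\<lambda>q. l (fst q) (snd q)) \<in> borel_measurable (Leb t \<Otimes>\<^sub>M F t)"
proof -
  have t0: "0 \<le> t" using t by simp
  note good_pred_F[OF t0, measurable]
  have "(\<lambda>q. (fst q, snd q)) \<in> Leb t \<Otimes>\<^sub>M F t \<rightarrow>\<^sub>M borel \<Otimes>\<^sub>M F t"
    by (intro measurable_Pair measurable_compose[OF measurable_fst id_Leb] measurable_snd)
  from measurable_compose[OF this Lu_measurable_F[OF t0]]
  have [measurable]: "(\<lambda>q. L (u (clamp t (fst q)) (snd q))) \<in> borel_measurable (Leb t \<Otimes>\<^sub>M F t)" by simp
  have "(\<lambda>q. if good (snd q) then L (u (clamp t (fst q)) (snd q)) else 0) \<in> borel_measurable (Leb t \<Otimes>\<^sub>M F t)"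
    by measurable
  then show ?thesis
    by (subst measurable_cong[where g="\<lambda>q. if good (snd q) then L (u (clamp t (fst q)) (snd q)) else 0"])
       (auto simp: space_pair_measure l_def)
qed

lemma norm_u_powr_section: "w \<in> space M ==> t \<ge> 0 ==> (\<lambda>s. ennreal (norm (u (clamp t s) w) powr p)) \<in> borel_measurable borel"
  using measurable_compose[OF measurable_Pair2'[of w M borel] norm_u_measurable[of t]] by simp

lemma powr_l_le_energy:
  assumes w: "w \<in> space M" and T: "0 \<le> T"
  shows "(\<integral>\<^sup>+ s\<in>{0..T}. ennreal (norm (l s w) powr p) \<partial>lborel) \<le>
    ennreal ((2 * cL) powr p) * (ennreal T + energy T w)"
proof -
  define K where "K = (2 * cL) powr p"
  have K: "K \<ge> 0" by (simp add: K_def)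
  have bd: "norm (l s w) powr p \<le> K * (1 + norm (u s w) powr p)" if s: "0 \<le> s" for s
  proof -
    have "norm (l s w) \<le> cL * (1 + norm (u s w))"
      using L_growth[OF u_in[OF s w]] cL s by (simp add: l_def)
    also have "... \<le> cL * (2 * max 1 (norm (u s w)))" using cL by (intro mult_left_mono) auto
    finally have "norm (l s w) powr p \<le> (2 * cL * max 1 (norm (u s w))) powr p" using p by (intro powr_mono2) auto
    also have "... = K * (max 1 (norm (u s w))) powr p" using cL by (simp add: powr_mult K_def)
    also have "... \<le> K * (1 + norm (u s w) powr p)"
      by (intro mult_left_mono) (auto simp: K_def max_def)
    finally show ?thesis .
  qed
  have "(\<integral>\<^sup>+ s\<in>{0..T}. ennreal (norm (l s w) powr p) \<partial>lborel) \<le>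
    (\<integral>\<^sup>+ s. ennreal K * (indicator {0..T} s + ennreal (norm (u (clamp T s) w) powr p) * indicator {0..T} s) \<partial>lborel)"
  proof (intro nn_integral_mono)
    fix s
    show "ennreal (norm (l s w) powr p) * indicator {0..T} s \<le>
      ennreal K * (indicator {0..T} s + ennreal (norm (u (clamp T s) w) powr p) * indicator {0..T} s)"
    proof (cases "s \<in> {0..T}")
      case True
      then have "ennreal (norm (l s w) powr p) \<le> ennreal (K * (1 + norm (u s w) powr p))" by (intro ennreal_leI bd) simp
      then show ?thesis using True K by (simp add: ennreal_mult)
    qed simp
  qed
  also have "... = ennreal K * (ennreal T + energy T w)"
    using norm_u_powr_section[OF w T] T by (subst nn_integral_cmult) (auto simp: nn_integral_add energy_clamp)
  finally show ?thesis by (simp add: K_def)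
qed

lemma l_p:
  assumes w: "w \<in> space M"
  shows "(\<integral>\<^sup>+ s\<in>{0..T}. ennreal (norm (l s w) powr p) \<partial>lborel) < \<infinity>"
proof (cases "good w")
  case True
  obtain n :: nat where n: "T \<le> real n" using real_arch_simple by blast
  then have "(\<integral>\<^sup>+ s\<in>{0..T}. ennreal (norm (l s w) powr p) \<partial>lborel) \<le> (\<integral>\<^sup>+ s\<in>{0..real n}. ennreal (norm (l s w) powr p) \<partial>lborel)"
    by (intro nn_integral_mono) (auto simp: indicator_def)
  also note powr_l_le_energy[OF w, of "real n"]
  also have "ennreal ((2 * cL) powr p) * (ennreal (real n) + energy (real n) w) < \<infinity>"
    using True by (simp add: good_def ennreal_mult_less_top)
  finally show ?thesis by simp
qed (simp add: l_def)

lemma l_1: "(\<integral>\<^sup>+ w. L1 (Leb T) (\<lambda>s. l s w) \<partial>M) < \<infinity>"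
proof (cases "0 \<le> T")
  case T: True
  have "L1 (Leb T) (\<lambda>s. l s w) \<le> ennreal T + ennreal ((2 * cL) powr p) * (ennreal T + energy T w)"
    if w: "w \<in> space M" for w
    using measurable_compose[OF measurable_Pair2'[OF w, of borel] l_measurable]
    by (intro order_trans[OF L1_Leb_le_powr[OF p _ T]] add_left_mono powr_l_le_energy[OF w T]) simp
  then have "(\<integral>\<^sup>+ w. L1 (Leb T) (\<lambda>s. l s w) \<partial>M) \<le>
      (\<integral>\<^sup>+ w. ennreal T + ennreal ((2 * cL) powr p) * (ennreal T + energy T w) \<partial>M)"
    by (rule nn_integral_mono)
  also have "... = ennreal T + ennreal ((2 * cL) powr p) * (ennreal T + (\<integral>\<^sup>+ w. energy T w \<partial>M))"
    using energy_measurable[OF T] by (simp add: nn_integral_add nn_integral_cmult emeasure_space_1)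
  also have "... < \<infinity>" using energy_expectation[OF T] by (simp add: ennreal_mult_less_top)
  finally show ?thesis .
qed (simp add: nn_integral_Leb)

end

theorem theorem4p8:
  fixes M :: "'w measure"
    and F :: "real \<Rightarrow> 'w measure"
    and W :: "real \<Rightarrow> 'xi::{real_inner, banach, second_countable_topology} \<Rightarrow> 'w \<Rightarrow> real"
    and D\<^sub>A :: "'h::{real_inner, banach, second_countable_topology} set"
    and A :: "'h \<Rightarrow> 'h"
    and S :: "real \<Rightarrow> 'h \<Rightarrow>\<^sub>L 'h"
    and \<sigma> :: "'xi \<Rightarrow>\<^sub>L 'h"
    and D\<^sub>G :: "'k::{real_inner, banach, second_countable_topology} set"
    and G :: "'k \<Rightarrow> 'h"
    and \<Lambda> :: "'u::banach set"
    and L :: "'u \<Rightarrow> 'k"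
    and u :: "real \<Rightarrow> 'w \<Rightarrow> 'u"
    and X :: "real \<Rightarrow> 'w \<Rightarrow> 'h"
    and \<phi> :: "'h \<Rightarrow> real"
    and x :: 'h
    and \<gamma> \<beta> C\<^sub>G a\<^sub>G C\<^sub>L p lam T :: real
  assumes "usual_filtered_prob_space M F"
    and "cylindrical_BM M F W"
    and "closed_densely_defined D\<^sub>A A"
    and "generates D\<^sub>A A S"
    and "\<And>s. s > 0 \<Longrightarrow> trace_class (cov_op S \<sigma> s)"
    and "0 < \<gamma>" and "\<gamma> < 1 / 2"
    and "\<And>t. t \<ge> 0 \<Longrightarrow>
      (\<integral>\<^sup>+ s\<in>{0<..t}. ennreal (s powr (- 2 * \<gamma>) * op_trace (cov_op S \<sigma> s)) \<partial>lborel) < \<infinity>"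
    and "closed_densely_defined D\<^sub>G G"
    and "\<And>s. s > 0 \<Longrightarrow> \<exists>E :: 'k \<Rightarrow>\<^sub>L 'h. \<forall>k\<in>D\<^sub>G. E k = S s (G k)"
    and "0 < C\<^sub>G" and "0 \<le> \<beta>" and "\<beta> < 1"
    and "\<And>s. s > 0 \<Longrightarrow>
      norm (ext_op S D\<^sub>G G s) \<le> C\<^sub>G * max (s powr (- \<beta>)) 1 * exp (a\<^sub>G * s)"
    and "\<Lambda> \<in> sets borel"
    and "L \<in> restrict_space borel \<Lambda> \<rightarrow>\<^sub>M borel"
    and "0 < C\<^sub>L" and "\<And>v. v \<in> \<Lambda> \<Longrightarrow> norm (L v) \<le> C\<^sub>L * (1 + norm v)"
    and "1 / (1 - \<beta>) < p"
    and "\<phi> \<in> dom_A0 M W S \<sigma> \<inter> class_S S D\<^sub>G G"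
    and "0 < lam" and "0 < T"
    and "u \<in> admissible M F \<Lambda> p"
    and "is_state_process M W S \<sigma> (ext_op S D\<^sub>G G) L x u X"
  shows
    "(LINT \<omega>|M. exp (- lam * T) * \<phi> (X T \<omega>)) =
       \<phi> x +
       (LINT \<omega>|M. (LINT t:{0..T}|lborel.
          exp (- lam * t) *
            ((A0 M W S \<sigma> \<phi> (X t \<omega>) - lam * \<phi> (X t \<omega>)) +
             L (u t \<omega>) \<bullet> G_derivative D\<^sub>G G \<phi> (X t \<omega>))))"
proof -
  note filt = assms(1) and BM = assms(2) and gen = assms(4) and tr = assms(5) and dom = assms(20) and X = assms(24)
  have C0: "C0_semigroup S" using gen by (simp add: generates_def)
  have dense: "closure D\<^sub>G = UNIV" using assms(9) by (simp add: closed_densely_defined_def)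
  have "prob_space M" using filt by (simp add: usual_filtered_prob_space_def)
  then have fBM: "filtered_BM M F W" using filt BM by (simp add: filtered_BM_def filtered_BM_axioms_def)
  define E where "E = ext_op S D\<^sub>G G"
  have "1 \<le> 1 / (1 - \<beta>)" using assms(12,13) by (simp add: field_simps)
  then have p1: "1 < p" using assms(19) by linarith

  interpret drift M F W S \<sigma> E C\<^sub>G a\<^sub>G \<beta>
  proof (intro drift.intro stochastic_convolution.intro stochastic_convolution_axioms.intro drift_axioms.intro fBM C0)
    show "(\<integral>\<^sup>+ s\<in>{0..t}. hs_norm_sq (\<lambda>v. S s (\<sigma> v)) \<partial>lborel) < \<infinity>" if "t \<ge> 0" for t
      by (rule hs_norm_sq_integrable[OF C0 tr assms(6) that assms(8)[OF that]])
    show "E (r + s) k = S r (E s k)" if "0 \<le> r" "0 < s" for r s k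
      unfolding E_def by (rule ext_op_add[OF dense assms(10) C0 that])
    show "norm (E s) \<le> C\<^sub>G * max (s powr - \<beta>) 1 * exp (a\<^sub>G * s)" if "s > 0" for s
      unfolding E_def by (rule assms(14)[OF that])
  qed (use assms in auto)

  interpret ctl: admissible_control M F W \<Lambda> L u C\<^sub>L p
    by (intro admissible_control.intro fBM admissible_control_axioms.intro) (use assms p1 in auto)

  have l_sec: "(\<lambda>s. ctl.l s w) \<in> borel_measurable borel" if "w \<in> space M" for w
    using measurable_compose[OF measurable_Pair2'[OF that, of borel] ctl.l_measurable] by simp
  define Y where "Y t w = X t w - S t x - conv (\<lambda>s. ctl.l s w) t" for t w
  have XM: "X t \<in> borel_measurable M" if "t \<ge> 0" for t using X that by (simp add: is_state_process_def)
  have Xc: "continuous_on {0..} (\<lambda>t. X t w)" if "w \<in> space M" for w using X that by (simp add: is_state_process_def)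

  interpret continuous_noise M F W S \<sigma> E C\<^sub>G a\<^sub>G \<beta> Y
  proof unfold_locales
    show "continuous_on {0..} (\<lambda>t. Y t w)" if w: "w \<in> space M" for w
      unfolding Y_def
      by (intro continuous_on_diff Xc[OF w] S_continuous continuous_on_atLeast conv_continuous[OF assms(19) l_sec[OF w] ctl.l_p[OF w]])
    show "Y t \<in> borel_measurable M" if t: "t \<ge> 0" for t
    proof -
      have "(\<lambda>w. conv (\<lambda>s. ctl.l s w) t) \<in> borel_measurable M"
      proof (rule conv_measurable_param)
        show "(\<lambda>q. ctl.l (snd q) (fst q)) \<in> borel_measurable (M \<Otimes>\<^sub>M borel)"
          using measurable_compose[OF measurable_Pair[OF measurable_snd measurable_fst] ctl.l_measurable] by simp
      qed simp
      then show ?thesis unfolding Y_def[abs_def] by (intro borel_measurable_diff XM[OF t]) auto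
    qed
    show "AE w in M. Y t w = stoch_conv M W S \<sigma> t w" if t: "t \<ge> 0" for t
    proof -
      have "AE w in M. X t w = S t x + stoch_conv M W S \<sigma> t w + (LINT s:{0..<t}|lborel. E (t - s) (L (u s w)))"
        using X t by (simp add: is_state_process_def E_def)
      then show ?thesis
        using ctl.l_AE
      proof eventually_elim
        case (elim w)
        have "conv (\<lambda>s. ctl.l s w) t = (LINT s:{0..<t}|lborel. E (t - s) (L (u s w)))"
          unfolding conv_def by (rule set_lebesgue_integral_cong) (use elim(2) in auto)
        then show ?case using elim(1) by (simp add: Y_def)
      qed
    qed
  qed

  interpret controlled M F W S \<sigma> E C\<^sub>G a\<^sub>G \<beta> Y ctl.l T p
    by unfold_locales (use assms ctl.l_measurable ctl.l_adapted ctl.l_p ctl.l_1 in auto)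

  define \<psi> where "\<psi> = A0 M W S \<sigma> \<phi>"
  define D where "D = G_derivative D\<^sub>G G \<phi>"
  note pc = is_A0_harmonic[OF is_A0_A0[of \<phi> M W S \<sigma>], folded \<psi>_def]
  have pc: "pi_converges (\<lambda>n x. (P0 M W S \<sigma> (1 / real (Suc n)) \<phi> x - \<phi> x) / (1 / real (Suc n))) \<psi>"
    using dom by (intro pc) simp
  have \<phi>B: "\<phi> \<in> bcontfun" using dom by (simp add: dom_A0_def)
  have \<psi>B: "\<psi> \<in> bcontfun" using pc by (simp add: pi_converges_def)
  obtain c c' where \<phi>c: "continuous_on UNIV \<phi>" "\<And>x. \<bar>\<phi> x\<bar> \<le> c" and \<psi>c: "continuous_on UNIV \<psi>" "\<And>x. \<bar>\<psi> x\<bar> \<le> c'"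
    using \<phi>B \<psi>B by (auto simp: bcontfun_def bounded_iff)
  obtain C where C: "\<And>n x. \<bar>(P0 M W S \<sigma> (1 / real (Suc n)) \<phi> x - \<phi> x) / (1 / real (Suc n))\<bar> \<le> C"
    using pi_converges_bound[OF pc] by blast
  have P0P: "P0 M W S \<sigma> (1 / real (Suc n)) \<phi> x = P (1 / real (Suc n)) \<phi> x" for n x
    by (rule P0_eq[OF _ \<phi>c(1)]) simp
  have lim: "(\<lambda>n. (P0 M W S \<sigma> (1 / real (Suc n)) \<phi> x - \<phi> x) / (1 / real (Suc n))) \<longlonglongrightarrow> \<psi> x" for x
    using pc unfolding pi_converges_def by blast
  have S: "\<phi> \<in> class_S S D\<^sub>G G" using dom by simp
  obtain cD where Dc: "continuous_on UNIV D" "\<And>x. norm (D x) \<le> cD"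
    using S by (auto simp: class_S_def C1G_b_def D_def bounded_iff)

  interpret controlled_test M F W S \<sigma> E C\<^sub>G a\<^sub>G \<beta> Y ctl.l T p \<phi> \<psi> D c c' cD x
  proof unfold_locales
    show "P \<tau> \<phi> y - \<phi> y = integral {0..\<tau>} (\<lambda>t. P t \<psi> y)" if "\<tau> \<ge> 0" for \<tau> y
      by (rule dynkin[OF \<phi>c \<psi>c lim[unfolded P0P] C[unfolded P0P] that])
    show "loc_unif (quot \<phi> k) (\<lambda>y. D y \<bullet> k)" for k
      by (rule quot_loc_unif) (use S in "simp add: class_S_def D_def E_def")
  qed (use \<phi>c \<psi>c Dc in auto)

  have state: "state ctl.l t w = X t w" for t w by (simp add: state_def Y_def)
  define R where "R L' t w = exp (- lam * t) * ((\<psi> (X t w) - lam * \<phi> (X t w)) + L' t w \<bullet> D (X t w))" for L' t w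
  have XQ: "(\<lambda>q. X (fst q) (snd q)) \<in> borel_measurable Q"
    by (rule continuous_process_measurable[OF Xc XM])
  have LuQ: "(\<lambda>q. L (u (fst q) (snd q))) \<in> borel_measurable Q"
  proof -
    have "(\<lambda>q. L (u (ctl.clamp T (fst q)) (snd q))) \<in> borel_measurable Q"
      by (rule measurable_Q[OF ctl.Lu_measurable[OF less_imp_le less_imp_le, OF assms(22) assms(22)]])
    then show ?thesis
      by (subst measurable_cong[where g="\<lambda>q. L (u (ctl.clamp T (fst q)) (snd q))"]) (auto simp: space_pair_measure)
  qed
  have fst_m: "fst \<in> borel_measurable Q" by (rule measurable_compose[OF measurable_fst id_Leb])
  have RQ: "(\<lambda>q. R L' (fst q) (snd q)) \<in> borel_measurable Q" if "(\<lambda>q. L' (fst q) (snd q)) \<in> borel_measurable Q" for L'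
    unfolding R_def using fst_m
    by (intro borel_measurable_times borel_measurable_add borel_measurable_diff borel_measurable_inner that
        borel_measurable_const continuous_compose_measurable[OF \<phi>(1) XQ] continuous_compose_measurable[OF \<psi>(1) XQ]
        continuous_compose_measurable[OF D(1) XQ]) simp
  have RM: "(\<lambda>w. LINT t|Leb T. R L' t w) \<in> borel_measurable M" if "(\<lambda>q. L' (fst q) (snd q)) \<in> borel_measurable Q" for L'
  proof -
    interpret L: finite_measure "Leb T" by (rule finite_Leb)
    show ?thesis
      using measurable_pair_swap[OF RQ[OF that]] by (intro L.borel_measurable_lebesgue_integral) simp
  qed
  have "(LINT w|M. exp (- lam * T) * \<phi> (X T w)) = \<phi> x + (LINT w|M. LINT t|Leb T. R ctl.l t w)"
    using controlled_formula[of lam] unfolding state R_def .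
  also have "(LINT w|M. LINT t|Leb T. R ctl.l t w) = (LINT w|M. LINT t|Leb T. R (\<lambda>t w. L (u t w)) t w)"
  proof (rule integral_cong_AE[OF RM[OF l_Q] RM[OF LuQ]])
    show "AE w in M. (LINT t|Leb T. R ctl.l t w) = (LINT t|Leb T. R (\<lambda>t w. L (u t w)) t w)"
      using ctl.l_AE by eventually_elim (auto intro!: Bochner_Integration.integral_cong simp: R_def)
  qed
  also have "... = (LINT w|M. (LINT t:{0..T}|lborel. R (\<lambda>t w. L (u t w)) t w))"
  proof (rule Bochner_Integration.integral_cong[OF refl])
    fix w assume "w \<in> space M"
    then have "(\<lambda>t. R (\<lambda>t w. L (u t w)) t w) \<in> borel_measurable (Leb T)"
      using measurable_compose[OF measurable_Pair2' RQ[OF LuQ]] by simp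
    then show "(LINT t|Leb T. R (\<lambda>t w. L (u t w)) t w) = (LINT t:{0..T}|lborel. R (\<lambda>t w. L (u t w)) t w)"
      by (rule integral_Icc_Leb[symmetric])
  qed
  finally show ?thesis unfolding R_def \<psi>_def D_def .
qed

end
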